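(* Let $T$ be a nonsingular map on a probability space $(X,m)$ (the probability measure $m$ is not assumed to be invariant), and let $f:X\to\mathbb{R}$ be measurable. Let $\mathcal{G}$, $\mathcal{H}$ be complex Banach spaces and let $\iota:\mathcal{G}\to\mathcal{H}$ be a continuous linear map such that the image of the unit ball of $\mathcal{G}$ is relatively compact in $\mathcal{H}$. Let $\alpha_0\in\mathcal{G}$, $\ell_0\in\mathcal{G}'$ (the dual of $\mathcal{G}$), $0<\epsilon_0<1$, and let operators $\mathcal{L}_t:\mathcal{G}\to\mathcal{G}$ be given for $|t|\le\epsilon_0$. Assume: 1. For all $t,t'\in[-\epsilon_0,\epsilon_0]$ and all $n,p\in\mathbb{N}$, $$\int e^{itS_nf\circ T^p}e^{it'S_pf}\,dm=\langle\ell_0,\mathcal{L}_t^n\mathcal{L}_{t'}^p\alpha_0\rangle .$$ 2. There exist constants $C>0$, $\eta<1$ and $M\ge1$ such that, for all $u\in\mathcal{G}$, all $n\in\mathbb{N}$ and all $t\in[-\epsilon_0,\epsilon_0]$, $$\|\mathcal{L}_t^nu\|_{\mathcal{G}}\le C\eta^n\|u\|_{\mathcal{G}}+CM^n\|\iota(u)\|_{\mathcal{H}}\quad\text{and}\quad \|\iota(\mathcal{L}_t^nu)\|_{\mathcal{H}}\le CM^n\|\iota(u)\|_{\mathcal{H}} .$$ 3. The eigenvalues of modulus $\ge1$ of the operator $\mathcal{L}_0$ are simple. Moreover, $\mathcal{L}_0'\ell_0=\ell_0$, where $\mathcal{L}_0'$ is the dual operator. 4. There exist $\beta_0>0$ and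 $C>0$ such that, for all $t\in[-\epsilon_0,\epsilon_0]$, $\|\iota\circ(\mathcal{L}_t-\mathcal{L}_0)\|_{\mathcal{G}\to\mathcal{H}}\le C|t|^{\beta_0}$. Let $B_n$ be a renormalizing sequence such that $S_nf/B_n$ converges in distribution (with respect to $m$) to a random variable $\mathcal{W}$. Then $S_nf/B_n$ satisfies an almost sure limit theorem towards $\mathcal{W}$.
   Context: Notation: $S_nf=f+f\circ T+\cdots+f\circ T^{n-1}$ ($S_0f=0$), and $\mathbb{N}=\{0,1,2,\dots\}$. In assumption 1, $i$ is the imaginary unit. Slow variation: a continuous $L:(0,\infty)\to(0,\infty)$ is slowly varying if $L(\lambda x)/L(x)\to1$ as $x\to\infty$ for all $\lambda>0$; it is normalized if it is $C^1$ and $L'(x)=o(L(x)/x)$. A renormalizing sequence is a sequence $B_n=B(n)$ where $B(x)=x^dL(x)$ with $d>0$ and $L$ a normalized slowly varying function. Almost sure limit theorem: $S_n/B_n$ satisfies an almost sure limit theorem towards $\mathcal{W}$ if, for almost all $\omega$, the measures $\frac{1}{\log N}\sum_{k=1}^N\frac1k\delta_{S_k(\omega)/B_k}$ converge weakly as $N\to\infty$ to the law of $\mathcal{W}$ ($\delta_x$ is the Dirac mass at $x$). *)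

theory Defs
  imports "HOL-Probability.Probability" "HOL-Library.Landau_Symbols"
begin

section \<open>Complex Banach spaces\<close>

text \<open>
  A complex Banach space is a Banach space (over the reals, as in the library) whose real scalar
  multiplication is the restriction of a complex one for which the norm is homogeneous.
\<close>

class complex_banach = banach +
  fixes scaleC :: "complex \<Rightarrow> 'a \<Rightarrow> 'a"  (infixr "*\<^sub>C" 75)
  assumes scaleC_add_right: "c *\<^sub>C (x + y) = c *\<^sub>C x + c *\<^sub>C y"
    and scaleC_add_left: "(c + d) *\<^sub>C x = c *\<^sub>C x + d *\<^sub>C x"
    and scaleC_scaleC: "c *\<^sub>C (d *\<^sub>C x) = (c * d) *\<^sub>C x"
    and scaleR_scaleC: "r *\<^sub>R x = complex_of_real r *\<^sub>C x"
    and norm_scaleC: "norm (c *\<^sub>C x) = cmod c * norm x"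

instantiation complex :: complex_banach
begin

definition scaleC_complex :: "complex \<Rightarrow> complex \<Rightarrow> complex" where
  "scaleC_complex c x = c * x"

instance
  by standard (auto simp: scaleC_complex_def algebra_simps norm_mult scaleR_conv_of_real)

end

text \<open>
  Continuous complex-linear maps. Since the norm only sees the real structure, the library's
  \<open>onorm\<close> is the operator norm. The dual of a complex Banach space consists of the bounded
  complex-linear maps to \<^typ>\<open>complex\<close>; the pairing of \<open>l\<close> with \<open>u\<close> is \<open>l u\<close>.
\<close>

definition bounded_clinear :: "('g::complex_banach \<Rightarrow> 'h::complex_banach) \<Rightarrow> bool" where
  "bounded_clinear A \<longleftrightarrow> bounded_linear A \<and> (\<forall>c u. A (c *\<^sub>C u) = c *\<^sub>C A u)"

definition dual_operator :: "('g::complex_banach \<Rightarrow> 'h::complex_banach) \<Rightarrow> ('h \<Rightarrow> complex) \<Rightarrow> ('g \<Rightarrow> complex)" where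
  "dual_operator A l = l \<circ> A"

definition eigenvalue :: "('g::complex_banach \<Rightarrow> 'g) \<Rightarrow> complex \<Rightarrow> bool" where
  "eigenvalue A z \<longleftrightarrow> (\<exists>u. u \<noteq> 0 \<and> A u = z *\<^sub>C u)"

definition generalized_eigenspace :: "('g::complex_banach \<Rightarrow> 'g) \<Rightarrow> complex \<Rightarrow> 'g set" where
  "generalized_eigenspace A z = {u. \<exists>k. ((\<lambda>v. A v - z *\<^sub>C v) ^^ k) u = 0}"

text \<open>Simplicity means algebraic multiplicity one: the generalized eigenspace is a complex line.\<close>

definition simple_eigenvalue :: "('g::complex_banach \<Rightarrow> 'g) \<Rightarrow> complex \<Rightarrow> bool" where
  "simple_eigenvalue A z \<longleftrightarrow>
     eigenvalue A z \<and> (\<exists>u. u \<noteq> 0 \<and> generalized_eigenspace A z = range (\<lambda>c. c *\<^sub>C u))"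


section \<open>Nonsingular maps and Birkhoff sums\<close>

text \<open>
  Only the preservation of null sets under preimages is required; the stronger convention, with
  an equivalence, is a special case.
\<close>

definition nonsingular_map :: "'a measure \<Rightarrow> ('a \<Rightarrow> 'a) \<Rightarrow> bool" where
  "nonsingular_map m T \<longleftrightarrow>
     T \<in> measurable m m \<and> (\<forall>A \<in> null_sets m. T -` A \<inter> space m \<in> null_sets m)"

definition birkhoff_sum :: "('a \<Rightarrow> 'a) \<Rightarrow> ('a \<Rightarrow> real) \<Rightarrow> nat \<Rightarrow> 'a \<Rightarrow> real" where
  "birkhoff_sum T f n x = (\<Sum>k<n. f ((T ^^ k) x))"


section \<open>Slow variation\<close>

definition slowly_varying :: "(real \<Rightarrow> real) \<Rightarrow> bool" where
  "slowly_varying L \<longleftrightarrow> continuous_on {0<..} L \<and> (\<forall>x>0. L x > 0) \<and>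
     (\<forall>c>0. ((\<lambda>x. L (c * x) / L x) \<longlongrightarrow> 1) at_top)"

definition normalized_slowly_varying :: "(real \<Rightarrow> real) \<Rightarrow> bool" where
  "normalized_slowly_varying L \<longleftrightarrow> slowly_varying L \<and>
     (\<exists>L'. (\<forall>x>0. (L has_real_derivative L' x) (at x)) \<and> continuous_on {0<..} L' \<and>
           L' \<in> o[at_top](\<lambda>x. L x / x))"

text \<open>The value at \<open>n = 0\<close> is left free, as \<open>L\<close> is only meaningful on the positive reals.\<close>

definition renormalizing_sequence :: "(nat \<Rightarrow> real) \<Rightarrow> bool" where
  "renormalizing_sequence B \<longleftrightarrow>
     (\<exists>d>0. \<exists>L. normalized_slowly_varying L \<and> (\<forall>n\<ge>1. B n = real n powr d * L (real n)))"


section \<open>Almost sure limit theorems\<close>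

text \<open>
  Weak convergence of finite Borel measures, against bounded continuous functions. The library's
  \<open>weak_conv_m\<close> is convergence of distribution functions, which is meant for probability measures;
  the logarithmic averages below only have asymptotic mass one.
\<close>

definition converges_weakly :: "(nat \<Rightarrow> real measure) \<Rightarrow> real measure \<Rightarrow> bool" where
  "converges_weakly \<mu> \<nu> \<longleftrightarrow>
     (\<forall>g :: real \<Rightarrow> real. continuous_on UNIV g \<and> bounded (range g) \<longrightarrow>
        (\<lambda>n. \<integral>x. g x \<partial>\<mu> n) \<longlonglongrightarrow> (\<integral>x. g x \<partial>\<nu>))"

text \<open>The measure giving, for each \<open>k \<in> {1..N}\<close>, mass \<open>1 / (k log N)\<close> to the point \<open>y k\<close>.\<close>

definition log_average :: "(nat \<Rightarrow> real) \<Rightarrow> nat \<Rightarrow> real measure" where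
  "log_average y N =
     distr (point_measure {1..N} (\<lambda>k. ennreal (1 / ln (real N) * (1 / real k)))) borel y"

lemma emeasure_log_average:
  assumes "A \<in> sets borel"
  shows "emeasure (log_average y N) A =
           (\<Sum>k=1..N. ennreal (1 / ln (real N) * (1 / real k)) * emeasure (return borel (y k)) A)"
proof -
  have "emeasure (log_average y N) A =
      (\<Sum>k\<in>y -` A \<inter> {1..N}. ennreal (1 / ln (real N) * (1 / real k)))"
    unfolding log_average_def using assms
    by (subst emeasure_distr) (auto simp: space_point_measure emeasure_point_measure_finite)
  also have "\<dots> = (\<Sum>k=1..N. ennreal (1 / ln (real N) * (1 / real k)) * emeasure (return borel (y k)) A)"
    using assms by (intro sum.mono_neutral_cong_left) (auto simp: indicator_def)
  finally show ?thesis .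
qed

definition almost_sure_limit_theorem :: "'a measure \<Rightarrow> (nat \<Rightarrow> 'a \<Rightarrow> real) \<Rightarrow> real measure \<Rightarrow> bool" where
  "almost_sure_limit_theorem m Y \<nu> \<longleftrightarrow>
     (AE \<omega> in m. converges_weakly (log_average (\<lambda>k. Y k \<omega>)) \<nu>)"

end

theory Submission
  imports Defs
begin

text \<open>
  By quasi-compactness and simplicity, the peripheral eigenvalues of \<open>\<L> 0\<close> are finitely many, and
  \<open>\<L> t\<close> contracts the complement of their eigenspaces uniformly for small \<open>t\<close>. Each peripheral
  eigenfunctional of \<open>\<L> 0\<close> deforms to an eigenfunctional of \<open>\<L> t\<close>, up to an error \<open>O(\<bar>t\<bar> powr \<delta>)\<close>. As
  characteristic functions are bounded, the perturbed eigenvalues of modulus \<open>> 1\<close> do not contribute,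
  so the coding gives
  \<open>E (exp (i t S\<^sub>n \<circ> T\<^sup>p) exp (i s S\<^sub>p)) = E (exp (i t S\<^sub>n)) E (exp (i s S\<^sub>p)) + O(\<bar>t\<bar> powr \<delta>)\<close>
  uniformly in \<open>n\<close> and \<open>p\<close>, where \<open>S\<^sub>n\<close> is the Birkhoff sum. For \<open>k \<le> n\<close> this makes the covariance
  of \<open>exp (i t S\<^sub>k / B\<^sub>k)\<close> and \<open>exp (i t S\<^sub>n / B\<^sub>n)\<close> of order \<open>(k / n) powr \<kappa>\<close>. Hence the second moments
  of the centred logarithmic sums are \<open>O(log N)\<close>; after normalization they are summable along
  \<open>N = 2 ^ (j * j)\<close>, and the averages vary little in between. This gives almost sure convergence of the
  characteristic functions of the logarithmic averages at all rational points, from which weak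
  convergence follows by tightness.
\<close>

section \<open>Complex Banach spaces\<close>

text \<open>\<open>L t - L 0\<close> is small only from the strong to the weak norm; in the strong
  operator norm it may stay large, so the classical perturbation theory of spectral projections is
  out of reach. Peripheral eigenfunctionals do survive: if \<open>l (L 0 u) = z * l u\<close> and
  \<open>cmod z \<ge> 1\<close>, then \<open>l w\<close> is bounded by the strong norm of
  \<open>(L 0 ^^ n) w\<close>, which the Lasota--Yorke inequality controls by a damped strong norm
  and an amplified weak norm of \<open>w\<close>. With \<open>n\<close> of order
  \<open>- ln \<bar>t\<bar>\<close>, weak smallness becomes a power of \<open>\<bar>t\<bar>\<close>.
  This is why functionals are perturbed first, and eigenvectors only where needed. The probabilistic
  half meets two obstacles. Convergence in distribution has no rate and no moments are assumed, so
  the power of \<open>k / n\<close> in the covariances has to come from asymptotic independence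
  itself, by comparing the times \<open>m\<close> and \<open>2 * m\<close>. And the exceptional null
  set depends on the frequency: countably many frequencies do not give tightness, so characters are
  also averaged over a Gaussian frequency by Fubini, which yields test functions that detect
  escaping mass.\<close>

lemma scaleC_one [simp]: "1 *\<^sub>C x = (x :: 'a::complex_banach)"
  using scaleR_scaleC[of 1 x] by simp

lemma scaleC_zero_left [simp]: "0 *\<^sub>C x = (0 :: 'a::complex_banach)"
  using scaleR_scaleC[of 0 x] by simp

lemma scaleC_zero_right [simp]: "c *\<^sub>C 0 = (0 :: 'a::complex_banach)"
  by (metis mult_zero_right norm_eq_zero norm_scaleC norm_zero)

lemma bounded_bilinear_scaleC: "bounded_bilinear (scaleC :: complex \<Rightarrow> 'a \<Rightarrow> 'a::complex_banach)"
proof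
  show "\<exists>K. \<forall>a b. norm (a *\<^sub>C b :: 'a) \<le> norm a * norm b * K"
    by (rule exI[of _ 1]) (simp add: norm_scaleC)
  fix r a and b :: 'a
  show "(r *\<^sub>R a) *\<^sub>C b = r *\<^sub>R (a *\<^sub>C b)"
    unfolding scaleR_scaleC[of r "a *\<^sub>C b"] by (simp add: scaleC_scaleC scaleR_conv_of_real)
  show "a *\<^sub>C r *\<^sub>R b = r *\<^sub>R (a *\<^sub>C b)"
    by (simp add: scaleR_scaleC scaleC_scaleC mult.commute)
qed (rule scaleC_add_left scaleC_add_right)+

interpretation scaleC: bounded_bilinear "scaleC :: complex \<Rightarrow> 'a \<Rightarrow> 'a::complex_banach"
  by (rule bounded_bilinear_scaleC)

lemma scaleC_complex_eq [simp]: "c *\<^sub>C (x :: complex) = c * x"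
  by (simp add: scaleC_complex_def)

lemma bounded_clinearD:
  assumes "bounded_clinear A"
  shows "A (x + y) = A x + A y" "A (x - y) = A x - A y" "A (c *\<^sub>C x) = c *\<^sub>C A x"
    "A 0 = 0" "A (- x) = - A x" "A (sum g I) = (\<Sum>i\<in>I. A (g i))" "bounded_linear A"
    "\<exists>K>0. \<forall>x. norm (A x) \<le> K * norm x"
proof -
  have A: "bounded_linear A" and hom: "\<And>c x. A (c *\<^sub>C x) = c *\<^sub>C A x"
    using assms by (auto simp: bounded_clinear_def)
  then interpret bounded_linear A by simp
  show "A (x + y) = A x + A y" "A (x - y) = A x - A y" "A (c *\<^sub>C x) = c *\<^sub>C A x"
    "A 0 = 0" "A (- x) = - A x" "A (sum g I) = (\<Sum>i\<in>I. A (g i))" "bounded_linear A"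
    using A hom by (auto simp: add diff neg zero sum)
  show "\<exists>K>0. \<forall>x. norm (A x) \<le> K * norm x"
    using pos_bounded by (metis mult.commute)
qed

lemma bounded_clinear_funpow:
  fixes A :: "'a::complex_banach \<Rightarrow> 'a"
  shows "bounded_clinear A \<Longrightarrow> bounded_clinear (A ^^ n)"
proof (induction n)
  case 0
  then show ?case by (simp add: bounded_clinear_def id_def bounded_linear_ident)
next
  case (Suc n)
  then show ?case
    by (auto simp: bounded_clinear_def o_def intro: bounded_linear_compose)
qed

lemma bounded_clinear_compose:
  "bounded_clinear A \<Longrightarrow> bounded_clinear B \<Longrightarrow> bounded_clinear (\<lambda>x. A (B x))"
  by (auto simp: bounded_clinear_def intro: bounded_linear_compose)

lemma bounded_clinear_ident [simp]: "bounded_clinear (\<lambda>x. x)"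
  by (simp add: bounded_clinear_def)

lemma bounded_clinear_diff:
  "bounded_clinear A \<Longrightarrow> bounded_clinear B \<Longrightarrow> bounded_clinear (\<lambda>x. A x - B x)"
  by (auto simp: bounded_clinear_def scaleC.diff_right intro: bounded_linear_sub)

lemma bounded_clinear_scaleC_const:
  "bounded_clinear A \<Longrightarrow> bounded_clinear (\<lambda>x. A x *\<^sub>C v)"
  unfolding bounded_clinear_def
  by (auto simp: scaleC_scaleC intro: bounded_linear_compose[OF scaleC.bounded_linear_left])

lemma bounded_clinear_const_scaleC:
  "bounded_clinear A \<Longrightarrow> bounded_clinear (\<lambda>x. c *\<^sub>C A x)"
  unfolding bounded_clinear_def
  by (auto simp: scaleC_scaleC mult.commute intro: bounded_linear_compose[OF scaleC.bounded_linear_right])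

lemma bounded_clinear_sum:
  "(\<And>i. i \<in> I \<Longrightarrow> bounded_clinear (A i)) \<Longrightarrow> bounded_clinear (\<lambda>x. \<Sum>i\<in>I. A i x)"
  unfolding bounded_clinear_def by (auto simp: scaleC.sum_right intro: bounded_linear_sum)

lemma bounded_clinearI:
  assumes "\<And>x y. A (x + y) = A x + A y" "\<And>c x. A (c *\<^sub>C x) = c *\<^sub>C A x"
    and "\<And>x. norm (A x) \<le> K * norm x"
  shows "bounded_clinear A"
  unfolding bounded_clinear_def
  using assms by (auto intro!: bounded_linear_intro[of _ K] simp: scaleR_scaleC mult.commute)

lemma norm_funpow_le:
  fixes A :: "'a::real_normed_vector \<Rightarrow> 'a"
  assumes "\<And>u. norm (A u) \<le> K * norm u" and "K \<ge> 0"
  shows "norm ((A ^^ n) u) \<le> K ^ n * norm u"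
proof (induction n)
  case (Suc n)
  have "norm ((A ^^ Suc n) u) \<le> K * norm ((A ^^ n) u)" using assms(1) by simp
  also have "\<dots> \<le> K * (K ^ n * norm u)" using Suc assms by (intro mult_left_mono) auto
  finally show ?case by simp
qed simp

lemma funpow_eigenvector:
  fixes L :: "'a::complex_banach \<Rightarrow> 'a"
  assumes "bounded_clinear L" "L u = z *\<^sub>C u"
  shows "(L ^^ n) u = z ^ n *\<^sub>C u"
  by (induction n) (auto simp: bounded_clinearD[OF assms(1)] assms(2) scaleC_scaleC mult.commute)

section \<open>Decay of powers from lower bounds\<close>

text \<open>Orthogonality of the characters of a cyclic group: for \<open>n \<noteq> m\<close> the
  ratio is a nontrivial \<open>N\<close>-th root of unity, so its geometric sum vanishes. It is the
  discrete substitute for a Cauchy coefficient integral.\<close>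

lemma sum_roots_of_unity_power:
  fixes N :: nat and \<omega> :: complex
  assumes "m < N" "n < N" and \<omega>: "\<omega> = exp (2 * of_real pi * \<i> / of_nat N)"
  shows "(\<Sum>j<N. (inverse \<omega> ^ m * \<omega> ^ n) ^ j) = (if n = m then of_nat N else 0)"
proof -
  have N: "N \<ge> 1" using assms by simp
  have pw: "\<omega> ^ k = exp (2 * of_real pi * \<i> * of_nat k / of_nat N)" for k
    by (simp add: \<omega> exp_of_nat_mult[symmetric] mult_ac)
  have \<omega>N: "\<omega> ^ N = 1"
    using N by (simp add: pw exp_of_nat2_mult)
  have nz: "\<omega> \<noteq> 0" using \<omega> by simp
  show ?thesis
  proof (cases "n = m")
    case True
    then show ?thesis using nz by (simp add: power_mult_distrib[symmetric])
  next
    case False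
    define x where "x = inverse \<omega> ^ m * \<omega> ^ n"
    have "\<omega> ^ n \<noteq> \<omega> ^ m"
      unfolding pw using complex_root_unity_eq[OF N, of n m] False assms by (simp add: cong_def)
    then have x1: "x \<noteq> 1"
      unfolding x_def using nz by (simp add: field_simps)
    have "x ^ N = (inverse \<omega> ^ N) ^ m * (\<omega> ^ N) ^ n"
      by (simp only: x_def power_mult_distrib power_mult[symmetric] mult.commute)
    then have "x ^ N = 1"
      using \<omega>N by (simp add: power_inverse)
    then have "(\<Sum>j<N. x ^ j) = 0"
      using x1 by (simp add: sum_gp_strict)
    then show ?thesis using False by (simp add: x_def)
  qed
qed

text \<open>
  Put \<open>w = \<rho> \<omega> ^ j\<close>, \<open>z = 1 / w\<close> with \<open>\<omega>\<close> a root of unity. The sum of \<open>(k + 1) w ^ (k + 2) L ^ k u\<close> over \<open>k < N\<close> nearly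
  inverts \<open>(z - L)\<^sup>2\<close>, so its seminorm is controlled by applying the lower bound twice. Averaging over \<open>j\<close>
  extracts the \<open>m\<close>-th term, where the factor \<open>m + 1\<close> produces the decay.
\<close>

lemma weighted_power_bound:
  fixes L :: "'g::complex_banach \<Rightarrow> 'g" and q :: "'g \<Rightarrow> real"
  assumes tri: "\<And>x y. q (x + y) \<le> q x + q y"
    and hom: "\<And>c x. q (c *\<^sub>C x) = cmod c * q x"
    and lin: "\<And>x y. L (x + y) = L x + L y" "\<And>c x. L (c *\<^sub>C x) = c *\<^sub>C L x"
    and c: "c > 0" and lower: "\<And>z u. 1 \<le> cmod z \<Longrightarrow> c * q u \<le> q (z *\<^sub>C u - L u)"
    and r: "0 < \<rho>" "\<rho> \<le> 1" and mN: "m < N"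
  shows "c\<^sup>2 * (real (m + 1) * \<rho> ^ (m + 2) * q ((L ^^ m) u)) \<le>
    q u + (\<rho> ^ N + c * real N * \<rho> ^ (N + 1)) * q ((L ^^ N) u)"
proof -
  have q0: "q 0 = 0" using hom[of 0 0] by simp
  have qneg: "q (- x) = q x" for x
    using hom[of "-1" x] by (simp add: scaleC.minus_left)
  have qdiff: "q (x - y) \<le> q x + q y" for x y
    using tri[of x "- y"] qneg[of y] by simp
  have qsum: "q (sum g I) \<le> (\<Sum>i\<in>I. q (g i))" if "finite I" for g :: "nat \<Rightarrow> 'g" and I
    using that by induction (auto simp: q0 intro: order_trans[OF tri])
  have L0: "L 0 = 0" using lin(2)[of 0 0] by simp
  define x where "x n = (L ^^ n) u" for n
  \<comment> \<open>With \<open>z * w = 1\<close>, \<open>W\<close> and \<open>V\<close> are the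
    truncated Neumann series of the first and the second power of the resolvent at \<open>z\<close>,
    applied to \<open>u\<close>.\<close>
  define V where "V w n = (\<Sum>k<n. (of_nat (k + 1) * w ^ (k + 2)) *\<^sub>C x k)" for w :: complex and n
  define W where "W w n = (\<Sum>k<n. w ^ (k + 1) *\<^sub>C x k)" for w :: complex and n
  have LW: "z *\<^sub>C W w n - L (W w n) = u - w ^ n *\<^sub>C x n"
    if "z * w = 1" for z w n
  proof (induction n)
    case (Suc n)
    have zw: "z * (w * w ^ n) = w ^ n" using that by (metis mult.assoc mult_1)
    have "z *\<^sub>C W w (Suc n) - L (W w (Suc n)) =
      (z *\<^sub>C W w n - L (W w n)) + w ^ n *\<^sub>C x n - w ^ Suc n *\<^sub>C x (Suc n)"
      by (simp add: W_def x_def lin scaleC_add_right scaleC_scaleC zw)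
    then show ?case using Suc by simp
  qed (simp add: W_def x_def L0)
  have LV: "z *\<^sub>C V w n - L (V w n) = W w n - (of_nat n * w ^ (n + 1)) *\<^sub>C x n"
    if "z * w = 1" for z w n
  proof (induction n)
    case (Suc n)
    have zw: "z * ((1 + of_nat n) * (w * (w * w ^ n))) = (1 + of_nat n) * (w * w ^ n)"
      using that by (metis mult.left_commute mult.assoc mult_1)
    have "z *\<^sub>C V w (Suc n) - L (V w (Suc n)) =
      (z *\<^sub>C V w n - L (V w n)) + ((1 + of_nat n) * w ^ (n + 1)) *\<^sub>C x n
       - (of_nat (n + 1) * w ^ (n + 2)) *\<^sub>C x (Suc n)"
      by (simp add: V_def x_def lin scaleC_add_right scaleC_scaleC zw)
    then show ?case
      unfolding Suc by (simp add: W_def scaleC_add_left distrib_right)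
  qed (simp add: V_def W_def L0)
  have bnd: "c\<^sup>2 * q (V w N) \<le> q u + (\<rho> ^ N + c * real N * \<rho> ^ (N + 1)) * q (x N)"
    if w: "cmod w = \<rho>" for w
  proof -
    define z where "z = inverse w"
    have w0: "w \<noteq> 0" using w r by auto
    have zw: "z * w = 1" using w0 by (simp add: z_def)
    have z1: "1 \<le> cmod z" using w r by (simp add: z_def norm_inverse one_le_inverse)
    have "c * q (W w N) \<le> q (u - w ^ N *\<^sub>C x N)"
      using lower[OF z1, of "W w N"] LW[OF zw] by simp
    also have "\<dots> \<le> q u + \<rho> ^ N * q (x N)"
      using qdiff[of u "w ^ N *\<^sub>C x N"] by (simp add: hom norm_power w)
    finally have 1: "c * q (W w N) \<le> q u + \<rho> ^ N * q (x N)" .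
    have "c * q (V w N) \<le> q (W w N - (of_nat N * w ^ (N + 1)) *\<^sub>C x N)"
      using lower[OF z1, of "V w N"] LV[OF zw] by simp
    also have "\<dots> \<le> q (W w N) + real N * \<rho> ^ (N + 1) * q (x N)"
      using qdiff[of "W w N" "(of_nat N * w ^ (N + 1)) *\<^sub>C x N"]
      by (simp add: hom norm_power norm_mult w)
    finally have "c * (c * q (V w N)) \<le> c * (q (W w N) + real N * \<rho> ^ (N + 1) * q (x N))"
      using c by (intro mult_left_mono) auto
    then show ?thesis using 1 by (simp add: algebra_simps power2_eq_square)
  qed
  define \<omega> where "\<omega> = exp (2 * of_real pi * \<i> / of_nat N :: complex)"
  have nz: "\<omega> \<noteq> 0" by (simp add: \<omega>_def)
  have n\<omega>: "cmod \<omega> = 1" by (simp add: \<omega>_def norm_exp_eq_Re)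
  have "(\<Sum>j<N. (inverse \<omega> ^ (m + 2)) ^ j *\<^sub>C V (of_real \<rho> * \<omega> ^ j) N)
      = (\<Sum>j<N. \<Sum>k<N. ((inverse \<omega> ^ m * \<omega> ^ k) ^ j * (of_nat (k + 1) * of_real \<rho> ^ (k + 2))) *\<^sub>C x k)"
    unfolding V_def scaleC.sum_right scaleC_scaleC
  proof (intro sum.cong refl arg_cong2[where f = scaleC])
    fix j k
    have a: "inverse \<omega> ^ (m + 2) * \<omega> ^ (k + 2) = inverse \<omega> ^ m * \<omega> ^ k"
      using nz by (simp add: field_simps)
    have "(inverse \<omega> ^ (m + 2)) ^ j * (\<omega> ^ j) ^ (k + 2) = (inverse \<omega> ^ (m + 2) * \<omega> ^ (k + 2)) ^ j"
      unfolding power_mult_distrib power_mult[symmetric] by (simp add: mult.commute)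
    also have "\<dots> = (inverse \<omega> ^ m * \<omega> ^ k) ^ j" by (simp only: a)
    finally show "(inverse \<omega> ^ (m + 2)) ^ j * (of_nat (k + 1) * (of_real \<rho> * \<omega> ^ j) ^ (k + 2))
      = (inverse \<omega> ^ m * \<omega> ^ k) ^ j * (of_nat (k + 1) * of_real \<rho> ^ (k + 2))"
      unfolding power_mult_distrib[of "of_real \<rho>"] by (simp only: mult_ac)
  qed
  also have "\<dots> = (\<Sum>k<N. ((\<Sum>j<N. (inverse \<omega> ^ m * \<omega> ^ k) ^ j) * (of_nat (k + 1) * of_real \<rho> ^ (k + 2))) *\<^sub>C x k)"
    by (subst sum.swap) (simp only: sum_distrib_right scaleC.sum_left)
  also have "\<dots> = (\<Sum>k<N. if k = m then (of_nat N * (of_nat (m + 1) * of_real \<rho> ^ (m + 2))) *\<^sub>C x m else 0)"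
    by (intro sum.cong) (auto simp: sum_roots_of_unity_power[OF mN _ \<omega>_def])
  also have "\<dots> = (of_nat N * (of_nat (m + 1) * of_real \<rho> ^ (m + 2))) *\<^sub>C x m"
    using mN by (simp add: sum.delta)
  finally have eq: "(of_nat N * (of_nat (m + 1) * of_real \<rho> ^ (m + 2))) *\<^sub>C x m
     = (\<Sum>j<N. (inverse \<omega> ^ (m + 2)) ^ j *\<^sub>C V (of_real \<rho> * \<omega> ^ j) N)" ..
  have "real N * (real (m + 1) * \<rho> ^ (m + 2) * q (x m))
     = q (\<Sum>j<N. (inverse \<omega> ^ (m + 2)) ^ j *\<^sub>C V (of_real \<rho> * \<omega> ^ j) N)"
    unfolding eq[symmetric] hom norm_mult norm_of_nat norm_power norm_of_real
    using r by (simp add: mult.assoc)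
  also have "\<dots> \<le> (\<Sum>j<N. q (V (of_real \<rho> * \<omega> ^ j) N))"
    by (rule order_trans[OF qsum]) (auto simp: hom norm_mult norm_power norm_inverse n\<omega>)
  finally have "c\<^sup>2 * (real N * (real (m + 1) * \<rho> ^ (m + 2) * q (x m)))
     \<le> (\<Sum>j<N. c\<^sup>2 * q (V (of_real \<rho> * \<omega> ^ j) N))"
    unfolding sum_distrib_left[symmetric] by (intro mult_left_mono) auto
  also have "\<dots> \<le> (\<Sum>j<N. q u + (\<rho> ^ N + c * real N * \<rho> ^ (N + 1)) * q (x N))"
    using r by (intro sum_mono bnd) (auto simp: norm_mult norm_power n\<omega>)
  also have "\<dots> = real N * (q u + (\<rho> ^ N + c * real N * \<rho> ^ (N + 1)) * q (x N))"
    by simp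
  finally have "real N * (c\<^sup>2 * (real (m + 1) * \<rho> ^ (m + 2) * q (x m)))
      \<le> real N * (q u + (\<rho> ^ N + c * real N * \<rho> ^ (N + 1)) * q (x N))"
    by (simp only: mult_ac)
  then show ?thesis
    using mN unfolding x_def by (subst (asm) mult_le_cancel_left_pos) auto
qed

text \<open>Only a lower bound for \<open>z - L\<close> in a seminorm is available, not an inverse;
  this form fits the distance to a subspace. Let \<open>r\<close> be the optimal growth rate of
  \<open>q\<close> along powers. In the preceding bound with \<open>\<rho> = 1 / s\<close>,
  \<open>s > r\<close>, the boundary terms vanish as \<open>N\<close> grows; letting
  \<open>s\<close> decrease to \<open>r\<close> bounds \<open>q ((L ^^ m) u)\<close> by
  \<open>r ^ m * q u\<close> times a constant over \<open>m + 1\<close>. For large \<open>m\<close>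
  this beats the rate \<open>r\<close>, unless some power contracts.\<close>

lemma power_decay_of_lower_bound:
  fixes L :: "'g::complex_banach \<Rightarrow> 'g" and q :: "'g \<Rightarrow> real"
  assumes tri: "\<And>x y. q (x + y) \<le> q x + q y"
    and hom: "\<And>c x. q (c *\<^sub>C x) = cmod c * q x"
    and lin: "\<And>x y. L (x + y) = L x + L y" "\<And>c x. L (c *\<^sub>C x) = c *\<^sub>C L x"
    and bd: "\<And>x. q (L x) \<le> M * q x"
    and c: "c > 0" and lower: "\<And>z u. 1 \<le> cmod z \<Longrightarrow> c * q u \<le> q (z *\<^sub>C u - L u)"
  shows "\<exists>m>0. \<exists>\<theta>. 0 \<le> \<theta> \<and> \<theta> < 1 \<and> (\<forall>u. q ((L ^^ m) u) \<le> \<theta> * q u)"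
proof -
  have q0: "q 0 = 0" using hom[of 0 0] by simp
  have qneg: "q (- x) = q x" for x
    using hom[of "-1" x] by (simp add: scaleC.minus_left)
  have qge: "q x \<ge> 0" for x
    using tri[of x "- x"] qneg[of x] q0 by simp
  \<comment> \<open>Rates below 1 are excluded because the lower bound is only available for
    \<open>1 \<le> cmod z\<close>.\<close>
  define R where "R = {r::real. r \<ge> 1 \<and> (\<exists>K. \<forall>n u. q ((L ^^ n) u) \<le> K * r ^ n * q u)}"
  have "q ((L ^^ n) u) \<le> 1 * (max M 1) ^ n * q u" for n u
  proof (induction n)
    case (Suc n)
    have "q ((L ^^ Suc n) u) \<le> max M 1 * q ((L ^^ n) u)"
      using bd[of "(L ^^ n) u"] mult_right_mono[OF max.cobounded1[of M 1] qge[of "(L ^^ n) u"]] by simp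
    also have "\<dots> \<le> max M 1 * (1 * (max M 1) ^ n * q u)"
      using Suc by (intro mult_left_mono) auto
    finally show ?case by simp
  qed simp
  then have "max M 1 \<in> R" unfolding R_def by (auto intro!: exI[of _ 1])
  then have ne: "R \<noteq> {}" by auto
  have bdd: "bdd_below R" by (rule bdd_belowI[of _ 1]) (auto simp: R_def)
  define r where "r = Inf R"
  have r1: "r \<ge> 1" unfolding r_def using ne by (intro cInf_greatest) (auto simp: R_def)
  have key: "c\<^sup>2 * (real (m + 1) * q ((L ^^ m) u)) \<le> s ^ (m + 2) * q u" if s: "s > r" for s m u
  proof -
    obtain t where t: "t \<in> R" "t < s"
      using s cInf_lessD[OF ne, of s] unfolding r_def by auto
    then obtain K where K: "\<And>n u. q ((L ^^ n) u) \<le> K * t ^ n * q u" and t1: "t \<ge> 1"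
      by (auto simp: R_def)
    define \<rho> where "\<rho> = 1 / s"
    have s0: "s > 0" "s \<ge> 1" using s r1 by auto
    have \<rho>: "0 < \<rho>" "\<rho> \<le> 1" using s0 by (auto simp: \<rho>_def)
    have x: "0 \<le> t / s" "t / s < 1" using t t1 s0 by auto
    have *: "c\<^sup>2 * (real (m + 1) * \<rho> ^ (m + 2) * q ((L ^^ m) u)) \<le>
       q u + (K * q u) * ((t / s) ^ N) + (c * \<rho> * K * q u) * (real N * (t / s) ^ N)" if "N > m" for N
    proof -
      have "c\<^sup>2 * (real (m + 1) * \<rho> ^ (m + 2) * q ((L ^^ m) u)) \<le>
        q u + (\<rho> ^ N + c * real N * \<rho> ^ (N + 1)) * q ((L ^^ N) u)"
        by (rule weighted_power_bound[OF tri hom lin c lower \<rho> that])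
      also have "\<dots> \<le> q u + (\<rho> ^ N + c * real N * \<rho> ^ (N + 1)) * (K * t ^ N * q u)"
        using K[of N u] \<rho> c by (intro add_left_mono mult_left_mono) auto
      also have "\<dots> = q u + (K * q u) * ((t / s) ^ N) + (c * \<rho> * K * q u) * (real N * (t / s) ^ N)"
        by (simp add: \<rho>_def field_simps)
      finally show ?thesis .
    qed
    have 1: "(\<lambda>N. (t / s) ^ N) \<longlonglongrightarrow> 0"
      using x by (intro LIMSEQ_realpow_zero) auto
    have 2: "(\<lambda>N. real N * (t / s) ^ N) \<longlonglongrightarrow> 0"
      using x powser_times_n_limit_0[of "t / s"] by simp
    have "(\<lambda>N. q u + (K * q u) * ((t / s) ^ N) + (c * \<rho> * K * q u) * (real N * (t / s) ^ N))
        \<longlonglongrightarrow> q u + (K * q u) * 0 + (c * \<rho> * K * q u) * 0"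
      by (intro tendsto_intros 1 2)
    then have "c\<^sup>2 * (real (m + 1) * \<rho> ^ (m + 2) * q ((L ^^ m) u)) \<le> q u"
      by (intro LIMSEQ_le_const[where X = "\<lambda>N. q u + (K * q u) * ((t / s) ^ N) + (c * \<rho> * K * q u) * (real N * (t / s) ^ N)"])
         (use * in \<open>auto simp del: power_Suc intro!: exI[of _ "Suc m"]\<close>)
    then have "s ^ (m + 2) * (c\<^sup>2 * (real (m + 1) * \<rho> ^ (m + 2) * q ((L ^^ m) u))) \<le> s ^ (m + 2) * q u"
      using s0 by (intro mult_left_mono) auto
    moreover have "s ^ (m + 2) * \<rho> ^ (m + 2) = 1"
      using s0 by (simp only: power_mult_distrib[symmetric]) (simp add: \<rho>_def)
    moreover have "s ^ (m + 2) * (c\<^sup>2 * (real (m + 1) * \<rho> ^ (m + 2) * q ((L ^^ m) u)))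
        = (s ^ (m + 2) * \<rho> ^ (m + 2)) * (c\<^sup>2 * (real (m + 1) * q ((L ^^ m) u)))"
      by (simp only: mult_ac)
    ultimately show ?thesis by (simp only: mult_1)
  qed
  have key': "c\<^sup>2 * (real (m + 1) * q ((L ^^ m) u)) \<le> r ^ (m + 2) * q u" for m u
  proof (rule tendsto_lowerbound)
    show "((\<lambda>s. s ^ (m + 2) * q u) \<longlongrightarrow> r ^ (m + 2) * q u) (at_right r)"
      by (intro tendsto_intros)
    show "\<forall>\<^sub>F s in at_right r. c\<^sup>2 * (real (m + 1) * q ((L ^^ m) u)) \<le> s ^ (m + 2) * q u"
      using key by (auto simp: eventually_at_right_field intro: exI[of _ "r + 1"])
  qed simp
  \<comment> \<open>Large enough that the factor \<open>m + 1\<close> beats twice the constant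
    \<open>r\<^sup>2 / c\<^sup>2\<close>.\<close>
  obtain m0 :: nat where "2 * r\<^sup>2 / c\<^sup>2 < real m0" using reals_Archimedean2 by blast
  then have m0: "2 * r\<^sup>2 < c\<^sup>2 * real m0" using c by (simp add: field_simps)
  define m where "m = Suc m0"
  have m: "m > 0" "2 * r\<^sup>2 \<le> c\<^sup>2 * real (m + 1)"
    using m0 zero_le_power2[of c] by (simp_all add: m_def distrib_left, linarith)
  have half: "q ((L ^^ m) u) \<le> (r ^ m / 2) * q u" for u
  proof -
    have "2 * r\<^sup>2 * q ((L ^^ m) u) \<le> c\<^sup>2 * real (m + 1) * q ((L ^^ m) u)"
      using m qge by (intro mult_right_mono) auto
    also have "\<dots> \<le> r\<^sup>2 * (r ^ m * q u)"
      using key'[of m u] by (simp add: power_add power2_eq_square mult_ac)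
    finally have "r\<^sup>2 * (2 * q ((L ^^ m) u)) \<le> r\<^sup>2 * (r ^ m * q u)" by (simp add: mult_ac)
    then have "2 * q ((L ^^ m) u) \<le> r ^ m * q u"
      using r1 by (subst (asm) mult_le_cancel_left_pos) auto
    then show ?thesis by simp
  qed
  \<comment> \<open>Otherwise \<open>root m (r ^ m / 2)\<close> is an admissible rate smaller than
    \<open>r\<close>, as one sees by cutting exponents into blocks of length
    \<open>m\<close>.\<close>
  have "r ^ m / 2 < 1"
  proof (rule ccontr)
    assume "\<not> r ^ m / 2 < 1"
    then have rm: "r ^ m / 2 \<ge> 1" by simp
    define s where "s = root m (r ^ m / 2)"
    have sm: "s ^ m = r ^ m / 2" using m rm by (simp add: s_def)
    have s1: "s \<ge> 1" using rm m by (simp add: s_def)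
    have "s ^ m < r ^ m" using sm one_le_power[OF r1, of m] by linarith
    then have "s < r" using r1 by (intro power_less_imp_less_base[of s m r]) auto
    define K where "K = (\<Sum>j<m. (max M 1) ^ j)"
    have K0: "K \<ge> 0" by (auto simp: K_def intro: sum_nonneg)
    have init: "q ((L ^^ j) u) \<le> K * q u" if "j < m" for j u
    proof -
      have "q ((L ^^ j) u) \<le> (max M 1) ^ j * q u"
        using \<open>\<And>n u. q ((L ^^ n) u) \<le> 1 * (max M 1) ^ n * q u\<close>[of j u] by simp
      also have "\<dots> \<le> K * q u"
        unfolding K_def using that qge by (intro mult_right_mono member_le_sum) auto
      finally show ?thesis .
    qed
    have pow: "q ((L ^^ (m * k)) u) \<le> (s ^ m) ^ k * q u" for k u
    proof (induction k)
      case (Suc k)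
      have "q ((L ^^ (m * Suc k)) u) = q ((L ^^ m) ((L ^^ (m * k)) u))"
        by (simp add: funpow_add)
      also have "\<dots> \<le> s ^ m * q ((L ^^ (m * k)) u)" unfolding sm by (rule half)
      also have "\<dots> \<le> s ^ m * ((s ^ m) ^ k * q u)" using Suc s1 by (intro mult_left_mono) auto
      finally show ?case by simp
    qed simp
    have "q ((L ^^ n) u) \<le> K * s ^ n * q u" for n u
    proof -
      have "q ((L ^^ n) u) = q ((L ^^ (n mod m)) ((L ^^ (m * (n div m))) u))"
        by (metis funpow_add mod_mult_div_eq o_apply)
      also have "\<dots> \<le> K * q ((L ^^ (m * (n div m))) u)" using m by (intro init) auto
      also have "\<dots> \<le> K * (s ^ (m * (n div m)) * q u)"
        using pow K0 by (intro mult_left_mono) (auto simp: power_mult)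
      also have "\<dots> \<le> K * (s ^ n * q u)"
        using s1 K0 qge by (intro mult_left_mono mult_right_mono power_increasing) auto
      finally show ?thesis by simp
    qed
    then have "s \<in> R" using s1 by (auto simp: R_def)
    then have "r \<le> s" unfolding r_def using bdd by (intro cInf_lower) auto
    then show False using \<open>s < r\<close> by simp
  qed
  then show ?thesis using half m r1 by (intro exI[of _ m] exI[of _ "r ^ m / 2"] conjI) auto
qed

text \<open>\<open>K\<close> and \<open>\<rho>\<close> are chosen before the operator and the
  seminorm, so that one pair serves a whole family \<open>L t\<close>. They come from cutting
  \<open>n\<close> into blocks of length \<open>m\<close>.\<close>

lemma exponential_decay_of_power_contraction:
  fixes M \<theta> :: real and m :: nat
  assumes m: "m > 0" and \<theta>: "0 \<le> \<theta>" "\<theta> < 1" and M: "0 \<le> M"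
  shows "\<exists>K \<rho>. 0 < K \<and> 0 < \<rho> \<and> \<rho> < 1 \<and> (\<forall>(L :: 'g \<Rightarrow> 'g) q. (\<forall>u. 0 \<le> q u) \<longrightarrow>
    (\<forall>u. q (L u) \<le> M * q u) \<longrightarrow> (\<forall>u. q ((L ^^ m) u) \<le> \<theta> * q u) \<longrightarrow>
    (\<forall>n u. q ((L ^^ n) u) \<le> K * \<rho> ^ n * q u))"
proof -
  \<comment> \<open>\<open>\<theta>\<close> may be 0, while the rate \<open>\<rho>\<close> has to be
    positive.\<close>
  define \<theta>' where "\<theta>' = max \<theta> (1/2)"
  have \<theta>': "0 < \<theta>'" "\<theta>' < 1" "\<theta> \<le> \<theta>'" using \<theta> by (auto simp: \<theta>'_def)
  define \<rho> where "\<rho> = root m \<theta>'"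
  have \<rho>m: "\<rho> ^ m = \<theta>'" using m \<theta>' by (simp add: \<rho>_def)
  have \<rho>: "0 < \<rho>" "\<rho> < 1" using m \<theta>' by (auto simp: \<rho>_def)
  define K0 where "K0 = (max M 1) ^ m"
  define K where "K = K0 / \<rho> ^ m"
  have K0: "K0 \<ge> 1" by (simp add: K0_def)
  have K: "K > 0" using K0 \<rho> by (simp add: K_def)
  have "q ((L ^^ n) u) \<le> K * \<rho> ^ n * q u"
    if q: "\<forall>u. 0 \<le> q u" and bd: "\<forall>u. q (L u) \<le> M * q u"
      and ct: "\<forall>u. q ((L ^^ m) u) \<le> \<theta> * q u" for L :: "'g \<Rightarrow> 'g" and q n u
  proof -
    have 1: "q ((L ^^ j) u) \<le> (max M 1) ^ j * q u" for j u
    proof (induction j)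
      case (Suc j)
      have "q ((L ^^ Suc j) u) \<le> max M 1 * q ((L ^^ j) u)"
        using order_trans[OF bd[rule_format] mult_right_mono[OF max.cobounded1 q[rule_format]]] by simp
      also have "\<dots> \<le> max M 1 * ((max M 1) ^ j * q u)"
        using Suc by (intro mult_left_mono) auto
      finally show ?case by simp
    qed simp
    have 2: "q ((L ^^ (m * k)) u) \<le> \<theta>' ^ k * q u" for k u
    proof (induction k)
      case (Suc k)
      have "q ((L ^^ (m * Suc k)) u) = q ((L ^^ m) ((L ^^ (m * k)) u))"
        by (simp add: funpow_add)
      also have "\<dots> \<le> \<theta>' * q ((L ^^ (m * k)) u)"
        using order_trans[OF ct[rule_format] mult_right_mono[OF \<theta>'(3) q[rule_format]]] .
      also have "\<dots> \<le> \<theta>' * (\<theta>' ^ k * q u)" using Suc \<theta>' by (intro mult_left_mono) auto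
      finally show ?case by simp
    qed simp
    have "q ((L ^^ n) u) = q ((L ^^ (n mod m)) ((L ^^ (m * (n div m))) u))"
      by (metis funpow_add mod_mult_div_eq o_apply)
    also have "\<dots> \<le> (max M 1) ^ (n mod m) * q ((L ^^ (m * (n div m))) u)" by (rule 1)
    also have "\<dots> \<le> K0 * (\<theta>' ^ (n div m) * q u)"
      unfolding K0_def using m q 2 by (intro mult_mono power_increasing) (auto simp: less_imp_le)
    also have "\<theta>' ^ (n div m) * \<rho> ^ m \<le> \<rho> ^ n"
    proof -
      have "\<theta>' ^ (n div m) * \<rho> ^ m = \<rho> ^ (m * (n div m) + m)"
        by (simp only: \<rho>m[symmetric] power_mult power_add)
      also have "\<dots> \<le> \<rho> ^ n"
        using \<rho> mod_less_divisor[OF m, of n] mult_div_mod_eq[of m n]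
        by (intro power_decreasing) linarith+
      finally show ?thesis .
    qed
    then have "K0 * (\<theta>' ^ (n div m) * q u) \<le> K * \<rho> ^ n * q u"
    proof -
      assume *: "\<theta>' ^ (n div m) * \<rho> ^ m \<le> \<rho> ^ n"
      have "\<theta>' ^ (n div m) \<le> \<rho> ^ n / \<rho> ^ m" using * \<rho> by (simp add: field_simps)
      then have "K0 * (\<theta>' ^ (n div m) * q u) \<le> K0 * (\<rho> ^ n / \<rho> ^ m * q u)"
        using q K0 by (intro mult_left_mono mult_right_mono) auto
      then show ?thesis by (simp add: K_def)
    qed
    finally show ?thesis .
  qed
  then show ?thesis using K \<rho> by blast
qed

section \<open>Distance to a complex subspace\<close>

definition complex_subspace :: "'g::complex_banach set \<Rightarrow> bool" where
  "complex_subspace E \<longleftrightarrow> 0 \<in> E \<and> (\<forall>x\<in>E. \<forall>y\<in>E. x + y \<in> E) \<and> (\<forall>c. \<forall>x\<in>E. c *\<^sub>C x \<in> E)"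

lemma complex_subspaceD:
  assumes "complex_subspace E"
  shows "0 \<in> E" "x \<in> E \<Longrightarrow> y \<in> E \<Longrightarrow> x + y \<in> E" "x \<in> E \<Longrightarrow> c *\<^sub>C x \<in> E"
    "x \<in> E \<Longrightarrow> - x \<in> E" "x \<in> E \<Longrightarrow> y \<in> E \<Longrightarrow> x - y \<in> E"
proof -
  show "0 \<in> E" and add: "x \<in> E \<Longrightarrow> y \<in> E \<Longrightarrow> x + y \<in> E" "x \<in> E \<Longrightarrow> c *\<^sub>C x \<in> E" for x y c
    using assms by (auto simp: complex_subspace_def)
  show neg: "x \<in> E \<Longrightarrow> - x \<in> E" for x
    using add(2)[of x "-1"] by (simp add: scaleC.minus_left)
  show "x \<in> E \<Longrightarrow> y \<in> E \<Longrightarrow> x - y \<in> E"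
    using add(1)[of x "- y"] neg[of y] by simp
qed

lemma complex_subspace_sum:
  assumes "complex_subspace E" "\<And>i. i \<in> I \<Longrightarrow> g i \<in> E"
  shows "sum g I \<in> E"
  using assms(2) by (induction I rule: infinite_finite_induct) (auto simp: complex_subspaceD[OF assms(1)])

lemma infdist_approx:
  assumes "E \<noteq> {}" "infdist x E < d"
  obtains e where "e \<in> E" "norm (x - e) < d"
proof -
  have "(INF a\<in>E. dist x a) < d" using assms by (simp add: infdist_notempty)
  then show ?thesis
    using assms(1) that by (subst (asm) cINF_less_iff) (auto simp: dist_norm intro: bdd_belowI2[of _ 0])
qed

text \<open>The distance to \<open>E\<close> is the seminorm of the quotient by \<open>E\<close>; it
  stands in for the quotient space throughout.\<close>

lemma
  assumes E: "complex_subspace E"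
  shows infdist_triangle_subspace: "infdist (x + y) E \<le> infdist x E + infdist y E"
    and infdist_scaleC: "infdist (c *\<^sub>C x) E = cmod c * infdist x E"
    and infdist_le_norm: "infdist x E \<le> norm x"
    and infdist_add_member: "e \<in> E \<Longrightarrow> infdist (x + e) E = infdist x E"
    and infdist_diff_member: "e \<in> E \<Longrightarrow> infdist (x - e) E = infdist x E"
proof -
  note E' = complex_subspaceD[OF E]
  have ne: "E \<noteq> {}" using E'(1) by auto
  show tri: "infdist (x + y) E \<le> infdist x E + infdist y E" for x y
  proof (rule field_le_epsilon)
    fix d :: real assume d: "d > 0"
    obtain e where e: "e \<in> E" "norm (x - e) < infdist x E + d / 2"
      by (rule infdist_approx[OF ne, of x "infdist x E + d / 2"]) (use d in auto)
    obtain e' where e': "e' \<in> E" "norm (y - e') < infdist y E + d / 2"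
      by (rule infdist_approx[OF ne, of y "infdist y E + d / 2"]) (use d in auto)
    have "infdist (x + y) E \<le> dist (x + y) (e + e')" using e e' by (intro infdist_le E')
    also have "\<dots> \<le> norm (x - e) + norm (y - e')"
      unfolding dist_norm by (rule order_trans[OF _ norm_triangle_ineq]) (simp add: algebra_simps)
    finally show "infdist (x + y) E \<le> infdist x E + infdist y E + d" using e e' by simp
  qed
  have le: "infdist (c *\<^sub>C x) E \<le> cmod c * infdist x E" for c x
  proof (rule field_le_epsilon)
    fix d :: real assume d: "d > 0"
    have c1: "0 < cmod c + 1" by (simp add: add_nonneg_pos)
    obtain e where e: "e \<in> E" "norm (x - e) < infdist x E + d / (cmod c + 1)"
      by (rule infdist_approx[OF ne, of x "infdist x E + d / (cmod c + 1)"]) (use d c1 in auto)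
    have "infdist (c *\<^sub>C x) E \<le> dist (c *\<^sub>C x) (c *\<^sub>C e)" using e by (intro infdist_le E')
    also have "\<dots> = cmod c * norm (x - e)"
      by (simp add: dist_norm scaleC.diff_right[symmetric] norm_scaleC)
    also have "\<dots> \<le> cmod c * (infdist x E + d / (cmod c + 1))"
      using e by (intro mult_left_mono) auto
    also have "\<dots> \<le> cmod c * infdist x E + d"
      using d c1 by (simp add: field_simps)
    finally show "infdist (c *\<^sub>C x) E \<le> cmod c * infdist x E + d" .
  qed
  show "infdist (c *\<^sub>C x) E = cmod c * infdist x E"
  proof (cases "c = 0")
    case True
    then show ?thesis using E'(1) by simp
  next
    case False
    have "infdist x E = infdist (inverse c *\<^sub>C (c *\<^sub>C x)) E" using False by (simp add: scaleC_scaleC)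
    also have "\<dots> \<le> inverse (cmod c) * infdist (c *\<^sub>C x) E"
      using le[of "inverse c" "c *\<^sub>C x"] by (simp add: norm_inverse)
    finally show ?thesis using le[of c x] False by (simp add: field_simps)
  qed
  show "infdist x E \<le> norm x" using infdist_le[OF E'(1), of x] by simp
  show add: "infdist (x + e) E = infdist x E" if "e \<in> E" for e x
    using tri[of x e] tri[of "x + e" "- e"] that E'(4)[OF that] by simp
  show "infdist (x - e) E = infdist x E" if "e \<in> E"
    using add[of "- e" x] E'(4)[OF that] by simp
qed

text \<open>Along a fast subsequence each jump is corrected by an element of \<open>E\<close>. The
  corrected sequence \<open>w\<close> has summable increments, so it converges in the whole space,
  and corrections are invisible to the distance.\<close>

lemma complete_modulo_subspace:
  assumes E: "complex_subspace E"
    and cau: "\<And>\<epsilon>. \<epsilon> > 0 \<Longrightarrow> \<exists>N. \<forall>j\<ge>N. \<forall>k\<ge>N. infdist (u j - u k) E < (\<epsilon>::real)"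
  shows "\<exists>w s. strict_mono (s :: nat \<Rightarrow> nat) \<and> (\<lambda>k. infdist (u (s k) - w) E) \<longlonglongrightarrow> 0"
proof -
  note E' = complex_subspaceD[OF E]
  have ne: "E \<noteq> {}" using E'(1) by auto
  have "\<exists>s :: nat \<Rightarrow> nat. \<forall>k. (\<forall>j\<ge>s k. infdist (u j - u (s k)) E < (1/2) ^ k) \<and> s k < s (Suc k)"
  proof (rule dependent_nat_choice)
    show "\<exists>x. \<forall>j\<ge>x. infdist (u j - u x) E < (1 / 2) ^ 0" using cau[of 1] by fastforce
    fix x and n :: nat
    obtain N where "\<forall>j\<ge>N. \<forall>k\<ge>N. infdist (u j - u k) E < (1/2) ^ Suc n"
      using cau[of "(1/2) ^ Suc n"] by auto
    then show "\<exists>y. (\<forall>j\<ge>y. infdist (u j - u y) E < (1 / 2) ^ Suc n) \<and> x < y"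
      by (intro exI[of _ "max N (Suc x)"]) auto
  qed
  then obtain s where s: "\<And>k j. j \<ge> s k \<Longrightarrow> infdist (u j - u (s k)) E < (1/2) ^ k"
    and mono: "strict_mono s" by (auto simp: strict_mono_Suc_iff)
  have "\<exists>e. e \<in> E \<and> norm (u (s (Suc k)) - u (s k) - e) < (1/2) ^ k" for k
    using infdist_approx[OF ne s[of k "s (Suc k)"]] mono
    by (metis lessI less_imp_le strict_mono_less)
  then obtain e where e: "\<And>k. e k \<in> E" "\<And>k. norm (u (s (Suc k)) - u (s k) - e k) < (1/2) ^ k"
    by metis
  define w where "w k = u (s k) - (\<Sum>i<k. e i)" for k
  have step: "norm (w (Suc k) - w k) \<le> (1/2) ^ k" for k
    using e(2)[of k] by (simp add: w_def algebra_simps less_imp_le)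
  have "summable (\<lambda>k. w (Suc k) - w k)"
    by (rule summable_comparison_test'[of "\<lambda>k. (1/2::real) ^ k" 0]) (auto intro: step summable_geometric)
  then have "(\<lambda>n. \<Sum>k<n. w (Suc k) - w k) \<longlonglongrightarrow> (\<Sum>k. w (Suc k) - w k)"
    by (rule summable_LIMSEQ)
  then have "(\<lambda>n. (\<Sum>k<n. w (Suc k) - w k) + w 0) \<longlonglongrightarrow> (\<Sum>k. w (Suc k) - w k) + w 0"
    by (intro tendsto_intros)
  then obtain l where l: "w \<longlonglongrightarrow> l" by (auto simp: sum_lessThan_telescope)
  have "infdist (u (s k) - l) E \<le> norm (w k - l)" for k
  proof -
    have m: "(\<Sum>i<k. e i) \<in> E" by (intro complex_subspace_sum[OF E] e)
    have "u (s k) - l = (w k - l) + (\<Sum>i<k. e i)" by (simp add: w_def)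
    then have "infdist (u (s k) - l) E = infdist (w k - l) E"
      by (simp only: infdist_add_member[OF E m])
    then show ?thesis using infdist_le_norm[OF E] by simp
  qed
  moreover have "(\<lambda>k. norm (w k - l)) \<longlonglongrightarrow> 0"
    using l by (simp add: LIM_zero tendsto_norm_zero)
  ultimately have "(\<lambda>k. infdist (u (s k) - l) E) \<longlonglongrightarrow> 0"
    by (intro Lim_null_comparison[of "\<lambda>k. infdist (u (s k) - l) E" "\<lambda>k. norm (w k - l)"])
       (auto simp: infdist_nonneg)
  then show ?thesis using mono by blast
qed

section \<open>Spans of finitely many eigenvectors\<close>

definition complex_span :: "('i \<Rightarrow> 'g::complex_banach) \<Rightarrow> 'i set \<Rightarrow> 'g set" where
  "complex_span v I = range (\<lambda>c. \<Sum>i\<in>I. c i *\<^sub>C v i)"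

lemma complex_subspace_span: "complex_subspace (complex_span v I)"
  unfolding complex_subspace_def complex_span_def
proof (intro conjI ballI allI)
  show "0 \<in> range (\<lambda>c. \<Sum>i\<in>I. c i *\<^sub>C v i)" by (rule range_eqI[of _ _ "\<lambda>_. 0"]) simp
  fix x y assume "x \<in> range (\<lambda>c. \<Sum>i\<in>I. c i *\<^sub>C v i)" "y \<in> range (\<lambda>c. \<Sum>i\<in>I. c i *\<^sub>C v i)"
  then obtain a b where "x = (\<Sum>i\<in>I. a i *\<^sub>C v i)" "y = (\<Sum>i\<in>I. b i *\<^sub>C v i)" by auto
  then show "x + y \<in> range (\<lambda>c. \<Sum>i\<in>I. c i *\<^sub>C v i)"
    by (intro range_eqI[of _ _ "\<lambda>i. a i + b i"]) (simp add: scaleC_add_left sum.distrib)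
next
  fix c x assume "x \<in> range (\<lambda>c. \<Sum>i\<in>I. c i *\<^sub>C v i)"
  then obtain a where "x = (\<Sum>i\<in>I. a i *\<^sub>C v i)" by auto
  then show "c *\<^sub>C x \<in> range (\<lambda>c. \<Sum>i\<in>I. c i *\<^sub>C v i)"
    by (intro range_eqI[of _ _ "\<lambda>i. c * a i"]) (simp add: scaleC_scaleC scaleC.sum_right)
qed

lemma complex_span_insert:
  assumes "finite I" "j \<notin> I"
  shows "complex_span v (insert j I) = {e + c *\<^sub>C v j | e c. e \<in> complex_span v I}"
proof (intro equalityI subsetI)
  fix x assume "x \<in> complex_span v (insert j I)"
  then obtain a where "x = (\<Sum>i\<in>insert j I. a i *\<^sub>C v i)" by (auto simp: complex_span_def)
  then have "x = (\<Sum>i\<in>I. a i *\<^sub>C v i) + a j *\<^sub>C v j" using assms by (simp add: add.commute)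
  then show "x \<in> {e + c *\<^sub>C v j | e c. e \<in> complex_span v I}" by (auto simp: complex_span_def)
next
  fix x assume "x \<in> {e + c *\<^sub>C v j | e c. e \<in> complex_span v I}"
  then obtain a c where x: "x = (\<Sum>i\<in>I. a i *\<^sub>C v i) + c *\<^sub>C v j" by (auto simp: complex_span_def)
  have "(\<Sum>i\<in>I. (a(j := c)) i *\<^sub>C v i) = (\<Sum>i\<in>I. a i *\<^sub>C v i)"
    using assms by (intro sum.cong) auto
  then have "x = (\<Sum>i\<in>insert j I. (a(j := c)) i *\<^sub>C v i)" using assms x by (simp add: add.commute)
  then show "x \<in> complex_span v (insert j I)" unfolding complex_span_def by blast
qed

lemma adjoin_vector_coefficient:
  assumes E: "complex_subspace E" and e: "e \<in> E"
  shows "cmod c * infdist v E \<le> norm (e + c *\<^sub>C v)"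
proof -
  have "cmod c * infdist v E = infdist (c *\<^sub>C v) E" by (simp add: infdist_scaleC[OF E])
  also have "\<dots> = infdist (c *\<^sub>C v + e) E" by (simp add: infdist_add_member[OF E e])
  also have "\<dots> \<le> norm (e + c *\<^sub>C v)" using infdist_le_norm[OF E] by (simp add: add.commute)
  finally show ?thesis .
qed

text \<open>The distance from \<open>v\<close> to \<open>E\<close> controls the coefficient of
  \<open>v\<close>, so convergence of \<open>e + c *\<^sub>C v\<close> forces convergence of
  \<open>c\<close>, and then of the part in \<open>E\<close>.\<close>

lemma closed_adjoin_vector:
  assumes E: "complex_subspace E" and cl: "closed E" and v: "v \<notin> E"
  shows "closed {e + c *\<^sub>C v | e c. e \<in> E}"
  unfolding closed_sequential_limits
proof (intro allI impI, elim conjE)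
  note E' = complex_subspaceD[OF E]
  fix x l assume x: "\<forall>n. x n \<in> {e + c *\<^sub>C v | e c. e \<in> E}" and lim: "x \<longlonglongrightarrow> l"
  define d where "d = infdist v E"
  have d: "d > 0" unfolding d_def using cl v E'(1) by (intro infdist_pos_not_in_closed) auto
  obtain e c where e: "\<And>n. e n \<in> E" and xe: "\<And>n. x n = e n + c n *\<^sub>C v"
    using x by (simp only: mem_Collect_eq) metis
  have "Cauchy c"
  proof (rule CauchyI)
    fix \<epsilon> :: real assume "\<epsilon> > 0"
    then obtain N where N: "\<And>m n. m \<ge> N \<Longrightarrow> n \<ge> N \<Longrightarrow> norm (x m - x n) < \<epsilon> * d"
      using CauchyD[OF LIMSEQ_imp_Cauchy[OF lim], of "\<epsilon> * d"] d by auto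
    have "norm (c m - c n) < \<epsilon>" if "m \<ge> N" "n \<ge> N" for m n
    proof -
      have "cmod (c m - c n) * d \<le> norm ((e m - e n) + (c m - c n) *\<^sub>C v)"
        unfolding d_def by (intro adjoin_vector_coefficient[OF E] E' e)
      also have "(e m - e n) + (c m - c n) *\<^sub>C v = x m - x n"
        by (simp add: xe scaleC.diff_left)
      finally have "cmod (c m - c n) * d < \<epsilon> * d" using N[OF that] by linarith
      then show ?thesis using d by simp
    qed
    then show "\<exists>M. \<forall>m\<ge>M. \<forall>n\<ge>M. norm (c m - c n) < \<epsilon>" by blast
  qed
  then obtain c0 where c0: "c \<longlonglongrightarrow> c0" using Cauchy_convergent convergent_def by blast
  have "(\<lambda>n. x n - c n *\<^sub>C v) \<longlonglongrightarrow> l - c0 *\<^sub>C v"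
    by (intro tendsto_diff lim scaleC.tendsto c0 tendsto_const)
  then have "l - c0 *\<^sub>C v \<in> E"
    using closed_sequentially[OF cl, of "\<lambda>n. x n - c n *\<^sub>C v"] e by (simp add: xe)
  then show "l \<in> {e + c *\<^sub>C v | e c. e \<in> E}"
    by (simp only: mem_Collect_eq) (metis diff_add_cancel)
qed

text \<open>The coefficient bound is a quantitative linear independence and feeds its own induction:
  if \<open>v a\<close> were in the old span, applying \<open>L - a\<close> would give a vanishing
  combination of the old eigenvectors with coefficients \<open>(z - a) * c z\<close>, so all
  \<open>c z\<close> would vanish. The new coefficient is then controlled by the distance from
  \<open>v a\<close> to the old span.\<close>

lemma eigenvector_span:
  assumes L: "bounded_clinear L" and fin: "finite \<Lambda>"
    and v: "\<And>z. z \<in> \<Lambda> \<Longrightarrow> v z \<noteq> 0 \<and> L (v z) = z *\<^sub>C v z"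
  shows "closed (complex_span v \<Lambda>) \<and>
    (\<exists>K>0. \<forall>c. \<forall>z\<in>\<Lambda>. cmod (c z) \<le> K * norm (\<Sum>z\<in>\<Lambda>. c z *\<^sub>C v z))"
  using fin v
proof (induction \<Lambda> rule: finite_induct)
  case empty
  then show ?case by (auto simp: complex_span_def intro: exI[of _ 1])
next
  case (insert a \<Lambda>)
  note L' = bounded_clinearD[OF L]
  let ?E = "complex_span v \<Lambda>"
  note E = complex_subspace_span[of v \<Lambda>]
  from insert obtain K where cl: "closed ?E" and K: "K > 0"
    and Kb: "\<And>c z. z \<in> \<Lambda> \<Longrightarrow> cmod (c z) \<le> K * norm (\<Sum>z\<in>\<Lambda>. c z *\<^sub>C v z)" by auto
  have va: "v a \<noteq> 0" "L (v a) = a *\<^sub>C v a" using insert by auto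
  have notin: "v a \<notin> ?E"
  proof
    assume "v a \<in> ?E"
    then obtain c where c: "v a = (\<Sum>z\<in>\<Lambda>. c z *\<^sub>C v z)" by (auto simp: complex_span_def)
    have "L (v a) = (\<Sum>z\<in>\<Lambda>. (z * c z) *\<^sub>C v z)"
      unfolding c L' using insert by (intro sum.cong) (auto simp: L' scaleC_scaleC mult.commute)
    moreover have "L (v a) = (\<Sum>z\<in>\<Lambda>. (a * c z) *\<^sub>C v z)"
      unfolding va(2) by (subst c) (simp add: scaleC.sum_right scaleC_scaleC)
    ultimately have "(\<Sum>z\<in>\<Lambda>. ((z - a) * c z) *\<^sub>C v z) = 0"
      by (simp add: left_diff_distrib scaleC.diff_left sum_subtractf)
    then have "c z = 0" if "z \<in> \<Lambda>" for z
      using Kb[OF that, of "\<lambda>z. (z - a) * c z"] that insert(2) by auto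
    then show False using va c by simp
  qed
  define d where "d = infdist (v a) ?E"
  have d: "d > 0" unfolding d_def using cl notin complex_subspaceD(1)[OF E]
    by (intro infdist_pos_not_in_closed) auto
  have "closed (complex_span v (insert a \<Lambda>))"
    unfolding complex_span_insert[OF insert(1,2)]
    by (rule closed_adjoin_vector[OF E cl notin])
  moreover have "cmod (c z) \<le> (1 / d + K * (1 + norm (v a) / d)) * norm (\<Sum>z\<in>insert a \<Lambda>. c z *\<^sub>C v z)"
    if z: "z \<in> insert a \<Lambda>" for c z
  proof -
    define x where "x = (\<Sum>z\<in>\<Lambda>. c z *\<^sub>C v z)"
    define y where "y = x + c a *\<^sub>C v a"
    have y: "(\<Sum>z\<in>insert a \<Lambda>. c z *\<^sub>C v z) = y" using insert by (simp add: y_def x_def add.commute)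
    have "cmod (c a) * d \<le> norm y" unfolding d_def y_def
      by (intro adjoin_vector_coefficient[OF E]) (auto simp: x_def complex_span_def)
    then have ca: "cmod (c a) \<le> norm y / d" using d by (simp add: field_simps)
    have "norm x \<le> norm y + norm (c a *\<^sub>C v a)" unfolding y_def
      by (metis add_diff_cancel_right' norm_triangle_ineq4)
    also have "\<dots> \<le> norm y + norm y / d * norm (v a)"
      using mult_right_mono[OF ca norm_ge_zero[of "v a"]] by (simp add: norm_scaleC)
    finally have xy: "norm x \<le> (1 + norm (v a) / d) * norm y" by (simp add: algebra_simps)
    have e1: "norm y / d \<le> (1 / d + K * (1 + norm (v a) / d)) * norm y"
      using d K by (simp add: distrib_right add_nonneg_nonneg)
    have e2: "K * ((1 + norm (v a) / d) * norm y) \<le> (1 / d + K * (1 + norm (v a) / d)) * norm y"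
    proof -
      have "(1 / d + K * X) * norm y = 1 / d * norm y + K * (X * norm y)" for X
        by (simp only: distrib_right mult.assoc)
      moreover have "0 \<le> 1 / d * norm y" using d by simp
      ultimately show ?thesis by simp
    qed
    show ?thesis
    proof (cases "z = a")
      case True
      then show ?thesis using ca e1 y by simp
    next
      case False
      then have "cmod (c z) \<le> K * norm x" using Kb[of z c] z by (simp add: x_def)
      also have "\<dots> \<le> K * ((1 + norm (v a) / d) * norm y)"
        using xy K by (intro mult_left_mono) auto
      finally show ?thesis using e2 y by simp
    qed
  qed
  moreover have "1 / d + K * (1 + norm (v a) / d) > 0" using d K by (simp add: add_pos_nonneg)
  ultimately show ?case by blast
qed

lemma complex_span_member: "finite I \<Longrightarrow> i \<in> I \<Longrightarrow> v i \<in> complex_span v I"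
  unfolding complex_span_def
  by (rule range_eqI[of _ _ "\<lambda>j. if j = i then 1 else 0"])
     (simp add: if_distrib[of "\<lambda>c. c *\<^sub>C _"] sum.delta cong: if_cong)

lemma complex_span_mono:
  assumes "finite J" "I \<subseteq> J"
  shows "complex_span v I \<subseteq> complex_span v J"
proof
  fix x assume "x \<in> complex_span v I"
  then obtain c where "x = (\<Sum>i\<in>I. c i *\<^sub>C v i)" by (auto simp: complex_span_def)
  also have "\<dots> \<in> complex_span v J"
    using assms by (intro complex_subspace_sum[OF complex_subspace_span]
        complex_subspaceD(3)[OF complex_subspace_span] complex_span_member) auto
  finally show "x \<in> complex_span v J" .
qed

lemma complex_span_invariant:
  assumes L: "bounded_clinear L" and I: "finite I"
    and v: "\<And>i. i \<in> I \<Longrightarrow> L (v i) \<in> complex_span v I" and x: "x \<in> complex_span v I"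
  shows "L x \<in> complex_span v I"
proof -
  obtain c where "x = (\<Sum>i\<in>I. c i *\<^sub>C v i)" using x by (auto simp: complex_span_def)
  then have "L x = (\<Sum>i\<in>I. c i *\<^sub>C L (v i))" by (simp add: bounded_clinearD[OF L])
  then show ?thesis
    using v by (auto intro!: complex_subspace_sum[OF complex_subspace_span]
        complex_subspaceD(3)[OF complex_subspace_span])
qed

lemma funpow_invariant: "(\<And>x. x \<in> E \<Longrightarrow> L x \<in> E) \<Longrightarrow> x \<in> E \<Longrightarrow> (L ^^ n) x \<in> E"
  by (induction n) auto

lemma compact_operator_subsequence:
  fixes \<iota> :: "'g::complex_banach \<Rightarrow> 'h::complex_banach"
  assumes \<iota>: "bounded_clinear \<iota>" and cpt: "compact (closure (\<iota> ` ball 0 1))"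
    and bd: "\<And>k. norm (x k) \<le> b"
  shows "\<exists>s :: nat \<Rightarrow> nat. strict_mono s \<and> Cauchy (\<lambda>k. \<iota> (x (s k)))"
proof -
  interpret bounded_linear \<iota> by (rule bounded_clinearD[OF \<iota>])
  define a where "a = b + 1"
  have b: "b \<ge> 0" using bd[of 0] norm_ge_zero order_trans by blast
  then have a: "a > 0" by (simp add: a_def)
  have "\<iota> ((1 / a) *\<^sub>R x k) \<in> closure (\<iota> ` ball 0 1)" for k
  proof -
    have "norm ((1 / a) *\<^sub>R x k) < 1" using bd[of k] a by (simp add: a_def field_simps)
    then show ?thesis by (intro subsetD[OF closure_subset] imageI) simp
  qed
  then obtain l s where s: "strict_mono s" and l: "(\<lambda>k. \<iota> ((1 / a) *\<^sub>R x (s k))) \<longlonglongrightarrow> l"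
    using cpt[unfolded compact_def, rule_format, of "\<lambda>k. \<iota> ((1 / a) *\<^sub>R x k)"] by (auto simp: o_def)
  have "(\<lambda>k. a *\<^sub>R \<iota> ((1 / a) *\<^sub>R x (s k))) \<longlonglongrightarrow> a *\<^sub>R l"
    using l by (intro tendsto_intros)
  then have "(\<lambda>k. \<iota> (x (s k))) \<longlonglongrightarrow> a *\<^sub>R l"
    using a by (simp add: scaleR)
  then show ?thesis using s LIMSEQ_imp_Cauchy by blast
qed

lemma small_power_times:
  fixes \<eta> :: real assumes "0 < \<eta>" "\<eta> < 1" "0 < (\<epsilon>::real)"
  shows "\<exists>n. C * \<eta> ^ n < \<epsilon>"
proof -
  have "(\<lambda>n. C * \<eta> ^ n) \<longlonglongrightarrow> C * 0" using assms by (intro tendsto_intros LIMSEQ_realpow_zero) auto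
  then have "eventually (\<lambda>n. C * \<eta> ^ n < \<epsilon>) sequentially"
    using assms(3) by (intro order_tendstoD) auto
  then show ?thesis by (auto simp: eventually_sequentially)
qed

section \<open>Spectral decomposition of a quasi-compact operator\<close>

locale quasi_compact =
  fixes L :: "'g::complex_banach \<Rightarrow> 'g" and \<iota> :: "'g \<Rightarrow> 'h::complex_banach"
    and C \<eta> R :: real
  assumes L: "bounded_clinear L" and \<iota>: "bounded_clinear \<iota>"
    and cpt: "compact (closure (\<iota> ` ball 0 1))"
    and C: "C > 0" and \<eta>: "0 < \<eta>" "\<eta> < 1" and R: "R \<ge> 1"
    and LY: "\<And>n u. norm ((L ^^ n) u) \<le> C * \<eta> ^ n * norm u + C * R ^ n * norm (\<iota> u)"
begin

text \<open>Riesz's argument. Infinitely many eigenvalues would give strictly increasing spans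
  \<open>E k\<close> and vectors of norm at most 2 at distance 1 from the previous span. Modulo
  \<open>E k\<close>, \<open>L ^^ n\<close> multiplies the new direction by \<open>z k ^ n\<close>,
  of modulus at least 1, so the images stay separated. Compactness of \<open>\<iota>\<close> and the
  Lasota--Yorke inequality bring two of them close.\<close>

lemma finite_peripheral_eigenvalues: "finite {z. eigenvalue L z \<and> 1 \<le> cmod z}"
proof (rule ccontr)
  assume "infinite {z. eigenvalue L z \<and> 1 \<le> cmod z}"
  then obtain z :: "nat \<Rightarrow> complex" where inj: "inj z"
    and "range z \<subseteq> {z. eigenvalue L z \<and> 1 \<le> cmod z}"
    by (auto dest: infinite_countable_subset)
  then have ev: "eigenvalue L (z k)" and z1: "1 \<le> cmod (z k)" for k by auto
  define v where "v w = (SOME u. u \<noteq> 0 \<and> L u = w *\<^sub>C u)" for w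
  have v: "v (z k) \<noteq> 0 \<and> L (v (z k)) = z k *\<^sub>C v (z k)" for k
    unfolding v_def by (rule someI_ex[OF ev[of k, unfolded eigenvalue_def]])
  define E where "E k = complex_span v (z ` {..<k})" for k
  have sub: "complex_subspace (E k)" for k by (simp add: E_def complex_subspace_span)
  note sub' = complex_subspaceD[OF sub]
  have cl: "closed (E k)" for k
    unfolding E_def using v by (intro conjunct1[OF eigenvector_span[OF L]]) auto
  have mono: "E j \<subseteq> E k" if "j \<le> k" for j k
    unfolding E_def using that by (intro complex_span_mono) auto
  have mem: "v (z k) \<in> E (Suc k)" for k
    unfolding E_def by (intro complex_span_member) auto
  have inv: "(L ^^ n) x \<in> E k" if "x \<in> E k" for n x k
  proof (rule funpow_invariant[OF _ that])
    show "L x \<in> E k" if "x \<in> E k" for x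
      using that unfolding E_def
      by (rule complex_span_invariant[OF L, rotated 2])
         (auto simp: v intro!: complex_subspaceD(3)[OF complex_subspace_span] complex_span_member)
  qed
  have notin: "v (z k) \<notin> E k" for k
  proof
    assume "v (z k) \<in> E k"
    then obtain c where c: "v (z k) = (\<Sum>w\<in>z ` {..<k}. c w *\<^sub>C v w)"
      by (auto simp: E_def complex_span_def)
    have nin: "z k \<notin> z ` {..<k}" using inj by (auto dest: injD)
    have "\<exists>K>0. \<forall>c. \<forall>w\<in>insert (z k) (z ` {..<k}). cmod (c w) \<le> K * norm (\<Sum>w\<in>insert (z k) (z ` {..<k}). c w *\<^sub>C v w)"
      using v by (intro conjunct2[OF eigenvector_span[OF L]]) auto
    then obtain K where K: "\<And>c. cmod (c (z k)) \<le> K * norm (\<Sum>w\<in>insert (z k) (z ` {..<k}). c w *\<^sub>C v w)"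
      by auto
    have "(\<Sum>w\<in>z ` {..<k}. (c(z k := -1)) w *\<^sub>C v w) = v (z k)"
      unfolding c by (intro sum.cong refl) (metis fun_upd_other nin)
    then have "(\<Sum>w\<in>insert (z k) (z ` {..<k}). (c(z k := -1)) w *\<^sub>C v w) = 0"
      using nin by (simp add: scaleC.minus_left)
    then show False using K[of "c(z k := -1)"] by simp
  qed
  have "\<exists>u. infdist u (E k) = 1 \<and> norm u \<le> 2 \<and> u \<in> E (Suc k)
      \<and> (\<forall>n. (L ^^ n) u - z k ^ n *\<^sub>C u \<in> E k)" for k
  proof -
    define d where "d = infdist (v (z k)) (E k)"
    have d: "d > 0" unfolding d_def using cl notin sub'(1)
      by (intro infdist_pos_not_in_closed) blast+
    define w where "w = of_real (1 / d) *\<^sub>C v (z k)"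
    have w1: "infdist w (E k) = 1"
      using d by (simp add: w_def infdist_scaleC[OF sub] d_def norm_divide)
    obtain e where e: "e \<in> E k" "norm (w - e) < 2"
      using infdist_approx[of "E k" w 2] w1 sub'(1) by auto
    have Lw: "(L ^^ n) w = z k ^ n *\<^sub>C w" for n
    proof (rule funpow_eigenvector[OF L])
      show "L w = z k *\<^sub>C w"
        using v[of k] by (simp add: w_def bounded_clinearD[OF L] scaleC_scaleC mult.commute)
    qed
    have "(L ^^ n) (w - e) - z k ^ n *\<^sub>C (w - e) \<in> E k" for n
    proof -
      have "(L ^^ n) (w - e) - z k ^ n *\<^sub>C (w - e) = z k ^ n *\<^sub>C e - (L ^^ n) e"
        by (simp add: bounded_clinearD[OF bounded_clinear_funpow[OF L]] Lw scaleC.diff_right)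
      also have "\<dots> \<in> E k" using e by (intro sub' inv)
      finally show ?thesis .
    qed
    moreover have "w - e \<in> E (Suc k)"
      using e mono[of k "Suc k"] mem[of k] unfolding w_def by (intro sub') auto
    ultimately show ?thesis
      using e w1 by (intro exI[of _ "w - e"]) (auto simp: infdist_diff_member[OF sub])
  qed
  then obtain u where u: "\<And>k. infdist (u k) (E k) = 1" "\<And>k. norm (u k) \<le> 2" "\<And>k. u k \<in> E (Suc k)"
      "\<And>k n. (L ^^ n) (u k) - z k ^ n *\<^sub>C u k \<in> E k" by metis
  \<comment> \<open>Differences of the vectors \<open>y k\<close> below have norm at most 4. The
    strong term is thus below \<open>1 / 2\<close>, and the weak term gets the other half.\<close>
  obtain n where n: "(4 * C) * \<eta> ^ n < 1 / 2"
    using small_power_times[OF \<eta>, of "1/2" "4 * C"] by auto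
  \<comment> \<open>Division by \<open>z k ^ n\<close> makes \<open>(L ^^ n) (y k)\<close> equal to
    \<open>u k\<close> modulo \<open>E k\<close>, and does not increase norms because
    \<open>cmod (z k) \<ge> 1\<close>.\<close>
  define y where "y k = inverse (z k ^ n) *\<^sub>C u k" for k
  have zn: "z k ^ n \<noteq> 0" for k using z1[of k] by auto
  have y2: "norm (y k) \<le> 2" for k
  proof -
    have "inverse (cmod (z k) ^ n) \<le> 1" using z1[of k] by (intro inverse_le_1_iff[THEN iffD2]) auto
    then have "inverse (cmod (z k) ^ n) * norm (u k) \<le> 1 * 2" using u(2) by (intro mult_mono) auto
    then show ?thesis by (simp add: y_def norm_scaleC norm_inverse norm_power)
  qed
  have sep: "1 \<le> norm ((L ^^ n) (y k - y j))" if "j < k" for j k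
  proof -
    note Ln = bounded_clinearD[OF bounded_clinear_funpow[OF L]]
    have "(L ^^ n) (y k) - u k = inverse (z k ^ n) *\<^sub>C ((L ^^ n) (u k) - z k ^ n *\<^sub>C u k)"
      using zn[of k] by (simp add: y_def Ln scaleC.diff_right scaleC_scaleC)
    then have a: "(L ^^ n) (y k) - u k \<in> E k" using u(4) sub'(3) by simp
    have "u j \<in> E k" using u(3)[of j] mono[of "Suc j" k] that by auto
    then have b: "(L ^^ n) (y j) \<in> E k" unfolding y_def by (intro inv sub')
    have "(L ^^ n) (y k - y j) = u k + (((L ^^ n) (y k) - u k) - (L ^^ n) (y j))"
      by (simp add: Ln)
    then have "infdist ((L ^^ n) (y k - y j)) (E k) = 1"
      using u(1) a b by (simp only: infdist_add_member[OF sub sub'(5)])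
    then show ?thesis using infdist_le_norm[OF sub, of "(L ^^ n) (y k - y j)" k] by simp
  qed
  obtain s where s: "strict_mono s" and cau: "Cauchy (\<lambda>k. \<iota> (y (s k)))"
    using compact_operator_subsequence[OF \<iota> cpt, where x = y and b = 2, OF y2] by (elim exE conjE)
  have CR: "C * R ^ n > 0" using C R by simp
  obtain N where N: "\<And>j k. j \<ge> N \<Longrightarrow> k \<ge> N \<Longrightarrow> norm (\<iota> (y (s j)) - \<iota> (y (s k))) < 1 / 2 / (C * R ^ n)"
    using CauchyD[OF cau, of "1 / 2 / (C * R ^ n)"] CR by auto
  define a where "a = y (s (Suc N)) - y (s N)"
  have "1 \<le> norm ((L ^^ n) a)" unfolding a_def using s by (intro sep) (simp add: strict_mono_less)
  also have "\<dots> \<le> C * \<eta> ^ n * norm a + C * R ^ n * norm (\<iota> a)" by (rule LY)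
  also have "norm a \<le> 4" using norm_triangle_ineq4[of "y (s (Suc N))" "y (s N)"] y2[of "s N"] y2[of "s (Suc N)"]
    by (simp add: a_def)
  also have "norm (\<iota> a) \<le> 1 / 2 / (C * R ^ n)"
    using N[of "Suc N" N] by (simp add: a_def bounded_clinearD[OF \<iota>])
  also have "C * R ^ n * (1 / 2 / (C * R ^ n)) = 1 / 2" using C R by simp
  finally show False using n C \<eta> CR by (simp add: mult_left_mono)
qed

text \<open>Failing lower bounds would give normalized approximate eigenvectors modulo
  \<open>E\<close>, with \<open>z\<close> bounded because \<open>L\<close> acts boundedly on the
  distance. Then \<open>z ^ n *\<^sub>C u\<close> is close to \<open>(L ^^ n) u\<close> as well, and
  the Lasota--Yorke inequality with compactness of \<open>\<iota>\<close> makes a subsequence Cauchy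
  modulo \<open>E\<close>. Its limit is a genuine eigenvector modulo \<open>E\<close>, hence in
  \<open>E\<close>, although the sequence has distance 1 from \<open>E\<close>.\<close>

lemma lower_bound_modulo:
  assumes E: "complex_subspace E" and cl: "closed E" and inv: "\<And>x. x \<in> E \<Longrightarrow> L x \<in> E"
    and no_ev: "\<And>z u. 1 \<le> cmod z \<Longrightarrow> z *\<^sub>C u - L u \<in> E \<Longrightarrow> u \<in> E"
    and bd: "\<And>u. infdist (L u) E \<le> K * infdist u E"
  shows "\<exists>c>0. \<forall>z u. 1 \<le> cmod z \<longrightarrow> c * infdist u E \<le> infdist (z *\<^sub>C u - L u) E"
proof (rule ccontr)
  note E' = complex_subspaceD[OF E] and L' = bounded_clinearD[OF L]
  note tri = infdist_triangle_subspace[OF E] and hom = infdist_scaleC[OF E]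
  define q where "q x = infdist x E" for x
  have qge: "q x \<ge> 0" for x by (simp add: q_def infdist_nonneg)
  have qtri: "q (x + y) \<le> q x + q y" for x y by (simp add: q_def tri)
  have qhom: "q (c *\<^sub>C x) = cmod c * q x" for c x by (simp add: q_def hom)
  have qdiff: "q (x - y) \<le> q x + q y" for x y
    using qtri[of x "- y"] qhom[of "-1" y] by (simp add: scaleC.minus_left)
  have qL: "q (L x) \<le> max K 1 * q x" for x
    using bd[of x] mult_right_mono[OF max.cobounded1[of K 1] qge[of x]] by (simp add: q_def)
  assume "\<not> ?thesis"
  then have neg: "\<exists>z u. 1 \<le> cmod z \<and> q (z *\<^sub>C u - L u) < c * q u" if "c > 0" for c
    using that by (auto simp: q_def not_le)
  have "\<exists>z u. 1 \<le> cmod z \<and> q u = 1 \<and> norm u \<le> 2 \<and> q (z *\<^sub>C u - L u) < 1 / real (Suc k)" for k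
  proof -
    obtain z u where z: "1 \<le> cmod z" and zu: "q (z *\<^sub>C u - L u) < 1 / real (Suc k) * q u"
      using neg[of "1 / real (Suc k)"] by auto
    have qu: "q u > 0" using zu qge[of "z *\<^sub>C u - L u"] qge[of u] by (cases "q u = 0") auto
    define w where "w = of_real (1 / q u) *\<^sub>C u"
    have w1: "q w = 1" using qu by (simp add: w_def qhom norm_divide)
    obtain e where e: "e \<in> E" "norm (w - e) < 2"
      using infdist_approx[of E w 2] w1 E'(1) by (auto simp: q_def)
    have "z *\<^sub>C (w - e) - L (w - e) = (z *\<^sub>C w - L w) - (z *\<^sub>C e - L e)"
      by (simp add: L' scaleC.diff_right)
    then have "q (z *\<^sub>C (w - e) - L (w - e)) = q (z *\<^sub>C w - L w)"
      using infdist_diff_member[OF E E'(5)[OF E'(3)[OF e(1)] inv[OF e(1)]]] by (simp add: q_def)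
    also have "z *\<^sub>C w - L w = of_real (1 / q u) *\<^sub>C (z *\<^sub>C u - L u)"
      by (simp add: w_def L' scaleC.diff_right scaleC_scaleC mult.commute)
    also have "q \<dots> = q (z *\<^sub>C u - L u) / q u" using qu by (simp add: qhom norm_divide)
    also have "\<dots> < 1 / real (Suc k)" using zu qu by (simp add: field_simps)
    finally show ?thesis using z w1 e infdist_diff_member[OF E e(1), of w]
      by (intro exI[of _ z] exI[of _ "w - e"]) (simp add: q_def)
  qed
  then obtain z u where z1: "\<And>k. 1 \<le> cmod (z k)" and qu: "\<And>k. q (u k) = 1" and u2: "\<And>k. norm (u k) \<le> 2"
    and zu: "\<And>k. q (z k *\<^sub>C u k - L (u k)) < 1 / real (Suc k)" by metis
  define M where "M = 1 + max K 1"
  have M: "M \<ge> 1" by (simp add: M_def)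
  have zM: "cmod (z k) \<le> M" for k
  proof -
    have "cmod (z k) = q ((z k *\<^sub>C u k - L (u k)) + L (u k))" by (simp add: qhom qu)
    also have "\<dots> \<le> q (z k *\<^sub>C u k - L (u k)) + max K 1 * q (u k)"
      using qtri qL by (meson add_left_mono order_trans)
    also have "\<dots> \<le> M" using zu[of k] by (simp add: qu M_def) (smt (verit) divide_le_eq_1 of_nat_0_le_iff)
    finally show ?thesis .
  qed
  have "compact (cball (0::complex) M)" by simp
  moreover have "\<forall>k. z k \<in> cball 0 M" using zM by simp
  ultimately obtain s1 z0 where s1: "strict_mono s1" and z0: "(\<lambda>k. z (s1 k)) \<longlonglongrightarrow> z0"
    unfolding compact_def o_def by metis
  obtain s2 where s2: "strict_mono s2" and cau: "Cauchy (\<lambda>k. \<iota> (u (s1 (s2 k))))"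
    using compact_operator_subsequence[OF \<iota> cpt, where x = "\<lambda>k. u (s1 k)" and b = 2, OF u2] by (elim exE conjE)
  define s where "s k = s1 (s2 k)" for k
  have s: "strict_mono s" using strict_mono_o[OF s1 s2] by (simp add: s_def[abs_def] o_def)
  have zs: "(\<lambda>k. z (s k)) \<longlonglongrightarrow> z0"
    using LIMSEQ_subseq_LIMSEQ[OF z0 s2] by (simp add: s_def o_def)
  have err: "(\<lambda>k. q (z (s k) *\<^sub>C u (s k) - L (u (s k)))) \<longlonglongrightarrow> 0"
  proof (rule Lim_null_comparison)
    show "\<forall>\<^sub>F k in sequentially. norm (q (z (s k) *\<^sub>C u (s k) - L (u (s k)))) \<le> 1 / real (Suc k)"
    proof (intro always_eventually allI)
      fix k
      have "q (z (s k) *\<^sub>C u (s k) - L (u (s k))) \<le> 1 / real (Suc (s k))" using zu by (rule less_imp_le)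
      also have "\<dots> \<le> 1 / real (Suc k)" using strict_mono_imp_increasing[OF s, of k]
        by (intro divide_left_mono) auto
      finally show "norm (q (z (s k) *\<^sub>C u (s k) - L (u (s k)))) \<le> 1 / real (Suc k)"
        using qge by simp
    qed
    show "(\<lambda>k. 1 / real (Suc k)) \<longlonglongrightarrow> 0" by (rule LIMSEQ_Suc[OF lim_1_over_n])
  qed
  \<comment> \<open>The defect at time \<open>n\<close> is bounded by the defect at time 1,
    uniformly over the bounded set of \<open>z\<close>.\<close>
  have pw: "\<exists>D\<ge>0. \<forall>z u. cmod z \<le> M \<longrightarrow> q (z ^ n *\<^sub>C u - (L ^^ n) u) \<le> D * q (z *\<^sub>C u - L u)" for n
  proof (induction n)
    case 0
    then show ?case using qhom[of 0 0] by (auto intro: exI[of _ 0])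
  next
    case (Suc n)
    then obtain D where D: "D \<ge> 0" "\<And>z u. cmod z \<le> M \<Longrightarrow> q (z ^ n *\<^sub>C u - (L ^^ n) u) \<le> D * q (z *\<^sub>C u - L u)"
      by auto
    have "q (z ^ Suc n *\<^sub>C u - (L ^^ Suc n) u) \<le> (M ^ n + max K 1 * D) * q (z *\<^sub>C u - L u)"
      if zM: "cmod z \<le> M" for z u
    proof -
      have "z ^ Suc n *\<^sub>C u - (L ^^ Suc n) u = z ^ n *\<^sub>C (z *\<^sub>C u - L u) + L (z ^ n *\<^sub>C u - (L ^^ n) u)"
        by (simp add: L' scaleC.diff_right scaleC_scaleC mult.commute)
      then have "q (z ^ Suc n *\<^sub>C u - (L ^^ Suc n) u) \<le> q (z ^ n *\<^sub>C (z *\<^sub>C u - L u)) + q (L (z ^ n *\<^sub>C u - (L ^^ n) u))"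
        by (simp only: qtri)
      also have "q (z ^ n *\<^sub>C (z *\<^sub>C u - L u)) \<le> M ^ n * q (z *\<^sub>C u - L u)"
        unfolding qhom norm_power using zM qge by (intro mult_right_mono power_mono) auto
      also have "q (L (z ^ n *\<^sub>C u - (L ^^ n) u)) \<le> max K 1 * (D * q (z *\<^sub>C u - L u))"
        by (rule order_trans[OF qL]) (use D(2)[OF zM] in \<open>auto intro: mult_left_mono\<close>)
      finally show ?thesis by (simp add: algebra_simps)
    qed
    moreover have "M ^ n + max K 1 * D \<ge> 0" using M D by simp
    ultimately show ?case by blast
  qed
  have qcau: "\<exists>N. \<forall>j\<ge>N. \<forall>k\<ge>N. infdist (u (s j) - u (s k)) E < \<epsilon>" if \<epsilon>: "\<epsilon> > 0" for \<epsilon>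
  proof -
    \<comment> \<open>Five errors will be added: the defects of the two vectors, the difference of
      the numbers \<open>z ^ n\<close>, and the strong and the weak term of the Lasota--Yorke
      inequality.\<close>
    obtain n where n: "(4 * C) * \<eta> ^ n < \<epsilon> / 5"
      using small_power_times[OF \<eta>, of "\<epsilon>/5" "4 * C"] \<epsilon> by auto
    obtain D where D: "D \<ge> 0" "\<And>z u. cmod z \<le> M \<Longrightarrow> q (z ^ n *\<^sub>C u - (L ^^ n) u) \<le> D * q (z *\<^sub>C u - L u)"
      using pw by blast
    have CR: "C * R ^ n > 0" using C R by simp
    obtain N1 where N1: "\<And>j k. j \<ge> N1 \<Longrightarrow> k \<ge> N1 \<Longrightarrow> norm (\<iota> (u (s j)) - \<iota> (u (s k))) < \<epsilon> / 5 / (C * R ^ n)"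
      using CauchyD[OF cau, of "\<epsilon> / 5 / (C * R ^ n)"] CR \<epsilon> by (auto simp: s_def)
    have "Cauchy (\<lambda>k. z (s k) ^ n)" by (rule LIMSEQ_imp_Cauchy[OF tendsto_power[OF zs]])
    then obtain N2 where N2: "\<And>j k. j \<ge> N2 \<Longrightarrow> k \<ge> N2 \<Longrightarrow> cmod (z (s j) ^ n - z (s k) ^ n) < \<epsilon> / 5"
      using CauchyD[of "\<lambda>k. z (s k) ^ n" "\<epsilon> / 5"] \<epsilon> by auto
    have "(\<lambda>k. D * q (z (s k) *\<^sub>C u (s k) - L (u (s k)))) \<longlonglongrightarrow> D * 0"
      by (intro tendsto_intros err)
    then have "\<forall>\<^sub>F k in sequentially. D * q (z (s k) *\<^sub>C u (s k) - L (u (s k))) < \<epsilon> / 5"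
      using \<epsilon> by (intro order_tendstoD(2)) auto
    then obtain N3 where N3: "\<And>k. k \<ge> N3 \<Longrightarrow> D * q (z (s k) *\<^sub>C u (s k) - L (u (s k))) < \<epsilon> / 5"
      by (auto simp: eventually_sequentially)
    have "q (u (s j) - u (s k)) < \<epsilon>" if j: "j \<ge> Max {N1, N2, N3}" and k: "k \<ge> Max {N1, N2, N3}" for j k
    proof -
      define a b where "a = u (s j)" and "b = u (s k)"
      define x y where "x = z (s j)" and "y = z (s k)"
      have eq: "x ^ n *\<^sub>C (a - b) = ((x ^ n *\<^sub>C a - (L ^^ n) a) - (y ^ n *\<^sub>C b - (L ^^ n) b))
          + ((L ^^ n) (a - b) - (x ^ n - y ^ n) *\<^sub>C b)"
        by (simp add: scaleC.diff_right scaleC.diff_left bounded_clinearD[OF bounded_clinear_funpow[OF L]])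
      have "q (a - b) \<le> cmod (x ^ n) * q (a - b)"
        using qge[of "a - b"] one_le_power[OF z1[of "s j"], of n]
        by (simp add: x_def norm_power mult_le_cancel_right1)
      also have "\<dots> = q (x ^ n *\<^sub>C (a - b))" by (simp add: qhom)
      also have "\<dots> \<le> q ((x ^ n *\<^sub>C a - (L ^^ n) a) - (y ^ n *\<^sub>C b - (L ^^ n) b))
          + q ((L ^^ n) (a - b) - (x ^ n - y ^ n) *\<^sub>C b)" unfolding eq by (rule qtri)
      also have "\<dots> \<le> (q (x ^ n *\<^sub>C a - (L ^^ n) a) + q (y ^ n *\<^sub>C b - (L ^^ n) b))
          + (q ((L ^^ n) (a - b)) + q ((x ^ n - y ^ n) *\<^sub>C b))"
        by (intro add_mono qdiff)
      also have "q (x ^ n *\<^sub>C a - (L ^^ n) a) < \<epsilon> / 5"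
        using D(2)[OF zM, of "s j" a] N3[of j] j by (simp add: x_def a_def)
      also have "q (y ^ n *\<^sub>C b - (L ^^ n) b) < \<epsilon> / 5"
        using D(2)[OF zM, of "s k" b] N3[of k] k by (simp add: y_def b_def)
      also have "q ((x ^ n - y ^ n) *\<^sub>C b) < \<epsilon> / 5"
        using N2[of j k] j k by (simp add: qhom b_def qu x_def y_def)
      also have "q ((L ^^ n) (a - b)) < \<epsilon> / 5 + \<epsilon> / 5"
      proof -
        have "q ((L ^^ n) (a - b)) \<le> C * \<eta> ^ n * norm (a - b) + C * R ^ n * norm (\<iota> (a - b))"
          unfolding q_def using infdist_le_norm[OF E] LY order_trans by blast
        also have "C * \<eta> ^ n * norm (a - b) \<le> C * \<eta> ^ n * 4"
          using norm_triangle_ineq4[of a b] u2[of "s j"] u2[of "s k"] C \<eta>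
          by (intro mult_left_mono) (auto simp: a_def b_def)
        also have "\<dots> < \<epsilon> / 5" using n by (simp add: mult_ac)
        also have "C * R ^ n * norm (\<iota> (a - b)) < C * R ^ n * (\<epsilon> / 5 / (C * R ^ n))"
          using N1[of j k] j k CR by (intro mult_strict_left_mono) (auto simp: a_def b_def bounded_clinearD[OF \<iota>])
        also have "\<dots> = \<epsilon> / 5" using C R by simp
        finally show ?thesis by simp
      qed
      finally show ?thesis by (simp add: a_def b_def)
    qed
    then show ?thesis unfolding q_def by blast
  qed
  obtain w r where r: "strict_mono r" and w: "(\<lambda>k. infdist (u (s (r k)) - w) E) \<longlonglongrightarrow> 0"
    using complete_modulo_subspace[OF E, of "\<lambda>k. u (s k)"] qcau by blast
  have z01: "1 \<le> cmod z0"
    using tendsto_norm[OF zs] z1 by (intro LIMSEQ_le_const[of "\<lambda>k. cmod (z (s k))"]) auto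
  have "q (z0 *\<^sub>C w - L w) \<le> 0"
  proof (rule LIMSEQ_le_const)
    let ?f = "\<lambda>k. q (z (s (r k)) *\<^sub>C u (s (r k)) - L (u (s (r k)))) + cmod (z (s (r k)) - z0) * 1
       + (M * q (u (s (r k)) - w) + max K 1 * q (u (s (r k)) - w))"
    have "?f \<longlonglongrightarrow> 0 + 0 * 1 + (M * 0 + max K 1 * 0)"
      using LIMSEQ_subseq_LIMSEQ[OF err r] LIMSEQ_subseq_LIMSEQ[OF zs r] w
      by (intro tendsto_intros) (auto simp: o_def q_def LIM_zero tendsto_norm_zero)
    then show "?f \<longlonglongrightarrow> 0" by simp
    show "\<exists>N. \<forall>k\<ge>N. q (z0 *\<^sub>C w - L w) \<le> ?f k"
    proof (intro exI allI impI)
      fix k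
      define a x where "a = u (s (r k))" and "x = z (s (r k))"
      have "z0 *\<^sub>C w - L w = ((x *\<^sub>C a - L a) - (x - z0) *\<^sub>C a) - (z0 *\<^sub>C (a - w) - L (a - w))"
        by (simp add: scaleC.diff_right scaleC.diff_left L')
      then have "q (z0 *\<^sub>C w - L w) \<le> (q (x *\<^sub>C a - L a) + q ((x - z0) *\<^sub>C a)) + (q (z0 *\<^sub>C (a - w)) + q (L (a - w)))"
        by (metis add_mono order_trans qdiff)
      also have "q ((x - z0) *\<^sub>C a) = cmod (x - z0) * 1" by (simp add: qhom a_def qu)
      also have "q (z0 *\<^sub>C (a - w)) \<le> M * q (a - w)"
        unfolding qhom using tendsto_norm[OF zs] zM
        by (intro mult_right_mono qge LIMSEQ_le_const2[of "\<lambda>k. cmod (z (s k))" "cmod z0"]) auto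
      also have "q (L (a - w)) \<le> max K 1 * q (a - w)" by (rule qL)
      finally show "q (z0 *\<^sub>C w - L w) \<le> ?f k" by (simp add: a_def x_def)
    qed
  qed
  then have "infdist (z0 *\<^sub>C w - L w) E = 0" using qge[of "z0 *\<^sub>C w - L w"] by (simp add: q_def)
  then have "z0 *\<^sub>C w - L w \<in> E"
    using in_closed_iff_infdist_zero[OF cl] E'(1) by auto
  then have wE: "w \<in> E" by (rule no_ev[OF z01])
  have "infdist (u (s (r k)) - w) E = 1" for k
    using qu[of "s (r k)"] by (simp add: infdist_diff_member[OF E wE] q_def)
  then show False using w by (simp add: LIMSEQ_const_iff)
qed

end

text \<open>The tail of the telescoping series gives the rate. It serves both the coefficients of
  the spectral decomposition and the power iteration for perturbed eigenvectors.\<close>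

lemma geometric_increments_limit:
  fixes b :: "nat \<Rightarrow> 'a::banach"
  assumes step: "\<And>n. norm (b (Suc n) - b n) \<le> A * r ^ n" and r: "0 \<le> r" "r < 1"
  shows "\<exists>c. \<forall>n. norm (b n - c) \<le> A * r ^ n / (1 - r)"
proof -
  have sm: "summable (\<lambda>n. A * r ^ (n + k))" for k
    using r by (intro summable_mult summable_ignore_initial_segment summable_geometric) auto
  have sb: "summable (\<lambda>n. b (Suc (n + k)) - b (n + k))" for k
    by (rule summable_comparison_test'[OF sm[of k], of 0]) (use step in auto)
  have tel: "(\<lambda>n. b (n + k)) \<longlonglongrightarrow> b k + (\<Sum>n. b (Suc (n + k)) - b (n + k))" for k
  proof -
    have "(\<lambda>n. b k + (\<Sum>i<n. b (Suc (i + k)) - b (i + k))) \<longlonglongrightarrow> b k + (\<Sum>n. b (Suc (n + k)) - b (n + k))"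
      by (intro tendsto_intros summable_LIMSEQ sb)
    moreover have "(\<Sum>i<n. b (Suc (i + k)) - b (i + k)) = b (n + k) - b k" for n
      using sum_lessThan_telescope[of "\<lambda>i. b (i + k)" n] by simp
    ultimately show ?thesis by simp
  qed
  define c where "c = b 0 + (\<Sum>n. b (Suc (n + 0)) - b (n + 0))"
  have lim: "b \<longlonglongrightarrow> c" using tel[of 0] by (simp add: c_def)
  have "norm (b k - c) \<le> A * r ^ k / (1 - r)" for k
  proof -
    have "c = b k + (\<Sum>n. b (Suc (n + k)) - b (n + k))"
      using LIMSEQ_unique[OF LIMSEQ_ignore_initial_segment[OF lim] tel] .
    then have "norm (b k - c) = norm (\<Sum>n. b (Suc (n + k)) - b (n + k))" by simp
    also have "\<dots> \<le> (\<Sum>n. A * r ^ (n + k))"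
      using step by (intro norm_suminf_le sm) auto
    also have "\<dots> = A * r ^ k * (\<Sum>n. r ^ n)"
      using r by (subst suminf_mult[symmetric]) (auto simp: power_add mult_ac summable_geometric)
    also have "\<dots> = A * r ^ k / (1 - r)" using r by (simp add: suminf_geometric)
    finally show ?thesis .
  qed
  then show ?thesis by blast
qed

lemma infdist_operator_le:
  assumes A: "bounded_clinear A" and bd: "\<And>x. norm (A x) \<le> K * norm x" "K > 0"
    and E: "complex_subspace E" and inv: "\<And>x. x \<in> E \<Longrightarrow> A x \<in> E"
  shows "infdist (A u) E \<le> K * infdist u E"
proof (rule field_le_epsilon)
  fix d :: real assume d: "d > 0"
  obtain e where e: "e \<in> E" "norm (u - e) < infdist u E + d / K"
    using infdist_approx[of E u "infdist u E + d / K"] d bd(2) complex_subspaceD(1)[OF E] by auto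
  have "infdist (A u) E \<le> dist (A u) (A e)" using e by (intro infdist_le inv)
  also have "\<dots> \<le> K * norm (u - e)"
    using bd(1)[of "u - e"] by (simp add: dist_norm bounded_clinearD[OF A])
  also have "\<dots> \<le> K * (infdist u E + d / K)" using e bd(2) by (intro mult_left_mono) auto
  also have "\<dots> = K * infdist u E + d" using bd(2) by (simp add: field_simps)
  finally show "infdist (A u) E \<le> K * infdist u E + d" .
qed

section \<open>Peripheral eigenfunctionals and the spectral gap\<close>

context quasi_compact
begin

text \<open>Subtracting \<open>g\<close> removes the right-hand side, except for its component along
  \<open>v z\<close>, where division by \<open>z - w\<close> fails. What is left says that
  \<open>x\<close> is a generalized eigenvector of order 2, and simplicity makes it a multiple of
  \<open>v z\<close>.\<close>

lemma no_eigenvector_modulo_peripheral: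
  assumes simple: "\<And>z. eigenvalue L z \<Longrightarrow> 1 \<le> cmod z \<Longrightarrow> simple_eigenvalue L z"
    and \<Lambda>: "\<Lambda> = {z. eigenvalue L z \<and> 1 \<le> cmod z}"
    and v: "\<And>z. z \<in> \<Lambda> \<Longrightarrow> v z \<noteq> 0 \<and> L (v z) = z *\<^sub>C v z"
    and z: "1 \<le> cmod z" and u: "z *\<^sub>C u - L u \<in> complex_span v \<Lambda>"
  shows "u \<in> complex_span v \<Lambda>"
proof -
  note L' = bounded_clinearD[OF L]
  note E' = complex_subspaceD[OF complex_subspace_span[of v \<Lambda>]]
  have fin: "finite \<Lambda>" unfolding \<Lambda> by (rule finite_peripheral_eigenvalues)
  obtain c where c: "z *\<^sub>C u - L u = (\<Sum>w\<in>\<Lambda>. c w *\<^sub>C v w)" using u by (auto simp: complex_span_def)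
  define g where "g = (\<Sum>w\<in>\<Lambda>. (if w = z then 0 else c w / (z - w)) *\<^sub>C v w)"
  have gE: "g \<in> complex_span v \<Lambda>" by (auto simp: g_def complex_span_def)
  define x where "x = u - g"
  have Lg: "L g = (\<Sum>w\<in>\<Lambda>. (w * (if w = z then 0 else c w / (z - w))) *\<^sub>C v w)"
    unfolding g_def L' using v by (intro sum.cong) (auto simp: scaleC_scaleC mult_ac)
  have "z *\<^sub>C x - L x = (z *\<^sub>C u - L u) - (z *\<^sub>C g - L g)" by (simp add: x_def L' scaleC.diff_right)
  also have "z *\<^sub>C g - L g = (\<Sum>w\<in>\<Lambda>. (if w = z then 0 else c w) *\<^sub>C v w)"
    unfolding Lg unfolding g_def scaleC.sum_right sum_subtractf[symmetric] scaleC_scaleC scaleC.diff_left[symmetric]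
    by (intro sum.cong refl arg_cong2[where f = scaleC]) (auto simp: field_simps)
  also have "(z *\<^sub>C u - L u) - \<dots> = (\<Sum>w\<in>\<Lambda>. if w = z then c z *\<^sub>C v z else 0)"
    unfolding c sum_subtractf[symmetric] by (intro sum.cong) auto
  finally have eq: "z *\<^sub>C x - L x = (if z \<in> \<Lambda> then c z *\<^sub>C v z else 0)"
    using fin by (simp add: sum.delta)
  have "x \<in> complex_span v \<Lambda>"
  proof (cases "z \<in> \<Lambda>")
    case False
    then have "L x = z *\<^sub>C x" using eq by simp
    then have "x = 0" using False z by (auto simp: \<Lambda> eigenvalue_def)
    then show ?thesis using E'(1) by simp
  next
    case True
    have vz: "v z \<noteq> 0" "L (v z) = z *\<^sub>C v z" using v True by auto
    obtain w where w: "generalized_eigenspace L z = range (\<lambda>c. c *\<^sub>C w)"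
      using simple[of z] True by (auto simp: \<Lambda> simple_eigenvalue_def)
    have "((\<lambda>v. L v - z *\<^sub>C v) ^^ 1) (v z) = 0" using vz by simp
    then have "v z \<in> range (\<lambda>c. c *\<^sub>C w)" unfolding w[symmetric] generalized_eigenspace_def by blast
    then obtain a where a: "v z = a *\<^sub>C w" by auto
    have "L x - z *\<^sub>C x = - (c z *\<^sub>C v z)" using eq True by (simp add: algebra_simps)
    then have "((\<lambda>v. L v - z *\<^sub>C v) ^^ 2) x = 0"
      by (simp add: numeral_2_eq_2 L' vz scaleC.minus_right scaleC_scaleC mult.commute)
    then have "x \<in> range (\<lambda>c. c *\<^sub>C w)" unfolding w[symmetric] generalized_eigenspace_def by blast
    then obtain b where b: "x = b *\<^sub>C w" by auto
    have "a \<noteq> 0" using a vz by auto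
    then have "x = (b / a) *\<^sub>C v z" by (simp add: a b scaleC_scaleC)
    also have "\<dots> \<in> complex_span v \<Lambda>" using True fin by (intro E'(3) complex_span_member)
    finally show ?thesis .
  qed
  moreover have "u = x + g" by (simp add: x_def)
  ultimately show ?thesis using gE E'(2) by simp
qed

text \<open>Since \<open>(L ^^ n) u\<close> approaches the span of the eigenvectors exponentially
  fast, choose approximating coefficients \<open>a n\<close>. They nearly satisfy
  \<open>a (Suc n) z = z * a n z\<close>, so \<open>a n z / z ^ n\<close> converges, and the limit
  is the value of the eigenfunctional. Exponential decay of the remainder determines these values
  uniquely, whence linearity and the relation with \<open>L\<close>.\<close>

theorem spectral_decomposition:
  assumes simple: "\<And>z. eigenvalue L z \<Longrightarrow> 1 \<le> cmod z \<Longrightarrow> simple_eigenvalue L z"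
    and \<Lambda>: "\<Lambda> = {z. eigenvalue L z \<and> 1 \<le> cmod z}"
  obtains v \<ll> K \<rho> where "\<And>z. z \<in> \<Lambda> \<Longrightarrow> v z \<noteq> 0" "\<And>z. z \<in> \<Lambda> \<Longrightarrow> L (v z) = z *\<^sub>C v z"
    "\<And>z. z \<in> \<Lambda> \<Longrightarrow> bounded_clinear (\<ll> z)" "\<And>z u. z \<in> \<Lambda> \<Longrightarrow> \<ll> z (L u) = z * \<ll> z u"
    "\<And>z w. z \<in> \<Lambda> \<Longrightarrow> w \<in> \<Lambda> \<Longrightarrow> \<ll> z (v w) = (if w = z then 1 else 0)"
    "K > 0" "0 < \<rho>" "\<rho> < 1"
    "\<And>n u. norm ((L ^^ n) (u - (\<Sum>z\<in>\<Lambda>. \<ll> z u *\<^sub>C v z))) \<le> K * \<rho> ^ n * norm u"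
proof -
  note L' = bounded_clinearD[OF L] and Ln = bounded_clinearD[OF bounded_clinear_funpow[OF L]]
  have fin: "finite \<Lambda>" unfolding \<Lambda> by (rule finite_peripheral_eigenvalues)
  have z1: "1 \<le> cmod z" if "z \<in> \<Lambda>" for z using that by (simp add: \<Lambda>)
  define v where "v w = (SOME u. u \<noteq> 0 \<and> L u = w *\<^sub>C u)" for w
  have v: "v z \<noteq> 0 \<and> L (v z) = z *\<^sub>C v z" if "z \<in> \<Lambda>" for z
  proof -
    have "\<exists>u. u \<noteq> 0 \<and> L u = z *\<^sub>C u" using that by (simp add: \<Lambda> eigenvalue_def)
    then show ?thesis unfolding v_def by (rule someI_ex)
  qed
  define E where "E = complex_span v \<Lambda>"
  have E: "complex_subspace E" unfolding E_def by (rule complex_subspace_span)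
  note E' = complex_subspaceD[OF E]
  have vE: "L (v i) \<in> complex_span v \<Lambda>" if "i \<in> \<Lambda>" for i
    using complex_subspaceD(3)[OF complex_subspace_span complex_span_member[OF fin that], of i] v[OF that]
    by simp
  have inv: "L x \<in> E" if "x \<in> E" for x
    using complex_span_invariant[OF L fin vE] that by (simp add: E_def)
  obtain K1 where cl: "closed E" and K1: "K1 > 0"
    and K1b: "\<And>c z. z \<in> \<Lambda> \<Longrightarrow> cmod (c z) \<le> K1 * norm (\<Sum>z\<in>\<Lambda>. c z *\<^sub>C v z)"
    using eigenvector_span[OF L fin, of v] v unfolding E_def by auto
  obtain K0 where K0: "K0 > 0" "\<And>x. norm (L x) \<le> K0 * norm x" using L'(8) by auto
  have bd: "infdist (L u) E \<le> K0 * infdist u E" for u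
    by (rule infdist_operator_le[OF L K0(2) K0(1) E inv])
  have no_ev: "u \<in> E" if "1 \<le> cmod z" "z *\<^sub>C u - L u \<in> E" for z u
    unfolding E_def
    by (rule no_eigenvector_modulo_peripheral[OF _ \<Lambda> v that(1) that(2)[unfolded E_def]])
       (rule simple)
  have "\<exists>c>0. \<forall>z u. 1 \<le> cmod z \<longrightarrow> c * infdist u E \<le> infdist (z *\<^sub>C u - L u) E"
    by (rule lower_bound_modulo[OF E cl inv no_ev bd])
  then obtain c where c: "c > 0" "\<And>z u. 1 \<le> cmod z \<Longrightarrow> c * infdist u E \<le> infdist (z *\<^sub>C u - L u) E"
    by auto
  have "\<exists>m>0. \<exists>\<theta>. 0 \<le> \<theta> \<and> \<theta> < 1 \<and> (\<forall>u. infdist ((L ^^ m) u) E \<le> \<theta> * infdist u E)"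
    by (rule power_decay_of_lower_bound[OF infdist_triangle_subspace[OF E] infdist_scaleC[OF E] L'(1,3) bd c])
  then obtain m \<theta> where m: "m > 0" "0 \<le> \<theta>" "\<theta> < 1" "\<And>u. infdist ((L ^^ m) u) E \<le> \<theta> * infdist u E"
    by auto
  obtain K2 \<rho> where K2: "0 < K2" and \<rho>: "0 < \<rho>" "\<rho> < 1"
    and K2': "\<forall>(L :: 'g \<Rightarrow> 'g) q. (\<forall>u. 0 \<le> q u) \<longrightarrow>
      (\<forall>u. q (L u) \<le> K0 * q u) \<longrightarrow> (\<forall>u. q ((L ^^ m) u) \<le> \<theta> * q u) \<longrightarrow>
      (\<forall>n u. q ((L ^^ n) u) \<le> K2 * \<rho> ^ n * q u)"
    using exponential_decay_of_power_contraction[OF m(1-3) less_imp_le[OF K0(1)], where 'g = 'g]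
    by (elim exE conjE)
  have K2b: "infdist ((L ^^ n) u) E \<le> K2 * \<rho> ^ n * infdist u E" for n u
    by (rule K2'[THEN spec[of _ L], THEN spec[of _ "\<lambda>u. infdist u E"], THEN mp, THEN mp, THEN mp, THEN spec, THEN spec])
       (intro allI infdist_nonneg bd m(4))+
  \<comment> \<open>The distance may not be attained; doubling the constant leaves room for an
    actual point of the span.\<close>
  have near: "infdist ((L ^^ n) u) E < 2 * K2 * \<rho> ^ n * norm u" if "u \<noteq> 0" for n u
  proof -
    have "infdist ((L ^^ n) u) E \<le> K2 * \<rho> ^ n * norm u"
      using K2b[of n u] infdist_le_norm[OF E, of u] K2 \<rho> by (meson less_imp_le mult_left_mono mult_nonneg_nonneg order_trans zero_le_power)
    also have "\<dots> < 2 * K2 * \<rho> ^ n * norm u" using K2 \<rho> that by simp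
    finally show ?thesis .
  qed
  define K5 where "K5 = 2 * K2 * (1 + K0)"
  define K6 where "K6 = K1 * K5 / (1 - \<rho>)"
  define K7 where "K7 = 2 * K2 + (\<Sum>z\<in>\<Lambda>. K6 * norm (v z))"
  have K5: "K5 > 0" using K2 K0 by (simp add: K5_def)
  have K6: "K6 > 0" using K1 K5 \<rho> by (simp add: K6_def)
  have K7: "K7 > 0" using K2 K6 by (auto simp: K7_def intro!: add_pos_nonneg sum_nonneg)
  define \<Phi> where "\<Phi> c = (\<Sum>z\<in>\<Lambda>. c z *\<^sub>C v z)" for c
  have L\<Phi>: "(L ^^ n) (\<Phi> c) = \<Phi> (\<lambda>z. z ^ n * c z)" for n c
    unfolding \<Phi>_def Ln using v
    by (intro sum.cong) (auto simp: funpow_eigenvector[OF L] scaleC_scaleC mult.commute)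
  have \<Phi>diff: "\<Phi> a - \<Phi> b = \<Phi> (\<lambda>z. a z - b z)" for a b
    by (simp add: \<Phi>_def scaleC.diff_left sum_subtractf)
  have ex: "\<exists>c. \<forall>n. norm ((L ^^ n) (u - \<Phi> c)) \<le> K7 * \<rho> ^ n * norm u" for u
  proof (cases "u = 0")
    case True
    then show ?thesis by (intro exI[of _ "\<lambda>_. 0"]) (simp add: \<Phi>_def Ln)
  next
    case u: False
    have "\<exists>a. norm ((L ^^ n) u - \<Phi> a) < 2 * K2 * \<rho> ^ n * norm u" for n
      using infdist_approx[OF _ near[OF u, of n]] E'(1) unfolding E_def complex_span_def \<Phi>_def by blast
    then obtain a where a: "\<And>n. norm ((L ^^ n) u - \<Phi> (a n)) < 2 * K2 * \<rho> ^ n * norm u" by metis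
    have step: "norm (\<Phi> (\<lambda>z. a (Suc n) z - z * a n z)) \<le> K5 * \<rho> ^ n * norm u" for n
    proof -
      have "\<Phi> (\<lambda>z. a (Suc n) z - z * a n z) = L ((L ^^ n) u - \<Phi> (a n)) - ((L ^^ Suc n) u - \<Phi> (a (Suc n)))"
        using L\<Phi>[of 1 "a n"] by (simp add: \<Phi>diff[symmetric] L')
      also have "norm \<dots> \<le> K0 * norm ((L ^^ n) u - \<Phi> (a n)) + norm ((L ^^ Suc n) u - \<Phi> (a (Suc n)))"
        by (rule order_trans[OF norm_triangle_ineq4]) (intro add_right_mono K0)
      also have "\<dots> \<le> K0 * (2 * K2 * \<rho> ^ n * norm u) + 2 * K2 * \<rho> ^ Suc n * norm u"
        using a K0 by (intro add_mono mult_left_mono less_imp_le[OF a]) auto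
      also have "2 * K2 * \<rho> ^ Suc n * norm u \<le> 2 * K2 * \<rho> ^ n * norm u"
        using K2 \<rho> by (intro mult_right_mono mult_left_mono power_decreasing) auto
      finally show ?thesis by (simp add: K5_def algebra_simps)
    qed
    have "\<exists>c. \<forall>n. cmod (a n z - z ^ n * c) \<le> K6 * \<rho> ^ n * norm u" if z: "z \<in> \<Lambda>" for z
    proof -
      have z0: "cmod z > 0" "z \<noteq> 0" using z1[OF z] by auto
      have r: "0 \<le> \<rho> / cmod z" "\<rho> / cmod z < 1" using \<rho> z1[OF z] z0 by (auto simp: field_simps)
      have "norm (a (Suc n) z / z ^ Suc n - a n z / z ^ n) \<le> (K1 * K5 * norm u / cmod z) * (\<rho> / cmod z) ^ n" for n
      proof -
        have "a (Suc n) z / z ^ Suc n - a n z / z ^ n = (a (Suc n) z - z * a n z) / z ^ Suc n"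
          using z0 by (simp add: field_simps)
        then have "norm (a (Suc n) z / z ^ Suc n - a n z / z ^ n) = cmod (a (Suc n) z - z * a n z) / cmod z ^ Suc n"
          by (simp add: norm_divide norm_power norm_mult)
        also have "\<dots> \<le> K1 * (K5 * \<rho> ^ n * norm u) / cmod z ^ Suc n"
          using K1b[OF z, of "\<lambda>z. a (Suc n) z - z * a n z"] step[of n] K1
          unfolding \<Phi>_def[symmetric]
          by (intro divide_right_mono) (auto intro: order_trans mult_left_mono)
        also have "\<dots> = (K1 * K5 * norm u / cmod z) * (\<rho> / cmod z) ^ n"
          by (simp add: power_divide mult_ac)
        finally show ?thesis .
      qed
      from geometric_increments_limit[OF this r]
      obtain c where c: "\<And>n. norm (a n z / z ^ n - c) \<le> (K1 * K5 * norm u / cmod z) * (\<rho> / cmod z) ^ n / (1 - \<rho> / cmod z)"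
        by auto
      have "cmod (a n z - z ^ n * c) \<le> K6 * \<rho> ^ n * norm u" for n
      proof -
        have "a n z - z ^ n * c = z ^ n * (a n z / z ^ n - c)" using z0 by (simp add: field_simps)
        then have "cmod (a n z - z ^ n * c) = cmod z ^ n * norm (a n z / z ^ n - c)"
          by (simp add: norm_mult norm_power)
        also have "\<dots> \<le> cmod z ^ n * ((K1 * K5 * norm u / cmod z) * (\<rho> / cmod z) ^ n / (1 - \<rho> / cmod z))"
          using c by (intro mult_left_mono) auto
        also have "\<dots> = K1 * K5 * norm u * \<rho> ^ n / (cmod z - \<rho>)"
          using z0 r by (simp add: power_divide field_simps)
        also have "\<dots> \<le> K1 * K5 * norm u * \<rho> ^ n / (1 - \<rho>)"
          using z1[OF z] \<rho> K1 K5 by (intro divide_left_mono mult_pos_pos) auto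
        finally show ?thesis by (simp add: K6_def mult_ac)
      qed
      then show ?thesis by blast
    qed
    then obtain c where c: "\<And>z n. z \<in> \<Lambda> \<Longrightarrow> cmod (a n z - z ^ n * c z) \<le> K6 * \<rho> ^ n * norm u"
      by metis
    have "norm ((L ^^ n) (u - \<Phi> c)) \<le> K7 * \<rho> ^ n * norm u" for n
    proof -
      have "(L ^^ n) (u - \<Phi> c) = ((L ^^ n) u - \<Phi> (a n)) + \<Phi> (\<lambda>z. a n z - z ^ n * c z)"
        by (simp add: Ln L\<Phi> \<Phi>diff[symmetric])
      also have "norm \<dots> \<le> 2 * K2 * \<rho> ^ n * norm u + (\<Sum>z\<in>\<Lambda>. (K6 * \<rho> ^ n * norm u) * norm (v z))"
        unfolding \<Phi>_def
        by (intro order_trans[OF norm_triangle_ineq] add_mono order_trans[OF norm_sum] sum_mono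
              less_imp_le[OF a[unfolded \<Phi>_def]])
           (use c in \<open>auto simp: norm_scaleC intro: mult_right_mono\<close>)
      also have "\<dots> = K7 * \<rho> ^ n * norm u"
        by (simp add: K7_def sum_distrib_left sum_distrib_right algebra_simps)
      finally show ?thesis .
    qed
    then show ?thesis by blast
  qed
  define cc where "cc u = (SOME c. \<forall>n. norm ((L ^^ n) (u - \<Phi> c)) \<le> K7 * \<rho> ^ n * norm u)" for u
  have cc: "norm ((L ^^ n) (u - \<Phi> (cc u))) \<le> K7 * \<rho> ^ n * norm u" for n u
    using someI_ex[OF ex[of u]] unfolding cc_def by blast
  \<comment> \<open>Two coefficient families with decaying remainders differ by a combination of
    eigenvectors that \<open>L ^^ n\<close> does not shrink, as
    \<open>cmod z \<ge> 1\<close>.\<close>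
  have uniq: "cc u z = c z"
    if z: "z \<in> \<Lambda>" and c: "\<And>n. norm ((L ^^ n) (u - \<Phi> c)) \<le> A * \<rho> ^ n" for u c z A
  proof -
    have "cmod (c z - cc u z) \<le> K1 * (A + K7 * norm u) * \<rho> ^ n" for n
    proof -
      have "cmod (c z - cc u z) \<le> cmod (z ^ n * (c z - cc u z))"
        using one_le_power[OF z1[OF z], of n] mult_right_mono[of 1 "cmod z ^ n" "cmod (c z - cc u z)"]
        by (simp add: norm_mult norm_power)
      also have "\<dots> \<le> K1 * norm (\<Phi> (\<lambda>z. z ^ n * (c z - cc u z)))"
        using K1b[OF z, of "\<lambda>z. z ^ n * (c z - cc u z)"] by (simp add: \<Phi>_def)
      also have "\<Phi> (\<lambda>z. z ^ n * (c z - cc u z)) = (L ^^ n) (u - \<Phi> (cc u)) - (L ^^ n) (u - \<Phi> c)"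
        by (simp add: L\<Phi>[symmetric] \<Phi>diff[symmetric] Ln)
      also have "K1 * norm \<dots> \<le> K1 * (K7 * \<rho> ^ n * norm u + A * \<rho> ^ n)"
        using K1 by (intro mult_left_mono order_trans[OF norm_triangle_ineq4] add_mono cc c) auto
      finally show ?thesis by (simp add: algebra_simps)
    qed
    moreover have "(\<lambda>n. K1 * (A + K7 * norm u) * \<rho> ^ n) \<longlonglongrightarrow> K1 * (A + K7 * norm u) * 0"
      using \<rho> by (intro tendsto_intros LIMSEQ_realpow_zero) auto
    ultimately have "cmod (c z - cc u z) \<le> 0"
      by (intro LIMSEQ_le_const[where X = "\<lambda>n. K1 * (A + K7 * norm u) * \<rho> ^ n"]) auto
    then show ?thesis by simp
  qed
  define \<ll> where "\<ll> z u = cc u z" for z u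
  have l_add: "\<ll> z (x + y) = \<ll> z x + \<ll> z y" if "z \<in> \<Lambda>" for z x y
    unfolding \<ll>_def
  proof (rule uniq[OF that])
    fix n
    have "\<Phi> (\<lambda>z. cc x z + cc y z) = \<Phi> (cc x) + \<Phi> (cc y)"
      by (simp add: \<Phi>_def scaleC_add_left sum.distrib)
    then have "x + y - \<Phi> (\<lambda>z. cc x z + cc y z) = (x - \<Phi> (cc x)) + (y - \<Phi> (cc y))" by simp
    then have "norm ((L ^^ n) (x + y - \<Phi> (\<lambda>z. cc x z + cc y z))) \<le> K7 * \<rho> ^ n * norm x + K7 * \<rho> ^ n * norm y"
      by (simp only: Ln(1)) (intro order_trans[OF norm_triangle_ineq] add_mono cc)
    then show "norm ((L ^^ n) (x + y - \<Phi> (\<lambda>z. cc x z + cc y z))) \<le> (K7 * norm x + K7 * norm y) * \<rho> ^ n"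
      by (simp add: algebra_simps)
  qed
  have l_scale: "\<ll> z (a *\<^sub>C x) = a * \<ll> z x" if "z \<in> \<Lambda>" for z x a
    unfolding \<ll>_def
  proof (rule uniq[OF that])
    fix n
    have "a *\<^sub>C x - \<Phi> (\<lambda>z. a * cc x z) = a *\<^sub>C (x - \<Phi> (cc x))"
      by (simp add: \<Phi>_def scaleC.diff_right scaleC.sum_right scaleC_scaleC)
    then have "norm ((L ^^ n) (a *\<^sub>C x - \<Phi> (\<lambda>z. a * cc x z))) = cmod a * norm ((L ^^ n) (x - \<Phi> (cc x)))"
      by (simp only: Ln(3) norm_scaleC)
    also have "\<dots> \<le> cmod a * (K7 * \<rho> ^ n * norm x)" by (intro mult_left_mono cc) auto
    finally show "norm ((L ^^ n) (a *\<^sub>C x - \<Phi> (\<lambda>z. a * cc x z))) \<le> (cmod a * K7 * norm x) * \<rho> ^ n"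
      by (simp add: algebra_simps)
  qed
  have l_L: "\<ll> z (L u) = z * \<ll> z u" if "z \<in> \<Lambda>" for z u
    unfolding \<ll>_def
  proof (rule uniq[OF that])
    fix n
    have "L u - \<Phi> (\<lambda>z. z * cc u z) = L (u - \<Phi> (cc u))"
      using L\<Phi>[of 1 "cc u"] by (simp add: L')
    then have "norm ((L ^^ n) (L u - \<Phi> (\<lambda>z. z * cc u z))) = norm ((L ^^ Suc n) (u - \<Phi> (cc u)))"
      by (simp add: funpow_swap1)
    also have "\<dots> \<le> K7 * \<rho> ^ Suc n * norm u" by (rule cc)
    finally show "norm ((L ^^ n) (L u - \<Phi> (\<lambda>z. z * cc u z))) \<le> (K7 * \<rho> * norm u) * \<rho> ^ n"
      by (simp add: algebra_simps)
  qed
  have l_v: "\<ll> z (v w) = (if w = z then 1 else 0)" if "z \<in> \<Lambda>" "w \<in> \<Lambda>" for z w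
  proof -
    have "cc (v w) z = (if w = z then 1 else 0)"
    proof (rule uniq[OF that(1)])
      fix n
      have "\<Phi> (\<lambda>z. if w = z then 1 else 0) = v w"
        using fin that by (simp add: \<Phi>_def if_distrib[of "\<lambda>c. c *\<^sub>C _"] sum.delta cong: if_cong)
      then show "norm ((L ^^ n) (v w - \<Phi> (\<lambda>z. if w = z then 1 else 0))) \<le> 0 * \<rho> ^ n"
        by (simp add: Ln)
    qed
    then show ?thesis by (simp add: \<ll>_def)
  qed
  have l_bd: "cmod (\<ll> z u) \<le> (K1 * (1 + K7)) * norm u" if "z \<in> \<Lambda>" for z u
  proof -
    have "norm (\<Phi> (cc u)) \<le> norm u + norm (u - \<Phi> (cc u))"
      by (metis norm_minus_commute norm_triangle_sub)
    also have "\<dots> \<le> norm u + K7 * norm u" using cc[of 0 u] by simp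
    finally have "K1 * norm (\<Phi> (cc u)) \<le> K1 * (norm u + K7 * norm u)"
      using K1 by (intro mult_left_mono) auto
    then show ?thesis using K1b[OF that, of "cc u"] by (simp add: \<ll>_def \<Phi>_def algebra_simps)
  qed
  show ?thesis
  proof (rule that[of v \<ll> K7 \<rho>])
    show "bounded_clinear (\<ll> z)" if "z \<in> \<Lambda>" for z
      using l_add[OF that] l_scale[OF that] l_bd[OF that] by (intro bounded_clinearI) auto
  qed (use v l_L l_v K7 \<rho> cc in \<open>auto simp: \<ll>_def \<Phi>_def\<close>)
qed

end

section \<open>Perturbation of the peripheral spectrum\<close>

text \<open>Passing from the sum at time \<open>n\<close> to the sum at time \<open>Suc n\<close>
  minus \<open>z a\<close> times the sum at \<open>n\<close> removes the term of \<open>a\<close>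
  and keeps boundedness, so the induction hypothesis kills all other coefficients; the factor
  \<open>z k - z a\<close> is nonzero by injectivity. A single term with base outside the closed
  unit disc is unbounded.\<close>

lemma bounded_exponential_sum_zero:
  fixes z c :: "'i \<Rightarrow> complex"
  assumes "finite I" "inj_on z I" "\<And>i. i \<in> I \<Longrightarrow> 1 < cmod (z i)"
    and "\<And>n. cmod (\<Sum>i\<in>I. c i * z i ^ n) \<le> b" and "i \<in> I"
  shows "c i = 0"
  using assms
proof (induction I arbitrary: c b i rule: finite_induct)
  case empty
  then show ?case by simp
next
  case (insert a I)
  have zero: "c k = 0" if "k \<in> I" for k
  proof -
    have "c k * (z k - z a) = 0"
    proof (rule insert.IH[of "\<lambda>k. c k * (z k - z a)" "b + cmod (z a) * b"])
      fix n
      have "(\<Sum>k\<in>I. c k * (z k - z a) * z k ^ n) = (\<Sum>k\<in>insert a I. c k * (z k - z a) * z k ^ n)"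
        using insert by simp
      also have "\<dots> = (\<Sum>k\<in>insert a I. c k * z k ^ Suc n) - z a * (\<Sum>k\<in>insert a I. c k * z k ^ n)"
        unfolding sum_distrib_left sum_subtractf[symmetric]
        by (intro sum.cong) (auto simp: algebra_simps)
      also have "cmod \<dots> \<le> b + cmod (z a) * b"
        unfolding norm_mult
        by (intro order_trans[OF norm_triangle_ineq4] add_mono mult_left_mono insert.prems(3))
           (simp add: norm_mult mult_left_mono insert.prems(3))
      finally show "cmod (\<Sum>k\<in>I. c k * (z k - z a) * z k ^ n) \<le> b + cmod (z a) * b" .
    qed (use insert.prems that in auto)
    moreover have "z k \<noteq> z a" using insert.prems(1) insert.hyps(2) that by (auto simp: inj_on_def)
    ultimately show ?thesis by simp
  qed
  have "c a = 0"
  proof (rule ccontr)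
    assume ca: "c a \<noteq> 0"
    have le: "cmod (c a) * cmod (z a) ^ n \<le> b" for n
      using insert.prems(3)[of n] insert.hyps zero by (simp add: norm_mult norm_power)
    obtain n where "b / cmod (c a) < cmod (z a) ^ n"
      using real_arch_pow[of "cmod (z a)" "b / cmod (c a)"] insert.prems(2) by auto
    then show False using le[of n] ca by (simp add: field_simps)
  qed
  then show ?case using zero insert.prems(4) by auto
qed

text \<open>One constant \<open>M\<close> bounds eigenvectors, eigenfunctionals, number and size of
  the eigenvalues and the inverse gaps. All later constants depend on \<open>M\<close> and
  \<open>\<rho>\<close> only, hence are uniform in the perturbation.\<close>

locale spectral_perturbation =
  fixes L0 :: "'g::complex_banach \<Rightarrow> 'g" and \<Lambda> :: "complex set" and v :: "complex \<Rightarrow> 'g"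
    and \<ll> :: "complex \<Rightarrow> 'g \<Rightarrow> complex" and M \<rho> :: real
  assumes L0: "bounded_clinear L0" and fin: "finite \<Lambda>" and \<Lambda>1: "\<And>z. z \<in> \<Lambda> \<Longrightarrow> 1 \<le> cmod z"
    and L0v: "\<And>z. z \<in> \<Lambda> \<Longrightarrow> L0 (v z) = z *\<^sub>C v z"
    and l: "\<And>z. z \<in> \<Lambda> \<Longrightarrow> bounded_clinear (\<ll> z)"
    and lL0: "\<And>z u. z \<in> \<Lambda> \<Longrightarrow> \<ll> z (L0 u) = z * \<ll> z u"
    and lv: "\<And>z w. z \<in> \<Lambda> \<Longrightarrow> w \<in> \<Lambda> \<Longrightarrow> \<ll> z (v w) = (if w = z then 1 else 0)"
    and M: "M \<ge> 1" and \<rho>: "0 < \<rho>" "\<rho> < 1"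
    and vM: "\<And>z. z \<in> \<Lambda> \<Longrightarrow> norm (v z) \<le> M"
    and lM: "\<And>z u. z \<in> \<Lambda> \<Longrightarrow> cmod (\<ll> z u) \<le> M * norm u"
    and cardM: "real (card \<Lambda>) \<le> M"
    and gap: "\<And>z w. z \<in> \<Lambda> \<Longrightarrow> w \<in> \<Lambda> \<Longrightarrow> z \<noteq> w \<Longrightarrow> 1 / M \<le> cmod (z - w)"
    and LaM: "\<And>z. z \<in> \<Lambda> \<Longrightarrow> cmod z \<le> M"
begin

section \<open>Peripheral projection and resolvent of the reduced operator\<close>

definition proj :: "'g \<Rightarrow> 'g" where "proj u = (\<Sum>z\<in>\<Lambda>. \<ll> z u *\<^sub>C v z)"

definition coproj :: "'g \<Rightarrow> 'g" where "coproj u = u - proj u"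

lemma proj: "bounded_clinear proj"
  unfolding proj_def[abs_def] by (intro bounded_clinear_sum bounded_clinear_scaleC_const l)

lemma coproj: "bounded_clinear coproj"
  unfolding coproj_def[abs_def] by (intro bounded_clinear_diff proj bounded_clinear_ident)

lemma l_proj: "z \<in> \<Lambda> \<Longrightarrow> \<ll> z (proj u) = \<ll> z u"
  unfolding proj_def using fin
  by (simp add: bounded_clinearD[OF l] lv if_distrib[of "\<lambda>c. _ * c"] sum.delta' cong: if_cong)

lemma l_coproj: "z \<in> \<Lambda> \<Longrightarrow> \<ll> z (coproj u) = 0"
  by (simp add: coproj_def bounded_clinearD[OF l] l_proj)

lemma proj_v: "z \<in> \<Lambda> \<Longrightarrow> proj (v z) = v z"
  unfolding proj_def using fin
  by (simp add: lv if_distrib[of "\<lambda>c. c *\<^sub>C _"] sum.delta cong: if_cong)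

lemma coproj_v: "z \<in> \<Lambda> \<Longrightarrow> coproj (v z) = 0"
  by (simp add: coproj_def proj_v)

lemma coproj_proj: "coproj (proj u) = 0"
  unfolding proj_def by (simp add: bounded_clinearD[OF coproj] coproj_v)

lemma coproj_idem: "coproj (coproj u) = coproj u"
  by (simp add: coproj_def[of u] bounded_clinearD[OF coproj] coproj_proj)

lemma sum_bound:
  assumes "\<And>z. z \<in> \<Lambda> \<Longrightarrow> norm (g z :: 'x::real_normed_vector) \<le> b" "0 \<le> b"
  shows "norm (sum g \<Lambda>) \<le> M * b"
proof -
  have "norm (sum g \<Lambda>) \<le> real (card \<Lambda>) * b" using assms(1) by (rule sum_norm_bound)
  also have "\<dots> \<le> M * b" using cardM assms(2) by (rule mult_right_mono)
  finally show ?thesis .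
qed

lemma combination_bound:
  assumes "\<And>z. z \<in> \<Lambda> \<Longrightarrow> cmod (c z) \<le> b" "0 \<le> b"
  shows "norm (\<Sum>z\<in>\<Lambda>. c z *\<^sub>C v z) \<le> M ^ 2 * b"
proof -
  have "norm (\<Sum>z\<in>\<Lambda>. c z *\<^sub>C v z) \<le> M * (b * M)"
    using assms M vM by (intro sum_bound) (auto simp: norm_scaleC intro!: mult_mono)
  then show ?thesis by (simp add: power2_eq_square mult_ac)
qed

lemma proj_le: "norm (proj u) \<le> M ^ 3 * norm u"
  using combination_bound[of "\<lambda>z. \<ll> z u" "M * norm u"] lM M
  by (simp add: proj_def power3_eq_cube power2_eq_square mult_ac)

definition Mp :: real where "Mp = 1 + M ^ 3"

lemma Mp: "Mp \<ge> 1" using M by (simp add: Mp_def)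

lemma coproj_le: "norm (coproj u) \<le> Mp * norm u"
  unfolding coproj_def
  by (rule order_trans[OF norm_triangle_ineq4]) (use proj_le[of u] in \<open>simp add: Mp_def algebra_simps\<close>)

text \<open>
  Operators close to \<open>L0\<close> as seen by the peripheral eigenfunctionals, and contracting the
  complement of the peripheral eigenspaces; they need not be close to \<open>L0\<close> in operator norm.
\<close>

definition near :: "('g \<Rightarrow> 'g) \<Rightarrow> real \<Rightarrow> bool" where
  "near L d \<longleftrightarrow> bounded_clinear L \<and> 0 \<le> d \<and> (\<forall>u. norm (L u) \<le> M * norm u) \<and>
     (\<forall>z\<in>\<Lambda>. \<forall>u. cmod (\<ll> z (L u - L0 u)) \<le> d * norm u) \<and>
     (\<forall>n u. norm (((\<lambda>u. L (coproj u)) ^^ n) u) \<le> M * \<rho> ^ n * norm u)"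

text \<open>Halfway between the decay rate on the complement and the unit circle. Perturbed
  eigenvalues stay outside this radius, where the resolvent series converges with the uniform bound
  \<open>Mw\<close>.\<close>

definition r1 :: real where "r1 = (1 + \<rho>) / 2"

lemma r1: "\<rho> < r1" "r1 < 1" "0 < r1" "r1 - \<rho> = (1 - \<rho>) / 2" using \<rho> by (auto simp: r1_def field_simps)

definition Mw :: real where "Mw = 2 * M / (1 - \<rho>)"

lemma Mw: "Mw > 0" using M \<rho> by (simp add: Mw_def)

text \<open>
  \<open>res L z\<close> is the resolvent \<open>(z - reduced L)\<inverse>\<close>. The functional \<open>\<Sum>a\<in>\<Lambda>. \<gamma> a * z * \<ll> a (res L z u)\<close> of \<open>u\<close>
  satisfies \<open>p (L u) = z * p u\<close> as soon as \<open>(z - k) * \<gamma> k = (\<Sum>a\<in>\<Lambda>. \<gamma> a * coupling L a k z)\<close> for all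
  \<open>k\<in>\<Lambda>\<close>. For small couplings, normalizing \<open>\<gamma> i = 1\<close> makes this a fixed point problem for a contraction.
\<close>

definition reduced :: "('g \<Rightarrow> 'g) \<Rightarrow> 'g \<Rightarrow> 'g" where "reduced L u = L (coproj u)"

definition res :: "('g \<Rightarrow> 'g) \<Rightarrow> complex \<Rightarrow> 'g \<Rightarrow> 'g" where
  "res L z u = (\<Sum>n. inverse z ^ Suc n *\<^sub>C (reduced L ^^ n) u)"

definition coupling :: "('g \<Rightarrow> 'g) \<Rightarrow> complex \<Rightarrow> complex \<Rightarrow> complex \<Rightarrow> complex" where
  "coupling L a k z = (let u = v k + coproj (res L z (L (v k))) in \<ll> a (L u - L0 u))"

text \<open>For an operator with \<open>near L d\<close>, \<open>d * M1\<close> bounds the couplings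
  and \<open>d * M2\<close> is their Lipschitz constant in \<open>z\<close>.\<close>

definition M1 :: real where "M1 = M + Mp * Mw * M ^ 2"
definition M2 :: real where "M2 = Mp * Mw ^ 2 * M ^ 2"

lemma M12: "M1 > 0" "M2 > 0"
  unfolding M1_def M2_def using M Mp Mw by (auto intro!: add_pos_nonneg mult_pos_pos mult_nonneg_nonneg)

context
  fixes L d
  assumes near: "near L d"
begin

lemma near_L: "bounded_clinear L" and near_d: "0 \<le> d" and near_le: "norm (L u) \<le> M * norm u"
  and near_l: "z \<in> \<Lambda> \<Longrightarrow> cmod (\<ll> z (L u - L0 u)) \<le> d * norm u"
  and near_pow: "norm ((reduced L ^^ n) u) \<le> M * \<rho> ^ n * norm u"
  using near by (auto simp: near_def reduced_def[abs_def])

lemma reduced: "bounded_clinear (reduced L)"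
  unfolding reduced_def[abs_def] by (intro bounded_clinear_compose[OF near_L coproj])

lemma res_term_bound:
  assumes "r1 \<le> cmod z"
  shows "norm (inverse z ^ Suc n *\<^sub>C (reduced L ^^ n) u) \<le> (M * norm u / r1) * (\<rho> / r1) ^ n"
proof -
  have "inverse (cmod z) ^ Suc n \<le> inverse r1 ^ Suc n"
    using assms r1 by (intro power_mono) (auto intro: le_imp_inverse_le)
  then have "norm (inverse z ^ Suc n *\<^sub>C (reduced L ^^ n) u) \<le> inverse r1 ^ Suc n * (M * \<rho> ^ n * norm u)"
    unfolding norm_scaleC norm_power norm_inverse
    using r1 by (intro mult_mono near_pow) auto
  also have "\<dots> = (M * norm u / r1) * (\<rho> / r1) ^ n"
    by (simp add: divide_inverse power_mult_distrib mult_ac)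
  finally show ?thesis .
qed

lemma res_summable:
  assumes "r1 \<le> cmod z"
  shows "summable (\<lambda>n. inverse z ^ Suc n *\<^sub>C (reduced L ^^ n) u)"
  by (rule summable_comparison_test'[of "\<lambda>n. (M * norm u / r1) * (\<rho> / r1) ^ n" 0])
     (use res_term_bound[OF assms] r1 \<rho> in \<open>auto intro!: summable_mult summable_geometric\<close>)

lemma res_le:
  assumes "r1 \<le> cmod z"
  shows "norm (res L z u) \<le> Mw * norm u"
proof -
  have "norm (res L z u) \<le> (\<Sum>n. (M * norm u / r1) * (\<rho> / r1) ^ n)"
    unfolding res_def using r1 \<rho>
    by (intro norm_suminf_le res_term_bound assms summable_mult summable_geometric) auto
  also have "\<dots> = (M * norm u / r1) * (1 / (1 - \<rho> / r1))"
    using r1 \<rho> by (subst suminf_mult) (auto simp: suminf_geometric intro!: summable_geometric)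
  also have "\<dots> = M * norm u / (r1 - \<rho>)" using r1 by (simp add: field_simps)
  also have "\<dots> = Mw * norm u" unfolding r1(4) by (simp add: Mw_def)
  finally show ?thesis .
qed

lemma res:
  assumes "r1 \<le> cmod z"
  shows "bounded_clinear (res L z)"
proof (rule bounded_clinearI[OF _ _ res_le[OF assms]])
  note An = bounded_clinearD[OF bounded_clinear_funpow[OF reduced]]
  show "res L z (x + y) = res L z x + res L z y" for x y
    unfolding res_def by (simp add: An scaleC_add_right suminf_add res_summable[OF assms] del: power_Suc)
  show "res L z (c *\<^sub>C x) = c *\<^sub>C res L z x" for c x
    unfolding res_def bounded_linear.suminf[OF scaleC.bounded_linear_right res_summable[OF assms]]
    by (simp add: An scaleC_scaleC mult.commute del: power_Suc)
qed

lemma res_reduced: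
  assumes z: "r1 \<le> cmod z"
  shows "res L z (reduced L u) = z *\<^sub>C res L z u - u"
    and "reduced L (res L z u) = z *\<^sub>C res L z u - u"
proof -
  have z0: "z \<noteq> 0" using z r1 by auto
  let ?f = "\<lambda>n. inverse z ^ Suc n *\<^sub>C (reduced L ^^ n) u"
  have "z *\<^sub>C ?f n = inverse z ^ n *\<^sub>C (reduced L ^^ n) u" for n
    using z0 by (simp add: scaleC_scaleC mult.assoc[symmetric])
  then have "z *\<^sub>C res L z u = (\<Sum>n. inverse z ^ n *\<^sub>C (reduced L ^^ n) u)"
    and s: "summable (\<lambda>n. inverse z ^ n *\<^sub>C (reduced L ^^ n) u)"
    using bounded_linear.suminf[OF scaleC.bounded_linear_right[of z] res_summable[OF z, of u]]
      bounded_linear.summable[OF scaleC.bounded_linear_right[of z] res_summable[OF z, of u]] by (auto simp: res_def)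
  then have eq: "z *\<^sub>C res L z u - u = (\<Sum>n. inverse z ^ Suc n *\<^sub>C (reduced L ^^ Suc n) u)"
    using suminf_split_head[OF s] by simp
  then show "res L z (reduced L u) = z *\<^sub>C res L z u - u"
    by (simp add: res_def funpow_swap1 del: power_Suc)
  have "reduced L (res L z u) = (\<Sum>n. reduced L (inverse z ^ Suc n *\<^sub>C (reduced L ^^ n) u))"
    unfolding res_def using bounded_linear.suminf[OF bounded_clinearD(7)[OF reduced] res_summable[OF z]]
    by simp
  then show "reduced L (res L z u) = z *\<^sub>C res L z u - u"
    unfolding eq by (simp add: bounded_clinearD[OF reduced] del: power_Suc)
qed

lemma res_v:
  assumes z: "r1 \<le> cmod z" and k: "k \<in> \<Lambda>"
  shows "z *\<^sub>C res L z (v k) = v k"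
  using res_reduced(1)[OF z, of "v k"]
  by (simp add: reduced_def coproj_v[OF k] bounded_clinearD[OF near_L] bounded_clinearD[OF res[OF z]])

text \<open>The resolvent identity \<open>res L z u - res L z' u = (z' - z) *\<^sub>C res L z (res L
  z' u)\<close>.\<close>

lemma res_Lipschitz:
  assumes z: "r1 \<le> cmod z" and z': "r1 \<le> cmod z'"
  shows "norm (res L z u - res L z' u) \<le> Mw ^ 2 * norm u * cmod (z - z')"
proof -
  note W = bounded_clinearD[OF res[OF z]]
  define x where "x = res L z u - res L z' u"
  have "z *\<^sub>C x - reduced L x = (z' - z) *\<^sub>C res L z' u"
    using res_reduced(2)[OF z, of u] res_reduced(2)[OF z', of u]
    by (simp add: x_def bounded_clinearD[OF reduced] scaleC.diff_right scaleC.diff_left)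
  moreover have "res L z (z *\<^sub>C x - reduced L x) = x"
    using res_reduced(1)[OF z, of x] by (simp add: W)
  ultimately have "x = (z' - z) *\<^sub>C res L z (res L z' u)" by (simp add: W)
  then have "norm x = cmod (z - z') * norm (res L z (res L z' u))"
    by (simp add: norm_scaleC norm_minus_commute)
  also have "\<dots> \<le> cmod (z - z') * (Mw * (Mw * norm u))"
    using Mw by (intro mult_left_mono order_trans[OF res_le[OF z]] res_le[OF z']) auto
  finally show ?thesis by (simp add: x_def power2_eq_square mult_ac)
qed

text \<open>Eigenfunctionals of \<open>L0\<close> vanish on \<open>L0 (coproj u)\<close>, so
  \<open>L0\<close> can be subtracted for free. Every trace of the complement in the peripheral
  directions is therefore of order \<open>d\<close>.\<close>

lemma l_reduced: "z \<in> \<Lambda> \<Longrightarrow> \<ll> z (reduced L u) = \<ll> z (L (coproj u) - L0 (coproj u))"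
  by (simp add: reduced_def bounded_clinearD[OF l] lL0 l_coproj)

lemma Lv_le: "k \<in> \<Lambda> \<Longrightarrow> norm (L (v k)) \<le> M ^ 2"
  using order_trans[OF near_le[of "v k"] mult_left_mono[OF vM[of k], of M]] M by (simp add: power2_eq_square)

lemma coupling_le:
  assumes "r1 \<le> cmod z" "a \<in> \<Lambda>" "k \<in> \<Lambda>"
  shows "cmod (coupling L a k z) \<le> d * M1"
proof -
  have "norm (v k + coproj (res L z (L (v k)))) \<le> M + Mp * (Mw * M ^ 2)"
    using assms Mp Mw
    by (intro order_trans[OF norm_triangle_ineq] add_mono vM order_trans[OF coproj_le] mult_left_mono
        order_trans[OF res_le] Lv_le) auto
  then have "d * norm (v k + coproj (res L z (L (v k)))) \<le> d * M1"
    unfolding M1_def using near_d by (intro mult_left_mono) (auto simp: mult_ac)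
  then show ?thesis unfolding coupling_def Let_def using near_l[OF assms(2)] order_trans by blast
qed

lemma coupling_Lipschitz:
  assumes "r1 \<le> cmod z" "r1 \<le> cmod z'" "a \<in> \<Lambda>" "k \<in> \<Lambda>"
  shows "cmod (coupling L a k z - coupling L a k z') \<le> d * M2 * cmod (z - z')"
proof -
  let ?w = "L (v k)"
  define x where "x = coproj (res L z ?w - res L z' ?w)"
  have "coupling L a k z - coupling L a k z' = \<ll> a (L x - L0 x)"
    using assms(3) unfolding coupling_def Let_def x_def
    by (simp add: bounded_clinearD[OF l] bounded_clinearD[OF near_L] bounded_clinearD[OF L0] bounded_clinearD[OF coproj])
  also have "cmod \<dots> \<le> d * norm x" by (rule near_l[OF assms(3)])
  also have "\<dots> \<le> d * (Mp * (Mw ^ 2 * M ^ 2 * cmod (z - z')))"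
  proof (intro mult_left_mono near_d)
    have "norm x \<le> Mp * norm (res L z ?w - res L z' ?w)" unfolding x_def by (rule coproj_le)
    also have "\<dots> \<le> Mp * (Mw ^ 2 * norm ?w * cmod (z - z'))"
      using Mp assms by (intro mult_left_mono res_Lipschitz) auto
    also have "\<dots> \<le> Mp * (Mw ^ 2 * M ^ 2 * cmod (z - z'))"
      using Mp Lv_le[OF assms(4)] by (intro mult_left_mono mult_right_mono) auto
    finally show "norm x \<le> Mp * (Mw ^ 2 * M ^ 2 * cmod (z - z'))" .
  qed
  finally show ?thesis by (simp add: M2_def mult_ac)
qed

end

end

section \<open>Perturbed eigenvalues and eigenfunctionals\<close>

context spectral_perturbation
begin

text \<open>The couplings depend on \<open>z\<close> through the resolvent, so coefficients and
  eigenvalue are found together by Banach's fixed point theorem. With \<open>\<gamma> i = 1\<close>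
  the equation for \<open>k = i\<close> determines \<open>z\<close>; the one for
  \<open>k \<noteq> i\<close> is divided by \<open>i - k\<close>, which the spectral gaps keep away
  from 0.\<close>

lemma perturbed_coefficients:
  "\<exists>d0>0. \<exists>K>0. \<forall>L d. near L d \<longrightarrow> d \<le> d0 \<longrightarrow> (\<forall>i\<in>\<Lambda>. \<exists>\<gamma> z. \<gamma> i = 1 \<and> cmod (z - i) \<le> K * d \<and>
     r1 \<le> cmod z \<and> (\<forall>k\<in>\<Lambda>. k \<noteq> i \<longrightarrow> cmod (\<gamma> k) \<le> K * d) \<and>
     (\<forall>k\<in>\<Lambda>. (z - k) * \<gamma> k = (\<Sum>a\<in>\<Lambda>. \<gamma> a * coupling L a k z)))"
proof -
  \<comment> \<open>The first bound keeps \<open>z\<close> outside the radius \<open>r1\<close>; the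
    second makes the quadratic term \<open>(z - i) * \<gamma> k\<close> a small Lipschitz
    perturbation. \<open>d0\<close> does the same for the couplings.\<close>
  define r where "r = min ((1 - \<rho>) / 2) (1 / (8 * M ^ 4))"
  have r: "0 < r" "r \<le> (1 - \<rho>) / 2" "r \<le> 1 / (8 * M ^ 4)"
    unfolding r_def using \<rho> M by (simp, intro min.cobounded1, intro min.cobounded2)
  have M4: "M ^ 4 * r \<le> 1 / 8" using r(3) M by (simp add: field_simps)
  have r_le: "r \<le> 1" using r(2) \<rho> by simp
  define B where "B = M * (M + 1)"
  define X1 where "X1 = M * B * M1"
  define X2 where "X2 = M * (M * M1 + B * M2)"
  have B: "B > 0" using M by (simp add: B_def)
  have X: "X1 > 0" "X2 > 0" using B M M12 by (auto simp: X1_def X2_def intro!: mult_pos_pos add_pos_pos)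
  define d0 where "d0 = min (r / (2 * M ^ 3 * X1)) (1 / (16 * M ^ 3 * X2))"
  have M3: "M ^ 3 \<ge> 1" using M by simp
  have d0: "d0 > 0" using r X M by (simp add: d0_def)
  have d0X: "M ^ 3 * (d * X1) \<le> r / 2" "M ^ 3 * (d * X2) \<le> 1 / 16" if "d \<le> d0" for d
  proof -
    have "d \<le> r / (2 * M ^ 3 * X1)" "d \<le> 1 / (16 * M ^ 3 * X2)" using that by (auto simp: d0_def)
    then show "M ^ 3 * (d * X1) \<le> r / 2" "M ^ 3 * (d * X2) \<le> 1 / 16"
      using X M by (auto simp: field_simps)
  qed
  define K where "K = X1 + 2 * M * X1"
  have K: "K > 0" unfolding K_def using X M by (intro add_pos_nonneg) auto
  have "\<exists>\<gamma> z. \<gamma> i = 1 \<and> cmod (z - i) \<le> K * d \<and> r1 \<le> cmod z \<and>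
     (\<forall>k\<in>\<Lambda>. k \<noteq> i \<longrightarrow> cmod (\<gamma> k) \<le> K * d) \<and>
     (\<forall>k\<in>\<Lambda>. (z - k) * \<gamma> k = (\<Sum>a\<in>\<Lambda>. \<gamma> a * coupling L a k z))"
    if near: "near L d" and d: "d \<le> d0" and i: "i \<in> \<Lambda>" for L d i
  proof -
    note d_ge = near_d[OF near]
    \<comment> \<open>Coefficients are coded as \<open>\<gamma> k = \<ll> k x\<close> by a vector
      \<open>x\<close> near \<open>v i\<close>, so that the iteration lives in the given Banach
      space.\<close>
    define S where "S = cball (v i) r \<times> cball i r"
    have S_x: "norm (x - v i) \<le> r" and S_z: "cmod (z - i) \<le> r" if "(x, z) \<in> S" for x z
      using that by (auto simp: S_def dist_norm norm_minus_commute)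
    have S_r1: "r1 \<le> cmod z" if "(x, z) \<in> S" for x z
    proof -
      have "cmod i - cmod z \<le> r" using S_z[OF that] norm_triangle_ineq2[of i z]
        by (simp add: norm_minus_commute)
      then show ?thesis using \<Lambda>1[OF i] r(2) by (simp add: r1_def field_simps)
    qed
    have S_l: "cmod (\<ll> a x) \<le> B" if "(x, z) \<in> S" "a \<in> \<Lambda>" for x z a
    proof -
      have "norm x \<le> M + 1" using S_x[OF that(1)] vM[OF i] r_le norm_triangle_sub[of x "v i"] by linarith
      then show ?thesis unfolding B_def
        using lM[OF that(2), of x] M by (meson less_eq_real_def mult_left_mono order_trans zero_le_one)
    qed
    have S_lk: "cmod (\<ll> k x) \<le> M * r" if "(x, z) \<in> S" "k \<in> \<Lambda>" "k \<noteq> i" for x z k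
    proof -
      have "\<ll> k x = \<ll> k (x - v i)" using that i by (simp add: bounded_clinearD[OF l] lv)
      also have "cmod \<dots> \<le> M * norm (x - v i)" using that by (intro lM)
      also have "\<dots> \<le> M * r" using S_x[OF that(1)] M by (intro mult_left_mono) auto
      finally show ?thesis .
    qed
    define s where "s x z k = (\<Sum>a\<in>\<Lambda>. \<ll> a x * coupling L a k z)" for x z k
    have s_le: "cmod (s x z k) \<le> d * X1" if xz: "(x, z) \<in> S" and k: "k \<in> \<Lambda>" for x z k
    proof -
      have "cmod (s x z k) \<le> M * (B * (d * M1))"
        unfolding s_def using S_l[OF xz] coupling_le[OF near S_r1[OF xz] _ k] B M12 d_ge
        by (intro sum_bound) (auto simp: norm_mult intro!: mult_mono)
      then show ?thesis by (simp add: X1_def mult_ac)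
    qed
    have s_lip: "cmod (s x z k - s x' z' k) \<le> d * X2 * (norm (x - x') + cmod (z - z'))"
      if xz: "(x, z) \<in> S" and xz': "(x', z') \<in> S" and k: "k \<in> \<Lambda>" for x z x' z' k
    proof -
      define D where "D = norm (x - x') + cmod (z - z')"
      have D: "norm (x - x') \<le> D" "cmod (z - z') \<le> D" "D \<ge> 0" by (auto simp: D_def)
      have "s x z k - s x' z' k = (\<Sum>a\<in>\<Lambda>. \<ll> a (x - x') * coupling L a k z + \<ll> a x' * (coupling L a k z - coupling L a k z'))"
        unfolding s_def sum_subtractf[symmetric]
        by (intro sum.cong) (auto simp: bounded_clinearD[OF l] algebra_simps)
      also have "cmod \<dots> \<le> M * ((M * D) * (d * M1) + B * (d * M2 * D))"
      proof (intro sum_bound)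
        fix a assume a: "a \<in> \<Lambda>"
        have "cmod (\<ll> a (x - x')) \<le> M * D"
          using lM[OF a, of "x - x'"] mult_left_mono[OF D(1), of M] M by linarith
        then have 1: "cmod (\<ll> a (x - x') * coupling L a k z) \<le> (M * D) * (d * M1)"
          unfolding norm_mult using coupling_le[OF near S_r1[OF xz] a k] M D by (intro mult_mono) auto
        have "cmod (coupling L a k z - coupling L a k z') \<le> d * M2 * D"
          using order_trans[OF coupling_Lipschitz[OF near S_r1[OF xz] S_r1[OF xz'] a k] mult_left_mono[OF D(2)]]
            d_ge M12 by simp
        then have 2: "cmod (\<ll> a x' * (coupling L a k z - coupling L a k z')) \<le> B * (d * M2 * D)"
          unfolding norm_mult using S_l[OF xz' a] B by (intro mult_mono) auto
        show "cmod (\<ll> a (x - x') * coupling L a k z + \<ll> a x' * (coupling L a k z - coupling L a k z'))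
            \<le> (M * D) * (d * M1) + B * (d * M2 * D)"
          using norm_triangle_ineq 1 2 by (meson add_mono order_trans)
      qed (use M D B d_ge M12 in \<open>auto intro!: add_nonneg_nonneg mult_nonneg_nonneg\<close>)
      also have "\<dots> = d * X2 * D" by (simp add: X2_def algebra_simps)
      finally show ?thesis by (simp add: D_def)
    qed
    \<comment> \<open>This solves
      \<open>(i - k) * \<gamma> k = s x z k - (z - i) * \<gamma> k\<close>, a rewriting of the
      equation for \<open>k\<close>; no correction along \<open>v i\<close> keeps
      \<open>\<gamma> i = 1\<close>.\<close>
    define g where "g x z k = (if k = i then 0 else (s x z k - (z - i) * \<ll> k x) / (i - k))" for x z k
    define F where "F = (\<lambda>(x, z). (v i + (\<Sum>k\<in>\<Lambda>. g x z k *\<^sub>C v k), i + s x z i))"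
    have inv_gap: "cmod (w / (i - k)) \<le> M * b" if "k \<in> \<Lambda>" "k \<noteq> i" "cmod w \<le> b" for w k b
    proof -
      have "cmod w \<le> M * b * (1 / M)" using that M by simp
      also have "\<dots> \<le> M * b * cmod (i - k)"
        using gap[OF i that(1)] that M order_trans[OF norm_ge_zero that(3)] by (intro mult_left_mono) auto
      finally show ?thesis using that by (simp add: norm_divide divide_le_eq)
    qed
    have g_le: "cmod (g x z k) \<le> M * (d * X1 + M * r * r)" if xz: "(x, z) \<in> S" and k: "k \<in> \<Lambda>" for x z k
    proof (cases "k = i")
      case True
      then show ?thesis using M d_ge X r by (simp add: g_def)
    next
      case False
      have "cmod (s x z k - (z - i) * \<ll> k x) \<le> d * X1 + r * (M * r)"
        using s_le[OF xz k] S_z[OF xz] S_lk[OF xz k False] r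
        by (intro order_trans[OF norm_triangle_ineq4] add_mono) (auto simp: norm_mult intro!: mult_mono)
      from inv_gap[OF k False this] show ?thesis using False by (simp add: g_def mult_ac)
    qed
    have g_lip: "cmod (g x z k - g x' z' k) \<le> M * ((d * X2 + M * r) * (norm (x - x') + cmod (z - z')))"
      if xz: "(x, z) \<in> S" and xz': "(x', z') \<in> S" and k: "k \<in> \<Lambda>" for x z x' z' k
    proof (cases "k = i")
      case True
      then show ?thesis using M d_ge X r by (simp add: g_def)
    next
      case False
      have "(s x z k - (z - i) * \<ll> k x) - (s x' z' k - (z' - i) * \<ll> k x')
         = (s x z k - s x' z' k) - ((z - i) * \<ll> k (x - x') + (z - z') * \<ll> k x')"
        using k by (simp add: bounded_clinearD[OF l] algebra_simps)
      also have "cmod \<dots> \<le> d * X2 * (norm (x - x') + cmod (z - z')) + (r * (M * norm (x - x')) + cmod (z - z') * (M * r))"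
        using S_z[OF xz] S_lk[OF xz' k False] r lM[OF k]
        by (intro order_trans[OF norm_triangle_ineq4] add_mono s_lip[OF xz xz' k] order_trans[OF norm_triangle_ineq])
           (auto simp: norm_mult intro!: mult_mono)
      also have "\<dots> = (d * X2 + M * r) * (norm (x - x') + cmod (z - z'))" by (simp add: algebra_simps)
      finally have "cmod (((s x z k - (z - i) * \<ll> k x) - (s x' z' k - (z' - i) * \<ll> k x')) / (i - k))
         \<le> M * ((d * X2 + M * r) * (norm (x - x') + cmod (z - z')))"
        by (rule inv_gap[OF k False])
      then show ?thesis using False by (simp add: g_def diff_divide_distrib)
    qed
    have "closed S" unfolding S_def by (intro closed_Times) auto
    note complete = this[folded complete_eq_closed]
    have "\<exists>!y\<in>S. F y = y"
    proof (rule Banach_fix[OF complete, where c = "1 / 2"])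
      show "S \<noteq> {}" using r by (auto simp: S_def)
      show "(0::real) \<le> 1 / 2" "1 / 2 < (1::real)" by auto
      show "F ` S \<subseteq> S"
      proof (rule image_subsetI)
        fix y assume yS: "y \<in> S"
        obtain x z where y: "y = (x, z)" by (cases y)
        have xz: "(x, z) \<in> S" using yS y by simp
        have "norm (\<Sum>k\<in>\<Lambda>. g x z k *\<^sub>C v k) \<le> M ^ 2 * (M * (d * X1 + M * r * r))"
          using M d_ge X r by (intro combination_bound g_le[OF xz]) auto
        also have "\<dots> = M ^ 3 * (d * X1) + M ^ 4 * r * r"
          by (simp add: power2_eq_square power3_eq_cube power4_eq_xxxx algebra_simps)
        also have "\<dots> \<le> r / 2 + 1 / 8 * r" using d0X[OF d] M4 r by (intro add_mono mult_right_mono) auto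
        finally have 1: "norm (\<Sum>k\<in>\<Lambda>. g x z k *\<^sub>C v k) \<le> r" using r by simp
        have "cmod (s x z i) \<le> d * X1" by (rule s_le[OF xz i])
        also have "\<dots> \<le> M ^ 3 * (d * X1)" using M3 d_ge X mult_right_mono[of 1 "M ^ 3" "d * X1"] by simp
        also have "\<dots> \<le> r" using d0X[OF d] r by simp
        finally show "F y \<in> S" using 1 unfolding y by (simp add: F_def S_def dist_norm)
      qed
      fix y y' assume y: "y \<in> S" and y': "y' \<in> S"
      obtain x z x' z' where yx: "y = (x, z)" "y' = (x', z')" by (cases y, cases y')
      define D where "D = norm (x - x') + cmod (z - z')"
      have D0: "D \<ge> 0" by (simp add: D_def)
      have xz: "(x, z) \<in> S" "(x', z') \<in> S" using y y' yx by auto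
      have "norm ((\<Sum>k\<in>\<Lambda>. g x z k *\<^sub>C v k) - (\<Sum>k\<in>\<Lambda>. g x' z' k *\<^sub>C v k))
          = norm (\<Sum>k\<in>\<Lambda>. (g x z k - g x' z' k) *\<^sub>C v k)"
        by (simp add: scaleC.diff_left sum_subtractf)
      also have "\<dots> \<le> M ^ 2 * (M * ((d * X2 + M * r) * D))"
        unfolding D_def using M d_ge X r by (intro combination_bound g_lip[OF xz]) auto
      also have "\<dots> = (M ^ 3 * (d * X2) + M ^ 4 * r) * D"
        by (simp add: power2_eq_square power3_eq_cube power4_eq_xxxx algebra_simps)
      also have "\<dots> \<le> (1 / 16 + 1 / 8) * D"
        using d0X[OF d] M4 D0 by (intro mult_right_mono add_mono) auto
      finally have 1: "norm (fst (F y) - fst (F y')) \<le> (1 / 16 + 1 / 8) * D" by (simp add: F_def yx)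
      have "cmod (s x z i - s x' z' i) \<le> d * X2 * D" unfolding D_def by (rule s_lip[OF xz i])
      also have "\<dots> \<le> M ^ 3 * (d * X2) * D"
        using M3 d_ge X D0 mult_right_mono[of 1 "M ^ 3" "d * X2"] by (intro mult_right_mono) auto
      also have "\<dots> \<le> 1 / 16 * D" using d0X[OF d] D0 by (intro mult_right_mono) auto
      finally have 2: "cmod (snd (F y) - snd (F y')) \<le> 1 / 16 * D" by (simp add: F_def yx)
      \<comment> \<open>The Lipschitz constants \<open>3 / 16\<close> and \<open>1 / 16\<close> add
        up to \<open>1 / 4\<close>; comparing the sum of the two distances with the product distance
        costs a factor 2.\<close>
      have "dist (F y) (F y') \<le> norm (fst (F y) - fst (F y')) + cmod (snd (F y) - snd (F y'))"
        unfolding dist_norm by (metis fst_diff norm_Pair_le prod.collapse snd_diff)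
      also have "\<dots> \<le> 1 / 4 * D" using 1 2 by simp
      also have "D \<le> 2 * dist y y'"
        using dist_fst_le[of y y'] dist_snd_le[of y y'] by (simp add: D_def yx dist_norm)
      finally show "dist (F y) (F y') \<le> 1 / 2 * dist y y'" by simp
    qed
    then obtain x z where xz: "(x, z) \<in> S" and fixp: "F (x, z) = (x, z)" by auto
    have x: "x = v i + (\<Sum>k\<in>\<Lambda>. g x z k *\<^sub>C v k)" and z: "z = i + s x z i"
      using fixp by (auto simp: F_def)
    have lx: "\<ll> k x = (if k = i then 1 else 0) + g x z k" if "k \<in> \<Lambda>" for k
    proof -
      have "\<ll> k x = \<ll> k (v i) + (\<Sum>j\<in>\<Lambda>. g x z j * \<ll> k (v j))"
        by (subst x) (simp add: bounded_clinearD[OF l[OF that]])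
      then show ?thesis using that i fin
        by (auto simp: lv if_distrib[of "\<lambda>c. _ * c"] sum.delta' cong: if_cong)
    qed
    have eq: "(z - k) * \<ll> k x = s x z k" if k: "k \<in> \<Lambda>" for k
    proof (cases "k = i")
      case True
      have "z - i = s x z i" using z by (metis add_diff_cancel_left')
      then show ?thesis using lx[OF k] True by (simp add: g_def)
    next
      case False
      have "\<ll> k x = (s x z k - (z - i) * \<ll> k x) / (i - k)"
        using lx[OF k] False by (simp add: g_def)
      then have "(i - k) * \<ll> k x = s x z k - (z - i) * \<ll> k x"
        by (subst (asm) nonzero_eq_divide_eq) (use False in \<open>auto simp: mult.commute\<close>)
      then show ?thesis by (simp add: algebra_simps)
    qed
    have zi: "cmod (z - i) \<le> X1 * d" using s_le[OF xz i] z by (metis add_diff_cancel_left' mult.commute)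
    \<comment> \<open>Membership in \<open>S\<close> only gives coefficients of order
      \<open>r\<close>. Dividing the solved equation by \<open>z - k\<close>, of modulus at least
      \<open>1 / (2 * M)\<close>, improves this to order \<open>d\<close>.\<close>
    have "cmod (\<ll> k x) \<le> 2 * M * X1 * d" if k: "k \<in> \<Lambda>" "k \<noteq> i" for k
    proof -
      have "r \<le> 1 / (2 * M)"
      proof -
        have "r * (2 * M) \<le> 1"
        proof -
          have "M * r \<le> M ^ 4 * r" using M r power_increasing[of 1 4 M] by (intro mult_right_mono) auto
          then have "2 * (M * r) \<le> 1" using M4 by linarith
          then show ?thesis by (simp add: mult_ac)
        qed
        then show ?thesis using M by (simp add: field_simps)
      qed
      moreover have "1 / M \<le> cmod (i - k)" using gap[OF i k(1)] k by auto
      moreover have "cmod (i - k) \<le> cmod (z - i) + cmod (z - k)"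
        using norm_triangle_ineq4[of "z - k" "z - i"] by simp
      ultimately have ge: "1 / (2 * M) \<le> cmod (z - k)" using S_z[OF xz] by (simp add: field_simps)
      have "cmod (\<ll> k x) * (1 / (2 * M)) \<le> cmod (\<ll> k x) * cmod (z - k)"
        using ge by (intro mult_left_mono) auto
      also have "\<dots> = cmod (s x z k)" by (simp add: eq[OF k(1), symmetric] norm_mult mult.commute)
      also have "\<dots> \<le> d * X1" by (rule s_le[OF xz k(1)])
      finally show ?thesis using M by (simp add: field_simps)
    qed
    moreover have "X1 * d \<le> K * d" "2 * M * X1 * d \<le> K * d"
      using d_ge X M by (auto simp: K_def intro!: mult_right_mono)
    ultimately show ?thesis
      using zi eq lx[OF i] S_r1[OF xz]
      by (intro exI[of _ "\<lambda>k. \<ll> k x"] exI[of _ z]) (auto simp: s_def g_def intro: order_trans)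
  qed
  then show ?thesis using d0 K by blast
qed

text \<open>On the range of \<open>coproj\<close> the functional \<open>p\<close> satisfies the
  eigenvalue equation by the resolvent equation alone, whatever the coefficients. On the vectors
  \<open>v k\<close> the equation is exactly the system solved by \<open>\<gamma>\<close>.\<close>

lemma perturbed_eigenfunctionals:
  "\<exists>d0>0. \<exists>K>0. \<forall>L d. near L d \<longrightarrow> d \<le> d0 \<longrightarrow> (\<exists>p z. \<forall>i\<in>\<Lambda>. cmod (z i - i) \<le> K * d \<and>
     bounded_clinear (p i) \<and> (\<forall>u. p i (L u) = z i * p i u) \<and> (\<forall>u. cmod (p i u - \<ll> i u) \<le> K * d * norm u))"
proof -
  obtain d0 K where d0: "d0 > 0" and K: "K > 0"
    and coef: "\<And>L d i. near L d \<Longrightarrow> d \<le> d0 \<Longrightarrow> i \<in> \<Lambda> \<Longrightarrow> \<exists>\<gamma> z. \<gamma> i = 1 \<and> cmod (z - i) \<le> K * d \<and>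
       r1 \<le> cmod z \<and> (\<forall>k\<in>\<Lambda>. k \<noteq> i \<longrightarrow> cmod (\<gamma> k) \<le> K * d) \<and>
       (\<forall>k\<in>\<Lambda>. (z - k) * \<gamma> k = (\<Sum>a\<in>\<Lambda>. \<gamma> a * coupling L a k z))"
    using perturbed_coefficients by blast
  \<comment> \<open>The summands account for the displacement of \<open>z\<close>, for the
    coefficients \<open>\<gamma> a\<close> with \<open>a \<noteq> i\<close>, and for the terms with
    \<open>reduced L\<close> in \<open>pu\<close>.\<close>
  define K' where "K' = K + M * (K * M) + M * ((1 + K * d0) * (Mp * Mw))"
  have K': "K' > 0" "K \<le> K'" using K d0 M Mp Mw by (auto simp: K'_def intro!: add_pos_nonneg add_nonneg_nonneg mult_nonneg_nonneg)
  have "\<exists>p z. cmod (z - i) \<le> K' * d \<and> bounded_clinear p \<and> (\<forall>u. p (L u) = z * p u) \<and>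
       (\<forall>u. cmod (p u - \<ll> i u) \<le> K' * d * norm u)"
    if near: "near L d" and d: "d \<le> d0" and i: "i \<in> \<Lambda>" for L d i
  proof -
    note d_ge = near_d[OF near] and L' = bounded_clinearD[OF near_L[OF near]]
    obtain \<gamma> z where \<gamma>i: "\<gamma> i = 1" and zi: "cmod (z - i) \<le> K * d" and zr: "r1 \<le> cmod z"
      and \<gamma>k: "\<And>k. k \<in> \<Lambda> \<Longrightarrow> k \<noteq> i \<Longrightarrow> cmod (\<gamma> k) \<le> K * d"
      and eq: "\<And>k. k \<in> \<Lambda> \<Longrightarrow> (z - k) * \<gamma> k = (\<Sum>a\<in>\<Lambda>. \<gamma> a * coupling L a k z)"
      using coef[OF near d i] by blast
    note W = bounded_clinearD[OF res[OF near zr]]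
    define p where "p u = (\<Sum>a\<in>\<Lambda>. \<gamma> a *\<^sub>C (z *\<^sub>C \<ll> a (res L z u)))" for u
    have p: "bounded_clinear p"
      unfolding p_def[abs_def]
      by (intro bounded_clinear_sum bounded_clinear_const_scaleC bounded_clinear_compose[OF l res[OF near zr]])
    note p' = bounded_clinearD[OF p]
    have zl: "z * \<ll> a (res L z u) = \<ll> a u + \<ll> a (reduced L (res L z u))" if "a \<in> \<Lambda>" for a u
      using res_reduced(2)[OF near zr, of u] that by (simp add: bounded_clinearD[OF l])
    have pu: "p u = (\<Sum>a\<in>\<Lambda>. \<gamma> a * (\<ll> a u + \<ll> a (reduced L (res L z u))))" for u
      by (simp add: p_def zl)
    have p_co: "p (L (coproj u)) = z * p (coproj u)" for u
    proof -
      have "p (L (coproj u)) = (\<Sum>a\<in>\<Lambda>. \<gamma> a * (z * \<ll> a (z *\<^sub>C res L z (coproj u) - coproj u)))"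
        using res_reduced(1)[OF near zr, of "coproj u"] by (simp add: p_def reduced_def coproj_idem)
      also have "\<dots> = z * p (coproj u)"
        unfolding p_def sum_distrib_left
        by (intro sum.cong) (auto simp: bounded_clinearD[OF l] l_coproj)
      finally show ?thesis .
    qed
    have p_v: "p (v k) = \<gamma> k" if k: "k \<in> \<Lambda>" for k
    proof -
      have "z *\<^sub>C \<ll> a (res L z (v k)) = (if a = k then 1 else 0)" if a: "a \<in> \<Lambda>" for a
        using arg_cong[OF res_v[OF near zr k], of "\<ll> a"] lv[OF a k] by (simp add: bounded_clinearD[OF l[OF a]])
      then have "p (v k) = (\<Sum>a\<in>\<Lambda>. \<gamma> a * (if a = k then 1 else 0))"
        unfolding p_def by (intro sum.cong) auto
      then show ?thesis using fin k by (simp add: if_distrib[of "\<lambda>c. _ * c"] sum.delta' cong: if_cong)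
    qed
    have p_Lv: "p (L (v k)) = z * \<gamma> k" if k: "k \<in> \<Lambda>" for k
    proof -
      have "\<ll> a (L (v k)) + \<ll> a (reduced L (res L z (L (v k)))) = (if a = k then k else 0) + coupling L a k z"
        if a: "a \<in> \<Lambda>" for a
        using a k by (simp add: coupling_def l_reduced[OF near a] bounded_clinearD[OF l[OF a]] L'
            bounded_clinearD[OF L0] L0v lv Let_def)
      then have "p (L (v k)) = (\<Sum>a\<in>\<Lambda>. (if a = k then \<gamma> a * k else 0) + \<gamma> a * coupling L a k z)"
        unfolding pu by (intro sum.cong) (auto simp: distrib_left)
      also have "\<dots> = \<gamma> k * k + (z - k) * \<gamma> k"
        unfolding sum.distrib eq[OF k] using fin k by (simp add: sum.delta)
      finally show ?thesis by (simp add: algebra_simps)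
    qed
    have pL: "p (L u) = z * p u" for u
    proof -
      have u: "u = proj u + coproj u" by (simp add: coproj_def)
      have "p (L (proj u)) = z * p (proj u)"
        unfolding proj_def by (simp add: L' p' p_Lv p_v sum_distrib_left mult_ac)
      then show ?thesis by (subst (1 2) u) (simp only: L' p' p_co distrib_left)
    qed
    have "cmod (p u - \<ll> i u) \<le> K' * d * norm u" for u
    proof -
      have \<gamma>_le: "cmod (\<gamma> a) \<le> 1 + K * d0" if "a \<in> \<Lambda>" for a
      proof (cases "a = i")
        case False
        have "K * d \<le> K * d0" using K d by simp
        then show ?thesis using \<gamma>k[OF that False] by simp
      qed (use \<gamma>i K d0 in simp)
      have "p u - \<ll> i u = (\<Sum>a\<in>\<Lambda>. (if a = i then 0 else \<gamma> a) * \<ll> a u) + (\<Sum>a\<in>\<Lambda>. \<gamma> a * \<ll> a (reduced L (res L z u)))"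
      proof -
        have "(\<Sum>a\<in>\<Lambda>. \<gamma> a * \<ll> a u) - \<ll> i u = (\<Sum>a\<in>\<Lambda>. \<gamma> a * \<ll> a u) - (\<Sum>a\<in>\<Lambda>. if a = i then \<ll> i u else 0)"
          using fin i by (simp add: sum.delta)
        also have "\<dots> = (\<Sum>a\<in>\<Lambda>. (if a = i then 0 else \<gamma> a) * \<ll> a u)"
          unfolding sum_subtractf[symmetric] using \<gamma>i by (intro sum.cong) auto
        finally show ?thesis unfolding pu by (simp add: distrib_left sum.distrib)
      qed
      also have "cmod \<dots> \<le> M * (K * d * (M * norm u)) + M * ((1 + K * d0) * (d * (Mp * (Mw * norm u))))"
      proof (intro order_trans[OF norm_triangle_ineq] add_mono sum_bound)
        fix a assume a: "a \<in> \<Lambda>"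
        show "cmod ((if a = i then 0 else \<gamma> a) * \<ll> a u) \<le> K * d * (M * norm u)"
          unfolding norm_mult using \<gamma>k[OF a] lM[OF a, of u] K d_ge by (intro mult_mono) auto
        have "cmod (\<ll> a (reduced L (res L z u))) \<le> d * norm (coproj (res L z u))"
          unfolding l_reduced[OF near a] by (rule near_l[OF near a])
        also have "\<dots> \<le> d * (Mp * (Mw * norm u))"
          using Mp d_ge by (intro mult_left_mono order_trans[OF coproj_le] res_le[OF near zr]) auto
        finally show "cmod (\<gamma> a * \<ll> a (reduced L (res L z u))) \<le> (1 + K * d0) * (d * (Mp * (Mw * norm u)))"
          unfolding norm_mult using \<gamma>_le[OF a] K d0 by (intro mult_mono) auto
      qed (use M K d_ge d0 Mp Mw in auto)
      also have "\<dots> \<le> K' * d * norm u"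
        using K d_ge by (simp add: K'_def algebra_simps)
      finally show ?thesis .
    qed
    moreover have "cmod (z - i) \<le> K' * d" using zi mult_right_mono[OF K'(2) d_ge] by linarith
    ultimately show ?thesis using p pL by blast
  qed
  then have "\<forall>L d. near L d \<longrightarrow> d \<le> d0 \<longrightarrow> (\<exists>p z. \<forall>i\<in>\<Lambda>. cmod (z i - i) \<le> K' * d \<and>
     bounded_clinear (p i) \<and> (\<forall>u. p i (L u) = z i * p i u) \<and> (\<forall>u. cmod (p i u - \<ll> i u) \<le> K' * d * norm u))"
    by metis
  then show ?thesis using d0 K' by blast
qed

end

section \<open>Orbits of perturbed operators\<close>

context spectral_perturbation
begin

text \<open>Variation of constants for \<open>L = reduced L + L \<circ> proj\<close>: the peripheral
  part is a source, propagated by the contracting part.\<close>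

lemma orbit_expansion:
  assumes near: "near L d"
  shows "(L ^^ n) u = (reduced L ^^ n) u + (\<Sum>i<n. (reduced L ^^ (n - 1 - i)) (L (proj ((L ^^ i) u))))"
proof (induction n)
  case (Suc n)
  note A' = bounded_clinearD[OF reduced[OF near]] and L' = bounded_clinearD[OF near_L[OF near]]
  have "(L ^^ Suc n) u = L (coproj ((L ^^ n) u) + proj ((L ^^ n) u))" by (simp add: coproj_def)
  also have "\<dots> = reduced L ((L ^^ n) u) + L (proj ((L ^^ n) u))" by (simp only: L' reduced_def)
  also have "reduced L ((L ^^ n) u) = (reduced L ^^ Suc n) u +
      (\<Sum>i<n. (reduced L ^^ (Suc (n - 1 - i))) (L (proj ((L ^^ i) u))))"
    by (subst Suc) (simp add: A')
  also have "(\<Sum>i<n. (reduced L ^^ (Suc (n - 1 - i))) (L (proj ((L ^^ i) u))))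
      = (\<Sum>i<n. (reduced L ^^ (Suc n - 1 - i)) (L (proj ((L ^^ i) u))))"
    by (intro sum.cong arg_cong2[where f = "\<lambda>k. (reduced L ^^ k)"] refl)
       (auto simp: Suc_diff_Suc intro!: arg_cong[where f = "\<lambda>k. (reduced L ^^ k) _"])
  finally show ?case by (simp add: add.assoc)
qed simp

lemma geometric_convolution_le:
  assumes "r1 \<le> \<sigma>"
  shows "(\<Sum>i<n. \<rho> ^ (n - 1 - i) * \<sigma> ^ i) \<le> 2 / (1 - \<rho>) * \<sigma> ^ n"
proof -
  have \<sigma>: "(1 - \<rho>) / 2 \<le> \<sigma> - \<rho>" using assms r1 by linarith
  then have pos: "\<sigma> - \<rho> > 0" "\<sigma> > 0" using \<rho> by auto
  have "(\<sigma> - \<rho>) * (\<Sum>i<n. \<rho> ^ (n - 1 - i) * \<sigma> ^ i) = \<sigma> ^ n - \<rho> ^ n"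
    by (simp add: diff_power_eq_sum power_diff_sumr2 mult.commute)
  also have "\<dots> \<le> \<sigma> ^ n" using \<rho> by simp
  finally have "(\<Sum>i<n. \<rho> ^ (n - 1 - i) * \<sigma> ^ i) \<le> \<sigma> ^ n / (\<sigma> - \<rho>)"
    using pos by (simp add: field_simps)
  also have "\<dots> \<le> \<sigma> ^ n / ((1 - \<rho>) / 2)"
    using \<sigma> pos \<rho> by (intro divide_left_mono mult_pos_pos) auto
  finally show ?thesis by (simp add: mult.commute)
qed

text \<open>Control of the perturbed eigenfunctionals along an orbit controls its norm. In the
  source terms of the expansion \<open>\<ll> k\<close> is replaced by \<open>p k\<close>, with an
  error \<open>\<kappa>\<close> times a norm already bounded by strong induction; smallness of
  \<open>\<kappa>\<close> absorbs this error into half of the bound.\<close>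

lemma orbit_bound:
  assumes near: "near L d"
    and p: "\<And>k u. k \<in> \<Lambda> \<Longrightarrow> cmod (p k u - \<ll> k u) \<le> \<kappa> * norm u"
    and \<kappa>: "0 \<le> \<kappa>" "4 * M ^ 4 * \<kappa> \<le> 1 - \<rho>" and \<sigma>: "r1 \<le> \<sigma>" and b: "0 \<le> b"
    and bd: "\<And>k n. k \<in> \<Lambda> \<Longrightarrow> cmod (p k ((L ^^ n) u)) \<le> b * \<sigma> ^ n"
  shows "norm ((L ^^ n) u) \<le> (2 * M * norm u + 4 * M ^ 4 / (1 - \<rho>) * b) * \<sigma> ^ n"
proof (induction n rule: less_induct)
  case (less n)
  define X where "X = 2 * M * norm u + 4 * M ^ 4 / (1 - \<rho>) * b"
  have X: "X \<ge> 0" using M b \<rho> by (simp add: X_def)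
  have \<sigma>0: "\<sigma> > 0" "\<rho> \<le> \<sigma>" using \<sigma> r1 by auto
  have term_le: "norm ((reduced L ^^ (n - 1 - i)) (L (proj ((L ^^ i) u)))) \<le> M ^ 4 * (b + \<kappa> * X) * (\<rho> ^ (n - 1 - i) * \<sigma> ^ i)"
    if i: "i < n" for i
  proof -
    have wi: "norm ((L ^^ i) u) \<le> X * \<sigma> ^ i" using less[OF i] by (simp add: X_def)
    have "cmod (\<ll> k ((L ^^ i) u)) \<le> (b + \<kappa> * X) * \<sigma> ^ i" if k: "k \<in> \<Lambda>" for k
    proof -
      have "cmod (\<ll> k ((L ^^ i) u)) \<le> cmod (p k ((L ^^ i) u)) + cmod (p k ((L ^^ i) u) - \<ll> k ((L ^^ i) u))"
        by (metis norm_minus_commute norm_triangle_sub)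
      also have "\<dots> \<le> b * \<sigma> ^ i + \<kappa> * (X * \<sigma> ^ i)"
        using \<kappa> wi by (intro add_mono bd k order_trans[OF p[OF k]] mult_left_mono) auto
      finally show ?thesis by (simp add: algebra_simps)
    qed
    then have "norm (proj ((L ^^ i) u)) \<le> M ^ 2 * ((b + \<kappa> * X) * \<sigma> ^ i)"
      unfolding proj_def using b \<kappa> X \<sigma>0 by (intro combination_bound) auto
    then have "norm (L (proj ((L ^^ i) u))) \<le> M * (M ^ 2 * ((b + \<kappa> * X) * \<sigma> ^ i))"
      using M by (intro order_trans[OF near_le[OF near]] mult_left_mono) auto
    then have "norm ((reduced L ^^ (n - 1 - i)) (L (proj ((L ^^ i) u)))) \<le>
        M * \<rho> ^ (n - 1 - i) * (M * (M ^ 2 * ((b + \<kappa> * X) * \<sigma> ^ i)))"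
      using M \<rho> by (intro order_trans[OF near_pow[OF near]] mult_left_mono) auto
    also have "\<dots> = M ^ 4 * (b + \<kappa> * X) * (\<rho> ^ (n - 1 - i) * \<sigma> ^ i)"
      by (simp add: power2_eq_square power4_eq_xxxx mult_ac)
    finally show ?thesis .
  qed
  have "norm ((L ^^ n) u) \<le> norm ((reduced L ^^ n) u) + (\<Sum>i<n. norm ((reduced L ^^ (n - 1 - i)) (L (proj ((L ^^ i) u)))))"
    unfolding orbit_expansion[OF near, of n u]
    by (rule order_trans[OF norm_triangle_ineq]) (intro add_left_mono norm_sum)
  also have "\<dots> \<le> M * \<rho> ^ n * norm u + (\<Sum>i<n. M ^ 4 * (b + \<kappa> * X) * (\<rho> ^ (n - 1 - i) * \<sigma> ^ i))"
    by (intro add_mono near_pow[OF near] sum_mono term_le) auto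
  also have "\<dots> \<le> M * \<sigma> ^ n * norm u + M ^ 4 * (b + \<kappa> * X) * (2 / (1 - \<rho>) * \<sigma> ^ n)"
    unfolding sum_distrib_left[symmetric] using M \<rho> \<sigma>0 b \<kappa> X
    by (intro add_mono mult_right_mono mult_left_mono power_mono geometric_convolution_le \<sigma>) auto
  also have "\<dots> = (M * norm u + 2 * M ^ 4 / (1 - \<rho>) * b + 2 * M ^ 4 * \<kappa> / (1 - \<rho>) * X) * \<sigma> ^ n"
    by (simp add: algebra_simps)
  also have "2 * M ^ 4 * \<kappa> / (1 - \<rho>) \<le> 1 / 2" using \<kappa> \<rho> by (simp add: field_simps)
  then have "(M * norm u + 2 * M ^ 4 / (1 - \<rho>) * b + 2 * M ^ 4 * \<kappa> / (1 - \<rho>) * X) * \<sigma> ^ n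
     \<le> (M * norm u + 2 * M ^ 4 / (1 - \<rho>) * b + 1 / 2 * X) * \<sigma> ^ n"
    using X \<sigma>0 by (intro mult_right_mono add_left_mono) auto
  also have "M * norm u + 2 * M ^ 4 / (1 - \<rho>) * b + 1 / 2 * X = X"
  proof -
    define y where "y = 2 * M ^ 4 / (1 - \<rho>) * b"
    have e: "4 * M ^ 4 / (1 - \<rho>) * b = 2 * y" by (simp add: y_def)
    show ?thesis unfolding X_def e y_def[symmetric] by simp
  qed
  finally show ?case by (simp add: X_def)
qed

text \<open>On the range of \<open>proj\<close>, \<open>\<Psi>\<close> corrects the defect of
  \<open>e\<close> as if \<open>p k\<close> were \<open>\<ll> k\<close>. Differences of its values
  only see \<open>p k - \<ll> k\<close>, so it contracts, and its fixed point has no defect.\<close>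

lemma dual_vectors:
  assumes p: "\<And>k. k \<in> \<Lambda> \<Longrightarrow> bounded_clinear (p k)"
    and pl: "\<And>k u. k \<in> \<Lambda> \<Longrightarrow> cmod (p k u - \<ll> k u) \<le> \<kappa> * norm u"
    and \<kappa>: "0 \<le> \<kappa>" "2 * M ^ 2 * \<kappa> \<le> 1" and j: "j \<in> \<Lambda>"
  shows "\<exists>e. norm e \<le> 2 * M \<and> (\<forall>k\<in>\<Lambda>. p k e = (if k = j then 1 else 0))"
proof -
  define \<Psi> where "\<Psi> e = e - (\<Sum>k\<in>\<Lambda>. (p k e - (if k = j then 1 else 0)) *\<^sub>C v k)" for e
  define S where "S = {e. coproj e = 0}"
  have Sproj: "e = (\<Sum>k\<in>\<Lambda>. \<ll> k e *\<^sub>C v k)" if "e \<in> S" for e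
    using that by (simp add: S_def coproj_def proj_def)
  have diff: "norm (\<Sum>k\<in>\<Lambda>. (\<ll> k e - p k e) *\<^sub>C v k) \<le> 1 / 2 * norm e" for e
  proof -
    have "norm (\<Sum>k\<in>\<Lambda>. (\<ll> k e - p k e) *\<^sub>C v k) \<le> M ^ 2 * (\<kappa> * norm e)"
      using pl \<kappa> by (intro combination_bound) (auto simp: norm_minus_commute)
    also have "\<dots> \<le> 1 / 2 * norm e"
      using \<kappa>(2) mult_right_mono[of "M ^ 2 * \<kappa>" "1/2" "norm e"] by (simp add: mult_ac)
    finally show ?thesis .
  qed
  have "closed S" unfolding S_def
    by (intro closed_Collect_eq continuous_intros
        bounded_linear.continuous_on[OF bounded_clinearD(7)[OF coproj]])
  note complete = this[folded complete_eq_closed]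
  have "\<exists>!e\<in>S. \<Psi> e = e"
  proof (rule Banach_fix[OF complete, where c = "1 / 2"])
    show "S \<noteq> {}" using coproj_v[OF j] by (auto simp: S_def)
      show "(0::real) \<le> 1 / 2" "1 / 2 < (1::real)" by auto
    show "\<Psi> ` S \<subseteq> S"
      by (auto simp: S_def \<Psi>_def bounded_clinearD[OF coproj] coproj_v)
    fix x y assume xy: "x \<in> S" "y \<in> S"
    have "x - y = (\<Sum>k\<in>\<Lambda>. \<ll> k (x - y) *\<^sub>C v k)"
      using xy by (intro Sproj) (simp add: S_def bounded_clinearD[OF coproj])
    then have "\<Psi> x - \<Psi> y = (\<Sum>k\<in>\<Lambda>. \<ll> k (x - y) *\<^sub>C v k) - (\<Sum>k\<in>\<Lambda>. (p k x - p k y) *\<^sub>C v k)"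
      by (simp add: \<Psi>_def scaleC.diff_left sum_subtractf)
    also have "\<dots> = (\<Sum>k\<in>\<Lambda>. (\<ll> k (x - y) - p k (x - y)) *\<^sub>C v k)"
      unfolding sum_subtractf[symmetric]
      by (intro sum.cong) (auto simp: scaleC.diff_left bounded_clinearD[OF p])
    finally show "dist (\<Psi> x) (\<Psi> y) \<le> 1 / 2 * dist x y"
      using diff[of "x - y"] by (simp add: dist_norm)
  qed
  then obtain e where eS: "e \<in> S" and fixp: "\<Psi> e = e" by auto
  then have zero: "(\<Sum>k\<in>\<Lambda>. (p k e - (if k = j then 1 else 0)) *\<^sub>C v k) = 0" by (simp add: \<Psi>_def)
  have pe: "p k e = (if k = j then 1 else 0)" if k: "k \<in> \<Lambda>" for k
  proof -
    have "\<ll> k (\<Sum>i\<in>\<Lambda>. (p i e - (if i = j then 1 else 0)) *\<^sub>C v i) = 0"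
      unfolding zero by (simp add: bounded_clinearD[OF l[OF k]])
    also have "\<ll> k (\<Sum>i\<in>\<Lambda>. (p i e - (if i = j then 1 else 0)) *\<^sub>C v i)
        = (\<Sum>i\<in>\<Lambda>. (p i e - (if i = j then 1 else 0)) * (if i = k then 1 else 0))"
      using lv[OF k] by (simp add: bounded_clinearD[OF l[OF k]])
    finally show ?thesis using k fin
      by (simp add: if_distrib[of "\<lambda>c. _ * c"] sum.delta cong: if_cong split: if_splits)
  qed
  have "(\<Sum>k\<in>\<Lambda>. (\<ll> k e - p k e) *\<^sub>C v k) = e - (\<Sum>k\<in>\<Lambda>. if k = j then v j else 0)"
    unfolding scaleC.diff_left sum_subtractf using Sproj[OF eS] pe
    by (auto intro!: arg_cong2[where f = minus] sum.cong)
  also have "\<dots> = e - v j" using fin j by (simp add: sum.delta)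
  finally have "norm (e - v j) \<le> 1 / 2 * norm e" using diff[of e] by simp
  then have "norm e \<le> 2 * M" using vM[OF j] norm_triangle_sub[of e "v j"] by simp
  then show ?thesis using pe by blast
qed

text \<open>Power iteration from a dual vector \<open>e\<close>. The defect
  \<open>L e - z j *\<^sub>C e\<close> is annihilated by every \<open>p k\<close>, so the orbit
  bound with \<open>b = 0\<close> makes it decay like \<open>r1 ^ n\<close>. As
  \<open>cmod (z j) \<ge> 1\<close>, the vectors
  \<open>inverse (z j) ^ n *\<^sub>C (L ^^ n) e\<close> converge.\<close>

lemma perturbed_eigenvector:
  assumes near: "near L d"
    and p: "\<And>k. k \<in> \<Lambda> \<Longrightarrow> bounded_clinear (p k)"
    and pl: "\<And>k u. k \<in> \<Lambda> \<Longrightarrow> cmod (p k u - \<ll> k u) \<le> \<kappa> * norm u"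
    and pL: "\<And>k u. k \<in> \<Lambda> \<Longrightarrow> p k (L u) = z k * p k u"
    and \<kappa>: "0 \<le> \<kappa>" "4 * M ^ 4 * \<kappa> \<le> 1 - \<rho>" and j: "j \<in> \<Lambda>" and zj: "1 \<le> cmod (z j)" "cmod (z j) \<le> M + 1"
  shows "\<exists>c. norm c \<le> 2 * M + 2 * M * (2 * M\<^sup>2 + 2 * M * (M + 1)) / (1 - r1) \<and> L c = z j *\<^sub>C c \<and>
    (\<forall>k\<in>\<Lambda>. p k c = (if k = j then 1 else 0))"
proof -
  note L' = bounded_clinearD[OF near_L[OF near]]
    and Ln = bounded_clinearD[OF bounded_clinear_funpow[OF near_L[OF near]]]
  have "M ^ 2 \<le> M ^ 4" using M by (intro power_increasing) auto
  then have "2 * M ^ 2 \<le> 4 * M ^ 4" using zero_le_power2[of M] by linarith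
  then have "2 * M ^ 2 * \<kappa> \<le> 4 * M ^ 4 * \<kappa>" using \<kappa>(1) by (rule mult_right_mono)
  then have "2 * M ^ 2 * \<kappa> \<le> 1" using \<kappa> \<rho> by linarith
  then obtain e where e: "norm e \<le> 2 * M" "\<And>k. k \<in> \<Lambda> \<Longrightarrow> p k e = (if k = j then 1 else 0)"
    using dual_vectors[OF p pl \<kappa>(1) _ j] by blast
  have z0: "z j \<noteq> 0" using zj by auto
  define w where "w = L e - z j *\<^sub>C e"
  have pw: "p k ((L ^^ n) w) = 0" if "k \<in> \<Lambda>" for k n
  proof (induction n)
    case 0
    then show ?case using that e(2)[OF that] by (simp add: w_def bounded_clinearD[OF p] pL)
  qed (simp add: pL that)
  have "norm ((L ^^ n) w) \<le> (2 * M * norm w + 4 * M ^ 4 / (1 - \<rho>) * 0) * r1 ^ n" for n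
    by (rule orbit_bound[OF near pl \<kappa>]) (auto simp: pw)
  then have wn: "norm ((L ^^ n) w) \<le> 2 * M * norm w * r1 ^ n" for n by simp
  have w: "norm w \<le> 2 * M\<^sup>2 + 2 * M * (M + 1)"
  proof -
    have "norm w \<le> norm (L e) + cmod (z j) * norm e"
      unfolding w_def by (rule order_trans[OF norm_triangle_ineq4]) (simp add: norm_scaleC)
    also have "\<dots> \<le> M * (2 * M) + (M + 1) * (2 * M)"
      using e zj M by (intro add_mono mult_mono order_trans[OF near_le[OF near]] mult_left_mono) auto
    finally show ?thesis by (simp add: power2_eq_square algebra_simps)
  qed
  define b where "b n = inverse (z j) ^ n *\<^sub>C (L ^^ n) e" for n
  have step: "b (Suc n) - b n = inverse (z j) ^ Suc n *\<^sub>C (L ^^ n) w" for n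
  proof -
    have "inverse (z j) ^ Suc n * z j = inverse (z j) ^ n" using z0 by simp
    then show ?thesis
      by (simp add: b_def w_def Ln scaleC.diff_right scaleC_scaleC funpow_swap1 del: power_Suc)
  qed
  have "norm (b (Suc n) - b n) \<le> (2 * M * (2 * M\<^sup>2 + 2 * M * (M + 1))) * r1 ^ n" for n
  proof -
    have "norm (b (Suc n) - b n) \<le> 1 * norm ((L ^^ n) w)"
      unfolding step norm_scaleC norm_power norm_inverse
      using zj by (intro mult_right_mono power_le_one) (auto simp: inverse_le_1_iff)
    also have "\<dots> \<le> 2 * M * norm w * r1 ^ n" using wn by simp
    also have "\<dots> \<le> (2 * M * (2 * M\<^sup>2 + 2 * M * (M + 1))) * r1 ^ n"
      using w M r1 by (intro mult_right_mono mult_left_mono) auto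
    finally show ?thesis .
  qed
  from geometric_increments_limit[OF this] r1 obtain c
    where c: "\<And>n. norm (b n - c) \<le> (2 * M * (2 * M\<^sup>2 + 2 * M * (M + 1))) * r1 ^ n / (1 - r1)" by auto
  have lim: "b \<longlonglongrightarrow> c"
  proof -
    have "(\<lambda>n. (2 * M * (2 * M\<^sup>2 + 2 * M * (M + 1))) * r1 ^ n / (1 - r1)) \<longlonglongrightarrow> (2 * M * (2 * M\<^sup>2 + 2 * M * (M + 1))) * 0 / (1 - r1)"
      using r1 by (intro tendsto_intros LIMSEQ_realpow_zero) auto
    then have "(\<lambda>n. (2 * M * (2 * M\<^sup>2 + 2 * M * (M + 1))) * r1 ^ n / (1 - r1)) \<longlonglongrightarrow> 0" by simp
    then have "(\<lambda>n. b n - c) \<longlonglongrightarrow> 0"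
      by (rule Lim_null_comparison[OF always_eventually[OF allI[OF c]]])
    then show ?thesis by (simp add: LIM_zero_iff)
  qed
  have "norm c \<le> norm (b 0) + norm (b 0 - c)" by (metis norm_minus_commute norm_triangle_sub)
  also have "\<dots> \<le> 2 * M + 2 * M * (2 * M\<^sup>2 + 2 * M * (M + 1)) / (1 - r1)"
    using c[of 0] e(1) by (intro add_mono) (auto simp: b_def)
  finally have nc: "norm c \<le> 2 * M + 2 * M * (2 * M\<^sup>2 + 2 * M * (M + 1)) / (1 - r1)" .
  have Lb: "L (b n) = z j *\<^sub>C b (Suc n)" for n
  proof -
    have "z j * inverse (z j) ^ Suc n = inverse (z j) ^ n" using z0 by simp
    then show ?thesis by (simp add: b_def L' scaleC_scaleC del: power_Suc)
  qed
  have "(\<lambda>n. L (b n)) \<longlonglongrightarrow> L c"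
    by (rule bounded_linear.tendsto[OF L'(7) lim])
  moreover have "(\<lambda>n. L (b n)) \<longlonglongrightarrow> z j *\<^sub>C c"
    unfolding Lb by (intro scaleC.tendsto tendsto_const LIMSEQ_Suc lim)
  ultimately have Lc: "L c = z j *\<^sub>C c" by (rule LIMSEQ_unique)
  have "p k c = (if k = j then 1 else 0)" if k: "k \<in> \<Lambda>" for k
  proof -
    have pn: "p k ((L ^^ n) e) = z k ^ n * p k e" for n
      by (induction n) (auto simp: pL k)
    have "p k (b n) = (if k = j then 1 else 0)" for n
      using z0 e(2)[OF k] by (simp add: b_def bounded_clinearD[OF p[OF k]] pn power_mult_distrib[symmetric])
    moreover have "(\<lambda>n. p k (b n)) \<longlonglongrightarrow> p k c"
      by (rule bounded_linear.tendsto[OF bounded_clinearD(7)[OF p[OF k]] lim])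
    ultimately show ?thesis by (simp add: LIMSEQ_const_iff)
  qed
  then show ?thesis using nc Lc by blast
qed

text \<open>
  \<open>Q u\<close> drops the components of \<open>u\<close> along the eigenvectors of \<open>L\<close> whose eigenvalue has modulus
  \<open>> 1\<close>; a functional that is bounded along the orbit of \<open>u\<close> cannot see them.
\<close>

theorem bounded_orbit_representation:
  "\<exists>d0>0. \<exists>K>0. \<forall>L d. near L d \<longrightarrow> d \<le> d0 \<longrightarrow>
    (\<exists>Q. (\<forall>u n. norm ((L ^^ n) (Q u)) \<le> K * norm u) \<and>
      (\<forall>\<psi> u b. bounded_clinear \<psi> \<longrightarrow> (\<forall>n. cmod (\<psi> ((L ^^ n) u)) \<le> b) \<longrightarrow>
        (\<forall>n. \<psi> ((L ^^ n) u) = \<psi> ((L ^^ n) (Q u)))) \<and>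
      (\<forall>i\<in>\<Lambda>. \<exists>\<zeta>. \<forall>u b. (\<forall>n. norm ((L ^^ n) u) \<le> b) \<longrightarrow>
        (\<forall>n. cmod (\<ll> i ((L ^^ n) u) - \<zeta> ^ n * \<ll> i u) \<le> K * d * b)))"
proof -
  obtain d1 K where d1: "d1 > 0" and K: "K > 0"
    and ex: "\<And>L d. near L d \<Longrightarrow> d \<le> d1 \<Longrightarrow> (\<exists>p z. \<forall>i\<in>\<Lambda>. cmod (z i - i) \<le> K * d \<and>
     bounded_clinear (p i) \<and> (\<forall>u. p i (L u) = z i * p i u) \<and> (\<forall>u. cmod (p i u - \<ll> i u) \<le> K * d * norm u))"
    using perturbed_eigenfunctionals by blast
  \<comment> \<open>The first bound is what \<open>orbit_bound\<close> requires. The second keeps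
    the perturbed eigenvalues distinct: each moves by at most a quarter of the minimal gap
    \<open>1 / M\<close>.\<close>
  define \<kappa>0 where "\<kappa>0 = min ((1 - \<rho>) / (4 * M ^ 4)) (1 / (4 * M))"
  have \<kappa>0: "\<kappa>0 > 0" "4 * M ^ 4 * \<kappa>0 \<le> 1 - \<rho>" "\<kappa>0 \<le> 1 / (4 * M)"
    using M \<rho> by (auto simp: \<kappa>0_def min_def field_simps)
  have "1 / (4 * M) \<le> 1" using M by simp
  then have \<kappa>0_1: "\<kappa>0 \<le> 1" using \<kappa>0(3) by linarith
  define d0 where "d0 = min d1 (\<kappa>0 / K)"
  have d0: "d0 > 0" using d1 \<kappa>0 K by (simp add: d0_def)
  define Kc where "Kc = 2 * M + 2 * M * (2 * M\<^sup>2 + 2 * M * (M + 1)) / (1 - r1)"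
  have Kc: "Kc \<ge> 0" using M r1 by (simp add: Kc_def)
  define KQ where "KQ = 1 + M * ((M + 1) * Kc)"
  have KQ: "KQ \<ge> 1" using M Kc by (simp add: KQ_def)
  define K' where "K' = 2 * M * KQ + 4 * M ^ 4 / (1 - \<rho>) * ((M + 1) * KQ) + 2 * K"
  have K'2: "2 * M * KQ + 4 * M ^ 4 / (1 - \<rho>) * ((M + 1) * KQ) \<le> K'" "2 * K \<le> K'"
    using M KQ \<rho> K by (auto simp: K'_def)
  have K': "K' > 0" using K'2 K by simp
  have "\<exists>Q. (\<forall>u n. norm ((L ^^ n) (Q u)) \<le> K' * norm u) \<and>
      (\<forall>\<psi> u b. bounded_clinear \<psi> \<longrightarrow> (\<forall>n. cmod (\<psi> ((L ^^ n) u)) \<le> b) \<longrightarrow>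
        (\<forall>n. \<psi> ((L ^^ n) u) = \<psi> ((L ^^ n) (Q u)))) \<and>
      (\<forall>i\<in>\<Lambda>. \<exists>\<zeta>. \<forall>u b. (\<forall>n. norm ((L ^^ n) u) \<le> b) \<longrightarrow>
        (\<forall>n. cmod (\<ll> i ((L ^^ n) u) - \<zeta> ^ n * \<ll> i u) \<le> K' * d * b))"
    if near: "near L d" and d: "d \<le> d0" for L d
  proof -
    note d_ge = near_d[OF near]
    have Ln: "bounded_clinear (L ^^ n)" for n by (rule bounded_clinear_funpow[OF near_L[OF near]])
    define \<kappa> where "\<kappa> = K * d"
    have "d \<le> \<kappa>0 / K" using d by (simp add: d0_def)
    then have "\<kappa> \<le> \<kappa>0" using K by (simp add: \<kappa>_def field_simps)
    moreover have "4 * M ^ 4 * \<kappa> \<le> 4 * M ^ 4 * \<kappa>0" using \<open>\<kappa> \<le> \<kappa>0\<close> M by (intro mult_left_mono) auto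
    moreover have "0 \<le> \<kappa>" using K d_ge by (simp add: \<kappa>_def)
    ultimately have \<kappa>: "0 \<le> \<kappa>" "4 * M ^ 4 * \<kappa> \<le> 1 - \<rho>" "\<kappa> \<le> 1 / (4 * M)" "\<kappa> \<le> 1"
      using \<kappa>0 \<kappa>0_1 by linarith+
    have "d \<le> d1" using d by (simp add: d0_def)
    then obtain p z where pz: "\<forall>i\<in>\<Lambda>. cmod (z i - i) \<le> \<kappa> \<and> bounded_clinear (p i) \<and>
        (\<forall>u. p i (L u) = z i * p i u) \<and> (\<forall>u. cmod (p i u - \<ll> i u) \<le> \<kappa> * norm u)"
      using ex[OF near] unfolding \<kappa>_def by blast
    have zi: "cmod (z i - i) \<le> \<kappa>" and p: "bounded_clinear (p i)" and pL: "p i (L u) = z i * p i u"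
      and pl: "cmod (p i u - \<ll> i u) \<le> \<kappa> * norm u" if "i \<in> \<Lambda>" for i u
      using pz that by auto
    have pLn: "p i ((L ^^ n) u) = z i ^ n * p i u" if "i \<in> \<Lambda>" for i n u
      by (induction n) (auto simp: pL that)
    have pM: "cmod (p i u) \<le> (M + 1) * norm u" if "i \<in> \<Lambda>" for i u
    proof -
      have "cmod (p i u) \<le> cmod (\<ll> i u) + cmod (p i u - \<ll> i u)" by (rule norm_triangle_sub)
      also have "\<dots> \<le> M * norm u + 1 * norm u"
        using \<kappa> by (intro add_mono lM that order_trans[OF pl[OF that]] mult_right_mono) auto
      finally show ?thesis by (simp add: algebra_simps)
    qed
    have inj: "inj_on z \<Lambda>"
    proof (rule inj_onI, rule ccontr)
      fix i k assume ik: "i \<in> \<Lambda>" "k \<in> \<Lambda>" "z i = z k" "i \<noteq> k"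
      have "cmod (i - k) \<le> cmod (z k - k) + cmod (z i - i)"
        using norm_triangle_ineq4[of "z k - k" "z i - i"] ik(3) by simp
      also have "\<dots> \<le> 1 / (4 * M) + 1 / (4 * M)" using order_trans[OF zi[OF ik(1)] \<kappa>(3)] order_trans[OF zi[OF ik(2)] \<kappa>(3)] by (rule add_mono[rotated])
      also have "\<dots> < 1 / M" using M by (simp add: field_simps)
      finally show False using gap[OF ik(1,2,4)] by simp
    qed
    define \<Lambda>' where "\<Lambda>' = {i\<in>\<Lambda>. 1 < cmod (z i)}"
    have sub: "\<Lambda>' \<subseteq> \<Lambda>" and fin': "finite \<Lambda>'" using fin by (auto simp: \<Lambda>'_def)
    have "\<exists>c. norm c \<le> Kc \<and> L c = z j *\<^sub>C c \<and> (\<forall>k\<in>\<Lambda>. p k c = (if k = j then 1 else 0))" if "j \<in> \<Lambda>'" for j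
    proof -
      have j: "j \<in> \<Lambda>" "1 \<le> cmod (z j)" using that by (auto simp: \<Lambda>'_def)
      have "cmod (z j) \<le> M + 1"
        using norm_triangle_sub[of "z j" j] zi[OF j(1)] LaM[OF j(1)] \<kappa>(4) by linarith
      then show ?thesis unfolding Kc_def
        using perturbed_eigenvector[OF near p pl pL \<kappa>(1,2) j] by blast
    qed
    then obtain c where c: "\<And>j. j \<in> \<Lambda>' \<Longrightarrow> norm (c j) \<le> Kc" "\<And>j. j \<in> \<Lambda>' \<Longrightarrow> L (c j) = z j *\<^sub>C c j"
      "\<And>j k. j \<in> \<Lambda>' \<Longrightarrow> k \<in> \<Lambda> \<Longrightarrow> p k (c j) = (if k = j then 1 else 0)" by metis
    define Q where "Q u = u - (\<Sum>j\<in>\<Lambda>'. p j u *\<^sub>C c j)" for u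
    have Q_le: "norm (Q u) \<le> KQ * norm u" for u
    proof -
      have "norm (\<Sum>j\<in>\<Lambda>'. p j u *\<^sub>C c j) \<le> real (card \<Lambda>') * ((M + 1) * norm u * Kc)"
        using pM[of _ u] c(1) sub M Kc
        by (intro sum_norm_bound) (auto simp: norm_scaleC intro!: mult_mono)
      also have "\<dots> \<le> M * ((M + 1) * norm u * Kc)"
        using order_trans[OF of_nat_mono[OF card_mono[OF fin sub]] cardM] M Kc
        by (intro mult_right_mono) auto
      finally show ?thesis unfolding Q_def
        using norm_triangle_ineq4[of u "\<Sum>j\<in>\<Lambda>'. p j u *\<^sub>C c j"] by (simp add: KQ_def algebra_simps)
    qed
    have pQ: "p k (Q u) = (if k \<in> \<Lambda>' then 0 else p k u)" if k: "k \<in> \<Lambda>" for k u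
    proof -
      have "p k (Q u) = p k u - (\<Sum>j\<in>\<Lambda>'. p j u * (if j = k then 1 else 0))"
        unfolding Q_def bounded_clinearD[OF p[OF k]]
        by (intro arg_cong2[where f = minus] sum.cong) (auto simp: c(3) k)
      then show ?thesis using fin' by (simp add: if_distrib[of "\<lambda>c. _ * c"] sum.delta cong: if_cong)
    qed
    \<comment> \<open>Without the growing directions all perturbed functionals are bounded along the
      orbit, so the orbit bound applies with rate 1.\<close>
    have Qn: "norm ((L ^^ n) (Q u)) \<le> K' * norm u" for u n
    proof -
      have "norm ((L ^^ n) (Q u)) \<le> (2 * M * norm (Q u) + 4 * M ^ 4 / (1 - \<rho>) * ((M + 1) * (KQ * norm u))) * 1 ^ n"
      proof (rule orbit_bound[OF near pl \<kappa>(1,2)])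
        show "r1 \<le> 1" using r1 by simp
        show "0 \<le> (M + 1) * (KQ * norm u)" using M KQ by simp
        fix k n assume k: "k \<in> \<Lambda>"
        have "cmod (p k ((L ^^ n) (Q u))) \<le> 1 * cmod (p k (Q u))"
        proof (cases "k \<in> \<Lambda>'")
          case True
          then show ?thesis by (simp add: pLn[OF k] pQ[OF k])
        next
          case False
          then have "cmod (z k) ^ n \<le> 1" using k by (intro power_le_one) (auto simp: \<Lambda>'_def)
          then show ?thesis unfolding pLn[OF k] norm_mult norm_power by (intro mult_right_mono) auto
        qed
        also have "\<dots> \<le> (M + 1) * (KQ * norm u)"
          using order_trans[OF pM[OF k, of "Q u"] mult_left_mono[OF Q_le]] M by simp
        finally show "cmod (p k ((L ^^ n) (Q u))) \<le> (M + 1) * (KQ * norm u) * 1 ^ n" by simp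
      qed
      also have "\<dots> \<le> (2 * M * (KQ * norm u) + 4 * M ^ 4 / (1 - \<rho>) * ((M + 1) * (KQ * norm u))) * 1 ^ n"
        using Q_le[of u] M by (intro mult_right_mono add_right_mono mult_left_mono) auto
      also have "\<dots> = (2 * M * KQ + 4 * M ^ 4 / (1 - \<rho>) * ((M + 1) * KQ)) * norm u"
        by (simp add: algebra_simps)
      also have "\<dots> \<le> K' * norm u" by (intro mult_right_mono K'2) auto
      finally show ?thesis .
    qed
    have rep: "\<psi> ((L ^^ n) u) = \<psi> ((L ^^ n) (Q u))"
      if \<psi>: "bounded_clinear \<psi>" and bd: "\<And>n. cmod (\<psi> ((L ^^ n) u)) \<le> b" for \<psi> u b n
    proof -
      note \<psi>' = bounded_clinearD[OF \<psi>]
      obtain a where a: "a > 0" "\<And>x. cmod (\<psi> x) \<le> a * norm x" using \<psi>'(8) by auto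
      have eq: "\<psi> ((L ^^ n) u) - \<psi> ((L ^^ n) (Q u)) = (\<Sum>j\<in>\<Lambda>'. (p j u * \<psi> (c j)) * z j ^ n)" for n
      proof -
        have "(L ^^ n) u - (L ^^ n) (Q u) = (\<Sum>j\<in>\<Lambda>'. (p j u * z j ^ n) *\<^sub>C c j)"
          unfolding bounded_clinearD(2)[OF Ln, symmetric] unfolding Q_def
          by (simp add: bounded_clinearD[OF Ln] funpow_eigenvector[OF near_L[OF near] c(2)] scaleC_scaleC)
        then have "\<psi> ((L ^^ n) u - (L ^^ n) (Q u)) = (\<Sum>j\<in>\<Lambda>'. (p j u * z j ^ n) * \<psi> (c j))"
          by (simp add: \<psi>')
        then show ?thesis by (simp add: \<psi>' mult_ac)
      qed
      \<comment> \<open>\<open>\<psi>\<close> is bounded along both orbits, and its difference on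
        them is a combination of powers of distinct numbers of modulus \<open>> 1\<close>.\<close>
      have "p j u * \<psi> (c j) = 0" if "j \<in> \<Lambda>'" for j
      proof (rule bounded_exponential_sum_zero[OF fin' inj_on_subset[OF inj sub], of "\<lambda>j. p j u * \<psi> (c j)" "b + a * (K' * norm u)"])
        show "1 < cmod (z i)" if "i \<in> \<Lambda>'" for i using that by (simp add: \<Lambda>'_def)
        show "cmod (\<Sum>j\<in>\<Lambda>'. (p j u * \<psi> (c j)) * z j ^ n) \<le> b + a * (K' * norm u)" for n
        proof -
          have "cmod (\<psi> ((L ^^ n) (Q u))) \<le> a * (K' * norm u)"
            using order_trans[OF a(2) mult_left_mono[OF Qn]] a(1) by simp
          then show ?thesis unfolding eq[symmetric]
            by (intro order_trans[OF norm_triangle_ineq4] add_mono bd)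
        qed
      qed fact
      then have "(\<Sum>j\<in>\<Lambda>'. (p j u * \<psi> (c j)) * z j ^ n) = 0"
        by (intro sum.neutral ballI) (simp only: mult_zero_left)
      then show ?thesis using eq[of n] by simp
    qed
    \<comment> \<open>\<open>\<zeta>\<close> is the perturbed eigenvalue, replaced by 0 if its
      modulus exceeds 1: along a bounded orbit \<open>p i u\<close> then vanishes and
      \<open>\<ll> i\<close> is pure error. At \<open>n = 0\<close> the convention
      \<open>0 ^ 0 = 1\<close> makes the difference exactly 0.\<close>
    have "\<exists>\<zeta>. \<forall>u b. (\<forall>n. norm ((L ^^ n) u) \<le> b) \<longrightarrow>
        (\<forall>n. cmod (\<ll> i ((L ^^ n) u) - \<zeta> ^ n * \<ll> i u) \<le> K' * d * b)" if i: "i \<in> \<Lambda>" for i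
    proof (intro exI allI impI)
      fix u b n assume bd: "\<forall>n. norm ((L ^^ n) u) \<le> b"
      have b0: "0 \<le> b" using bd[rule_format, of 0] norm_ge_zero order_trans by blast
      have pn: "cmod (p i ((L ^^ n) u) - \<ll> i ((L ^^ n) u)) \<le> \<kappa> * b" for n
        using order_trans[OF pl[OF i] mult_left_mono[OF bd[rule_format] \<kappa>(1)]] .
      have "2 * \<kappa> * b \<le> K' * d * b"
        using mult_right_mono[OF K'2(2) d_ge] b0 by (intro mult_right_mono) (auto simp: \<kappa>_def)
      moreover have "cmod (\<ll> i ((L ^^ n) u) - (if cmod (z i) \<le> 1 then z i else 0) ^ n * \<ll> i u) \<le> 2 * \<kappa> * b"
      proof (cases "cmod (z i) \<le> 1")
        case True
        have "\<ll> i ((L ^^ n) u) - z i ^ n * \<ll> i u = z i ^ n * (p i u - \<ll> i u) - (p i ((L ^^ n) u) - \<ll> i ((L ^^ n) u))"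
          by (simp add: pLn[OF i] algebra_simps)
        also have "cmod \<dots> \<le> 1 * (\<kappa> * b) + \<kappa> * b"
        proof (rule order_trans[OF norm_triangle_ineq4 add_mono[OF _ pn]])
          show "cmod (z i ^ n * (p i u - \<ll> i u)) \<le> 1 * (\<kappa> * b)"
            unfolding norm_mult norm_power using pn[of 0] True by (intro mult_mono power_le_one) auto
        qed
        finally show ?thesis using True by simp
      next
        case False
        have pb: "cmod (p i u) * cmod (z i) ^ n \<le> (M + 1) * b" for n
          using order_trans[OF pM[OF i] mult_left_mono[OF bd[rule_format, of n]]] M
          by (simp add: pLn[OF i] norm_mult norm_power mult.commute)
        have "p i u = 0"
        proof (rule ccontr)
          assume nz: "p i u \<noteq> 0"
          obtain n where "(M + 1) * b / cmod (p i u) < cmod (z i) ^ n"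
            using real_arch_pow[of "cmod (z i)" "(M + 1) * b / cmod (p i u)"] False by auto
          then show False using pb[of n] nz by (simp add: field_simps)
        qed
        then have "cmod (\<ll> i ((L ^^ m) u)) \<le> \<kappa> * b" for m using pn[of m] by (simp add: pLn[OF i])
        then have "cmod (\<ll> i ((L ^^ n) u)) \<le> \<kappa> * b" "0 \<le> \<kappa> * b" using \<kappa> b0 by auto
        then show ?thesis using False by (cases n) auto
      qed
      ultimately show "cmod (\<ll> i ((L ^^ n) u) - (if cmod (z i) \<le> 1 then z i else 0) ^ n * \<ll> i u) \<le> K' * d * b"
        by linarith
    qed
    then show ?thesis using Qn rep by blast
  qed
  then show ?thesis using d0 K' by blast
qed

end

section \<open>Families of operators satisfying a Lasota--Yorke inequality\<close>

lemma powr_small: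
  fixes A B \<beta> :: real
  assumes "B > 0" "\<beta> > 0"
  shows "\<exists>s>0. \<forall>t. \<bar>t\<bar> \<le> s \<longrightarrow> A * \<bar>t\<bar> powr \<beta> \<le> B"
proof -
  define s where "s = (B / (\<bar>A\<bar> + 1)) powr (1 / \<beta>)"
  have s: "s > 0" using assms by (simp add: s_def)
  have "A * \<bar>t\<bar> powr \<beta> \<le> B" if "\<bar>t\<bar> \<le> s" for t
  proof -
    have "\<bar>t\<bar> powr \<beta> \<le> s powr \<beta>" using that assms by (intro powr_mono2) auto
    also have "\<dots> = B / (\<bar>A\<bar> + 1)" using assms by (simp add: s_def powr_powr)
    finally have "\<bar>A\<bar> * \<bar>t\<bar> powr \<beta> \<le> \<bar>A\<bar> * (B / (\<bar>A\<bar> + 1))" by (intro mult_left_mono) auto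
    also have "\<dots> \<le> B" using assms by (simp add: field_simps)
    finally show ?thesis
      using mult_right_mono[OF abs_ge_self[of A], of "\<bar>t\<bar> powr \<beta>"] by simp
  qed
  then show ?thesis using s by blast
qed

text \<open>With \<open>n\<close> about \<open>\<beta> / 2 * (- ln t) / ln (R + 1)\<close>, the
  growth \<open>R ^ n\<close> costs at most \<open>t powr (- \<beta> / 2)\<close>, half of the
  available power, while \<open>\<eta> ^ n\<close> becomes a positive power of
  \<open>t\<close>.\<close>

lemma power_interpolation:
  fixes \<eta> R \<beta> :: real
  assumes \<eta>: "0 < \<eta>" "\<eta> < 1" and R: "R \<ge> 1" and \<beta>: "\<beta> > 0"
  shows "\<exists>\<delta>>0. \<exists>K>0. \<forall>t>0. t \<le> 1 \<longrightarrow> (\<exists>n. \<eta> ^ n \<le> K * t powr \<delta> \<and> R ^ n * t powr \<beta> \<le> K * t powr \<delta>)"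
proof -
  \<comment> \<open>\<open>R\<close> itself could be 1, with logarithm 0.\<close>
  define S where "S = R + 1"
  have S: "S > 1" "ln S > 0" using R by (auto simp: S_def)
  have le: "ln \<eta> < 0" using \<eta> by simp
  define \<delta> where "\<delta> = min (\<beta> / 2) (\<beta> / 2 * (- ln \<eta> / ln S))"
  have "\<beta> / 2 * (- ln \<eta> / ln S) > 0" using \<beta> S le by (intro mult_pos_pos divide_pos_pos) auto
  then have \<delta>: "\<delta> > 0" using \<beta> by (simp add: \<delta>_def)
  define K where "K = 1 + 1 / \<eta>"
  have K: "K > 0" "1 \<le> K" "1 / \<eta> \<le> K" using \<eta> by (auto simp: K_def add_pos_pos)
  have "\<exists>n. \<eta> ^ n \<le> K * t powr \<delta> \<and> R ^ n * t powr \<beta> \<le> K * t powr \<delta>" if t: "0 < t" "t \<le> 1" for t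
  proof -
    define x where "x = \<beta> / 2 * (- ln t) / ln S"
    have x: "x \<ge> 0" unfolding x_def using \<beta> S t by (intro divide_nonneg_nonneg mult_nonneg_nonneg) auto
    define n where "n = nat \<lfloor>x\<rfloor>"
    have n: "real n \<le> x" "x - 1 \<le> real n" using x by (auto simp: n_def)
    have "\<eta> ^ n = exp (ln \<eta> * real n)" using \<eta> by (simp add: powr_realpow[symmetric] powr_def mult.commute)
    also have "\<dots> \<le> exp (ln \<eta> * (x - 1))" using n le by (simp add: mult_left_mono_neg)
    also have "\<dots> = exp (ln \<eta> * x) / \<eta>" using \<eta> by (simp add: right_diff_distrib exp_diff)
    also have "exp (ln \<eta> * x) = t powr (\<beta> / 2 * (- ln \<eta> / ln S))"
      using t S by (simp add: powr_def x_def field_simps)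
    also have "t powr (\<beta> / 2 * (- ln \<eta> / ln S)) \<le> t powr \<delta>"
      using t by (intro powr_mono') (auto simp: \<delta>_def)
    then have "t powr (\<beta> / 2 * (- ln \<eta> / ln S)) / \<eta> \<le> t powr \<delta> / \<eta>"
      using \<eta> by (intro divide_right_mono) auto
    also have "t powr \<delta> / \<eta> \<le> K * t powr \<delta>"
      using mult_right_mono[OF K(3), of "t powr \<delta>"] by simp
    finally have 1: "\<eta> ^ n \<le> K * t powr \<delta>" .
    have "R ^ n \<le> S ^ n" using R by (intro power_mono) (auto simp: S_def)
    also have "\<dots> = exp (ln S * real n)" using S by (simp add: powr_realpow[symmetric] powr_def mult.commute)
    also have "\<dots> \<le> exp (ln S * x)" using n S by simp
    also have "\<dots> = t powr (- \<beta> / 2)" using t S by (simp add: powr_def x_def)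
    finally have "R ^ n * t powr \<beta> \<le> t powr (- \<beta> / 2) * t powr \<beta>" by (intro mult_right_mono) auto
    also have "\<dots> = t powr (\<beta> / 2)" by (simp add: powr_add[symmetric])
    also have "\<dots> \<le> t powr \<delta>" using t by (intro powr_mono') (auto simp: \<delta>_def)
    also have "\<dots> \<le> K * t powr \<delta>" using mult_right_mono[OF K(2), of "t powr \<delta>"] by simp
    finally show ?thesis using 1 by blast
  qed
  then show ?thesis using \<delta> K by blast
qed

text \<open>
  A negative \<open>\<eta>\<close> is harmless, even if \<open>\<bar>\<eta>\<bar> \<ge> 1\<close>: the hypothesis at odd times then has no
  strong norm on its right-hand side, and even times follow in one more step.
\<close>

lemma lasota_yorke_normalized:
  fixes L :: "real \<Rightarrow> 'g::complex_banach \<Rightarrow> 'g" and \<iota> :: "'g \<Rightarrow> 'h::complex_banach"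
  assumes "\<exists>C \<eta> R :: real. C > 0 \<and> \<eta> < 1 \<and> R \<ge> 1 \<and> (\<forall>u n. \<forall>t\<in>I.
      norm ((L t ^^ n) u) \<le> C * \<eta> ^ n * norm u + C * R ^ n * norm (\<iota> u) \<and>
      norm (\<iota> ((L t ^^ n) u)) \<le> C * R ^ n * norm (\<iota> u))"
  shows "\<exists>C \<eta> R :: real. C > 0 \<and> 0 < \<eta> \<and> \<eta> < 1 \<and> R \<ge> 1 \<and> (\<forall>u n. \<forall>t\<in>I.
      norm ((L t ^^ n) u) \<le> C * \<eta> ^ n * norm u + C * R ^ n * norm (\<iota> u) \<and>
      norm (\<iota> ((L t ^^ n) u)) \<le> C * R ^ n * norm (\<iota> u))"
proof -
  obtain C \<eta> R :: real where C: "C > 0" and \<eta>: "\<eta> < 1" and R: "R \<ge> 1"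
    and ly: "\<And>u n t. t \<in> I \<Longrightarrow> norm ((L t ^^ n) u) \<le> C * \<eta> ^ n * norm u + C * R ^ n * norm (\<iota> u)"
    and wk: "\<And>u n t. t \<in> I \<Longrightarrow> norm (\<iota> ((L t ^^ n) u)) \<le> C * R ^ n * norm (\<iota> u)"
    using assms by blast
  show ?thesis
  proof (cases "\<eta> \<ge> 0")
    case True
    have "norm ((L t ^^ n) u) \<le> C * (max \<eta> (1/2)) ^ n * norm u + C * R ^ n * norm (\<iota> u)" if "t \<in> I" for t n u
      by (rule order_trans[OF ly[OF that]])
         (use True C in \<open>auto intro!: mult_right_mono mult_left_mono power_mono\<close>)
    then show ?thesis using C \<eta> R wk by (intro exI[of _ C] exI[of _ "max \<eta> (1/2)"] exI[of _ R]) auto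
  next
    case False
    define C' where "C' = 1 + C + C\<^sup>2"
    have C': "C' > 0" "1 \<le> C'" "C \<le> C'" "C\<^sup>2 \<le> C'" using C by (auto simp: C'_def add_pos_pos)
    have odd: "norm ((L t ^^ n) u) \<le> C * R ^ n * norm (\<iota> u)" if "t \<in> I" "odd n" for t n u
    proof -
      have "\<eta> ^ n \<le> 0" using False that(2) by (simp add: power_less_zero_eq less_imp_le)
      then have "C * \<eta> ^ n * norm u \<le> 0" using C by (simp add: mult_nonneg_nonpos mult_nonpos_nonneg)
      then show ?thesis using ly[OF that(1), of n u] by simp
    qed
    have main: "norm ((L t ^^ n) u) \<le> C' * (1/2) ^ n * norm u + C' * R ^ n * norm (\<iota> u)" if t: "t \<in> I" for t n u
    proof (cases "n = 0")
      case True
      then show ?thesis using mult_right_mono[OF C'(2), of "norm u"] C' R by (simp add: add_increasing2)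
    next
      case n0: False
      have "norm ((L t ^^ n) u) \<le> C' * R ^ n * norm (\<iota> u)"
      proof (cases "odd n")
        case True
        show ?thesis
          by (rule order_trans[OF odd[OF t True]]) (use C' R in \<open>auto intro!: mult_right_mono\<close>)
      next
        case False
        then obtain m where m: "n = Suc m" "odd m" using n0 by (cases n) auto
        have "norm ((L t ^^ n) u) = norm ((L t ^^ m) (L t u))" by (simp add: m funpow_swap1)
        also have "\<dots> \<le> C * R ^ m * norm (\<iota> ((L t ^^ 1) u))" using odd[OF t m(2)] by simp
        also have "\<dots> \<le> C * R ^ m * (C * R ^ 1 * norm (\<iota> u))"
          using C R by (intro mult_left_mono wk t) auto
        also have "\<dots> = C\<^sup>2 * R ^ n * norm (\<iota> u)" by (simp add: m power2_eq_square mult_ac)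
        also have "\<dots> \<le> C' * R ^ n * norm (\<iota> u)" using C' R by (intro mult_right_mono) auto
        finally show ?thesis .
      qed
      moreover have "0 \<le> C' * (1/2) ^ n * norm u" using C' by simp
      ultimately show ?thesis by linarith
    qed
    have "norm (\<iota> ((L t ^^ n) u)) \<le> C' * R ^ n * norm (\<iota> u)" if "t \<in> I" for t n u
      by (rule order_trans[OF wk[OF that]]) (use C' R in \<open>auto intro!: mult_right_mono\<close>)
    then show ?thesis using main C' R by (intro exI[of _ C'] exI[of _ "1/2"] exI[of _ R]) auto
  qed
qed

section \<open>Stability of the family in the strong and the weak norm\<close>

locale lasota_yorke_family =
  fixes L :: "real \<Rightarrow> 'g::complex_banach \<Rightarrow> 'g" and \<iota> :: "'g \<Rightarrow> 'h::complex_banach"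
    and C \<eta> R \<epsilon> \<beta> H :: real
  assumes \<epsilon>: "0 < \<epsilon>" "\<epsilon> < 1"
    and L: "\<And>t. \<bar>t\<bar> \<le> \<epsilon> \<Longrightarrow> bounded_clinear (L t)" and \<iota>: "bounded_clinear \<iota>"
    and cpt: "compact (closure (\<iota> ` ball 0 1))"
    and C: "C > 0" and \<eta>: "0 < \<eta>" "\<eta> < 1" and R: "R \<ge> 1"
    and LY: "\<And>t n u. \<bar>t\<bar> \<le> \<epsilon> \<Longrightarrow> norm ((L t ^^ n) u) \<le> C * \<eta> ^ n * norm u + C * R ^ n * norm (\<iota> u)"
    and weak: "\<And>t n u. \<bar>t\<bar> \<le> \<epsilon> \<Longrightarrow> norm (\<iota> ((L t ^^ n) u)) \<le> C * R ^ n * norm (\<iota> u)"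
    and \<beta>: "\<beta> > 0" and H: "H > 0"
    and hoelder: "\<And>t u. \<bar>t\<bar> \<le> \<epsilon> \<Longrightarrow> norm (\<iota> (L t u - L 0 u)) \<le> H * \<bar>t\<bar> powr \<beta> * norm u"
begin

lemma zero_mem: "\<bar>0::real\<bar> \<le> \<epsilon>" using \<epsilon> by simp

sublocale base: quasi_compact "L 0" \<iota> C \<eta> R
  using L[OF zero_mem] \<iota> cpt C \<eta> R LY[OF zero_mem] by unfold_locales auto

lemma uniform_bound: "\<exists>K>0. \<forall>t u. \<bar>t\<bar> \<le> \<epsilon> \<longrightarrow> norm (L t u) \<le> K * norm u"
proof -
  obtain I where I: "I > 0" "\<And>x. norm (\<iota> x) \<le> I * norm x" using bounded_clinearD(8)[OF \<iota>] by auto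
  have "norm (L t u) \<le> (C * \<eta> + C * R * I) * norm u" if "\<bar>t\<bar> \<le> \<epsilon>" for t u
  proof -
    have "norm (L t u) \<le> C * \<eta> * norm u + C * R * norm (\<iota> u)" using LY[OF that, of 1 u] by simp
    also have "\<dots> \<le> C * \<eta> * norm u + C * R * (I * norm u)"
      using C R I by (intro add_left_mono mult_left_mono) auto
    finally show ?thesis by (simp add: algebra_simps)
  qed
  moreover have "C * \<eta> + C * R * I > 0" using C \<eta> R I by (intro add_pos_pos mult_pos_pos) auto
  ultimately show ?thesis by blast
qed

text \<open>Telescoping: the weak bound propagates the old error and the strong bound on
  \<open>L 0\<close> feeds the new one. \<open>D\<close> depends on \<open>k\<close>, which is
  harmless since \<open>k\<close> is fixed before \<open>t\<close> becomes small.\<close>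

lemma weak_difference_powers:
  "\<exists>D\<ge>0. \<forall>t u. \<bar>t\<bar> \<le> \<epsilon> \<longrightarrow> norm (\<iota> ((L t ^^ k) u - (L 0 ^^ k) u)) \<le> D * \<bar>t\<bar> powr \<beta> * norm u"
proof (induction k)
  case 0
  then show ?case by (auto simp: bounded_clinearD[OF \<iota>] intro: exI[of _ 0])
next
  case (Suc k)
  then obtain D where D: "D \<ge> 0" "\<And>t u. \<bar>t\<bar> \<le> \<epsilon> \<Longrightarrow> norm (\<iota> ((L t ^^ k) u - (L 0 ^^ k) u)) \<le> D * \<bar>t\<bar> powr \<beta> * norm u"
    by blast
  obtain K where K: "K > 0" "\<And>u. norm (L 0 u) \<le> K * norm u" using uniform_bound zero_mem by blast
  have "norm (\<iota> ((L t ^^ Suc k) u - (L 0 ^^ Suc k) u)) \<le> (C * R * D + H * K ^ k) * \<bar>t\<bar> powr \<beta> * norm u"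
    if t: "\<bar>t\<bar> \<le> \<epsilon>" for t u
  proof -
    let ?x = "(L t ^^ k) u - (L 0 ^^ k) u" and ?y = "(L 0 ^^ k) u"
    have w1: "norm (\<iota> (L t x)) \<le> C * R * norm (\<iota> x)" for x using weak[OF t, of 1 x] by simp
    have "(L t ^^ Suc k) u - (L 0 ^^ Suc k) u = L t ?x + (L t ?y - L 0 ?y)"
      by (simp add: bounded_clinearD[OF L[OF t]])
    then have "\<iota> ((L t ^^ Suc k) u - (L 0 ^^ Suc k) u) = \<iota> (L t ?x) + \<iota> (L t ?y - L 0 ?y)"
      by (simp only: bounded_clinearD(1)[OF \<iota>])
    then have "norm (\<iota> ((L t ^^ Suc k) u - (L 0 ^^ Suc k) u)) \<le> norm (\<iota> (L t ?x)) + norm (\<iota> (L t ?y - L 0 ?y))"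
      by (simp only: norm_triangle_ineq)
    also have "\<dots> \<le> C * R * (D * \<bar>t\<bar> powr \<beta> * norm u) + H * \<bar>t\<bar> powr \<beta> * (K ^ k * norm u)"
    proof (intro add_mono)
      show "norm (\<iota> (L t ?x)) \<le> C * R * (D * \<bar>t\<bar> powr \<beta> * norm u)"
        using C R by (intro order_trans[OF w1] mult_left_mono D(2)[OF t]) auto
      show "norm (\<iota> (L t ?y - L 0 ?y)) \<le> H * \<bar>t\<bar> powr \<beta> * (K ^ k * norm u)"
        using H K by (intro order_trans[OF hoelder[OF t]] mult_left_mono norm_funpow_le) auto
    qed
    finally show ?thesis by (simp add: algebra_simps)
  qed
  moreover have "C * R * D + H * K ^ k \<ge> 0" using C R D H K by simp
  ultimately show ?case by blast
qed

text \<open>With \<open>n\<close> from \<open>power_interpolation\<close>, the strong part of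
  \<open>w\<close> is damped by \<open>\<eta> ^ n\<close> and its weak part amplified by at most
  \<open>R ^ n\<close>; both end below a power of \<open>\<bar>t\<bar>\<close>. The price is an
  exponent \<open>\<delta>\<close> that may be smaller than \<open>\<beta>\<close>.\<close>

lemma eigenfunctional_difference:
  assumes l: "bounded_clinear l" and z: "1 \<le> cmod z" and lL: "\<And>u. l (L 0 u) = z * l u"
  shows "\<exists>\<delta>>0. \<exists>K>0. \<forall>t u. \<bar>t\<bar> \<le> \<epsilon> \<longrightarrow> cmod (l (L t u - L 0 u)) \<le> K * \<bar>t\<bar> powr \<delta> * norm u"
proof -
  obtain \<delta> K where \<delta>: "\<delta> > 0" and K: "K > 0"
    and interp: "\<And>t. 0 < t \<Longrightarrow> t \<le> 1 \<Longrightarrow> \<exists>n. \<eta> ^ n \<le> K * t powr \<delta> \<and> R ^ n * t powr \<beta> \<le> K * t powr \<delta>"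
    using power_interpolation[OF \<eta> R \<beta>] by blast
  obtain A where A: "A > 0" "\<And>x. cmod (l x) \<le> A * norm x" using bounded_clinearD(8)[OF l] by auto
  obtain K0 where K0: "K0 > 0" "\<And>t u. \<bar>t\<bar> \<le> \<epsilon> \<Longrightarrow> norm (L t u) \<le> K0 * norm u" using uniform_bound by blast
  define K' where "K' = A * (C * (2 * K0 * K + H * K))"
  have K': "K' > 0" unfolding K'_def using A C K0 K H by (intro mult_pos_pos add_pos_pos) auto
  have "cmod (l (L t u - L 0 u)) \<le> K' * \<bar>t\<bar> powr \<delta> * norm u" if t: "\<bar>t\<bar> \<le> \<epsilon>" for t u
  proof (cases "t = 0")
    case True
    then show ?thesis by (simp add: bounded_clinearD[OF l])
  next
    case False
    then obtain n where n: "\<eta> ^ n \<le> K * \<bar>t\<bar> powr \<delta>" "R ^ n * \<bar>t\<bar> powr \<beta> \<le> K * \<bar>t\<bar> powr \<delta>"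
      using interp[of "\<bar>t\<bar>"] t \<epsilon> by auto
    define w where "w = L t u - L 0 u"
    have w: "norm w \<le> 2 * K0 * norm u"
      unfolding w_def using K0(2)[OF t, of u] K0(2)[OF zero_mem, of u] norm_triangle_ineq4[of "L t u" "L 0 u"] by simp
    have ln: "l ((L 0 ^^ n) w) = z ^ n * l w" by (induction n) (auto simp: lL)
    have "cmod (l w) \<le> cmod (z ^ n * l w)"
      using one_le_power[OF z, of n] mult_right_mono[of 1 "cmod z ^ n" "cmod (l w)"] by (simp add: norm_mult norm_power)
    also have "\<dots> \<le> A * norm ((L 0 ^^ n) w)" unfolding ln[symmetric] by (rule A)
    also have "\<dots> \<le> A * (C * \<eta> ^ n * norm w + C * R ^ n * norm (\<iota> w))"
      using A by (intro mult_left_mono LY zero_mem) auto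
    also have "\<dots> \<le> A * (C * (K * \<bar>t\<bar> powr \<delta>) * (2 * K0 * norm u) + C * R ^ n * (H * \<bar>t\<bar> powr \<beta> * norm u))"
      unfolding w_def[symmetric] using A C R K n w hoelder[OF t, of u, folded w_def] \<eta>
      by (intro mult_left_mono add_mono mult_mono) auto
    also have "\<dots> = A * (C * (K * \<bar>t\<bar> powr \<delta>) * (2 * K0 * norm u) + C * (R ^ n * \<bar>t\<bar> powr \<beta>) * (H * norm u))"
      by (simp add: algebra_simps)
    also have "\<dots> \<le> A * (C * (K * \<bar>t\<bar> powr \<delta>) * (2 * K0 * norm u) + C * (K * \<bar>t\<bar> powr \<delta>) * (H * norm u))"
      using A C n H by (intro mult_left_mono add_left_mono mult_right_mono) auto
    also have "\<dots> = K' * \<bar>t\<bar> powr \<delta> * norm u" by (simp add: K'_def algebra_simps)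
    finally show ?thesis by (simp add: w_def)
  qed
  then show ?thesis using \<delta> K' by blast
qed

text \<open>
  Here \<open>P\<close> is the projection complementary to the peripheral part of \<open>L 0\<close>. As \<open>1 - P\<close> nearly
  annihilates \<open>(L t - L 0) x\<close>, a fixed power of \<open>L t \<circ> P\<close> is close to \<open>L t ^^ N \<circ> P\<close> in operator norm.
\<close>

lemma reduced_power_contraction:
  assumes P: "bounded_clinear P" and PL: "\<And>u. P (L 0 u) = L 0 (P u)" and PP: "\<And>u. P (P u) = P u"
    and dec: "\<And>n u. norm ((L 0 ^^ n) (P u)) \<le> K * \<rho> ^ n * norm u" and K: "K > 0" and \<rho>: "0 < \<rho>" "\<rho> < 1"
    and near: "\<And>t u. \<bar>t\<bar> \<le> \<epsilon> \<Longrightarrow> norm ((L t u - L 0 u) - P (L t u - L 0 u)) \<le> E * \<bar>t\<bar> powr \<delta> * norm u"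
    and E: "E > 0" and \<delta>: "\<delta> > 0"
  shows "\<exists>N>0. \<exists>t1>0. t1 \<le> \<epsilon> \<and> (\<forall>t u. \<bar>t\<bar> \<le> t1 \<longrightarrow> norm (((\<lambda>u. L t (P u)) ^^ N) u) \<le> 1 / 2 * norm u)"
proof -
  obtain I where I: "I > 0" "\<And>x. norm (\<iota> x) \<le> I * norm x" using bounded_clinearD(8)[OF \<iota>] by auto
  obtain Kp where Kp: "Kp > 0" "\<And>x. norm (P x) \<le> Kp * norm x" using bounded_clinearD(8)[OF P] by auto
  obtain K0 where K0: "K0 > 0" "\<And>t u. \<bar>t\<bar> \<le> \<epsilon> \<Longrightarrow> norm (L t u) \<le> K0 * norm u" using uniform_bound by blast
  obtain m0 where m0: "C * \<eta> ^ m0 < 1 / 4" using small_power_times[OF \<eta>, of "1/4" C] by auto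
  define m where "m = Suc m0"
  have "C * \<eta> ^ m \<le> C * \<eta> ^ m0" using \<eta> C by (intro mult_left_mono power_decreasing) (auto simp: m_def)
  then have m: "C * \<eta> ^ m \<le> 1 / 4" "m > 0" using m0 by (auto simp: m_def)
  define \<theta> where "\<theta> = max (1/2) (\<rho> ^ m)"
  have \<theta>: "1/2 \<le> \<theta>" "\<rho> ^ m \<le> \<theta>" "\<theta> < 1" "0 < \<theta>"
    using \<rho> m by (auto simp: \<theta>_def power_Suc_less_one intro: power_less_one_iff[THEN iffD2])
  define X where "X = C * R ^ m * (2 * (I * K))"
  have X: "X > 0" using C R I K by (simp add: X_def)
  \<comment> \<open>Large enough to start the iteration, and for the weak term to take at most half
    of each new bound.\<close>
  define C3 where "C3 = max Kp (2 * X / \<theta>)"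
  have C3: "C3 > 0" "Kp \<le> C3" "X \<le> C3 * \<theta> / 2" using Kp \<theta> X
    by (auto simp: C3_def max_def field_simps)
  \<comment> \<open>The weak norm is compared with that of the \<open>L 0\<close> orbit, whose decay
    is known. The range of \<open>t\<close> shrinks with \<open>i\<close>, but a single
    \<open>i\<close> will be used.\<close>
  have iter: "\<exists>s>0. \<forall>t u. \<bar>t\<bar> \<le> s \<longrightarrow> \<bar>t\<bar> \<le> \<epsilon> \<longrightarrow> norm ((L t ^^ (i * m)) (P u)) \<le> C3 * \<theta> ^ i * norm u" for i
  proof (induction i)
    case 0
    have "norm (P u) \<le> C3 * norm u" for u
      using Kp(2)[of u] mult_right_mono[OF C3(2), of "norm u"] by simp
    then show ?case by (auto intro: exI[of _ 1])
  next
    case (Suc i)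
    then obtain s where s: "s > 0" "\<And>t u. \<bar>t\<bar> \<le> s \<Longrightarrow> \<bar>t\<bar> \<le> \<epsilon> \<Longrightarrow> norm ((L t ^^ (i * m)) (P u)) \<le> C3 * \<theta> ^ i * norm u"
      by blast
    obtain D where D: "D \<ge> 0" "\<And>t u. \<bar>t\<bar> \<le> \<epsilon> \<Longrightarrow> norm (\<iota> ((L t ^^ (i * m)) u - (L 0 ^^ (i * m)) u)) \<le> D * \<bar>t\<bar> powr \<beta> * norm u"
      using weak_difference_powers by blast
    have "I * K * \<rho> ^ (i * m) > 0" using I K \<rho> by simp
    then obtain s' where s': "s' > 0" "\<And>t. \<bar>t\<bar> \<le> s' \<Longrightarrow> (D * Kp) * \<bar>t\<bar> powr \<beta> \<le> I * K * \<rho> ^ (i * m)"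
      using powr_small[OF _ \<beta>] by blast
    have "norm ((L t ^^ (Suc i * m)) (P u)) \<le> C3 * \<theta> ^ Suc i * norm u"
      if t: "\<bar>t\<bar> \<le> min s s'" "\<bar>t\<bar> \<le> \<epsilon>" for t u
    proof -
      define y where "y = (L t ^^ (i * m)) (P u)"
      have ny: "norm y \<le> C3 * \<theta> ^ i * norm u" unfolding y_def using s(2) t by simp
      have "\<iota> y = \<iota> ((L t ^^ (i * m)) (P u) - (L 0 ^^ (i * m)) (P u)) + \<iota> ((L 0 ^^ (i * m)) (P u))"
        by (simp add: y_def bounded_clinearD[OF \<iota>])
      then have "norm (\<iota> y) \<le> norm (\<iota> ((L t ^^ (i * m)) (P u) - (L 0 ^^ (i * m)) (P u))) + norm (\<iota> ((L 0 ^^ (i * m)) (P u)))"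
        by (simp only: norm_triangle_ineq)
      also have "\<dots> \<le> D * \<bar>t\<bar> powr \<beta> * (Kp * norm u) + I * (K * \<rho> ^ (i * m) * norm u)"
        using D I Kp(2)[of u]
        by (intro add_mono order_trans[OF D(2)[OF t(2)]] order_trans[OF I(2)] mult_left_mono dec) auto
      also have "D * \<bar>t\<bar> powr \<beta> * (Kp * norm u) \<le> I * K * \<rho> ^ (i * m) * norm u"
        using mult_right_mono[OF s'(2), of t "norm u"] t by (simp add: mult_ac)
      finally have iy: "norm (\<iota> y) \<le> 2 * (I * K) * \<rho> ^ (i * m) * norm u" by (simp add: algebra_simps)
      have "norm ((L t ^^ (Suc i * m)) (P u)) = norm ((L t ^^ m) y)" by (simp add: y_def funpow_add)
      also have "\<dots> \<le> C * \<eta> ^ m * norm y + C * R ^ m * norm (\<iota> y)" by (rule LY[OF t(2)])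
      also have "\<dots> \<le> 1 / 4 * (C3 * \<theta> ^ i * norm u) + C * R ^ m * (2 * (I * K) * \<rho> ^ (i * m) * norm u)"
        using m ny iy C R by (intro add_mono mult_mono mult_left_mono) auto
      also have "\<dots> = 1 / 4 * (C3 * \<theta> ^ i * norm u) + X * (\<rho> ^ m) ^ i * norm u"
        by (simp add: X_def power_mult[symmetric] mult_ac)
      also have "\<dots> \<le> \<theta> / 2 * (C3 * \<theta> ^ i * norm u) + (C3 * \<theta> / 2) * \<theta> ^ i * norm u"
        using \<theta> C3 \<rho> X by (intro add_mono mult_right_mono mult_mono power_mono) auto
      also have "\<dots> = C3 * \<theta> ^ Suc i * norm u" by simp
      finally show ?thesis .
    qed
    then show ?case using s(1) s'(1) by (intro exI[of _ "min s s'"]) auto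
  qed
  obtain i0 where i0: "C3 * \<theta> ^ i0 < 1 / 4" using small_power_times[of \<theta> "1/4" C3] \<theta> by auto
  define i where "i = Suc i0"
  have "C3 * \<theta> ^ i \<le> C3 * \<theta> ^ i0" using \<theta> C3 by (intro mult_left_mono power_decreasing) (auto simp: i_def)
  then have i: "C3 * \<theta> ^ i \<le> 1 / 4" "i > 0" using i0 by (auto simp: i_def)
  define N where "N = i * m"
  have N: "N > 0" using i m by (simp add: N_def)
  obtain s where s: "s > 0" "\<And>t u. \<bar>t\<bar> \<le> s \<Longrightarrow> \<bar>t\<bar> \<le> \<epsilon> \<Longrightarrow> norm ((L t ^^ N) (P u)) \<le> 1 / 4 * norm u"
  proof -
    obtain s where s: "s > 0" "\<And>t u. \<bar>t\<bar> \<le> s \<Longrightarrow> \<bar>t\<bar> \<le> \<epsilon> \<Longrightarrow> norm ((L t ^^ N) (P u)) \<le> C3 * \<theta> ^ i * norm u"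
      using iter[of i] unfolding N_def by blast
    then show ?thesis using that[of s] order_trans[OF s(2) mult_right_mono[OF i(1) norm_ge_zero]] by blast
  qed
  have PLP: "norm (P (L t (P u)) - L t (P u)) \<le> E * \<bar>t\<bar> powr \<delta> * (Kp * norm u)" if t: "\<bar>t\<bar> \<le> \<epsilon>" for t u
  proof -
    have "P (L t (P u)) - L t (P u) = - ((L t (P u) - L 0 (P u)) - P (L t (P u) - L 0 (P u)))"
      by (simp add: bounded_clinearD[OF P] PL PP)
    then have "norm (P (L t (P u)) - L t (P u)) = norm ((L t (P u) - L 0 (P u)) - P (L t (P u) - L 0 (P u)))"
      by (simp only: norm_minus_cancel)
    also have "\<dots> \<le> E * \<bar>t\<bar> powr \<delta> * norm (P u)" by (rule near[OF t])
    also have "\<dots> \<le> E * \<bar>t\<bar> powr \<delta> * (Kp * norm u)" using E Kp by (intro mult_left_mono) auto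
    finally show ?thesis .
  qed
  \<comment> \<open>Each additional \<open>P\<close> costs a power of \<open>\<bar>t\<bar>\<close>,
    because \<open>P\<close> nearly fixes \<open>L t (P u)\<close> by \<open>PLP\<close>.\<close>
  have cmp: "\<exists>G\<ge>0. \<forall>t u. \<bar>t\<bar> \<le> \<epsilon> \<longrightarrow> norm (((\<lambda>u. L t (P u)) ^^ Suc n) u - (L t ^^ Suc n) (P u)) \<le> G * \<bar>t\<bar> powr \<delta> * norm u" for n
  proof (induction n)
    case 0
    then show ?case by (auto intro: exI[of _ 0])
  next
    case (Suc n)
    then obtain G where G: "G \<ge> 0" "\<And>t u. \<bar>t\<bar> \<le> \<epsilon> \<Longrightarrow> norm (((\<lambda>u. L t (P u)) ^^ Suc n) u - (L t ^^ Suc n) (P u)) \<le> G * \<bar>t\<bar> powr \<delta> * norm u"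
      by blast
    have "norm (((\<lambda>u. L t (P u)) ^^ Suc (Suc n)) u - (L t ^^ Suc (Suc n)) (P u)) \<le> (G * (K0 * Kp) + K0 ^ Suc n * (E * Kp)) * \<bar>t\<bar> powr \<delta> * norm u"
      if t: "\<bar>t\<bar> \<le> \<epsilon>" for t u
    proof -
      let ?w = "L t (P u)"
      note Ln = bounded_clinearD[OF bounded_clinear_funpow[OF L[OF t], of "Suc n"]]
      have "((\<lambda>u. L t (P u)) ^^ Suc (Suc n)) u - (L t ^^ Suc (Suc n)) (P u)
          = (((\<lambda>u. L t (P u)) ^^ Suc n) ?w - (L t ^^ Suc n) (P ?w)) + (L t ^^ Suc n) (P ?w - ?w)"
        by (simp add: Ln(2) funpow_swap1 del: funpow.simps) (simp only: funpow_Suc_right o_apply funpow_swap1)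
      also have "norm \<dots> \<le> G * \<bar>t\<bar> powr \<delta> * norm ?w + K0 ^ Suc n * norm (P ?w - ?w)"
        using K0 t by (intro order_trans[OF norm_triangle_ineq] add_mono G norm_funpow_le) auto
      also have "\<dots> \<le> G * \<bar>t\<bar> powr \<delta> * (K0 * (Kp * norm u)) + K0 ^ Suc n * (E * \<bar>t\<bar> powr \<delta> * (Kp * norm u))"
        using G K0 Kp PLP[OF t]
        by (intro add_mono mult_left_mono order_trans[OF K0(2)[OF t]]) auto
      finally show ?thesis by (simp add: algebra_simps)
    qed
    moreover have "G * (K0 * Kp) + K0 ^ Suc n * (E * Kp) \<ge> 0" using G K0 Kp E by simp
    ultimately show ?case by blast
  qed
  obtain G where G: "G \<ge> 0" "\<And>t u. \<bar>t\<bar> \<le> \<epsilon> \<Longrightarrow> norm (((\<lambda>u. L t (P u)) ^^ N) u - (L t ^^ N) (P u)) \<le> G * \<bar>t\<bar> powr \<delta> * norm u"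
    using cmp[of "N - 1"] N by auto
  obtain s' where s': "s' > 0" "\<And>t. \<bar>t\<bar> \<le> s' \<Longrightarrow> G * \<bar>t\<bar> powr \<delta> \<le> 1 / 4"
    using powr_small[OF _ \<delta>, of "1/4" G] by auto
  define t1 where "t1 = min \<epsilon> (min s s')"
  have "norm (((\<lambda>u. L t (P u)) ^^ N) u) \<le> 1 / 2 * norm u" if t: "\<bar>t\<bar> \<le> t1" for t u
  proof -
    have te: "\<bar>t\<bar> \<le> \<epsilon>" "\<bar>t\<bar> \<le> s" "\<bar>t\<bar> \<le> s'" using t by (auto simp: t1_def)
    have "norm (((\<lambda>u. L t (P u)) ^^ N) u) \<le> norm ((L t ^^ N) (P u)) + norm (((\<lambda>u. L t (P u)) ^^ N) u - (L t ^^ N) (P u))"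
      by (rule norm_triangle_sub)
    also have "\<dots> \<le> 1 / 4 * norm u + 1 / 4 * norm u"
      by (intro add_mono s te order_trans[OF G(2)[OF te(1)]] mult_right_mono s') auto
    finally show ?thesis by simp
  qed
  then show ?thesis using N \<epsilon> s(1) s'(1) by (intro exI[of _ N] conjI exI[of _ t1]) (auto simp: t1_def)
qed

end

section \<open>Asymptotic independence from the spectral data\<close>

context lasota_yorke_family
begin

text \<open>\<open>l0\<close> is a multiple of the eigenfunctional at 1, so the quantity
  \<open>X n p\<close> of the proof equals \<open>\<zeta> ^ n * X 0 p\<close> up to
  \<open>O(\<bar>t\<bar> powr \<delta>)\<close>, with \<open>\<zeta>\<close> depending neither on
  \<open>s\<close> nor on \<open>p\<close>. The case \<open>p = 0\<close> identifies
  \<open>\<zeta> ^ n\<close> with \<open>X n 0\<close>, and the product formula follows.\<close>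

theorem asymptotic_independence:
  assumes simple: "\<And>z. eigenvalue (L 0) z \<Longrightarrow> 1 \<le> cmod z \<Longrightarrow> simple_eigenvalue (L 0) z"
    and l0: "bounded_clinear l0" and fixed: "\<And>u. l0 (L 0 u) = l0 u" and one: "l0 \<alpha> = 1"
    and bd: "\<And>t s n p. \<bar>t\<bar> \<le> \<epsilon> \<Longrightarrow> \<bar>s\<bar> \<le> \<epsilon> \<Longrightarrow> cmod (l0 ((L t ^^ n) ((L s ^^ p) \<alpha>))) \<le> 1"
  shows "\<exists>t1>0. \<exists>\<delta>>0. \<exists>K>0. t1 \<le> \<epsilon> \<and> (\<forall>t s n p. \<bar>t\<bar> \<le> t1 \<longrightarrow> \<bar>s\<bar> \<le> t1 \<longrightarrow>
    cmod (l0 ((L t ^^ n) ((L s ^^ p) \<alpha>)) - l0 ((L t ^^ n) \<alpha>) * l0 ((L s ^^ p) \<alpha>)) \<le> K * \<bar>t\<bar> powr \<delta>)"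
proof -
  define \<Lambda> where "\<Lambda> = {z. eigenvalue (L 0) z \<and> 1 \<le> cmod z}"
  have fin: "finite \<Lambda>" unfolding \<Lambda>_def by (rule base.finite_peripheral_eigenvalues)
  obtain v \<ll> K3 \<rho>0 where v0: "\<And>z. z \<in> \<Lambda> \<Longrightarrow> v z \<noteq> 0" and Lv: "\<And>z. z \<in> \<Lambda> \<Longrightarrow> L 0 (v z) = z *\<^sub>C v z"
    and l: "\<And>z. z \<in> \<Lambda> \<Longrightarrow> bounded_clinear (\<ll> z)" and lL: "\<And>z u. z \<in> \<Lambda> \<Longrightarrow> \<ll> z (L 0 u) = z * \<ll> z u"
    and lv: "\<And>z w. z \<in> \<Lambda> \<Longrightarrow> w \<in> \<Lambda> \<Longrightarrow> \<ll> z (v w) = (if w = z then 1 else 0)"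
    and K3: "K3 > 0" and \<rho>0: "0 < \<rho>0" "\<rho>0 < 1"
    and dec: "\<And>n u. norm ((L 0 ^^ n) (u - (\<Sum>z\<in>\<Lambda>. \<ll> z u *\<^sub>C v z))) \<le> K3 * \<rho>0 ^ n * norm u"
    by (rule base.spectral_decomposition[OF _ \<Lambda>_def]) (use simple in blast)+
  have z1: "1 \<le> cmod z" if "z \<in> \<Lambda>" for z using that by (simp add: \<Lambda>_def)
  note l0' = bounded_clinearD[OF l0] and L0' = bounded_clinearD[OF L[OF zero_mem]]
  define P where "P u = u - (\<Sum>z\<in>\<Lambda>. \<ll> z u *\<^sub>C v z)" for u
  have P: "bounded_clinear P" unfolding P_def[abs_def]
    by (intro bounded_clinear_diff bounded_clinear_ident bounded_clinear_sum bounded_clinear_scaleC_const l)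
  have PL: "P (L 0 u) = L 0 (P u)" for u
    unfolding P_def by (simp add: L0' lL Lv scaleC_scaleC mult.commute)
  have lP: "\<ll> z (P u) = 0" if "z \<in> \<Lambda>" for z u
    using that fin by (simp add: P_def bounded_clinearD[OF l[OF that]] lv if_distrib[of "\<lambda>c. _ * c"] sum.delta' cong: if_cong)
  have PP: "P (P u) = P u" for u
    using lP by (simp add: P_def[of "P u"])
  \<comment> \<open>\<open>l0\<close> is invariant under \<open>L 0\<close>, while powers of
    \<open>L 0\<close> decay on the range of \<open>P\<close>.\<close>
  have l0P: "l0 (P u) = 0" for u
  proof -
    obtain A where A: "A > 0" "\<And>x. cmod (l0 x) \<le> A * norm x" using l0'(8) by auto
    have it: "l0 ((L 0 ^^ n) x) = l0 x" for n x by (induction n) (auto simp: fixed)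
    have "cmod (l0 (P u)) \<le> A * (K3 * \<rho>0 ^ n * norm u)" for n
      using order_trans[OF A(2)[of "(L 0 ^^ n) (P u)"] mult_left_mono[OF dec[of n u, folded P_def]]] A(1)
      by (simp add: it)
    moreover have "(\<lambda>n. A * (K3 * \<rho>0 ^ n * norm u)) \<longlonglongrightarrow> A * (K3 * 0 * norm u)"
      using \<rho>0 by (intro tendsto_intros LIMSEQ_realpow_zero) auto
    ultimately have "cmod (l0 (P u)) \<le> 0"
      by (intro LIMSEQ_le_const[where X = "\<lambda>n. A * (K3 * \<rho>0 ^ n * norm u)"]) auto
    then show ?thesis by simp
  qed
  have l0v: "l0 (v z) = 0" if "z \<in> \<Lambda>" "z \<noteq> 1" for z
    using fixed[of "v z"] that by (simp add: Lv l0')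
  have l0_sum: "l0 u = (\<Sum>z\<in>\<Lambda>. \<ll> z u * l0 (v z))" for u
  proof -
    have "u = P u + (\<Sum>z\<in>\<Lambda>. \<ll> z u *\<^sub>C v z)" by (simp add: P_def)
    then have "l0 u = l0 (P u) + (\<Sum>z\<in>\<Lambda>. \<ll> z u * l0 (v z))"
      by (metis (no_types, lifting) l0'(1,3,6) scaleC_complex_eq sum.cong)
    then show ?thesis by (simp add: l0P)
  qed
  \<comment> \<open>Without the eigenvalue 1 the invariant functional would vanish, against
    \<open>l0 \<alpha> = 1\<close>.\<close>
  have mem1: "1 \<in> \<Lambda>"
  proof (rule ccontr)
    assume "1 \<notin> \<Lambda>"
    then have "l0 (v z) = 0" if "z \<in> \<Lambda>" for z using l0v[OF that] that by blast
    then have "l0 \<alpha> = 0" unfolding l0_sum[of \<alpha>] by (intro sum.neutral) auto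
    then show False using one by simp
  qed
  have l0_eq: "l0 u = l0 (v 1) * \<ll> 1 u" for u
  proof -
    have "l0 u = (\<Sum>z\<in>\<Lambda>. if z = 1 then \<ll> 1 u * l0 (v 1) else 0)"
      unfolding l0_sum[of u] by (intro sum.cong) (auto simp: l0v)
    then show ?thesis using fin mem1 by (simp add: mult.commute)
  qed
  have "\<forall>z\<in>\<Lambda>. \<exists>\<delta>>0. \<exists>K>0. \<forall>t u. \<bar>t\<bar> \<le> \<epsilon> \<longrightarrow> cmod (\<ll> z (L t u - L 0 u)) \<le> K * \<bar>t\<bar> powr \<delta> * norm u"
    using eigenfunctional_difference[OF l z1 lL] by blast
  then obtain \<delta>f Kf where \<delta>f: "\<And>z. z \<in> \<Lambda> \<Longrightarrow> \<delta>f z > 0" and Kf: "\<And>z. z \<in> \<Lambda> \<Longrightarrow> Kf z > (0::real)"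
    and ldf: "\<And>z t u. z \<in> \<Lambda> \<Longrightarrow> \<bar>t\<bar> \<le> \<epsilon> \<Longrightarrow> cmod (\<ll> z (L t u - L 0 u)) \<le> Kf z * \<bar>t\<bar> powr \<delta>f z * norm u"
    by metis
  define \<delta> where "\<delta> = Min (\<delta>f ` \<Lambda>)"
  have \<delta>: "\<delta> > 0" unfolding \<delta>_def using fin mem1 \<delta>f by (subst Min_gr_iff) auto
  define Kd where "Kd = (\<Sum>z\<in>\<Lambda>. Kf z)"
  have Kd: "Kd > 0" unfolding Kd_def using fin mem1 Kf by (intro sum_pos) auto
  have ld: "cmod (\<ll> z (L t u - L 0 u)) \<le> Kd * \<bar>t\<bar> powr \<delta> * norm u" if z: "z \<in> \<Lambda>" and t: "\<bar>t\<bar> \<le> \<epsilon>" for z t u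
  proof -
    have "Kf z \<le> Kd" unfolding Kd_def using fin z Kf by (intro member_le_sum) (auto simp: less_imp_le)
    moreover have "\<bar>t\<bar> powr \<delta>f z \<le> \<bar>t\<bar> powr \<delta>"
      using t \<epsilon> fin z by (intro powr_mono') (auto simp: \<delta>_def)
    ultimately have "Kf z * \<bar>t\<bar> powr \<delta>f z * norm u \<le> Kd * \<bar>t\<bar> powr \<delta> * norm u"
      using Kd by (intro mult_right_mono mult_mono) auto
    then show ?thesis using ldf[OF z t, of u] by linarith
  qed
  define E where "E = (\<Sum>z\<in>\<Lambda>. Kd * norm (v z)) + 1"
  have E: "E > 0" unfolding E_def using Kd by (intro add_nonneg_pos sum_nonneg) auto
  have nearP: "norm ((L t u - L 0 u) - P (L t u - L 0 u)) \<le> E * \<bar>t\<bar> powr \<delta> * norm u" if t: "\<bar>t\<bar> \<le> \<epsilon>" for t u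
  proof -
    have "norm ((L t u - L 0 u) - P (L t u - L 0 u)) = norm (\<Sum>z\<in>\<Lambda>. \<ll> z (L t u - L 0 u) *\<^sub>C v z)"
      by (simp add: P_def)
    also have "\<dots> \<le> (\<Sum>z\<in>\<Lambda>. Kd * \<bar>t\<bar> powr \<delta> * norm u * norm (v z))"
      by (rule order_trans[OF norm_sum]) (auto simp: norm_scaleC intro!: sum_mono mult_right_mono ld t)
    also have "\<dots> = (\<Sum>z\<in>\<Lambda>. Kd * norm (v z)) * \<bar>t\<bar> powr \<delta> * norm u"
      unfolding sum_distrib_right by (intro sum.cong) (auto simp: mult_ac)
    also have "\<dots> \<le> E * \<bar>t\<bar> powr \<delta> * norm u" by (intro mult_right_mono) (auto simp: E_def)
    finally show ?thesis .
  qed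
  obtain N t1 where N: "N > 0" and t1: "t1 > 0" "t1 \<le> \<epsilon>"
    and half: "\<And>t u. \<bar>t\<bar> \<le> t1 \<Longrightarrow> norm (((\<lambda>u. L t (P u)) ^^ N) u) \<le> 1 / 2 * norm u"
    using reduced_power_contraction[OF P PL PP dec[folded P_def] K3 \<rho>0 nearP E \<delta>] by blast
  obtain K0 where K0: "K0 > 0" "\<And>t u. \<bar>t\<bar> \<le> \<epsilon> \<Longrightarrow> norm (L t u) \<le> K0 * norm u" using uniform_bound by blast
  obtain Kp where Kp: "Kp > 0" "\<And>x. norm (P x) \<le> Kp * norm x" using bounded_clinearD(8)[OF P] by auto
  obtain K1 \<rho> where K1: "0 < K1" and \<rho>: "0 < \<rho>" "\<rho> < 1"
    and K1': "\<forall>(A :: 'g \<Rightarrow> 'g) q. (\<forall>u. 0 \<le> q u) \<longrightarrow>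
      (\<forall>u. q (A u) \<le> K0 * Kp * q u) \<longrightarrow> (\<forall>u. q ((A ^^ N) u) \<le> 1 / 2 * q u) \<longrightarrow>
      (\<forall>n u. q ((A ^^ n) u) \<le> K1 * \<rho> ^ n * q u)"
  proof -
    have "0 \<le> (1/2::real)" "(1/2::real) < 1" "0 \<le> K0 * Kp" using K0(1) Kp(1) by auto
    from exponential_decay_of_power_contraction[OF N this, where 'g = 'g] show ?thesis
      by (elim exE conjE) (rule that)
  qed
  have red: "norm (((\<lambda>u. L t (P u)) ^^ n) u) \<le> K1 * \<rho> ^ n * norm u" if t: "\<bar>t\<bar> \<le> t1" for t n u
  proof (rule K1'[THEN spec[of _ "\<lambda>u. L t (P u)"], THEN spec[of _ norm], THEN mp, THEN mp, THEN mp, THEN spec, THEN spec])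
    have te: "\<bar>t\<bar> \<le> \<epsilon>" using t t1 by simp
    show "\<forall>u. norm (L t (P u)) \<le> K0 * Kp * norm u"
      using order_trans[OF K0(2)[OF te] mult_left_mono[OF Kp(2)]] K0(1) by (simp add: mult.assoc)
  qed (use half[OF t] in auto)
  have "\<forall>z\<in>\<Lambda>. \<exists>A>0. \<forall>u. cmod (\<ll> z u) \<le> A * norm u" using bounded_clinearD(8)[OF l] by blast
  then obtain A where A: "\<And>z. z \<in> \<Lambda> \<Longrightarrow> A z > 0" "\<And>z u. z \<in> \<Lambda> \<Longrightarrow> cmod (\<ll> z u) \<le> A z * norm u" by metis
  define M where "M = 1 + (\<Sum>z\<in>\<Lambda>. norm (v z) + A z + cmod z + (\<Sum>w\<in>\<Lambda>. inverse (cmod (z - w)))) + real (card \<Lambda>) + K0 + K1"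
  have Ms: "x \<le> M" if "z \<in> \<Lambda>" "x \<le> norm (v z) + A z + cmod z + (\<Sum>w\<in>\<Lambda>. inverse (cmod (z - w)))" for x z
  proof -
    have "norm (v z) + A z + cmod z + (\<Sum>w\<in>\<Lambda>. inverse (cmod (z - w)))
        \<le> (\<Sum>z\<in>\<Lambda>. norm (v z) + A z + cmod z + (\<Sum>w\<in>\<Lambda>. inverse (cmod (z - w))))"
      by (rule member_le_sum[OF that(1) _ fin])
         (use A(1) in \<open>auto intro!: add_nonneg_nonneg sum_nonneg simp: less_imp_le\<close>)
    with that(2) have "x \<le> (\<Sum>z\<in>\<Lambda>. norm (v z) + A z + cmod z + (\<Sum>w\<in>\<Lambda>. inverse (cmod (z - w))))"
      by (rule order_trans)
    then show ?thesis using K0 K1 by (simp add: M_def)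
  qed
  have Msum: "(\<Sum>z\<in>\<Lambda>. norm (v z) + A z + cmod z + (\<Sum>w\<in>\<Lambda>. inverse (cmod (z - w)))) \<ge> 0"
    using A(1) by (intro sum_nonneg add_nonneg_nonneg) (auto simp: less_imp_le)
  have inv_nonneg: "(\<Sum>w\<in>\<Lambda>. inverse (cmod (z - w))) \<ge> 0" for z by (intro sum_nonneg) auto
  have KM: "K0 \<le> M" "K1 \<le> M" "1 \<le> M" "real (card \<Lambda>) \<le> M" using Msum K0 K1 by (auto simp: M_def)
  interpret sp: spectral_perturbation "L 0" \<Lambda> v \<ll> M \<rho>
  proof
    show "norm (v z) \<le> M" if "z \<in> \<Lambda>" for z
      using A(1)[OF that] inv_nonneg[of z] by (intro Ms[OF that]) (simp add: less_imp_le)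
    show "cmod z \<le> M" if "z \<in> \<Lambda>" for z
      using A(1)[OF that] inv_nonneg[of z] by (intro Ms[OF that]) (simp add: less_imp_le)
    show "cmod (\<ll> z u) \<le> M * norm u" if "z \<in> \<Lambda>" for z u
    proof -
      have "A z \<le> M" using inv_nonneg[of z] by (intro Ms[OF that]) simp
      then show ?thesis using A(2)[OF that, of u] mult_right_mono[of "A z" M "norm u"] by simp
    qed
    show "1 / M \<le> cmod (z - w)" if zw: "z \<in> \<Lambda>" "w \<in> \<Lambda>" "z \<noteq> w" for z w
    proof -
      have "inverse (cmod (z - w)) \<le> (\<Sum>w\<in>\<Lambda>. inverse (cmod (z - w)))"
        using fin zw by (intro member_le_sum) auto
      then have "inverse (cmod (z - w)) \<le> M"
        using A(1)[OF zw(1)] by (intro Ms[OF zw(1)]) (simp add: add_increasing less_imp_le)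
      then have "1 \<le> M * cmod (z - w)" using zw(3) by (simp add: field_simps)
      then show ?thesis using KM(3) by (simp add: field_simps)
    qed
  qed (use L[OF zero_mem] fin z1 Lv l lL lv KM \<rho> in auto)
  have coproj: "sp.coproj = P" by (rule ext) (simp add: sp.coproj_def sp.proj_def P_def)
  have near: "sp.near (L t) (Kd * \<bar>t\<bar> powr \<delta>)" if t: "\<bar>t\<bar> \<le> t1" for t
  proof -
    have te: "\<bar>t\<bar> \<le> \<epsilon>" using t t1 by simp
    have "norm (L t u) \<le> M * norm u" for u
      using K0(2)[OF te, of u] mult_right_mono[OF KM(1), of "norm u"] by simp
    moreover have "norm (((\<lambda>u. L t (P u)) ^^ n) u) \<le> M * \<rho> ^ n * norm u" for n u
      using order_trans[OF red[OF t] mult_right_mono[OF mult_right_mono[OF KM(2)] norm_ge_zero]] \<rho> by simp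
    ultimately show ?thesis
      unfolding sp.near_def coproj using L[OF te] Kd ld te by auto
  qed
  obtain d0 K2 where d0: "d0 > 0" and K2: "K2 > 0"
    and rep: "\<And>A d. sp.near A d \<Longrightarrow> d \<le> d0 \<Longrightarrow>
    (\<exists>Q. (\<forall>u n. norm ((A ^^ n) (Q u)) \<le> K2 * norm u) \<and>
      (\<forall>\<psi> u b. bounded_clinear \<psi> \<longrightarrow> (\<forall>n. cmod (\<psi> ((A ^^ n) u)) \<le> b) \<longrightarrow>
        (\<forall>n. \<psi> ((A ^^ n) u) = \<psi> ((A ^^ n) (Q u)))) \<and>
      (\<forall>i\<in>\<Lambda>. \<exists>\<zeta>. \<forall>u b. (\<forall>n. norm ((A ^^ n) u) \<le> b) \<longrightarrow>
        (\<forall>n. cmod (\<ll> i ((A ^^ n) u) - \<zeta> ^ n * \<ll> i u) \<le> K2 * d * b)))"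
    using sp.bounded_orbit_representation by blast
  obtain s0 where s0: "s0 > 0" "\<And>t. \<bar>t\<bar> \<le> s0 \<Longrightarrow> Kd * \<bar>t\<bar> powr \<delta> \<le> d0"
    using powr_small[OF d0 \<delta>] by blast
  define t2 where "t2 = min t1 s0"
  have t2: "t2 > 0" "t2 \<le> \<epsilon>" using t1 s0 by (auto simp: t2_def)
  define K' where "K' = 2 * (cmod (l0 (v 1)) * (K2 * Kd * (K2 * (K2 * norm \<alpha>)))) + 1"
  have K': "K' > 0" using K2 Kd by (simp add: K'_def add_nonneg_pos)
  have "cmod (l0 ((L t ^^ n) ((L s ^^ p) \<alpha>)) - l0 ((L t ^^ n) \<alpha>) * l0 ((L s ^^ p) \<alpha>)) \<le> K' * \<bar>t\<bar> powr \<delta>"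
    if t: "\<bar>t\<bar> \<le> t2" and s: "\<bar>s\<bar> \<le> t2" for t s n p
  proof -
    have te: "\<bar>t\<bar> \<le> \<epsilon>" and se: "\<bar>s\<bar> \<le> \<epsilon>" using t s t2 by auto
    have tn: "sp.near (L t) (Kd * \<bar>t\<bar> powr \<delta>)" "Kd * \<bar>t\<bar> powr \<delta> \<le> d0"
      and sn: "sp.near (L s) (Kd * \<bar>s\<bar> powr \<delta>)" "Kd * \<bar>s\<bar> powr \<delta> \<le> d0"
      using t s near s0(2) by (auto simp: t2_def)
    obtain Qs where Qs: "\<And>u n. norm ((L s ^^ n) (Qs u)) \<le> K2 * norm u"
      and Qs': "\<And>\<psi> u b n. bounded_clinear \<psi> \<Longrightarrow> (\<forall>n. cmod (\<psi> ((L s ^^ n) u)) \<le> b) \<Longrightarrow>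
         \<psi> ((L s ^^ n) u) = \<psi> ((L s ^^ n) (Qs u))"
      using rep[OF sn] by metis
    obtain Qt where Qt: "\<And>u n. norm ((L t ^^ n) (Qt u)) \<le> K2 * norm u"
      and Qt': "\<And>\<psi> u b n. bounded_clinear \<psi> \<Longrightarrow> (\<forall>n. cmod (\<psi> ((L t ^^ n) u)) \<le> b) \<Longrightarrow>
         \<psi> ((L t ^^ n) u) = \<psi> ((L t ^^ n) (Qt u))"
      and "\<exists>\<zeta>. \<forall>u b. (\<forall>n. norm ((L t ^^ n) u) \<le> b) \<longrightarrow>
        (\<forall>n. cmod (\<ll> 1 ((L t ^^ n) u) - \<zeta> ^ n * \<ll> 1 u) \<le> K2 * (Kd * \<bar>t\<bar> powr \<delta>) * b)"
      using rep[OF tn] mem1 by metis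
    then obtain \<zeta> where \<zeta>: "\<And>u b n. (\<forall>n. norm ((L t ^^ n) u) \<le> b) \<Longrightarrow>
        cmod (\<ll> 1 ((L t ^^ n) u) - \<zeta> ^ n * \<ll> 1 u) \<le> K2 * (Kd * \<bar>t\<bar> powr \<delta>) * b" by blast
    define X where "X n p = l0 ((L t ^^ n) ((L s ^^ p) \<alpha>))" for n p
    define e where "e = cmod (l0 (v 1)) * (K2 * (Kd * \<bar>t\<bar> powr \<delta>) * (K2 * (K2 * norm \<alpha>)))"
    have X1: "cmod (X n p) \<le> 1" for n p unfolding X_def by (rule bd[OF te se])
    \<comment> \<open>First the growing directions of \<open>L s\<close> are dropped, with
      \<open>l0 \<circ> (L t ^^ n)\<close> as functional, then those of \<open>L t\<close>; the
      coded integrals are bounded by 1, so neither changes them. The remaining \<open>L t\<close>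
      orbit is bounded uniformly in \<open>n\<close> and \<open>p\<close>, as \<open>\<zeta>\<close>
      requires.\<close>
    have key: "cmod (X n p - \<zeta> ^ n * X 0 p) \<le> e" for n p
    proof -
      define u where "u = (L s ^^ p) (Qs \<alpha>)"
      have Xu: "X n p = l0 ((L t ^^ n) u)" for n
        unfolding X_def u_def
        by (rule Qs'[OF bounded_clinear_compose[OF l0 bounded_clinear_funpow[OF L[OF te]]], of "n" \<alpha> 1 p])
           (use bd[OF te se] in auto)
      have Xq: "X n p = l0 ((L t ^^ n) (Qt u))" for n
        unfolding Xu by (rule Qt'[OF l0, of u 1]) (use X1 in \<open>simp add: Xu[symmetric]\<close>)
      have b: "norm ((L t ^^ n) (Qt u)) \<le> K2 * (K2 * norm \<alpha>)" for n
        using order_trans[OF Qt mult_left_mono[OF Qs]] K2 unfolding u_def by simp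
      have "X n p - \<zeta> ^ n * X 0 p = l0 (v 1) * (\<ll> 1 ((L t ^^ n) (Qt u)) - \<zeta> ^ n * \<ll> 1 (Qt u))"
        unfolding Xq l0_eq[of "(L t ^^ _) _"] by (simp add: algebra_simps)
      also have "cmod \<dots> \<le> e"
        unfolding e_def norm_mult by (intro mult_left_mono \<zeta>) (use b in auto)
      finally show ?thesis .
    qed
    have "X 0 0 = 1" by (simp add: X_def one)
    then have k0: "cmod (X n 0 - \<zeta> ^ n) \<le> e" using key[of n 0] by simp
    have "X n p - X n 0 * X 0 p = (X n p - \<zeta> ^ n * X 0 p) - (X n 0 - \<zeta> ^ n) * X 0 p"
      by (simp add: algebra_simps)
    also have "cmod \<dots> \<le> e + e * 1"
    proof (rule order_trans[OF norm_triangle_ineq4 add_mono[OF key]])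
      show "cmod ((X n 0 - \<zeta> ^ n) * X 0 p) \<le> e * 1"
        unfolding norm_mult using k0 X1[of 0 p] order_trans[OF norm_ge_zero k0] by (intro mult_mono) auto
    qed
    also have "\<dots> \<le> K' * \<bar>t\<bar> powr \<delta>" by (simp add: e_def K'_def algebra_simps)
    finally show ?thesis by (simp add: X_def)
  qed
  then show ?thesis using t2 \<delta> K' by blast
qed

end

section \<open>Logarithmic averages\<close>

lemma sum_inverse_le_ln_diff:
  assumes "1 \<le> M" "M \<le> N"
  shows "(\<Sum>k=Suc M..N. 1 / real k) \<le> ln (real N) - ln (real M)"
  using assms(2)
proof (induction N rule: dec_induct)
  case (step N)
  have N: "real N > 0" using step assms by simp
  have "ln (real N / real (Suc N)) \<le> real N / real (Suc N) - 1" using N by (intro ln_le_minus_one) auto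
  also have "\<dots> = - 1 / real (Suc N)" by (simp add: field_simps)
  finally have "1 / real (Suc N) \<le> ln (real (Suc N)) - ln (real N)"
    using N by (simp add: ln_div)
  then show ?case using step by simp
qed simp

lemma harm_le_ln: "1 \<le> N \<Longrightarrow> harm N \<le> 1 + ln (real N)"
  using sum_inverse_le_ln_diff[of 1 N]
  by (simp add: harm_def sum.atLeast_Suc_atMost inverse_eq_divide)

lemma ln_at_top_nat: "filterlim (\<lambda>N. ln (real N)) at_top sequentially"
  by (rule filterlim_compose[OF ln_at_top filterlim_real_sequentially])

lemma const_over_ln_tendsto: "(\<lambda>N. c / ln (real N)) \<longlonglongrightarrow> 0"
  by (rule real_tendsto_divide_at_top[OF tendsto_const ln_at_top_nat])

lemma harm_over_ln_tendsto: "(\<lambda>N. harm N / ln (real N)) \<longlonglongrightarrow> (1 :: real)"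
proof -
  have "(\<lambda>N. (harm N - ln (real N)) / ln (real N)) \<longlonglongrightarrow> 0"
    by (rule real_tendsto_divide_at_top[OF euler_mascheroni_LIMSEQ ln_at_top_nat])
  then have "(\<lambda>N. (harm N - ln (real N)) / ln (real N) + 1) \<longlonglongrightarrow> 0 + 1"
    by (intro tendsto_intros)
  moreover have "\<forall>\<^sub>F N in sequentially. (harm N - ln (real N)) / ln (real N) + 1 = harm N / ln (real N)"
    using eventually_gt_at_top[of 1] by eventually_elim (simp add: field_simps)
  ultimately show ?thesis by (simp add: tendsto_cong)
qed

text \<open>The terms up to a fixed index have a bounded sum, which division by \<open>ln N\<close>
  removes; past it the terms are uniformly small and the total weight is
  \<open>O(ln N)\<close>.\<close>

lemma log_average_null:
  fixes a :: "nat \<Rightarrow> complex"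
  assumes "a \<longlonglongrightarrow> 0"
  shows "(\<lambda>N. (\<Sum>k=1..N. a k / of_nat k) / of_real (ln (real N))) \<longlonglongrightarrow> 0"
proof (rule LIMSEQ_I)
  fix \<epsilon> :: real assume \<epsilon>: "\<epsilon> > 0"
  obtain K where K: "\<And>k. k \<ge> K \<Longrightarrow> cmod (a k) \<le> \<epsilon> / 4"
    using LIMSEQ_D[OF assms, of "\<epsilon>/4"] \<epsilon> by (auto intro: less_imp_le)
  define A where "A = (\<Sum>k=1..K. cmod (a k))"
  have le: "cmod (\<Sum>k=1..N. a k / of_nat k) \<le> A + \<epsilon> / 4 * (1 + ln (real N))" if "N \<ge> 1" for N
  proof -
    have "cmod (\<Sum>k=1..N. a k / of_nat k) \<le> (\<Sum>k=1..N. (if k \<le> K then cmod (a k) else 0) + \<epsilon> / 4 * (1 / real k))"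
    proof (rule sum_norm_le)
      fix k assume k: "k \<in> {1..N}"
      show "cmod (a k / of_nat k) \<le> (if k \<le> K then cmod (a k) else 0) + \<epsilon> / 4 * (1 / real k)"
      proof (cases "k \<le> K")
        case True
        have "cmod (a k) / real k \<le> cmod (a k) / 1" using k by (intro divide_left_mono) auto
        then show ?thesis using True \<epsilon> by (simp add: norm_divide add_increasing2)
      next
        case False
        then show ?thesis using K[of k] k by (simp add: norm_divide field_simps)
      qed
    qed
    also have "\<dots> = (\<Sum>k=1..N. if k \<le> K then cmod (a k) else 0) + \<epsilon> / 4 * harm N"
      by (simp add: sum.distrib sum_distrib_left harm_def inverse_eq_divide)
    also have "(\<Sum>k=1..N. if k \<le> K then cmod (a k) else 0) \<le> A"
      unfolding A_def by (subst sum.inter_filter[symmetric]) (auto intro: sum_mono2)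
    also have "\<epsilon> / 4 * harm N \<le> \<epsilon> / 4 * (1 + ln (real N))"
      using harm_le_ln[OF that] \<epsilon> by (intro mult_left_mono) auto
    finally show ?thesis by simp
  qed
  have "\<forall>\<^sub>F N in sequentially. (A + \<epsilon> / 4) / ln (real N) < \<epsilon> / 2"
    using \<epsilon> by (intro order_tendstoD[OF const_over_ln_tendsto]) auto
  moreover have "\<forall>\<^sub>F N in sequentially. N > (1::nat)" by (rule eventually_gt_at_top)
  ultimately have "\<forall>\<^sub>F N in sequentially. norm ((\<Sum>k=1..N. a k / of_nat k) / of_real (ln (real N)) - 0) < \<epsilon>"
  proof eventually_elim
    case (elim N)
    then have ln: "ln (real N) > 0" by simp
    have "norm ((\<Sum>k=1..N. a k / of_nat k) / of_real (ln (real N)) - 0) = cmod (\<Sum>k=1..N. a k / of_nat k) / ln (real N)"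
      using ln by (simp add: norm_divide)
    also have "\<dots> \<le> (A + \<epsilon> / 4 * (1 + ln (real N))) / ln (real N)"
      using le[of N] elim ln by (intro divide_right_mono) auto
    also have "\<dots> = (A + \<epsilon> / 4) / ln (real N) + \<epsilon> / 4" using ln by (simp add: field_simps)
    finally show ?case using elim \<epsilon> by linarith
  qed
  then show "\<exists>no. \<forall>n\<ge>no. norm ((\<Sum>k=1..n. a k / of_nat k) / of_real (ln (real n)) - 0) < \<epsilon>"
    by (simp add: eventually_sequentially)
qed

text \<open>The squares in the exponent balance two needs. From \<open>2 ^ (j * j)\<close> to the
  next such time the logarithm grows by \<open>(2 * j + 1) * ln 2\<close>, negligible against
  \<open>j * j * ln 2\<close>; and second moments of order \<open>1 / ln N\<close> become summable
  in \<open>j\<close>.\<close>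

lemma interpolate_along_squares:
  fixes a :: "nat \<Rightarrow> complex"
  assumes lip: "\<And>M N. 1 \<le> M \<Longrightarrow> M \<le> N \<Longrightarrow> cmod (a N - a M) \<le> 2 * (ln (real N) - ln (real M))"
    and sub: "(\<lambda>j. cmod (a (2 ^ (j * j))) / ln (2 ^ (j * j))) \<longlonglongrightarrow> 0"
  shows "(\<lambda>N. a N / of_real (ln (real N))) \<longlonglongrightarrow> 0"
proof (rule LIMSEQ_I)
  fix \<epsilon> :: real assume \<epsilon>: "\<epsilon> > 0"
  obtain J1 where J1: "\<And>j. j \<ge> J1 \<Longrightarrow> cmod (a (2 ^ (j * j))) / ln (2 ^ (j * j)) < \<epsilon> / 2"
    using LIMSEQ_D[OF sub, of "\<epsilon>/2"] \<epsilon> by (auto simp: abs_less_iff)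
  obtain J2 :: nat where J2: "12 / \<epsilon> < real J2" using reals_Archimedean2 by blast
  define J where "J = max 1 (max J1 J2)"
  have "norm (a N / of_real (ln (real N)) - 0) < \<epsilon>" if N: "N \<ge> 2 ^ (J * J)" for N
  proof -
    define i where "i = (LEAST i. N < 2 ^ (i * i))"
    have "N < 2 ^ N" by (rule less_exp)
    also have "(2::nat) ^ N \<le> 2 ^ (N * N)" by (cases N) (auto intro!: power_increasing)
    finally have ex: "\<exists>i. N < 2 ^ (i * i)" by blast
    have iN: "N < 2 ^ (i * i)" unfolding i_def by (rule LeastI_ex[OF ex])
    have "i > J"
    proof (rule ccontr)
      assume "\<not> i > J"
      then have "(2::nat) ^ (i * i) \<le> 2 ^ (J * J)" by (intro power_increasing mult_mono) auto
      from le_less_trans[OF N less_le_trans[OF iN this]] show False by simp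
    qed
    define j where "j = i - 1"
    have ij: "i = Suc j" and jJ: "j \<ge> J" using \<open>i > J\<close> by (auto simp: j_def)
    have "\<not> N < 2 ^ (j * j)" unfolding i_def[symmetric] using not_less_Least[of j "\<lambda>i. N < 2 ^ (i * i)"] ij i_def by auto
    then have jN: "2 ^ (j * j) \<le> N" by simp
    have N0: "N > 0" using less_le_trans[OF _ jN, of 0] by simp
    have j1: "j \<ge> 1" "j \<ge> J1" "j \<ge> J2" using jJ by (auto simp: J_def)
    define l where "l = ln (2::real)"
    have l: "l > 0" by (simp add: l_def)
    have lj: "ln (real (2 ^ (j * j))) = real (j * j) * l" by (simp add: l_def ln_realpow)
    have lnN: "real (j * j) * l \<le> ln (real N)"
      unfolding lj[symmetric] using jN N0 by (subst ln_le_cancel_iff) (auto simp flip: of_nat_le_iff)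
    have jj: "real (j * j) * l > 0" using j1 l by simp
    then have pos: "ln (real N) > 0" using lnN by linarith
    have "real N \<le> real (2 ^ (i * i))" using iN by (simp flip: of_nat_le_iff)
    then have "ln (real N) \<le> ln (real (2 ^ (i * i)))" using pos by (subst ln_le_cancel_iff) (auto intro: gr0I)
    also have "\<dots> = real (i * i) * l" by (simp add: l_def ln_realpow)
    finally have up: "ln (real N) - ln (real (2 ^ (j * j))) \<le> (2 * real j + 1) * l"
      unfolding lj by (simp add: ij algebra_simps)
    have "cmod (a N) \<le> cmod (a (2 ^ (j * j))) + cmod (a N - a (2 ^ (j * j)))" by (rule norm_triangle_sub)
    also have "\<dots> \<le> cmod (a (2 ^ (j * j))) + 2 * ((2 * real j + 1) * l)"
      using order_trans[OF lip[OF _ jN] mult_left_mono[OF up]] by simp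
    finally have "cmod (a N) / ln (real N) \<le> (cmod (a (2 ^ (j * j))) + 2 * ((2 * real j + 1) * l)) / ln (real N)"
      using pos by (intro divide_right_mono) auto
    also have "\<dots> \<le> (cmod (a (2 ^ (j * j))) + 2 * ((2 * real j + 1) * l)) / (real (j * j) * l)"
      using lnN jj l pos j1 by (intro divide_left_mono mult_pos_pos add_nonneg_nonneg) auto
    also have "\<dots> = cmod (a (2 ^ (j * j))) / (real (j * j) * l) + 2 * (2 * real j + 1) / (real (j * j))"
      using l by (simp add: add_divide_distrib)
    also have "cmod (a (2 ^ (j * j))) / (real (j * j) * l) < \<epsilon> / 2"
      using J1[OF j1(2)] lj by simp
    also have "2 * (2 * real j + 1) / (real (j * j)) \<le> 6 / real j"
      using j1 by (simp add: field_simps)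
    also have "6 / real j \<le> \<epsilon> / 2"
    proof -
      have "12 / \<epsilon> < real j" using J2 j1(3) by linarith
      then show ?thesis using \<epsilon> j1 by (simp add: field_simps)
    qed
    finally show ?thesis using pos by (simp add: norm_divide)
  qed
  then show "\<exists>no. \<forall>n\<ge>no. norm (a n / of_real (ln (real n)) - 0) < \<epsilon>" by blast
qed

section \<open>Almost sure convergence from decaying covariances\<close>

lemma sum_powr_le:
  fixes \<kappa> :: real
  assumes \<kappa>: "0 < \<kappa>" "\<kappa> \<le> 1"
  shows "(\<Sum>k=1..n. real k powr (\<kappa> - 1)) \<le> 1 / \<kappa> * real n powr \<kappa>"
proof (induction n)
  case (Suc n)
  have "\<kappa> * real (Suc n) powr (\<kappa> - 1) \<le> real (Suc n) powr \<kappa> - real n powr \<kappa>"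
  proof (cases "n = 0")
    case False
    have "\<exists>z. real n < z \<and> z < real (Suc n) \<and> real (Suc n) powr \<kappa> - real n powr \<kappa> = (real (Suc n) - real n) * (\<kappa> * z powr (\<kappa> - 1))"
      using False by (intro MVT2) (auto intro!: derivative_eq_intros)
    then obtain z where z: "real n < z" "z < real (Suc n)" "real (Suc n) powr \<kappa> - real n powr \<kappa> = \<kappa> * z powr (\<kappa> - 1)"
      by auto
    have "real (Suc n) powr (\<kappa> - 1) \<le> z powr (\<kappa> - 1)" using z \<kappa> False by (intro powr_mono2') auto
    then show ?thesis using z \<kappa> by simp
  qed (use \<kappa> in simp)
  then have "real (Suc n) powr (\<kappa> - 1) \<le> 1 / \<kappa> * (real (Suc n) powr \<kappa> - real n powr \<kappa>)"
    using \<kappa> by (simp add: field_simps)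
  then show ?case using Suc by (simp add: algebra_simps)
qed simp

lemma double_sum_symmetric_le:
  fixes c :: "nat \<Rightarrow> nat \<Rightarrow> real"
  assumes sym: "\<And>j k. c j k = c k j" and nonneg: "\<And>j k. c j k \<ge> 0"
  shows "(\<Sum>j=1..N. \<Sum>k=1..N. c j k) \<le> 2 * (\<Sum>n=1..N. \<Sum>k=1..n. c n k)"
proof (induction N)
  case (Suc N)
  have "(\<Sum>j=1..Suc N. \<Sum>k=1..Suc N. c j k) = (\<Sum>j=1..N. \<Sum>k=1..N. c j k) + (\<Sum>j=1..N. c j (Suc N)) + (\<Sum>k=1..Suc N. c (Suc N) k)"
    by (simp add: sum.distrib)
  also have "(\<Sum>j=1..N. c j (Suc N)) = (\<Sum>k=1..N. c (Suc N) k)" by (intro sum.cong sym) auto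
  also have "\<dots> \<le> (\<Sum>k=1..Suc N. c (Suc N) k)" using nonneg by simp
  finally show ?case using Suc by simp
qed simp

lemma measurable_cnj [measurable]: "cnj \<in> borel_measurable borel"
  by (intro borel_measurable_continuous_onI continuous_intros)

text \<open>With the weights \<open>1 / k\<close>, the covariance bound sums over
  \<open>k \<le> n\<close> to a multiple of \<open>1 / n\<close>, for every
  \<open>\<kappa> > 0\<close>, so the second moment is \<open>O(ln N)\<close> and not just
  \<open>O((ln N)\<^sup>2)\<close>. After normalization, its sum along the times
  \<open>2 ^ (j * j)\<close> is finite, and an integrable series of nonnegative functions has terms
  tending to 0 almost everywhere.\<close>

theorem (in prob_space) log_average_AE:
  fixes Z :: "nat \<Rightarrow> 'a \<Rightarrow> complex"
  assumes meas[measurable]: "\<And>k. Z k \<in> borel_measurable M"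
    and bdd: "\<And>k x. cmod (Z k x) \<le> 2"
    and \<kappa>: "0 < \<kappa>" "\<kappa> \<le> 1" and C: "C \<ge> 0"
    and cov: "\<And>n k. k0 \<le> k \<Longrightarrow> 1 \<le> k \<Longrightarrow> k \<le> n \<Longrightarrow> cmod (\<integral>x. Z n x * cnj (Z k x) \<partial>M) \<le> C * (real k / real n) powr \<kappa>"
  shows "AE x in M. (\<lambda>N. (\<Sum>k=1..N. Z k x / of_nat k) / of_real (ln (real N))) \<longlonglongrightarrow> 0"
proof -
  \<comment> \<open>The covariance bound starts at \<open>k0\<close>. Earlier terms are set to 0 and
    restored at the end, as they do not affect the limit.\<close>
  define Z' where "Z' k x = (if k0 \<le> k then Z k x else 0)" for k x
  have meas'[measurable]: "Z' k \<in> borel_measurable M" for k unfolding Z'_def by measurable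
  have bdd': "cmod (Z' k x) \<le> 2" for k x using bdd by (simp add: Z'_def)
  define T where "T N x = (\<Sum>k=1..N. Z' k x / of_nat k)" for N x
  have [measurable]: "T N \<in> borel_measurable M" for N unfolding T_def by measurable
  have lip: "cmod (T N x - T K x) \<le> 2 * (ln (real N) - ln (real K))" if "1 \<le> K" "K \<le> N" for N K x
  proof -
    have "T N x = T K x + (\<Sum>k=Suc K..N. Z' k x / of_nat k)"
      unfolding T_def using that sum.ub_add_nat[of 1 K "\<lambda>k. Z' k x / of_nat k" "N - K"] by simp
    then have "cmod (T N x - T K x) = cmod (\<Sum>k=Suc K..N. Z' k x / of_nat k)" by simp
    also have "\<dots> \<le> (\<Sum>k=Suc K..N. 2 * (1 / real k))"
      using bdd' by (intro sum_norm_le) (auto simp: norm_divide intro: divide_right_mono)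
    also have "\<dots> \<le> 2 * (ln (real N) - ln (real K))"
      unfolding sum_distrib_left[symmetric] by (intro mult_left_mono sum_inverse_le_ln_diff that) auto
    finally show ?thesis .
  qed
  have int: "integrable M (\<lambda>x. Z' j x * cnj (Z' k x))" for j k
  proof (rule integrable_const_bound[of _ "2 * 2"])
    show "AE x in M. cmod (Z' j x * cnj (Z' k x)) \<le> 2 * 2"
      unfolding norm_mult complex_mod_cnj by (intro AE_I2 mult_mono bdd') auto
  qed measurable
  define c where "c j k = cmod (\<integral>x. Z' j x * cnj (Z' k x) \<partial>M) / (real j * real k)" for j k
  have c_sym: "c j k = c k j" for j k
  proof -
    have "(\<integral>x. Z' j x * cnj (Z' k x) \<partial>M) = cnj (\<integral>x. Z' k x * cnj (Z' j x) \<partial>M)"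
      using integral_bounded_linear[OF bounded_linear_cnj int[of k j]] by (simp add: mult.commute)
    then show ?thesis by (simp add: c_def mult.commute)
  qed
  have c_le: "c n k \<le> C * (1 / real n) * (real n powr - \<kappa> * real k powr (\<kappa> - 1))" if "1 \<le> k" "k \<le> n" for n k
  proof -
    have "cmod (\<integral>x. Z' n x * cnj (Z' k x) \<partial>M) \<le> C * (real k / real n) powr \<kappa>"
    proof (cases "k0 \<le> k")
      case True
      then have "Z' n = Z n" "Z' k = Z k" using that by (auto simp: Z'_def)
      then show ?thesis using cov[OF True that] by simp
    qed (use C in \<open>simp add: Z'_def\<close>)
    then have "c n k \<le> C * (real k / real n) powr \<kappa> / (real n * real k)"
      unfolding c_def by (intro divide_right_mono) auto
    also have "\<dots> = C * (1 / real n) * (real n powr - \<kappa> * real k powr (\<kappa> - 1))"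
      using that by (simp add: powr_divide powr_diff powr_minus field_simps)
    finally show ?thesis .
  qed
  have second_moment: "(\<integral>x. (cmod (T N x))\<^sup>2 \<partial>M) \<le> 2 * C / \<kappa> * harm N" for N
  proof -
    have sq: "of_real ((cmod (T N x))\<^sup>2) = (\<Sum>j=1..N. \<Sum>k=1..N. (Z' j x * cnj (Z' k x)) / (of_nat j * of_nat k))" for x
    proof -
      have "of_real ((cmod (T N x))\<^sup>2) = T N x * cnj (T N x)" by (rule complex_norm_square)
      also have "\<dots> = (\<Sum>j=1..N. \<Sum>k=1..N. (Z' j x / of_nat j) * (cnj (Z' k x) / of_nat k))"
        unfolding T_def by (simp add: sum_product)
      finally show ?thesis by simp
    qed
    have "complex_of_real (\<integral>x. (cmod (T N x))\<^sup>2 \<partial>M) = (\<integral>x. complex_of_real ((cmod (T N x))\<^sup>2) \<partial>M)"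
      by (rule integral_complex_of_real[symmetric])
    also have "\<dots> = (\<Sum>j=1..N. \<Sum>k=1..N. (\<integral>x. Z' j x * cnj (Z' k x) \<partial>M) / (of_nat j * of_nat k))"
      unfolding sq using int by (simp add: Bochner_Integration.integral_sum)
    finally have "(\<integral>x. (cmod (T N x))\<^sup>2 \<partial>M) = Re (\<Sum>j=1..N. \<Sum>k=1..N. (\<integral>x. Z' j x * cnj (Z' k x) \<partial>M) / (of_nat j * of_nat k))"
      by (metis Re_complex_of_real)
    also have "\<dots> \<le> cmod (\<Sum>j=1..N. \<Sum>k=1..N. (\<integral>x. Z' j x * cnj (Z' k x) \<partial>M) / (of_nat j * of_nat k))"
      by (rule complex_Re_le_cmod)
    also have "\<dots> \<le> (\<Sum>j=1..N. \<Sum>k=1..N. c j k)"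
      by (intro sum_norm_le) (simp add: c_def norm_divide norm_mult)
    also have "\<dots> \<le> 2 * (\<Sum>n=1..N. \<Sum>k=1..n. c n k)"
      by (intro double_sum_symmetric_le c_sym) (simp add: c_def)
    also have "\<dots> \<le> 2 * (\<Sum>n=1..N. C / \<kappa> * (1 / real n))"
    proof (intro mult_left_mono sum_mono)
      fix n assume n: "n \<in> {1..N}"
      have "(\<Sum>k=1..n. c n k) \<le> (\<Sum>k=1..n. C * (1 / real n) * (real n powr - \<kappa> * real k powr (\<kappa> - 1)))"
        by (intro sum_mono c_le) auto
      also have "\<dots> = C * (1 / real n) * (real n powr - \<kappa> * (\<Sum>k=1..n. real k powr (\<kappa> - 1)))"
        by (simp only: sum_distrib_left)
      also have "\<dots> \<le> C * (1 / real n) * (real n powr - \<kappa> * (1 / \<kappa> * real n powr \<kappa>))"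
        using C by (intro mult_left_mono sum_powr_le \<kappa>) auto
      also have "\<dots> = C / \<kappa> * (1 / real n)" using n by (simp add: powr_minus field_simps)
      finally show "(\<Sum>k=1..n. c n k) \<le> C / \<kappa> * (1 / real n)" .
    qed auto
    also have "\<dots> = 2 * C / \<kappa> * harm N" by (simp add: harm_def sum_distrib_left inverse_eq_divide)
    finally show ?thesis .
  qed
  define l where "l = ln (2::real)"
  have l: "l > 0" by (simp add: l_def)
  \<comment> \<open>\<open>Suc j\<close> avoids the time \<open>2 ^ 0\<close>, whose logarithm is
    0.\<close>
  define X where "X j x = (cmod (T (2 ^ (Suc j * Suc j)) x) / ln (2 ^ (Suc j * Suc j)))\<^sup>2" for j x
  have [measurable]: "X j \<in> borel_measurable M" for j unfolding X_def by measurable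
  have lnj: "ln (2 ^ (Suc j * Suc j)) = real (Suc j * Suc j) * l" for j :: nat by (simp only: ln_realpow l_def)
  have X_int: "(\<integral>\<^sup>+x. ennreal (X j x) \<partial>M) \<le> ennreal (2 * C / \<kappa> * (1 + l) / l\<^sup>2 * (1 / real (Suc j) ^ 2))" for j
  proof -
    define N :: nat where "N = 2 ^ (Suc j * Suc j)"
    define L where "L = real (Suc j * Suc j) * l"
    have L: "L > 0" unfolding L_def using l by (intro mult_pos_pos) (simp_all add: add_pos_nonneg)
    have N1: "N \<ge> 1" by (simp add: N_def)
    have lnN: "ln (real N) = L" using lnj[of j] by (simp add: N_def L_def)
    have "integrable M (\<lambda>x. (cmod (T N x))\<^sup>2)"
    proof (rule integrable_const_bound[of _ "(2 * harm N)\<^sup>2"])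
      have "cmod (T N x) \<le> 2 * harm N" for x
        unfolding T_def harm_def sum_distrib_left using bdd'
        by (intro sum_norm_le) (auto simp: norm_divide inverse_eq_divide intro: divide_right_mono)
      from power_mono[OF this, where n = 2]
      show "AE x in M. norm ((cmod (T N x))\<^sup>2) \<le> (2 * harm N)\<^sup>2" by (intro AE_I2) simp
    qed measurable
    then have "(\<integral>\<^sup>+x. ennreal (X j x) \<partial>M) = ennreal (\<integral>x. X j x \<partial>M)"
      unfolding X_def N_def[symmetric]
      by (intro nn_integral_eq_integral) (auto simp: power_divide)
    also have "(\<integral>x. X j x \<partial>M) = (\<integral>x. (cmod (T N x))\<^sup>2 \<partial>M) / L\<^sup>2"
      unfolding X_def N_def[symmetric] lnj L_def[symmetric] power_divide by simp
    also have "\<dots> \<le> (2 * C / \<kappa> * (1 + L)) / L\<^sup>2"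
    proof (rule divide_right_mono)
      have "2 * C / \<kappa> * harm N \<le> 2 * C / \<kappa> * (1 + L)"
        using harm_le_ln[OF N1] C \<kappa> unfolding lnN by (intro mult_left_mono) auto
      then show "(\<integral>x. (cmod (T N x))\<^sup>2 \<partial>M) \<le> 2 * C / \<kappa> * (1 + L)" using second_moment[of N] by simp
    qed simp
    also have "\<dots> \<le> 2 * C / \<kappa> * (1 + l) / l\<^sup>2 * (1 / real (Suc j) ^ 2)"
    proof -
      define s where "s = real (Suc j)"
      have s: "s \<ge> 1" by (simp add: s_def)
      have Ls: "L = s\<^sup>2 * l" by (simp only: L_def s_def power2_eq_square of_nat_mult)
      have "1 + L \<le> s\<^sup>2 * (1 + l)" using s by (simp add: Ls algebra_simps)
      then have "(1 + L) / L\<^sup>2 \<le> s\<^sup>2 * (1 + l) / L\<^sup>2" by (intro divide_right_mono) auto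
      also have "\<dots> = (1 + l) / l\<^sup>2 * (1 / s\<^sup>2)" using s l by (simp add: Ls field_simps power2_eq_square)
      finally have "2 * C / \<kappa> * ((1 + L) / L\<^sup>2) \<le> 2 * C / \<kappa> * ((1 + l) / l\<^sup>2 * (1 / s\<^sup>2))"
        using C \<kappa> by (intro mult_left_mono) auto
      then show ?thesis by (simp add: s_def)
    qed
    finally show ?thesis by (simp add: ennreal_leI)
  qed
  have sm: "summable (\<lambda>j. 2 * C / \<kappa> * (1 + l) / l\<^sup>2 * (1 / real (Suc j) ^ 2))"
    using inverse_power_summable[of 2, where 'a = real]
    by (intro summable_mult) (subst summable_Suc_iff[of "\<lambda>j. 1 / real j ^ 2"], simp add: inverse_eq_divide)
  have "(\<integral>\<^sup>+x. (\<Sum>j. ennreal (X j x)) \<partial>M) = (\<Sum>j. \<integral>\<^sup>+x. ennreal (X j x) \<partial>M)"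
    by (rule nn_integral_suminf) measurable
  also have "\<dots> \<le> (\<Sum>j. ennreal (2 * C / \<kappa> * (1 + l) / l\<^sup>2 * (1 / real (Suc j) ^ 2)))"
    by (intro suminf_le X_int) auto
  also have "\<dots> = ennreal (\<Sum>j. 2 * C / \<kappa> * (1 + l) / l\<^sup>2 * (1 / real (Suc j) ^ 2))"
    using C \<kappa> l by (intro suminf_ennreal2 sm) auto
  finally have "(\<integral>\<^sup>+x. (\<Sum>j. ennreal (X j x)) \<partial>M) \<noteq> \<infinity>" by (auto simp: top_unique)
  then have "AE x in M. (\<Sum>j. ennreal (X j x)) \<noteq> \<infinity>"
    by (intro nn_integral_noteq_infinite) measurable
  then show ?thesis
  proof eventually_elim
    case (elim x)
    have "summable (\<lambda>j. X j x)"
      by (rule summable_suminf_not_top) (use elim in \<open>auto simp: X_def\<close>)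
    then have "(\<lambda>j. X j x) \<longlonglongrightarrow> 0" by (rule summable_LIMSEQ_zero)
    then have "(\<lambda>j. sqrt (X j x)) \<longlonglongrightarrow> sqrt 0" by (intro tendsto_intros)
    then have "(\<lambda>j. cmod (T (2 ^ (Suc j * Suc j)) x) / ln (2 ^ (Suc j * Suc j))) \<longlonglongrightarrow> 0"
      unfolding X_def lnj using l by (simp add: real_sqrt_abs)
    then have "(\<lambda>j. cmod (T (2 ^ (j * j)) x) / ln (2 ^ (j * j))) \<longlonglongrightarrow> 0"
      by (rule LIMSEQ_imp_Suc)
    then have T0: "(\<lambda>N. T N x / of_real (ln (real N))) \<longlonglongrightarrow> 0"
      using lip by (intro interpolate_along_squares[of "\<lambda>N. T N x"]) auto
    have "(\<lambda>k. Z k x - Z' k x) \<longlonglongrightarrow> 0"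
      by (rule tendsto_eventually) (use eventually_ge_at_top[of k0] in \<open>eventually_elim, simp add: Z'_def\<close>)
    then have "(\<lambda>N. (\<Sum>k=1..N. (Z k x - Z' k x) / of_nat k) / of_real (ln (real N))) \<longlonglongrightarrow> 0"
      by (rule log_average_null)
    from tendsto_add[OF T0 this] show ?case
      by (simp add: T_def add_divide_distrib[symmetric] sum.distrib[symmetric])
  qed
qed

section \<open>Weak convergence of logarithmic averages\<close>

text \<open>As \<open>j\<close> grows it tends to 1, so it detects escaping mass; and it is a
  Gaussian average of characters, so its averages follow from characteristic functions at almost
  every point.\<close>

definition gauss_bump :: "nat \<Rightarrow> real \<Rightarrow> real" where
  "gauss_bump j x = exp (- (x / real (Suc j))\<^sup>2 / 2)"

lemma gauss_bump_bounds: "0 \<le> gauss_bump j x" "gauss_bump j x \<le> 1"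
  by (simp_all add: gauss_bump_def)

lemma measurable_gauss_bump [measurable]: "gauss_bump j \<in> borel_measurable borel"
  unfolding gauss_bump_def[abs_def] by measurable

lemma gauss_bump_small:
  assumes "\<epsilon> > 0"
  shows "\<exists>R\<ge>0. \<forall>x. R \<le> \<bar>x\<bar> \<longrightarrow> gauss_bump j x \<le> \<epsilon>"
proof -
  define s where "s = sqrt (2 * \<bar>ln \<epsilon>\<bar>)"
  have s: "s\<^sup>2 / 2 = \<bar>ln \<epsilon>\<bar>" "s \<ge> 0" by (simp_all add: s_def)
  have "gauss_bump j x \<le> \<epsilon>" if "real (Suc j) * s \<le> \<bar>x\<bar>" for x
  proof -
    have "s \<le> \<bar>x\<bar> / real (Suc j)" using that by (simp add: field_simps)
    then have "s\<^sup>2 \<le> (\<bar>x\<bar> / real (Suc j))\<^sup>2" using s by (intro power_mono) auto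
    then have "s\<^sup>2 \<le> (x / real (Suc j))\<^sup>2" by (simp add: power_divide)
    then have "- (x / real (Suc j))\<^sup>2 / 2 \<le> ln \<epsilon>" using s(1) by linarith
    then have "gauss_bump j x \<le> exp (ln \<epsilon>)" unfolding gauss_bump_def by simp
    then show ?thesis using assms by simp
  qed
  then show ?thesis using s by (intro exI[of _ "real (Suc j) * s"]) auto
qed

lemma (in real_distribution) integral_gauss_bump_tendsto: "(\<lambda>j. \<integral>x. gauss_bump j x \<partial>M) \<longlonglongrightarrow> 1"
proof -
  have "(\<lambda>j. \<integral>x. gauss_bump j x \<partial>M) \<longlonglongrightarrow> (\<integral>x. 1 \<partial>M)"
  proof (rule integral_dominated_convergence[where w = "\<lambda>_. 1"])
    show "AE x in M. (\<lambda>j. gauss_bump j x) \<longlonglongrightarrow> 1"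
    proof (intro AE_I2)
      fix x
      have "(\<lambda>j. x / real (Suc j)) \<longlonglongrightarrow> 0"
        by (rule real_tendsto_divide_at_top[OF tendsto_const])
           (rule filterlim_compose[OF filterlim_real_sequentially filterlim_Suc])
      then have "(\<lambda>j. exp (- (x / real (Suc j))\<^sup>2 / 2)) \<longlonglongrightarrow> exp (- 0\<^sup>2 / 2)"
        by (intro tendsto_intros) auto
      then show "(\<lambda>j. gauss_bump j x) \<longlonglongrightarrow> 1" by (simp add: gauss_bump_def)
    qed
  qed (use gauss_bump_bounds in auto)
  then show ?thesis by (simp add: prob_space del: space_eq_univ)
qed

lemma (in real_distribution) measure_interval_tendsto:
  "(\<lambda>k. measure M {- real k<..real k}) \<longlonglongrightarrow> 1"
proof -
  have U: "(\<Union>k. {- real k<..real k}) = (UNIV :: real set)"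
  proof (intro equalityI subsetI UNIV_I)
    fix x :: real
    obtain k where "\<bar>x\<bar> < real k" using reals_Archimedean2 by blast
    then show "x \<in> (\<Union>k. {- real k<..real k})" by (intro UN_I[of k]) auto
  qed
  have "(\<lambda>k. measure M {- real k<..real k}) \<longlonglongrightarrow> measure M (\<Union>k. {- real k<..real k})"
    by (intro finite_Lim_measure_incseq) (auto simp: incseq_def)
  then show ?thesis using prob_space unfolding U by simp
qed

text \<open>A bump is at most the indicator of a large interval plus \<open>\<epsilon> / 2\<close>,
  so a bump integral close to 1 forces mass on that interval. This settles all large
  \<open>n\<close>; the finitely many others are tight one by one.\<close>

lemma tight_of_gauss_bumps:
  assumes rd: "\<And>n. real_distribution (\<mu> n)" and \<nu>: "real_distribution \<nu>"
    and bump: "\<And>j. (\<lambda>n. \<integral>x. gauss_bump j x \<partial>\<mu> n) \<longlonglongrightarrow> (\<integral>x. gauss_bump j x \<partial>\<nu>)"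
  shows "tight \<mu>"
  unfolding tight_def
proof (intro conjI allI impI rd)
  fix \<epsilon> :: real assume \<epsilon>: "\<epsilon> > 0"
  interpret \<mu>: real_distribution "\<mu> n" for n by (rule rd)
  interpret \<nu>: real_distribution \<nu> by (rule \<nu>)
  have "\<forall>\<^sub>F j in sequentially. 1 - \<epsilon> / 2 < (\<integral>x. gauss_bump j x \<partial>\<nu>)"
    using \<epsilon> by (intro order_tendstoD(1)[OF \<nu>.integral_gauss_bump_tendsto]) auto
  then obtain j where "1 - \<epsilon> / 2 < (\<integral>x. gauss_bump j x \<partial>\<nu>)"
    by (auto simp: eventually_sequentially)
  then have "\<forall>\<^sub>F n in sequentially. 1 - \<epsilon> / 2 < (\<integral>x. gauss_bump j x \<partial>\<mu> n)"
    by (rule order_tendstoD(1)[OF bump])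
  then obtain N where N: "\<And>n. n \<ge> N \<Longrightarrow> 1 - \<epsilon> / 2 < (\<integral>x. gauss_bump j x \<partial>\<mu> n)"
    by (auto simp: eventually_sequentially)
  obtain R where R: "R \<ge> 0" "\<And>x. R \<le> \<bar>x\<bar> \<Longrightarrow> gauss_bump j x \<le> \<epsilon> / 2"
    using gauss_bump_small[of "\<epsilon> / 2" j] \<epsilon> by auto
  have large: "1 - \<epsilon> < measure (\<mu> n) {- R'<..R'}" if n: "n \<ge> N" and R': "R \<le> R'" for n R'
  proof -
    have "(\<integral>x. gauss_bump j x \<partial>\<mu> n) \<le> (\<integral>x. indicator {- R'<..R'} x + \<epsilon> / 2 \<partial>\<mu> n)"
    proof (rule integral_mono)
      have "integrable (\<mu> n) (indicator {- R'<..R'} :: real \<Rightarrow> real)"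
        by (rule \<mu>.integrable_const_bound[of _ 1]) auto
      then show "integrable (\<mu> n) (\<lambda>x. indicator {- R'<..R'} x + \<epsilon> / 2)" by auto
      show "integrable (\<mu> n) (gauss_bump j)"
        by (rule \<mu>.integrable_const_bound[of _ 1]) (use gauss_bump_bounds in auto)
      show "gauss_bump j x \<le> indicator {- R'<..R'} x + \<epsilon> / 2" for x
        using R(2)[of x] R' gauss_bump_bounds[of j x] \<epsilon> by (auto simp: indicator_def abs_if split: if_splits)
    qed
    also have "\<dots> = measure (\<mu> n) {- R'<..R'} + \<epsilon> / 2"
      by (subst Bochner_Integration.integral_add)
         (auto intro!: \<mu>.integrable_const_bound[of _ 1] simp: \<mu>.prob_space simp del: \<mu>.space_eq_univ)
    finally show ?thesis using N[OF n] by simp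
  qed
  have "\<forall>\<^sub>F k in sequentially. \<forall>n\<in>{..<N}. 1 - \<epsilon> < measure (\<mu> n) {- real k<..real k}"
    using \<epsilon> by (intro eventually_ball_finite ballI order_tendstoD(1)[OF \<mu>.measure_interval_tendsto]) auto
  moreover have "\<forall>\<^sub>F k in sequentially. nat \<lceil>R\<rceil> + 1 \<le> k" by (rule eventually_ge_at_top)
  ultimately have "\<forall>\<^sub>F k in sequentially. - real k < real k \<and> (\<forall>n. 1 - \<epsilon> < measure (\<mu> n) {- real k<..real k})"
  proof eventually_elim
    case (elim k)
    have "R \<le> real k" "k > 0" using elim(2) R(1) by linarith+
    then show ?case using elim(1) large by (auto simp: not_less) (metis lessThan_iff linorder_not_le)
  qed
  from eventually_happens'[OF sequentially_bot this]
  show "\<exists>a b. a < b \<and> (\<forall>n. 1 - \<epsilon> < measure (\<mu> n) {a<..b})" by blast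
qed

text \<open>
  The Gaussian bumps give tightness; then the characteristic functions at rational points suffice.
\<close>

lemma weak_conv_of_char_rationals:
  assumes rd: "\<And>n. real_distribution (\<mu> n)" and \<nu>: "real_distribution \<nu>"
    and chars: "\<And>t. t \<in> \<rat> \<Longrightarrow> (\<lambda>n. char (\<mu> n) t) \<longlonglongrightarrow> char \<nu> t"
    and bump: "\<And>j. (\<lambda>n. \<integral>x. gauss_bump j x \<partial>\<mu> n) \<longlonglongrightarrow> (\<integral>x. gauss_bump j x \<partial>\<nu>)"
  shows "weak_conv_m \<mu> \<nu>"
proof (rule tight_subseq_weak_converge[OF rd \<nu> tight_of_gauss_bumps[OF rd \<nu> bump]])
  fix s \<nu>' assume s: "strict_mono (s :: nat \<Rightarrow> nat)" and \<nu>': "real_distribution \<nu>'"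
    and w: "weak_conv_m (\<mu> \<circ> s) \<nu>'"
  interpret \<nu>: real_distribution \<nu> by (rule \<nu>)
  interpret \<nu>': real_distribution \<nu>' by (rule \<nu>')
  have "char \<nu>' t = char \<nu> t" if "t \<in> \<rat>" for t
  proof (rule LIMSEQ_unique)
    show "(\<lambda>n. char ((\<mu> \<circ> s) n) t) \<longlonglongrightarrow> char \<nu>' t"
      by (rule levy_continuity1[OF _ \<nu>' w]) (simp add: rd)
    show "(\<lambda>n. char ((\<mu> \<circ> s) n) t) \<longlonglongrightarrow> char \<nu> t"
      using LIMSEQ_subseq_LIMSEQ[OF chars[OF that] s] by (simp add: o_def)
  qed
  then have sub: "\<rat> \<subseteq> {t. char \<nu>' t = char \<nu> t}" by auto
  have "closed {t. char \<nu>' t = char \<nu> t}"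
    by (intro closed_Collect_eq continuous_at_imp_continuous_on ballI \<nu>.isCont_char \<nu>'.isCont_char)
  then have "char \<nu>' t = char \<nu> t" for t
    using closure_minimal[OF sub] unfolding Rats_closure_real by auto
  then have "\<nu>' = \<nu>" by (intro Levy_uniqueness \<nu> \<nu>' ext)
  then show "weak_conv_m (\<mu> \<circ> s) \<nu>" using w by simp
qed

section \<open>Logarithmic averages and their characteristic functions\<close>

lemma integral_distr_point_measure:
  fixes g :: "real \<Rightarrow> 'b::{banach, second_countable_topology}"
  assumes "finite A" "\<And>a. a \<in> A \<Longrightarrow> 0 \<le> w a" and [measurable]: "g \<in> borel_measurable borel"
  shows "(\<integral>x. g x \<partial>distr (point_measure A (\<lambda>a. ennreal (w a))) borel y) = (\<Sum>a\<in>A. w a *\<^sub>R g (y a))"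
  using assms(1,2) by (subst integral_distr) (auto simp: lebesgue_integral_point_measure_finite)

lemma integral_log_average:
  fixes g :: "real \<Rightarrow> 'b::{banach, second_countable_topology}"
  assumes "g \<in> borel_measurable borel"
  shows "(\<integral>x. g x \<partial>log_average y N) = (1 / ln (real N)) *\<^sub>R (\<Sum>k=1..N. (1 / real k) *\<^sub>R g (y k))"
  unfolding log_average_def
proof (subst integral_distr_point_measure)
  show "0 \<le> 1 / ln (real N) * (1 / real a)" if "a \<in> {1..N}" for a using that by simp
qed (use assms in \<open>auto simp: scaleR_right.sum\<close>)

text \<open>The averages have mass \<open>harm N / ln N\<close>. Normalizing by \<open>harm\<close>
  gives probability measures, to which Levy's theory applies, and the ratio of the two
  normalizations tends to 1. The shift by \<open>Suc\<close> avoids the empty average.\<close>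

lemma converges_weakly_log_average:
  assumes \<nu>: "real_distribution \<nu>"
    and chars: "\<And>t. t \<in> \<rat> \<Longrightarrow> (\<lambda>N. (\<Sum>k=1..N. iexp (t * y k) / of_nat k) / of_real (ln (real N))) \<longlonglongrightarrow> char \<nu> t"
    and bump: "\<And>j. (\<lambda>N. (\<Sum>k=1..N. gauss_bump j (y k) / real k) / ln (real N)) \<longlonglongrightarrow> (\<integral>x. gauss_bump j x \<partial>\<nu>)"
  shows "converges_weakly (log_average y) \<nu>"
proof -
  define h where "h N = (harm (Suc N) :: real)" for N
  have h: "h N > 0" for N unfolding h_def by (intro harm_pos) simp
  define \<mu> where "\<mu> N = distr (point_measure {1..Suc N} (\<lambda>k. ennreal (1 / (h N * real k)))) borel y" for N
  have int\<mu>: "(\<integral>x. g x \<partial>\<mu> N) = (1 / h N) *\<^sub>R (\<Sum>k=1..Suc N. (1 / real k) *\<^sub>R g (y k))"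
    if "g \<in> borel_measurable borel" for g :: "real \<Rightarrow> 'b::{banach, second_countable_topology}" and N
  proof -
    have "(\<integral>x. g x \<partial>\<mu> N) = (\<Sum>k=1..Suc N. (1 / (h N * real k)) *\<^sub>R g (y k))"
      unfolding \<mu>_def using h[of N] that by (intro integral_distr_point_measure) auto
    then show ?thesis by (simp only: scaleR_sum_right scaleR_scaleR times_divide_times_eq mult_1)
  qed
  have rd: "real_distribution (\<mu> N)" for N
  proof -
    have "prob_space (\<mu> N)"
    proof
      have "emeasure (\<mu> N) (space (\<mu> N)) = emeasure (point_measure {1..Suc N} (\<lambda>k. ennreal (1 / (h N * real k)))) {1..Suc N}"
        unfolding \<mu>_def by (subst emeasure_distr) (auto simp: space_point_measure)
      also have "\<dots> = (\<Sum>k=1..Suc N. ennreal (1 / (h N * real k)))"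
        by (subst emeasure_point_measure_finite) auto
      also have "\<dots> = ennreal (\<Sum>k=1..Suc N. 1 / (h N * real k))"
        using h[of N] by (intro sum_ennreal) auto
      also have "(\<Sum>k=1..Suc N. 1 / (h N * real k)) = (1 / h N) * (\<Sum>k=1..Suc N. 1 / real k)"
        unfolding sum_distrib_left by simp
      also have "(\<Sum>k=1..Suc N. 1 / real k) = h N" by (simp add: h_def harm_def inverse_eq_divide)
      finally show "emeasure (\<mu> N) (space (\<mu> N)) = 1" using h[of N] by simp
    qed
    then show ?thesis by (simp add: real_distribution_def real_distribution_axioms_def \<mu>_def)
  qed
  have ratio: "(\<lambda>N. ln (real (Suc N)) / h N) \<longlonglongrightarrow> 1"
    using tendsto_inverse[OF LIMSEQ_Suc[OF harm_over_ln_tendsto]] by (simp add: h_def)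
  have ln0: "\<forall>\<^sub>F N in sequentially. ln (real (Suc N)) \<noteq> 0"
    using eventually_gt_at_top[of 1] by eventually_elim simp
  have "weak_conv_m \<mu> \<nu>"
  proof (rule weak_conv_of_char_rationals[OF rd \<nu>])
    fix t :: real assume t: "t \<in> \<rat>"
    have "(\<lambda>N. of_real (ln (real (Suc N)) / h N) * ((\<Sum>k=1..Suc N. iexp (t * y k) / of_nat k) / of_real (ln (real (Suc N))))) \<longlonglongrightarrow> of_real 1 * char \<nu> t"
      by (intro tendsto_mult tendsto_of_real ratio LIMSEQ_Suc chars t)
    moreover have "\<forall>\<^sub>F N in sequentially. of_real (ln (real (Suc N)) / h N) * ((\<Sum>k=1..Suc N. iexp (t * y k) / of_nat k) / of_real (ln (real (Suc N)))) = char (\<mu> N) t"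
      using ln0
    proof eventually_elim
      case (elim N)
      have "char (\<mu> N) t = (1 / h N) *\<^sub>R (\<Sum>k=1..Suc N. (1 / real k) *\<^sub>R iexp (t * y k))"
        unfolding char_def by (rule int\<mu>) measurable
      also have "(\<Sum>k=1..Suc N. (1 / real k) *\<^sub>R iexp (t * y k)) = (\<Sum>k=1..Suc N. iexp (t * y k) / of_nat k)"
        by (intro sum.cong) (auto simp: scaleR_conv_of_real)
      finally show ?case using elim h[of N] by (simp add: scaleR_conv_of_real)
    qed
    ultimately show "(\<lambda>N. char (\<mu> N) t) \<longlonglongrightarrow> char \<nu> t"
      using Lim_transform_eventually by fastforce
  next
    fix j
    have "(\<lambda>N. (ln (real (Suc N)) / h N) * ((\<Sum>k=1..Suc N. gauss_bump j (y k) / real k) / ln (real (Suc N)))) \<longlonglongrightarrow> 1 * (\<integral>x. gauss_bump j x \<partial>\<nu>)"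
      by (intro tendsto_mult ratio LIMSEQ_Suc bump)
    moreover have "\<forall>\<^sub>F N in sequentially. (ln (real (Suc N)) / h N) * ((\<Sum>k=1..Suc N. gauss_bump j (y k) / real k) / ln (real (Suc N))) = (\<integral>x. gauss_bump j x \<partial>\<mu> N)"
      using ln0
    proof eventually_elim
      case (elim N)
      have "(\<integral>x. gauss_bump j x \<partial>\<mu> N) = (1 / h N) *\<^sub>R (\<Sum>k=1..Suc N. (1 / real k) *\<^sub>R gauss_bump j (y k))"
        by (rule int\<mu>) measurable
      then show ?case using elim h[of N] by simp
    qed
    ultimately show "(\<lambda>N. \<integral>x. gauss_bump j x \<partial>\<mu> N) \<longlonglongrightarrow> (\<integral>x. gauss_bump j x \<partial>\<nu>)"
      using Lim_transform_eventually by fastforce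
  qed
  show ?thesis unfolding converges_weakly_def
  proof (intro allI impI, elim conjE)
    fix g :: "real \<Rightarrow> real" assume cont: "continuous_on UNIV g" and bd: "bounded (range g)"
    have [measurable]: "g \<in> borel_measurable borel" using cont by (rule borel_measurable_continuous_onI)
    obtain b where b: "\<And>x. norm (g x) \<le> b" using bd by (auto simp: bounded_iff)
    have "(\<lambda>N. \<integral>x. g x \<partial>\<mu> N) \<longlonglongrightarrow> (\<integral>x. g x \<partial>\<nu>)"
    proof (rule weak_conv_imp_integral_bdd_continuous_conv[OF rd \<nu> \<open>weak_conv_m \<mu> \<nu>\<close>])
      show "isCont g x" for x using cont by (simp add: continuous_on_eq_continuous_at)
    qed (rule b)
    then have "(\<lambda>N. inverse (ln (real (Suc N)) / h N) * (\<integral>x. g x \<partial>\<mu> N)) \<longlonglongrightarrow> inverse 1 * (\<integral>x. g x \<partial>\<nu>)"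
      by (intro tendsto_mult tendsto_inverse ratio) auto
    moreover have "inverse (ln (real (Suc N)) / h N) * (\<integral>x. g x \<partial>\<mu> N) = (\<integral>x. g x \<partial>log_average y (Suc N))" for N
    proof -
      have aux: "inverse (l / r) * ((1 / r) *\<^sub>R S) = (1 / l) *\<^sub>R S" if "r \<noteq> 0" for l r S :: real
        using that by simp
      show ?thesis
        unfolding int\<mu>[OF \<open>g \<in> borel_measurable borel\<close>] integral_log_average[OF \<open>g \<in> borel_measurable borel\<close>]
        by (rule aux) (use h[of N] in simp)
    qed
    ultimately have "(\<lambda>N. \<integral>x. g x \<partial>log_average y (Suc N)) \<longlonglongrightarrow> (\<integral>x. g x \<partial>\<nu>)" by simp
    then show "(\<lambda>N. \<integral>x. g x \<partial>log_average y N) \<longlonglongrightarrow> (\<integral>x. g x \<partial>\<nu>)" by (rule LIMSEQ_imp_Suc)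
  qed
qed

lemma gauss_bump_eq_integral:
  "complex_of_real (gauss_bump j x) = (\<integral>t. iexp (t / real (Suc j) * x) \<partial>std_normal_distribution)"
proof -
  have "complex_of_real (gauss_bump j x) = char std_normal_distribution (x / real (Suc j))"
    unfolding char_std_normal_distribution by (simp add: gauss_bump_def)
  also have "\<dots> = (\<integral>t. iexp (t / real (Suc j) * x) \<partial>std_normal_distribution)"
    unfolding char_def by (intro Bochner_Integration.integral_cong) (auto simp: field_simps)
  finally show ?thesis .
qed

text \<open>The convergence of characters is integrated against the normal law in \<open>t\<close>,
  by dominated convergence, and Fubini turns the limit into a bump integral. Almost every
  \<open>t\<close> is enough for this.\<close>

lemma log_average_gauss_bump:
  assumes \<nu>: "real_distribution \<nu>"
    and ae: "AE t in std_normal_distribution.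
      (\<lambda>N. (\<Sum>k=1..N. iexp (t / real (Suc j) * y k) / of_nat k) / of_real (ln (real N))) \<longlonglongrightarrow> char \<nu> (t / real (Suc j))"
  shows "(\<lambda>N. (\<Sum>k=1..N. gauss_bump j (y k) / real k) / ln (real N)) \<longlonglongrightarrow> (\<integral>x. gauss_bump j x \<partial>\<nu>)"
proof -
  interpret \<nu>: real_distribution \<nu> by (rule \<nu>)
  interpret \<gamma>: real_distribution std_normal_distribution by (rule real_dist_normal_dist)
  interpret P: pair_prob_space std_normal_distribution \<nu> ..
  define c where "c N t = (\<Sum>k=1..N. iexp (t / real (Suc j) * y k) / of_nat k) / of_real (ln (real N))" for N t
  \<comment> \<open>The convergent sequence \<open>harm N / ln N\<close> supplies the dominating
    constant; at \<open>N = 1\<close> the division by \<open>ln 1 = 0\<close> gives 0.\<close>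
  obtain B where B: "\<And>N. norm (harm N / ln (real N)) \<le> (B :: real)"
    using convergent_imp_Bseq[OF convergentI[OF harm_over_ln_tendsto]] by (auto simp: Bseq_def)
  have c_le: "cmod (c N t) \<le> B" for N t
  proof -
    have "cmod (\<Sum>k=1..N. iexp (t / real (Suc j) * y k) / of_nat k) \<le> harm N"
      unfolding harm_def by (intro sum_norm_le) (auto simp: norm_divide inverse_eq_divide)
    then have "cmod (c N t) \<le> harm N / \<bar>ln (real N)\<bar>"
      unfolding c_def norm_divide norm_of_real by (intro divide_right_mono) auto
    also have "\<dots> \<le> B" using B[of N] harm_nonneg[of N, where 'a = real] by (simp add: abs_divide)
    finally show ?thesis .
  qed
  have "(\<lambda>N. \<integral>t. c N t \<partial>std_normal_distribution) \<longlonglongrightarrow> (\<integral>t. char \<nu> (t / real (Suc j)) \<partial>std_normal_distribution)"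
  proof (rule integral_dominated_convergence[where w = "\<lambda>_. B"])
    show "(\<lambda>t. char \<nu> (t / real (Suc j))) \<in> borel_measurable std_normal_distribution" by measurable
    show "c N \<in> borel_measurable std_normal_distribution" for N unfolding c_def[abs_def] by measurable
    show "integrable std_normal_distribution (\<lambda>_. B)" by simp
  qed (use ae c_le in \<open>auto simp: c_def\<close>)
  moreover have "(\<integral>t. c N t \<partial>std_normal_distribution) = of_real ((\<Sum>k=1..N. gauss_bump j (y k) / real k) / ln (real N))" for N
  proof -
    have "integrable std_normal_distribution (\<lambda>t. iexp (t / real (Suc j) * y k))" for k
      by (rule \<gamma>.integrable_const_bound[of _ 1]) auto
    then have "(\<integral>t. c N t \<partial>std_normal_distribution)
        = (\<Sum>k=1..N. (\<integral>t. iexp (t / real (Suc j) * y k) \<partial>std_normal_distribution) / of_nat k) / of_real (ln (real N))"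
      unfolding c_def by (simp add: Bochner_Integration.integral_sum)
    then show ?thesis unfolding gauss_bump_eq_integral[symmetric] by simp
  qed
  moreover have "(\<integral>t. char \<nu> (t / real (Suc j)) \<partial>std_normal_distribution) = of_real (\<integral>x. gauss_bump j x \<partial>\<nu>)"
  proof -
    have "(\<integral>t. char \<nu> (t / real (Suc j)) \<partial>std_normal_distribution) = (\<integral>t. (\<integral>x. iexp (t / real (Suc j) * x) \<partial>\<nu>) \<partial>std_normal_distribution)"
      by (simp add: char_def)
    also have "\<dots> = (\<integral>x. (\<integral>t. iexp (t / real (Suc j) * x) \<partial>std_normal_distribution) \<partial>\<nu>)"
      by (rule P.Fubini_integral[symmetric]) (auto intro!: P.integrable_const_bound[of _ 1] simp: split_beta')
    also have "\<dots> = (\<integral>x. complex_of_real (gauss_bump j x) \<partial>\<nu>)"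
      unfolding gauss_bump_eq_integral ..
    finally show ?thesis by simp
  qed
  ultimately have "(\<lambda>N. complex_of_real ((\<Sum>k=1..N. gauss_bump j (y k) / real k) / ln (real N))) \<longlonglongrightarrow> of_real (\<integral>x. gauss_bump j x \<partial>\<nu>)"
    by simp
  then show ?thesis by (simp only: tendsto_of_real_iff)
qed

text \<open>The null set in \<open>conv\<close> may depend on \<open>t\<close>. The rational
  \<open>t\<close> share one null set; beyond them, Fubini turns convergence for almost every
  \<open>x\<close>, given \<open>t\<close>, into convergence for almost every \<open>t\<close>,
  given almost every \<open>x\<close>, which suffices for the bumps.\<close>

theorem (in prob_space) almost_sure_limit_theoremI:
  assumes meas[measurable]: "\<And>k. Y k \<in> borel_measurable M" and \<nu>: "real_distribution \<nu>"
    and conv: "\<And>t. AE x in M. (\<lambda>N. (\<Sum>k=1..N. iexp (t * Y k x) / of_nat k) / of_real (ln (real N))) \<longlonglongrightarrow> char \<nu> t"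
  shows "almost_sure_limit_theorem M Y \<nu>"
proof -
  interpret \<nu>: real_distribution \<nu> by (rule \<nu>)
  interpret \<gamma>: real_distribution std_normal_distribution by (rule real_dist_normal_dist)
  interpret P: pair_prob_space std_normal_distribution M ..
  define c where "c N t x = (\<Sum>k=1..N. iexp (t * Y k x) / of_nat k) / of_real (ln (real N))" for N t x
  \<comment> \<open>Convergence described by countable quantifiers, so that the convergence set is
    measurable in the product.\<close>
  have LIM: "(f \<longlonglongrightarrow> l) \<longleftrightarrow> (\<forall>i. \<exists>N. \<forall>n\<ge>N. cmod (f n - l) < 1 / real (Suc i))" for f l
  proof
    assume "\<forall>i. \<exists>N. \<forall>n\<ge>N. cmod (f n - l) < 1 / real (Suc i)"
    then show "f \<longlonglongrightarrow> l" unfolding LIMSEQ_iff by (metis nat_approx_posE order.strict_trans)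
  next
    assume "f \<longlonglongrightarrow> l"
    then show "\<forall>i. \<exists>N. \<forall>n\<ge>N. cmod (f n - l) < 1 / real (Suc i)"
      by (intro allI LIMSEQ_D) auto
  qed
  have "AE x in M. \<forall>t\<in>\<rat>. (\<lambda>N. c N t x) \<longlonglongrightarrow> char \<nu> t"
    using conv unfolding c_def by (intro AE_ball_countable[THEN iffD2] countable_rat ballI)
  moreover have "AE x in M. \<forall>j. AE t in std_normal_distribution. (\<lambda>N. c N (t / real (Suc j)) x) \<longlonglongrightarrow> char \<nu> (t / real (Suc j))"
  proof (intro AE_all_countable[THEN iffD2] allI)
    fix j
    have "AE t in std_normal_distribution. AE x in M. (\<lambda>N. c N (t / real (Suc j)) x) \<longlonglongrightarrow> char \<nu> (t / real (Suc j))"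
      unfolding c_def by (rule AE_I2) (rule conv)
    moreover have "{p \<in> space (std_normal_distribution \<Otimes>\<^sub>M M). (\<lambda>N. c N (fst p / real (Suc j)) (snd p)) \<longlonglongrightarrow> char \<nu> (fst p / real (Suc j))}
        \<in> sets (std_normal_distribution \<Otimes>\<^sub>M M)"
      unfolding LIM c_def by measurable
    ultimately show "AE x in M. AE t in std_normal_distribution. (\<lambda>N. c N (t / real (Suc j)) x) \<longlonglongrightarrow> char \<nu> (t / real (Suc j))"
      by (subst (asm) P.AE_commute)
  qed
  ultimately show ?thesis unfolding almost_sure_limit_theorem_def
  proof eventually_elim
    case (elim x)
    show ?case
    proof (rule converges_weakly_log_average[OF \<nu>])
      show "(\<lambda>N. (\<Sum>k=1..N. gauss_bump j (Y k x) / real k) / ln (real N)) \<longlonglongrightarrow> (\<integral>x. gauss_bump j x \<partial>\<nu>)" for j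
        using elim(2) by (intro log_average_gauss_bump[OF \<nu>]) (simp add: c_def)
    qed (use elim(1) in \<open>simp add: c_def\<close>)
  qed
qed

section \<open>From asymptotic independence to the almost sure limit theorem\<close>

text \<open>A Potter-type bound. Since \<open>x * L' x / L x\<close> tends to 0,
  \<open>d / 2 * ln x + ln (L x)\<close> is eventually nondecreasing, hence so is
  \<open>B n / real n powr (d / 2)\<close>; the finitely many initial values go into the constants.
  Half of the exponent \<open>d\<close> pays for the slowly varying factor.\<close>

lemma renormalizing_sequence_growth:
  assumes "renormalizing_sequence B"
  obtains C c \<delta> where "C > 0" "c > 0" "\<delta> > 0" "\<And>m n. 1 \<le> m \<Longrightarrow> m \<le> n \<Longrightarrow> B m \<le> C * B n"
    "\<And>n. 1 \<le> n \<Longrightarrow> c * real n powr \<delta> \<le> B n"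
proof -
  obtain d L where d: "d > 0" and L: "normalized_slowly_varying L" and B: "\<And>n. n \<ge> 1 \<Longrightarrow> B n = real n powr d * L (real n)"
    using assms by (auto simp: renormalizing_sequence_def)
  obtain L' where L': "\<And>x. x > 0 \<Longrightarrow> (L has_real_derivative L' x) (at x)" and o: "L' \<in> o[at_top](\<lambda>x. L x / x)"
    and Lpos: "\<And>x. x > 0 \<Longrightarrow> L x > 0"
    using L by (auto simp: normalized_slowly_varying_def slowly_varying_def)
  have "\<forall>\<^sub>F x in at_top. norm (L' x) \<le> d / 2 * norm (L x / x)"
    using landau_o.smallD[OF o, of "d / 2"] d by simp
  then obtain x0 where x0: "\<And>x. x \<ge> x0 \<Longrightarrow> \<bar>L' x\<bar> \<le> d / 2 * \<bar>L x / x\<bar>"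
    by (auto simp: eventually_at_top_linorder)
  define n0 where "n0 = max 1 (nat \<lceil>x0\<rceil>)"
  have n0: "n0 \<ge> 1" "x0 \<le> real n0" by (auto simp: n0_def) linarith
  define h where "h x = d / 2 * ln x + ln (L x)" for x
  have h_mono: "h (real m) \<le> h (real n)" if "n0 \<le> m" "m \<le> n" for m n
  proof (rule DERIV_nonneg_imp_nondecreasing[of "real m" "real n" h])
    fix x assume x: "real m \<le> x" "x \<le> real n"
    have "1 \<le> real m" using that n0 by simp
    then have x1: "x > 0" "x \<ge> x0" using x that n0 by linarith+
    have "(h has_real_derivative (d / 2 * (1 / x) + L' x / L x)) (at x)"
      unfolding h_def[abs_def] using x1 Lpos[of x] L'[of x]
      by (auto intro!: derivative_eq_intros simp: field_simps)
    moreover have "0 \<le> d / 2 * (1 / x) + L' x / L x"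
    proof -
      have "- L' x \<le> d / 2 * (L x / x)" using x0[OF x1(2)] x1(1) Lpos[OF x1(1)] by (simp add: abs_le_iff)
      then have "- L' x / L x \<le> d / 2 * (1 / x)" using x1 Lpos[OF x1(1)] by (simp add: field_simps)
      then show ?thesis by simp
    qed
    ultimately show "\<exists>y. (h has_real_derivative y) (at x) \<and> 0 \<le> y" by blast
  qed (use that in simp)
  define g where "g n = B n / real n powr (d / 2)" for n
  have g_exp: "g n = exp (h (real n))" if "n \<ge> 1" for n
  proof -
    have n: "real n > 0" using that by simp
    have "g n = real n powr (d / 2) * L (real n)"
      using n that by (simp add: g_def B field_simps powr_add[symmetric])
    also have "\<dots> = exp (h (real n))" using n Lpos[OF n] by (simp add: h_def exp_add powr_def)
    finally show ?thesis .
  qed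
  have g_pos: "g n > 0" if "n \<ge> 1" for n using g_exp[OF that] by simp
  have g_mono: "g m \<le> g n" if "n0 \<le> m" "m \<le> n" for m n
    using h_mono[OF that] g_exp[of m] g_exp[of n] that n0 by simp
  define a where "a = Min (g ` {1..n0})"
  define b where "b = Max (g ` {1..n0})"
  have fin: "finite (g ` {1..n0})" "g ` {1..n0} \<noteq> {}" using n0 by auto
  have a: "a > 0" unfolding a_def using fin g_pos by (subst Min_gr_iff) auto
  have ab: "a \<le> g n" "g n \<le> b" if "1 \<le> n" "n \<le> n0" for n
    using that fin by (auto simp: a_def b_def)
  have b: "a \<le> b" using ab[of 1] n0 by simp
  have ga: "a \<le> g n" if "n \<ge> 1" for n
  proof (cases "n \<le> n0")
    case False
    then show ?thesis using g_mono[of n0 n] ab(1)[of n0] n0 by simp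
  qed (use ab that in auto)
  have gg: "g m \<le> b / a * g n" if mn: "1 \<le> m" "m \<le> n" for m n
  proof (cases "n0 \<le> m")
    case True
    have "g m \<le> 1 * g n" using g_mono[OF True mn(2)] by simp
    also have "\<dots> \<le> b / a * g n" using a b g_pos[of n] mn by (intro mult_right_mono) auto
    finally show ?thesis .
  next
    case False
    then have "g m \<le> b" using ab mn by simp
    also have "\<dots> = b / a * a" using a by simp
    also have "\<dots> \<le> b / a * g n" using a b ga[of n] mn by (intro mult_left_mono) auto
    finally show ?thesis .
  qed
  have Bg: "B n = g n * real n powr (d / 2)" if "n \<ge> 1" for n using that by (simp add: g_def)
  show ?thesis
  proof (rule that[of "b / a" a "d / 2"])
    show "B m \<le> b / a * B n" if mn: "1 \<le> m" "m \<le> n" for m n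
    proof -
      have "B m \<le> (b / a * g n) * real n powr (d / 2)"
        unfolding Bg[OF mn(1)] using gg[OF mn] mn d g_pos[of n] a b
        by (intro mult_mono powr_mono2) auto
      then show ?thesis using Bg[of n] mn by (simp add: mult.assoc)
    qed
    show "a * real n powr (d / 2) \<le> B n" if "1 \<le> n" for n
      unfolding Bg[OF that] using ga[OF that] by (intro mult_right_mono) auto
  qed (use a b d in auto)
qed

text \<open>Weak convergence makes the laws tight, hence their characteristic functions
  equicontinuous at 0. The halving argument needs this at every intermediate time.\<close>

lemma char_near_one_uniformly:
  assumes rd: "\<And>n. real_distribution (\<mu> n)" and \<nu>: "real_distribution \<nu>" and w: "weak_conv_m \<mu> \<nu>"
  shows "\<exists>a>0. \<forall>n t. \<bar>t\<bar> \<le> a \<longrightarrow> cmod (1 - char (\<mu> n) t) \<le> 1 / 2"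
proof -
  interpret \<mu>: real_distribution "\<mu> n" for n by (rule rd)
  have "tight \<mu>"
  proof (rule tight_of_gauss_bumps[OF rd \<nu>])
    show "(\<lambda>n. \<integral>x. gauss_bump j x \<partial>\<mu> n) \<longlonglongrightarrow> (\<integral>x. gauss_bump j x \<partial>\<nu>)" for j
    proof (rule weak_conv_imp_integral_bdd_continuous_conv[OF rd \<nu> w, where B = 1])
      show "isCont (gauss_bump j) x" for x unfolding gauss_bump_def[abs_def] by (intro continuous_intros) auto
    qed (use gauss_bump_bounds in auto)
  qed
  \<comment> \<open>Mass \<open>7 / 8\<close> on an interval where
    \<open>cmod (1 - iexp (t * x)) \<le> 1 / 4\<close>, against the bound \<open>9 / 4\<close>
    elsewhere, gives \<open>9 / 4 - 2 * (7 / 8) = 1 / 2\<close>.\<close>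
  then obtain a b where ab: "a < b" "\<And>n. 1 - 1 / 8 < measure (\<mu> n) {a<..b}"
    unfolding tight_def by (meson divide_pos_pos zero_less_numeral zero_less_one)
  define r where "r = \<bar>a\<bar> + \<bar>b\<bar> + 1"
  have r: "r > 0" by (simp add: r_def)
  have "cmod (1 - char (\<mu> n) t) \<le> 1 / 2" if t: "\<bar>t\<bar> \<le> 1 / (4 * r)" for n t
  proof -
    have int: "integrable (\<mu> n) (\<lambda>x. iexp (t * x))" by (rule \<mu>.integrable_const_bound[of _ 1]) auto
    have ind: "integrable (\<mu> n) (indicator {a<..b} :: real \<Rightarrow> real)"
      by (rule \<mu>.integrable_const_bound[of _ 1]) auto
    have "1 - char (\<mu> n) t = (\<integral>x. 1 - iexp (t * x) \<partial>\<mu> n)"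
      unfolding char_def using int
      by (subst Bochner_Integration.integral_diff) (auto simp: \<mu>.prob_space simp del: \<mu>.space_eq_univ)
    also have "cmod \<dots> \<le> (\<integral>x. 9 / 4 - 2 * indicator {a<..b} x \<partial>\<mu> n)"
    proof (rule order_trans[OF integral_norm_bound], rule integral_mono)
      fix x
      show "cmod (1 - iexp (t * x)) \<le> 9 / 4 - 2 * indicator {a<..b} x"
      proof (cases "x \<in> {a<..b}")
        case True
        have "cmod (1 - iexp (t * x)) \<le> \<bar>t * x\<bar>"
          using iexp_approx1[of "t * x" 0] by (simp add: norm_minus_commute)
        also have "\<dots> \<le> 1 / (4 * r) * r"
          unfolding abs_mult using t True by (intro mult_mono) (auto simp: r_def)
        also have "\<dots> = 1 / 4" using r by simp
        finally show ?thesis using True by simp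
      next
        case False
        have "cmod (1 - iexp (t * x)) \<le> 1 + 1" by (rule order_trans[OF norm_triangle_ineq4]) simp
        then show ?thesis using False by simp
      qed
    qed (use int ind in auto)
    also have "\<dots> = 9 / 4 - 2 * measure (\<mu> n) {a<..b}"
      using ind by (subst Bochner_Integration.integral_diff) (auto simp: \<mu>.prob_space simp del: \<mu>.space_eq_univ)
    also have "\<dots> \<le> 1 / 2" using ab(2)[of n] by simp
    finally show ?thesis .
  qed
  then show ?thesis using r by (intro exI[of _ "1 / (4 * r)"]) auto
qed

text \<open>Reduces an arbitrary frequency to a small fraction of it, for which estimates near 0 are
  available.\<close>

lemma norm_iexp_multiple: "cmod (iexp (real N * x) - 1) \<le> real N * cmod (iexp x - 1)"
proof (induction N)
  case (Suc N)
  have "iexp (real (Suc N) * x) - 1 = iexp x * (iexp (real N * x) - 1) + (iexp x - 1)"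
    by (simp add: algebra_simps exp_add)
  then have "cmod (iexp (real (Suc N) * x) - 1) \<le> cmod (iexp (real N * x) - 1) + cmod (iexp x - 1)"
    by (metis norm_triangle_ineq norm_mult norm_exp_i_times mult_1)
  then show ?case using Suc by (simp add: algebra_simps)
qed simp

text \<open>Since \<open>(cmod (iexp y - 1))\<^sup>2 = 2 * Re (1 - iexp y)\<close>, the hypothesis
  bounds a second moment; \<open>2 * b * x \<le> x\<^sup>2 + b\<^sup>2\<close> then plays the role
  of Cauchy--Schwarz. Passing from \<open>b\<^sup>2\<close> to \<open>b\<close> halves the decay
  exponent later.\<close>

lemma (in prob_space) expectation_iexp_diff_le:
  assumes [measurable]: "X \<in> borel_measurable M" and b: "b > 0" "2 * cmod (1 - (\<integral>x. iexp (X x) \<partial>M)) \<le> b\<^sup>2"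
  shows "(\<integral>x. cmod (iexp (X x) - 1) \<partial>M) \<le> b"
proof -
  have int: "integrable M (\<lambda>x. iexp (X x))" by (rule integrable_const_bound[of _ 1]) auto
  have sq: "(cmod (iexp y - 1))\<^sup>2 = 2 * Re (1 - iexp y)" for y
    unfolding cmod_power2 by (simp add: Re_exp Im_exp power2_eq_square algebra_simps)
  have "(\<integral>x. cmod (iexp (X x) - 1) \<partial>M) \<le> (\<integral>x. 1 / b * Re (1 - iexp (X x)) + b / 2 \<partial>M)"
  proof (rule integral_mono)
    show "integrable M (\<lambda>x. cmod (iexp (X x) - 1))" using int by auto
    show "integrable M (\<lambda>x. 1 / b * Re (1 - iexp (X x)) + b / 2)" using int by auto
    fix x
    have "0 \<le> (cmod (iexp (X x) - 1) - b)\<^sup>2" by simp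
    then have "2 * b * cmod (iexp (X x) - 1) \<le> 2 * Re (1 - iexp (X x)) + b\<^sup>2"
      unfolding power2_diff sq by (simp add: mult_ac)
    then have "2 * b * cmod (iexp (X x) - 1) \<le> 2 * b * (1 / b * Re (1 - iexp (X x)) + b / 2)"
      using b by (simp add: distrib_left power2_eq_square)
    then show "cmod (iexp (X x) - 1) \<le> 1 / b * Re (1 - iexp (X x)) + b / 2"
      using b by (subst (asm) mult_le_cancel_left_pos) auto
  qed
  also have "\<dots> = 1 / b * Re (1 - (\<integral>x. iexp (X x) \<partial>M)) + b / 2"
  proof -
    have "(\<integral>x. 1 - iexp (X x) \<partial>M) = 1 - (\<integral>x. iexp (X x) \<partial>M)"
      using int by (subst Bochner_Integration.integral_diff) (auto simp: prob_space)
    moreover have "(\<integral>x. Re (1 - iexp (X x)) \<partial>M) = Re (\<integral>x. 1 - iexp (X x) \<partial>M)"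
      using int by (intro integral_Re) auto
    ultimately show ?thesis using int
      by (subst Bochner_Integration.integral_add) (auto simp: prob_space)
  qed
  also have "\<dots> \<le> 1 / b * (b\<^sup>2 / 2) + b / 2"
  proof -
    have "Re (1 - (\<integral>x. iexp (X x) \<partial>M)) \<le> cmod (1 - (\<integral>x. iexp (X x) \<partial>M))" by (rule complex_Re_le_cmod)
    also have "\<dots> \<le> b\<^sup>2 / 2" using b(2) by simp
    finally show ?thesis using b(1) by (intro add_right_mono mult_left_mono) auto
  qed
  also have "\<dots> = b" using b(1) by (simp add: power2_eq_square)
  finally show ?thesis .
qed

text \<open>
  If \<open>\<psi> (2 m)\<close> is nearly \<open>(\<psi> m)\<^sup>2\<close> and \<open>\<psi>\<close> stays close to \<open>1\<close>, then each halving of the time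
  shrinks \<open>1 - \<psi>\<close> by the factor \<open>2 / 3\<close>.
\<close>

lemma halving_estimate:
  fixes \<psi> :: "nat \<Rightarrow> complex"
  assumes near: "\<And>m. 1 \<le> m \<Longrightarrow> m \<le> n \<Longrightarrow> cmod (1 - \<psi> m) \<le> 1 / 2"
    and dbl: "\<And>m. cmod (\<psi> (2 * m) - (\<psi> m)\<^sup>2) \<le> e" and k: "1 \<le> k" "k \<le> n"
  shows "cmod (1 - \<psi> k) \<le> 3 / 2 * (real k / real n) powr (ln (3/2) / ln 2) + 2 * e"
proof -
  have e: "e \<ge> 0" using dbl[of 0] norm_ge_zero order_trans by blast
  have half: "cmod (1 - \<psi> m) \<le> 2 / 3 * (cmod (1 - \<psi> (2 * m)) + e)" if m: "1 \<le> m" "m \<le> n" for m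
  proof -
    have "3 / 2 \<le> cmod (1 + \<psi> m)"
    proof -
      have "cmod 2 - cmod (1 - \<psi> m) \<le> cmod (2 - (1 - \<psi> m))" by (rule norm_triangle_ineq2)
      moreover have "2 - (1 - \<psi> m) = 1 + \<psi> m" by simp
      ultimately show ?thesis using near[OF m] by simp
    qed
    then have "3 / 2 * cmod (1 - \<psi> m) \<le> cmod (1 + \<psi> m) * cmod (1 - \<psi> m)" by (intro mult_right_mono) auto
    also have "\<dots> = cmod ((1 - \<psi> (2 * m)) + (\<psi> (2 * m) - (\<psi> m)\<^sup>2))"
      unfolding norm_mult[symmetric] by (simp add: power2_eq_square algebra_simps)
    also have "\<dots> \<le> cmod (1 - \<psi> (2 * m)) + e"
      by (rule order_trans[OF norm_triangle_ineq]) (intro add_left_mono dbl)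
    finally show ?thesis by simp
  qed
  \<comment> \<open>\<open>2 * e\<close> is the fixed point of the recursion:
    \<open>2 / 3 * (2 * e + e) = 2 * e\<close>.\<close>
  have iter: "cmod (1 - \<psi> m) \<le> (2 / 3) ^ i + 2 * e" if "1 \<le> m" "2 ^ i * m \<le> n" for i m
    using that
  proof (induction i arbitrary: m)
    case 0
    then show ?case using near[of m] e by simp
  next
    case (Suc i)
    have "cmod (1 - \<psi> (2 * m)) \<le> (2 / 3) ^ i + 2 * e" using Suc.prems by (intro Suc.IH) (auto simp: mult_ac)
    moreover have "m \<le> n"
      using le_trans[OF mult_right_mono[of 1 "2 ^ Suc i" m] Suc.prems(2)] by simp
    ultimately show ?case using half[of m] Suc.prems(1) by simp
  qed
  \<comment> \<open>Only \<open>i - 1\<close> doublings of \<open>k\<close> stay at most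
    \<open>n\<close>; the missing one costs the factor \<open>3 / 2\<close>.\<close>
  define i where "i = (LEAST i. n < 2 ^ i * k)"
  have "n < 2 ^ n * k" using less_le_trans[OF less_exp[of n], of "2 ^ n * k"] k by simp
  then have ex: "\<exists>i. n < 2 ^ i * k" by blast
  have i1: "n < 2 ^ i * k" unfolding i_def by (rule LeastI_ex[OF ex])
  then have "i > 0" using k by (intro gr0I) auto
  then obtain j where j: "i = Suc j" by (cases i) auto
  have "\<not> n < 2 ^ j * k" using not_less_Least[of j "\<lambda>i. n < 2 ^ i * k"] j by (simp add: i_def)
  then have "cmod (1 - \<psi> k) \<le> (2 / 3) ^ j + 2 * e" using k by (intro iter) auto
  also have "(2 / 3) ^ j = 3 / 2 * (2 / 3 :: real) ^ i" by (simp add: j)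
  also have "(2 / 3 :: real) ^ i \<le> (real k / real n) powr (ln (3/2) / ln 2)"
  proof -
    have "(2 / 3 :: real) ^ i = exp (real i * ln (2 / 3))" by (simp add: exp_of_nat_mult)
    also have "ln (2 / 3 :: real) = - ln (3 / 2)" by (simp add: ln_div)
    also have "exp (real i * - ln (3 / 2)) = (1 / 2 ^ i) powr (ln (3/2) / ln 2)"
    proof -
      have "ln (1 / 2 ^ i :: real) = - (real i * ln 2)" by (simp add: ln_div ln_realpow)
      then show ?thesis by (simp add: powr_def)
    qed
    also have "\<dots> \<le> (real k / real n) powr (ln (3/2) / ln 2)"
    proof (rule powr_mono2)
      have "real n \<le> real (2 ^ i * k)" using i1 by (simp only: of_nat_le_iff)
      then have "real n \<le> 2 ^ i * real k" by simp
      then show "1 / 2 ^ i \<le> real k / real n" using k by (simp add: field_simps)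
    qed auto
    finally show ?thesis .
  qed
  finally show ?thesis by simp
qed

section \<open>Covariances of normalized Birkhoff sums\<close>

lemma birkhoff_sum_add: "birkhoff_sum T f (p + n) x = birkhoff_sum T f p x + birkhoff_sum T f n ((T ^^ p) x)"
proof (induction n)
  case (Suc n)
  have "(T ^^ (p + n)) x = (T ^^ n) ((T ^^ p) x)" by (metis add.commute comp_apply funpow_add)
  then show ?case using Suc by (simp add: birkhoff_sum_def)
qed (simp add: birkhoff_sum_def)

text \<open>In the covariance at times \<open>k \<le> n\<close>, the late block of length
  \<open>n - k\<close> has frequency \<open>t / B n\<close> and the early one
  \<open>t / B n - t / B k\<close>. Asymptotic independence splits them with an error
  \<open>O(\<bar>t / B n\<bar> powr \<delta>)\<close>, a negative power of \<open>n\<close>. What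
  remains differs from the product of the characteristic functions only through
  \<open>S k x / B n\<close>, and the halving estimate makes this a power of
  \<open>k / n\<close>.\<close>

theorem (in prob_space) almost_sure_limit_of_asymptotic_independence:
  fixes T :: "'a \<Rightarrow> 'a" and f :: "'a \<Rightarrow> real"
  assumes T[measurable]: "T \<in> measurable M M" and f[measurable]: "f \<in> borel_measurable M"
    and ren: "renormalizing_sequence B" and \<nu>: "real_distribution \<nu>"
    and lim: "weak_conv_m (\<lambda>n. distr M borel (\<lambda>x. birkhoff_sum T f n x / B n)) \<nu>"
    and pos: "t1 > 0" "\<delta> > 0" "K \<ge> 0"
    and indep: "\<And>t s n p. \<bar>t\<bar> \<le> t1 \<Longrightarrow> \<bar>s\<bar> \<le> t1 \<Longrightarrow>
      cmod ((\<integral>x. iexp (t * birkhoff_sum T f n ((T ^^ p) x)) * iexp (s * birkhoff_sum T f p x) \<partial>M)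
        - (\<integral>x. iexp (t * birkhoff_sum T f n x) \<partial>M) * (\<integral>x. iexp (s * birkhoff_sum T f p x) \<partial>M)) \<le> K * \<bar>t\<bar> powr \<delta>"
  shows "almost_sure_limit_theorem M (\<lambda>n x. birkhoff_sum T f n x / B n) \<nu>"
proof -
  define S where "S = birkhoff_sum T f"
  have Tn[measurable]: "T ^^ k \<in> measurable M M" for k
    by (induction k) (auto simp: measurable_ident intro: measurable_comp[OF _ T])
  have S[measurable]: "S n \<in> borel_measurable M" for n
    unfolding S_def birkhoff_sum_def[abs_def] by measurable
  have S_add: "S n x = S k x + S (n - k) ((T ^^ k) x)" if "k \<le> n" for n k x
    using birkhoff_sum_add[of T f k "n - k" x] that by (simp add: S_def)
  obtain CB c \<delta>' where CB: "CB > 0" and c: "c > 0" "\<delta>' > 0" and B_mono: "\<And>m n. 1 \<le> m \<Longrightarrow> m \<le> n \<Longrightarrow> B m \<le> CB * B n"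
    and B_ge: "\<And>n. 1 \<le> n \<Longrightarrow> c * real n powr \<delta>' \<le> B n"
    using renormalizing_sequence_growth[OF ren] by blast
  have B_pos: "B n > 0" if "n \<ge> 1" for n
    using less_le_trans[OF _ B_ge[OF that], of 0] c that by simp
  define \<mu> where "\<mu> n = distr M borel (\<lambda>x. S n x / B n)" for n
  have rd: "real_distribution (\<mu> n)" for n unfolding \<mu>_def by simp
  have lim': "weak_conv_m \<mu> \<nu>" using lim by (simp add: \<mu>_def[abs_def] S_def)
  have char\<mu>: "char (\<mu> n) t = (\<integral>x. iexp (t * (S n x / B n)) \<partial>M)" for n t
    unfolding char_def \<mu>_def by (subst integral_distr) auto
  define \<psi> where "\<psi> \<tau> n = (\<integral>x. iexp (\<tau> * S n x) \<partial>M)" for \<tau> n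
  have int: "integrable M (\<lambda>x. iexp (g x))" if "g \<in> borel_measurable M" for g
    using that by (intro integrable_const_bound[of _ 1]) auto
  have \<psi>_le: "cmod (\<psi> \<tau> n) \<le> 1" for \<tau> n
  proof -
    have "cmod (\<psi> \<tau> n) \<le> (\<integral>x. cmod (iexp (\<tau> * S n x)) \<partial>M)" unfolding \<psi>_def by (rule integral_norm_bound)
    then show ?thesis by (simp add: prob_space)
  qed
  have joint: "cmod ((\<integral>x. iexp (t * S n ((T ^^ p) x)) * iexp (s * S p x) \<partial>M) - \<psi> t n * \<psi> s p) \<le> K * \<bar>t\<bar> powr \<delta>"
    if "\<bar>t\<bar> \<le> t1" "\<bar>s\<bar> \<le> t1" for t s n p
    using indep[OF that, of n p] by (simp add: \<psi>_def S_def)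
  have split: "cmod (\<psi> t n - \<psi> t (n - p) * \<psi> t p) \<le> K * \<bar>t\<bar> powr \<delta>" if t: "\<bar>t\<bar> \<le> t1" and p: "p \<le> n" for t n p
  proof -
    have "\<psi> t n = (\<integral>x. iexp (t * S (n - p) ((T ^^ p) x)) * iexp (t * S p x) \<partial>M)"
      unfolding \<psi>_def
      by (intro Bochner_Integration.integral_cong) (simp_all add: S_add[OF p] exp_add[symmetric] algebra_simps)
    then show ?thesis using joint[OF t t, of "n - p" p] by simp
  qed
  obtain a0 where a0: "a0 > 0" and near1: "\<And>n t. \<bar>t\<bar> \<le> a0 \<Longrightarrow> cmod (1 - char (\<mu> n) t) \<le> 1 / 2"
    using char_near_one_uniformly[OF rd \<nu> lim'] by blast
  define \<kappa>1 where "\<kappa>1 = ln (3/2) / ln (2::real)"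
  \<comment> \<open>The cap 2 ensures \<open>\<kappa> / 2 \<le> 1\<close>, as
    \<open>log_average_AE\<close> requires; the exponent is halved by
    \<open>expectation_iexp_diff_le\<close>.\<close>
  define \<kappa> where "\<kappa> = min (min \<kappa>1 (\<delta>' * \<delta>)) 2"
  have \<kappa>1: "\<kappa>1 > 0" by (simp add: \<kappa>1_def)
  have \<kappa>: "0 < \<kappa>" "\<kappa> \<le> \<kappa>1" "\<kappa> \<le> \<delta>' * \<delta>" "\<kappa> \<le> 2" using \<kappa>1 c pos by (auto simp: \<kappa>_def)
  have powr_le: "(real k / real n) powr \<kappa>' \<le> (real k / real n) powr \<kappa>" if "1 \<le> k" "k \<le> n" "\<kappa> \<le> \<kappa>'" for k n \<kappa>'
    using that by (intro powr_mono') (auto simp: divide_le_eq)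
  \<comment> \<open>The error depends on \<open>n\<close> alone; inserting \<open>k \<ge> 1\<close>
    weakens it to the common form.\<close>
  have freq: "\<bar>t / B n\<bar> powr \<delta> \<le> (\<bar>t\<bar> / c) powr \<delta> * (real k / real n) powr \<kappa>" if kn: "1 \<le> k" "k \<le> n" for t k n
  proof -
    have n: "n \<ge> 1" using kn by simp
    have "\<bar>t / B n\<bar> \<le> \<bar>t\<bar> / (c * real n powr \<delta>')"
    proof -
      have "\<bar>t\<bar> / B n \<le> \<bar>t\<bar> / (c * real n powr \<delta>')" using B_ge[OF n] B_pos[OF n] c n by (intro divide_left_mono mult_pos_pos) auto
      then show ?thesis using B_pos[OF n] by (simp add: abs_divide)
    qed
    then have "\<bar>t / B n\<bar> powr \<delta> \<le> (\<bar>t\<bar> / (c * real n powr \<delta>')) powr \<delta>" using pos by (intro powr_mono2) auto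
    also have "\<dots> = (\<bar>t\<bar> / c) powr \<delta> * (1 / real n) powr (\<delta>' * \<delta>)"
      using c n by (simp add: powr_divide powr_mult powr_powr)
    also have "(1 / real n) powr (\<delta>' * \<delta>) \<le> (real k / real n) powr (\<delta>' * \<delta>)"
      using kn c pos by (intro powr_mono2) (auto intro: divide_right_mono)
    also have "(real k / real n) powr (\<delta>' * \<delta>) \<le> (real k / real n) powr \<kappa>" by (rule powr_le[OF kn \<kappa>(3)])
    finally show ?thesis by (simp add: mult_left_mono)
  qed
  \<comment> \<open>At every intermediate time \<open>m \<le> n\<close> the frequency
    \<open>\<theta> / B n\<close>, in units of \<open>1 / B m\<close>, stays below
    \<open>a0\<close>, because \<open>B m \<le> CB * B n\<close>.\<close>
  have small: "cmod (1 - \<psi> (\<theta> / B n) k) \<le> (3 / 2 + 2 * K * (\<bar>\<theta>\<bar> / c) powr \<delta>) * (real k / real n) powr \<kappa>"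
    if \<theta>: "\<bar>\<theta>\<bar> * CB \<le> a0" "\<bar>\<theta> / B n\<bar> \<le> t1" and kn: "1 \<le> k" "k \<le> n" for \<theta> k n
  proof -
    define \<tau> where "\<tau> = \<theta> / B n"
    have n: "B n > 0" using B_pos kn by simp
    have "cmod (1 - \<psi> \<tau> k) \<le> 3 / 2 * (real k / real n) powr \<kappa>1 + 2 * (K * \<bar>\<tau>\<bar> powr \<delta>)"
      unfolding \<kappa>1_def
    proof (rule halving_estimate[OF _ _ kn])
      fix m assume m: "1 \<le> m" "m \<le> n"
      have Bm: "B m > 0" using B_pos m by simp
      have "\<psi> \<tau> m = char (\<mu> m) (\<tau> * B m)" unfolding \<psi>_def char\<mu> using Bm by simp
      moreover have "\<bar>\<tau> * B m\<bar> \<le> a0"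
      proof -
        have "\<bar>\<tau> * B m\<bar> = \<bar>\<theta>\<bar> * (B m / B n)" using n Bm by (simp add: \<tau>_def abs_mult abs_divide)
        also have "\<dots> \<le> \<bar>\<theta>\<bar> * CB" using B_mono[OF m] n by (intro mult_left_mono) (auto simp: divide_le_eq)
        finally show ?thesis using \<theta>(1) by simp
      qed
      ultimately show "cmod (1 - \<psi> \<tau> m) \<le> 1 / 2" using near1 by simp
    next
      fix m show "cmod (\<psi> \<tau> (2 * m) - (\<psi> \<tau> m)\<^sup>2) \<le> K * \<bar>\<tau>\<bar> powr \<delta>"
        using split[of \<tau> m "2 * m"] \<theta>(2) by (simp add: \<tau>_def power2_eq_square)
    qed
    also have "\<dots> \<le> 3 / 2 * (real k / real n) powr \<kappa> + 2 * (K * ((\<bar>\<theta>\<bar> / c) powr \<delta> * (real k / real n) powr \<kappa>))"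
      unfolding \<tau>_def using pos by (intro add_mono mult_left_mono powr_le[OF kn \<kappa>(2)] freq[OF kn]) auto
    finally show ?thesis by (simp add: \<tau>_def algebra_simps)
  qed
  have avg: "AE x in M. (\<lambda>N. (\<Sum>k=1..N. iexp (t * (S k x / B k)) / of_nat k) / of_real (ln (real N))) \<longlonglongrightarrow> char \<nu> t" for t
  proof -
    \<comment> \<open>\<open>\<theta> = t / N0\<close> is small enough for \<open>small\<close>; the
      factor \<open>N0\<close> is recovered through \<open>norm_iexp_multiple\<close>.\<close>
    obtain N0 :: nat where "\<bar>t\<bar> * CB / a0 < real N0" using reals_Archimedean2 by blast
    moreover have "0 \<le> \<bar>t\<bar> * CB / a0" using CB a0 by simp
    ultimately have N0: "N0 > 0" "\<bar>t\<bar> * CB \<le> a0 * real N0" using a0 by (auto simp: field_simps intro: gr0I)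
    define \<theta> where "\<theta> = t / real N0"
    have \<theta>: "\<bar>\<theta>\<bar> * CB \<le> a0" "t = real N0 * \<theta>" "\<bar>\<theta>\<bar> \<le> \<bar>t\<bar>"
      using N0 by (auto simp: \<theta>_def abs_divide field_simps) (use mult_left_mono[of 1 "real N0" "\<bar>t\<bar>"] in auto)
    define D where "D = 3 / 2 + 2 * K * (\<bar>\<theta>\<bar> / c) powr \<delta>"
    have D: "D > 0" using pos by (simp add: D_def add_pos_nonneg)
    \<comment> \<open>Half of \<open>t1\<close>, because the early frequency is a difference of two
      such terms.\<close>
    have "\<exists>k0\<ge>1. \<forall>n\<ge>k0. \<bar>t / B n\<bar> \<le> t1 / 2"
    proof -
      define X where "X = 2 * \<bar>t\<bar> / t1 / c"
      have X: "X \<ge> 0" using pos c by (simp add: X_def)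
      obtain k0 :: nat where k0': "X powr (1 / \<delta>') \<le> real k0" using real_arch_simple by blast
      have k0: "2 * \<bar>t\<bar> / t1 \<le> c * real n powr \<delta>'" if "n \<ge> k0" for n
      proof -
        have "(X powr (1 / \<delta>')) powr \<delta>' \<le> real n powr \<delta>'" using k0' that c by (intro powr_mono2) auto
        then have "X \<le> real n powr \<delta>'" using X c by (simp add: powr_powr)
        then have "c * X \<le> c * real n powr \<delta>'" using c by (intro mult_left_mono) auto
        then show ?thesis using c(1) by (simp add: X_def)
      qed
      have "\<bar>t / B n\<bar> \<le> t1 / 2" if "n \<ge> max 1 k0" for n
      proof -
        have "2 * \<bar>t\<bar> / t1 \<le> B n" using k0[of n] B_ge[of n] that by simp
        then show ?thesis using pos B_pos[of n] that by (simp add: abs_divide field_simps)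
      qed
      then show ?thesis by (intro exI[of _ "max 1 k0"]) auto
    qed
    then obtain k0 where k0: "k0 \<ge> 1" "\<And>n. n \<ge> k0 \<Longrightarrow> \<bar>t / B n\<bar> \<le> t1 / 2" by blast
    define Z where "Z k x = iexp (t * (S k x / B k)) - char (\<mu> k) t" for k x
    have Zm: "Z k \<in> borel_measurable M" for k unfolding Z_def[abs_def] by measurable
    have Z2: "cmod (Z k x) \<le> 2" for k x
      using norm_triangle_ineq4[of "iexp (t * (S k x / B k))" "char (\<mu> k) t"]
        real_distribution.cmod_char_le_1[OF rd, of k t] by (simp add: Z_def del: of_real_mult)
    define A where "A = 2 * K * (\<bar>t\<bar> / c) powr \<delta> + 2 * (real N0 * sqrt (2 * D))"
    have A: "A \<ge> 0" using pos D by (simp add: A_def)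
    have cov: "cmod (\<integral>x. Z n x * cnj (Z k x) \<partial>M) \<le> A * (real k / real n) powr (\<kappa> / 2)"
      if k: "k0 \<le> k" "1 \<le> k" "k \<le> n" for n k
    proof -
      define a where "a = t / B n"
      define s where "s = t / B n - t / B k"
      have a1: "\<bar>a\<bar> \<le> t1" using order_trans[OF k0(2)[of n], of t1] k pos by (simp add: a_def)
      have s1: "\<bar>s\<bar> \<le> t1" using k0(2)[of n] k0(2)[of k] k unfolding s_def by linarith
      define R where "R = (real k / real n) powr (\<kappa> / 2)"
      have kn: "0 < real k / real n" using k by simp
      have R: "R > 0" "R\<^sup>2 = (real k / real n) powr \<kappa>"
        using k by (auto simp: R_def power2_eq_square powr_add[symmetric])
      define d where "d = (\<integral>x. cmod (iexp (a * S k x) - 1) \<partial>M)"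
      have d_le: "d \<le> real N0 * sqrt (2 * D) * R"
      proof -
        have "\<bar>\<theta> / B n\<bar> \<le> \<bar>t / B n\<bar>" using \<theta>(3) by (simp add: abs_divide divide_right_mono)
        then have \<theta>1: "\<bar>\<theta> / B n\<bar> \<le> t1" using a1 by (simp add: a_def)
        have "2 * cmod (1 - \<psi> (\<theta> / B n) k) \<le> (sqrt (2 * D) * R)\<^sup>2"
          using small[OF \<theta>(1) \<theta>1 k(2,3), folded D_def] D by (simp add: power_mult_distrib R(2))
        then have b: "(\<integral>x. cmod (iexp (\<theta> / B n * S k x) - 1) \<partial>M) \<le> sqrt (2 * D) * R"
          unfolding \<psi>_def using D R(1) by (intro expectation_iexp_diff_le) auto
        have "d \<le> (\<integral>x. real N0 * cmod (iexp (\<theta> / B n * S k x) - 1) \<partial>M)"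
          unfolding d_def
        proof (rule integral_mono)
          show "integrable M (\<lambda>x. cmod (iexp (a * S k x) - 1))"
            using int[of "\<lambda>x. a * S k x"] by auto
          show "integrable M (\<lambda>x. real N0 * cmod (iexp (\<theta> / B n * S k x) - 1))"
            using int[of "\<lambda>x. \<theta> / B n * S k x"] by auto
          have "a * S k x = real N0 * (\<theta> / B n * S k x)" for x by (simp add: a_def \<theta>(2))
          then show "cmod (iexp (a * S k x) - 1) \<le> real N0 * cmod (iexp (\<theta> / B n * S k x) - 1)" for x
            by (simp only: norm_iexp_multiple)
        qed
        also have "\<dots> \<le> real N0 * (sqrt (2 * D) * R)" using b by (simp add: mult_left_mono)
        finally show ?thesis by (simp add: mult.assoc)
      qed
      have chn: "char (\<mu> n) t = \<psi> a n" unfolding char\<mu> \<psi>_def a_def by simp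
      have e: "K * \<bar>a\<bar> powr \<delta> \<le> K * (\<bar>t\<bar> / c) powr \<delta> * R"
      proof -
        have "(real k / real n) powr \<kappa> \<le> R" unfolding R_def using k \<kappa> by (intro powr_mono') auto
        then have "(\<bar>t\<bar> / c) powr \<delta> * (real k / real n) powr \<kappa> \<le> (\<bar>t\<bar> / c) powr \<delta> * R"
          by (intro mult_left_mono) auto
        then have "\<bar>a\<bar> powr \<delta> \<le> (\<bar>t\<bar> / c) powr \<delta> * R" using freq[OF k(2,3), of t] by (simp add: a_def)
        then show ?thesis using pos by (simp add: mult.assoc mult_left_mono)
      qed
      have int_k: "integrable M (\<lambda>x. iexp (t * (S k x / B k)))" for k by (rule int) measurable
      have "(\<integral>x. Z n x * cnj (Z k x) \<partial>M)
          = (\<integral>x. iexp (t * (S n x / B n)) * cnj (iexp (t * (S k x / B k))) \<partial>M) - char (\<mu> n) t * cnj (char (\<mu> k) t)"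
      proof -
        have i: "integrable M (\<lambda>x. iexp (t * (S n x / B n)) * cnj (iexp (t * (S k x / B k))))"
          by (rule integrable_const_bound[of _ 1]) (auto simp: norm_mult simp del: of_real_mult)
        have "(\<integral>x. Z n x * cnj (Z k x) \<partial>M) = (\<integral>x. (iexp (t * (S n x / B n)) * cnj (iexp (t * (S k x / B k)))
            - iexp (t * (S n x / B n)) * cnj (char (\<mu> k) t)) - (char (\<mu> n) t * cnj (iexp (t * (S k x / B k))) - char (\<mu> n) t * cnj (char (\<mu> k) t)) \<partial>M)"
          unfolding Z_def by (intro Bochner_Integration.integral_cong) (auto simp: algebra_simps)
        also have "\<dots> = ((\<integral>x. iexp (t * (S n x / B n)) * cnj (iexp (t * (S k x / B k))) \<partial>M) - char (\<mu> n) t * cnj (char (\<mu> k) t))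
            - (char (\<mu> n) t * cnj (char (\<mu> k) t) - char (\<mu> n) t * cnj (char (\<mu> k) t))"
          unfolding char\<mu>[of n t] char\<mu>[of k t] using i int_k
          by (simp add: prob_space del: of_real_mult of_real_divide)
        finally show ?thesis by simp
      qed
      also have "(\<integral>x. iexp (t * (S n x / B n)) * cnj (iexp (t * (S k x / B k))) \<partial>M)
          = (\<integral>x. iexp (a * S (n - k) ((T ^^ k) x)) * iexp (s * S k x) \<partial>M)"
      proof (intro Bochner_Integration.integral_cong refl)
        fix x
        have "t * (S n x / B n) + - (t * (S k x / B k)) = a * S (n - k) ((T ^^ k) x) + s * S k x"
          by (simp add: S_add[OF k(3), of x] a_def s_def add_divide_distrib algebra_simps)
        moreover have "cnj (iexp (t * (S k x / B k))) = iexp (- (t * (S k x / B k)))"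
          by (simp add: exp_cnj)
        ultimately show "iexp (t * (S n x / B n)) * cnj (iexp (t * (S k x / B k)))
            = iexp (a * S (n - k) ((T ^^ k) x)) * iexp (s * S k x)"
          by (metis exp_add distrib_left of_real_add)
      qed
      \<comment> \<open>Three errors: splitting the joint integral, splitting
        \<open>\<psi> a n\<close>, and removing the frequency \<open>a\<close> from the early block.
        Both \<open>\<psi> s k\<close> and \<open>\<psi> a k\<close> are within \<open>d\<close> of
        their values without \<open>a\<close>.\<close>
      finally have cov_eq: "(\<integral>x. Z n x * cnj (Z k x) \<partial>M) =
          ((\<integral>x. iexp (a * S (n - k) ((T ^^ k) x)) * iexp (s * S k x) \<partial>M) - \<psi> a (n - k) * \<psi> s k)
          - (\<psi> a n - \<psi> a (n - k) * \<psi> a k) * cnj (char (\<mu> k) t)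
          + \<psi> a (n - k) * ((\<psi> s k - cnj (char (\<mu> k) t)) - (\<psi> a k - 1) * cnj (char (\<mu> k) t))"
        by (simp add: chn algebra_simps)
      have ch1: "cmod (cnj (char (\<mu> k) t)) \<le> 1" using real_distribution.cmod_char_le_1[OF rd] by simp
      have ia: "integrable M (\<lambda>x. iexp (a * S k x))" by (rule int) measurable
      have p1: "cmod (\<psi> a k - 1) \<le> d"
      proof -
        have "\<psi> a k - 1 = (\<integral>x. iexp (a * S k x) - 1 \<partial>M)"
          unfolding \<psi>_def using ia by (simp add: prob_space del: of_real_mult)
        then show ?thesis unfolding d_def by (metis integral_norm_bound)
      qed
      have p2: "cmod (\<psi> s k - cnj (char (\<mu> k) t)) \<le> d"
      proof -
        have "cnj (char (\<mu> k) t) = (\<integral>x. cnj (iexp (t * (S k x / B k))) \<partial>M)" unfolding char\<mu> by simp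
        also have "\<dots> = (\<integral>x. iexp (- (t / B k) * S k x) \<partial>M)"
          by (intro Bochner_Integration.integral_cong) (simp_all add: exp_cnj)
        finally have "\<psi> s k - cnj (char (\<mu> k) t) = (\<integral>x. iexp (s * S k x) - iexp (- (t / B k) * S k x) \<partial>M)"
          unfolding \<psi>_def using int[of "\<lambda>x. s * S k x"] int[of "\<lambda>x. - (t / B k) * S k x"]
          by (subst Bochner_Integration.integral_diff) auto
        also have "cmod \<dots> \<le> (\<integral>x. cmod (iexp (s * S k x) - iexp (- (t / B k) * S k x)) \<partial>M)"
          by (rule integral_norm_bound)
        also have "\<dots> = d" unfolding d_def
        proof (intro Bochner_Integration.integral_cong refl)
          fix x
          have "s * S k x = - (t / B k) * S k x + a * S k x" by (simp add: s_def a_def algebra_simps)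
          then have "iexp (s * S k x) = iexp (- (t / B k) * S k x) * iexp (a * S k x)"
            by (simp only: of_real_add distrib_left exp_add)
          then have "iexp (s * S k x) - iexp (- (t / B k) * S k x) = iexp (- (t / B k) * S k x) * (iexp (a * S k x) - 1)"
            by (simp only: right_diff_distrib mult_1_right)
          then show "cmod (iexp (s * S k x) - iexp (- (t / B k) * S k x)) = cmod (iexp (a * S k x) - 1)"
            by (simp only: norm_mult norm_exp_i_times mult_1)
        qed
        finally show ?thesis .
      qed
      have tri: "cmod (u - v + w) \<le> (a' + b') + c'" if "cmod u \<le> a'" "cmod v \<le> b'" "cmod w \<le> c'" for u v w a' b' c'
        using norm_triangle_ineq[of "u - v" w] norm_triangle_ineq4[of u v] that by linarith
      have "cmod (\<integral>x. Z n x * cnj (Z k x) \<partial>M) \<le> (K * \<bar>a\<bar> powr \<delta> + K * \<bar>a\<bar> powr \<delta> * 1) + 1 * (d + d * 1)"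
        unfolding cov_eq
      proof (rule tri[OF joint[OF a1 s1]])
        show "cmod ((\<psi> a n - \<psi> a (n - k) * \<psi> a k) * cnj (char (\<mu> k) t)) \<le> K * \<bar>a\<bar> powr \<delta> * 1"
          unfolding norm_mult using split[OF a1 k(3)] ch1 pos by (intro mult_mono) auto
        have "cmod ((\<psi> s k - cnj (char (\<mu> k) t)) - (\<psi> a k - 1) * cnj (char (\<mu> k) t)) \<le> d + d * 1"
        proof (rule order_trans[OF norm_triangle_ineq4 add_mono[OF p2]])
          show "cmod ((\<psi> a k - 1) * cnj (char (\<mu> k) t)) \<le> d * 1"
            unfolding norm_mult using p1 ch1 order_trans[OF norm_ge_zero p1] by (intro mult_mono) auto
        qed
        then show "cmod (\<psi> a (n - k) * ((\<psi> s k - cnj (char (\<mu> k) t)) - (\<psi> a k - 1) * cnj (char (\<mu> k) t))) \<le> 1 * (d + d * 1)"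
          unfolding norm_mult using \<psi>_le by (intro mult_mono) auto
      qed
      also have "\<dots> \<le> 2 * (K * (\<bar>t\<bar> / c) powr \<delta> * R) + 2 * (real N0 * sqrt (2 * D) * R)"
        using e d_le by simp
      also have "\<dots> = A * R" by (simp add: A_def algebra_simps)
      finally show ?thesis by (simp add: R_def)
    qed
    have "AE x in M. (\<lambda>N. (\<Sum>k=1..N. Z k x / of_nat k) / of_real (ln (real N))) \<longlonglongrightarrow> 0"
      by (rule log_average_AE[OF Zm Z2, where \<kappa> = "\<kappa> / 2", OF _ _ A cov]) (use \<kappa> in auto)
    then show ?thesis
    proof eventually_elim
      case (elim x)
      have "(\<lambda>k. char (\<mu> k) t) \<longlonglongrightarrow> char \<nu> t" by (rule levy_continuity1[OF rd \<nu> lim'])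
      then have "(\<lambda>k. char (\<mu> k) t - char \<nu> t) \<longlonglongrightarrow> 0" by (rule LIM_zero)
      then have l2: "(\<lambda>N. (\<Sum>k=1..N. (char (\<mu> k) t - char \<nu> t) / of_nat k) / of_real (ln (real N))) \<longlonglongrightarrow> 0"
        by (rule log_average_null)
      have l3: "(\<lambda>N. char \<nu> t * of_real (harm N / ln (real N))) \<longlonglongrightarrow> char \<nu> t * of_real 1"
        by (intro tendsto_intros harm_over_ln_tendsto)
      have "(\<Sum>k=1..N. iexp (t * (S k x / B k)) / of_nat k) / of_real (ln (real N))
          = (\<Sum>k=1..N. Z k x / of_nat k) / of_real (ln (real N))
          + (\<Sum>k=1..N. (char (\<mu> k) t - char \<nu> t) / of_nat k) / of_real (ln (real N))
          + char \<nu> t * of_real (harm N / ln (real N))" for N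
      proof -
        have "(\<Sum>k=1..N. iexp (t * (S k x / B k)) / of_nat k)
          = (\<Sum>k=1..N. (Z k x / of_nat k + (char (\<mu> k) t - char \<nu> t) / of_nat k) + char \<nu> t * (1 / of_nat k))"
          by (intro sum.cong) (auto simp: Z_def field_simps)
        also have "\<dots> = (\<Sum>k=1..N. Z k x / of_nat k) + (\<Sum>k=1..N. (char (\<mu> k) t - char \<nu> t) / of_nat k) + char \<nu> t * of_real (harm N)"
          by (simp add: sum.distrib sum_distrib_left harm_def inverse_eq_divide)
        finally show ?thesis by (simp add: add_divide_distrib)
      qed
      then show ?case using tendsto_add[OF tendsto_add[OF elim l2] l3] by simp
    qed
  qed
  show ?thesis
    unfolding S_def[symmetric]
    by (rule almost_sure_limit_theoremI[OF _ \<nu>]) (use avg in auto)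
qed

text \<open>The operators form a \<open>lasota_yorke_family\<close>, and the coding translates its
  asymptotic independence into the one required of the Birkhoff sums.\<close>

theorem theorem2p11:
  fixes m :: "'a measure" and T :: "'a \<Rightarrow> 'a" and f :: "'a \<Rightarrow> real"
    and \<iota> :: "'g::complex_banach \<Rightarrow> 'h::complex_banach"
    and \<alpha>\<^sub>0 :: 'g and l\<^sub>0 :: "'g \<Rightarrow> complex" and \<epsilon>\<^sub>0 :: real
    and \<L> :: "real \<Rightarrow> 'g \<Rightarrow> 'g"
    and B :: "nat \<Rightarrow> real"
    and P :: "'w measure" and W :: "'w \<Rightarrow> real"
  assumes prob_m: "prob_space m"
    and nonsingular: "nonsingular_map m T"
    and f_measurable: "f \<in> borel_measurable m"
    and \<iota>_linear: "bounded_clinear \<iota>"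
    and \<iota>_compact: "compact (closure (\<iota> ` ball 0 1))"
    and l\<^sub>0_dual: "bounded_clinear l\<^sub>0"
    and \<epsilon>\<^sub>0: "0 < \<epsilon>\<^sub>0" "\<epsilon>\<^sub>0 < 1"
    and operators: "\<And>t. t \<in> {-\<epsilon>\<^sub>0..\<epsilon>\<^sub>0} \<Longrightarrow> bounded_clinear (\<L> t)"
    and coding: "\<And>t t' n p. t \<in> {-\<epsilon>\<^sub>0..\<epsilon>\<^sub>0} \<Longrightarrow> t' \<in> {-\<epsilon>\<^sub>0..\<epsilon>\<^sub>0} \<Longrightarrow>
      (\<integral>x. exp (\<i> * complex_of_real (t * birkhoff_sum T f n ((T ^^ p) x))) *
            exp (\<i> * complex_of_real (t' * birkhoff_sum T f p x)) \<partial>m)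
        = l\<^sub>0 ((\<L> t ^^ n) ((\<L> t' ^^ p) \<alpha>\<^sub>0))"
    and lasota_yorke: "\<exists>C \<eta> R :: real. C > 0 \<and> \<eta> < 1 \<and> R \<ge> 1 \<and>
      (\<forall>u n. \<forall>t \<in> {-\<epsilon>\<^sub>0..\<epsilon>\<^sub>0}.
         norm ((\<L> t ^^ n) u) \<le> C * \<eta> ^ n * norm u + C * R ^ n * norm (\<iota> u) \<and>
         norm (\<iota> ((\<L> t ^^ n) u)) \<le> C * R ^ n * norm (\<iota> u))"
    and simple: "\<And>z. eigenvalue (\<L> 0) z \<Longrightarrow> cmod z \<ge> 1 \<Longrightarrow> simple_eigenvalue (\<L> 0) z"
    and fixed: "dual_operator (\<L> 0) l\<^sub>0 = l\<^sub>0"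
    and hoelder: "\<exists>\<beta>\<^sub>0 C :: real. \<beta>\<^sub>0 > 0 \<and> C > 0 \<and>
      (\<forall>t \<in> {-\<epsilon>\<^sub>0..\<epsilon>\<^sub>0}. onorm (\<lambda>u. \<iota> (\<L> t u - \<L> 0 u)) \<le> C * \<bar>t\<bar> powr \<beta>\<^sub>0)"
    and renormalizing: "renormalizing_sequence B"
    and prob_W: "prob_space P" and W_measurable: "W \<in> borel_measurable P"
    and limit: "weak_conv_m (\<lambda>n. distr m borel (\<lambda>x. birkhoff_sum T f n x / B n)) (distr P borel W)"
  shows "almost_sure_limit_theorem m (\<lambda>n x. birkhoff_sum T f n x / B n) (distr P borel W)"
proof -
  interpret prob_space m by (rule prob_m)
  have T: "T \<in> measurable m m" using nonsingular by (simp add: nonsingular_map_def)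
  have mem: "t \<in> {-\<epsilon>\<^sub>0..\<epsilon>\<^sub>0} \<longleftrightarrow> \<bar>t\<bar> \<le> \<epsilon>\<^sub>0" for t by auto
  have zero: "\<bar>0\<bar> \<le> \<epsilon>\<^sub>0" using \<epsilon>\<^sub>0 by simp
  obtain C \<eta> R :: real where C: "C > 0" and \<eta>: "0 < \<eta>" "\<eta> < 1" and R: "R \<ge> 1"
    and ly: "\<forall>u n. \<forall>t\<in>{-\<epsilon>\<^sub>0..\<epsilon>\<^sub>0}. norm ((\<L> t ^^ n) u) \<le> C * \<eta> ^ n * norm u + C * R ^ n * norm (\<iota> u) \<and>
      norm (\<iota> ((\<L> t ^^ n) u)) \<le> C * R ^ n * norm (\<iota> u)"
    using lasota_yorke_normalized[OF lasota_yorke] by (elim exE conjE)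
  obtain \<beta> H :: real where \<beta>: "\<beta> > 0" and H: "H > 0"
    and ho: "\<forall>t\<in>{-\<epsilon>\<^sub>0..\<epsilon>\<^sub>0}. onorm (\<lambda>u. \<iota> (\<L> t u - \<L> 0 u)) \<le> H * \<bar>t\<bar> powr \<beta>"
    using hoelder by (elim exE conjE)
  have diff: "norm (\<iota> (\<L> t u - \<L> 0 u)) \<le> H * \<bar>t\<bar> powr \<beta> * norm u" if t: "\<bar>t\<bar> \<le> \<epsilon>\<^sub>0" for t u
  proof -
    have "bounded_linear (\<lambda>u. \<iota> (\<L> t u - \<L> 0 u))"
      by (rule bounded_linear_compose[OF _ bounded_linear_sub])
         (use \<iota>_linear operators[unfolded mem, OF t] operators[unfolded mem, OF zero] in \<open>simp_all add: bounded_clinear_def\<close>)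
    then show ?thesis
      by (rule order_trans[OF onorm]) (intro mult_right_mono bspec[OF ho] norm_ge_zero, use t in \<open>simp only: mem\<close>)
  qed
  interpret lasota_yorke_family \<L> \<iota> C \<eta> R \<epsilon>\<^sub>0 \<beta> H
  proof unfold_locales
    fix t n u assume "\<bar>t\<bar> \<le> \<epsilon>\<^sub>0"
    then have t: "t \<in> {-\<epsilon>\<^sub>0..\<epsilon>\<^sub>0}" by (simp only: mem)
    show "bounded_clinear (\<L> t)" by (rule operators[OF t])
    show "norm ((\<L> t ^^ n) u) \<le> C * \<eta> ^ n * norm u + C * R ^ n * norm (\<iota> u)"
      "norm (\<iota> ((\<L> t ^^ n) u)) \<le> C * R ^ n * norm (\<iota> u)"
      using bspec[OF spec[OF spec[OF ly, of u], of n] t] by simp_all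
  qed (fact \<epsilon>\<^sub>0 \<iota>_linear \<iota>_compact C \<eta> R \<beta> H diff)+
  have code: "(\<integral>x. iexp (t * birkhoff_sum T f n ((T ^^ p) x)) * iexp (s * birkhoff_sum T f p x) \<partial>m)
      = l\<^sub>0 ((\<L> t ^^ n) ((\<L> s ^^ p) \<alpha>\<^sub>0))" if "\<bar>t\<bar> \<le> \<epsilon>\<^sub>0" "\<bar>s\<bar> \<le> \<epsilon>\<^sub>0" for t s n p
    using coding[unfolded mem, OF that] by simp
  have char1: "(\<integral>x. iexp (t * birkhoff_sum T f n x) \<partial>m) = l\<^sub>0 ((\<L> t ^^ n) \<alpha>\<^sub>0)" if "\<bar>t\<bar> \<le> \<epsilon>\<^sub>0" for t n
    using code[OF that zero, of n 0] by simp
  \<comment> \<open>The coding at frequency 0 and time 0 integrates the constant 1.\<close>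
  have \<alpha>1: "l\<^sub>0 \<alpha>\<^sub>0 = 1" using char1[OF zero, of 0] by (simp add: prob_space)
  have bd: "cmod (l\<^sub>0 ((\<L> t ^^ n) ((\<L> s ^^ p) \<alpha>\<^sub>0))) \<le> 1" if "\<bar>t\<bar> \<le> \<epsilon>\<^sub>0" "\<bar>s\<bar> \<le> \<epsilon>\<^sub>0" for t s n p
  proof -
    have "cmod (l\<^sub>0 ((\<L> t ^^ n) ((\<L> s ^^ p) \<alpha>\<^sub>0)))
        \<le> (\<integral>x. cmod (iexp (t * birkhoff_sum T f n ((T ^^ p) x)) * iexp (s * birkhoff_sum T f p x)) \<partial>m)"
      unfolding code[OF that, symmetric] by (rule integral_norm_bound)
    then show ?thesis by (simp add: norm_mult prob_space del: of_real_mult)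
  qed
  have fix0: "l\<^sub>0 (\<L> 0 u) = l\<^sub>0 u" for u using fun_cong[OF fixed, of u] by (simp add: dual_operator_def)
  have "\<exists>t1>0. \<exists>\<delta>>0. \<exists>K>0. t1 \<le> \<epsilon>\<^sub>0 \<and> (\<forall>t s n p. \<bar>t\<bar> \<le> t1 \<longrightarrow> \<bar>s\<bar> \<le> t1 \<longrightarrow>
      cmod (l\<^sub>0 ((\<L> t ^^ n) ((\<L> s ^^ p) \<alpha>\<^sub>0)) - l\<^sub>0 ((\<L> t ^^ n) \<alpha>\<^sub>0) * l\<^sub>0 ((\<L> s ^^ p) \<alpha>\<^sub>0)) \<le> K * \<bar>t\<bar> powr \<delta>)"
    by (rule asymptotic_independence[OF simple l\<^sub>0_dual fix0 \<alpha>1 bd])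
  then obtain t1 \<delta> K where t1: "t1 > 0" "\<delta> > 0" "K > 0" "t1 \<le> \<epsilon>\<^sub>0"
    and ind: "\<forall>t s n p. \<bar>t\<bar> \<le> t1 \<longrightarrow> \<bar>s\<bar> \<le> t1 \<longrightarrow>
      cmod (l\<^sub>0 ((\<L> t ^^ n) ((\<L> s ^^ p) \<alpha>\<^sub>0)) - l\<^sub>0 ((\<L> t ^^ n) \<alpha>\<^sub>0) * l\<^sub>0 ((\<L> s ^^ p) \<alpha>\<^sub>0)) \<le> K * \<bar>t\<bar> powr \<delta>"
    by (elim exE conjE)
  have \<nu>: "real_distribution (distr P borel W)"
    by (rule prob_space.real_distribution_distr[OF prob_W W_measurable])
  show ?thesis
  proof (rule almost_sure_limit_of_asymptotic_independence[OF T f_measurable renormalizing \<nu> limit t1(1,2) less_imp_le[OF t1(3)]])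
    fix t s :: real and n p assume ts: "\<bar>t\<bar> \<le> t1" "\<bar>s\<bar> \<le> t1"
    then have ts': "\<bar>t\<bar> \<le> \<epsilon>\<^sub>0" "\<bar>s\<bar> \<le> \<epsilon>\<^sub>0" using t1(4) by auto
    show "cmod ((\<integral>x. iexp (t * birkhoff_sum T f n ((T ^^ p) x)) * iexp (s * birkhoff_sum T f p x) \<partial>m)
        - (\<integral>x. iexp (t * birkhoff_sum T f n x) \<partial>m) * (\<integral>x. iexp (s * birkhoff_sum T f p x) \<partial>m)) \<le> K * \<bar>t\<bar> powr \<delta>"
      unfolding code[OF ts'] char1[OF ts'(1)] char1[OF ts'(2)] by (rule ind[rule_format, OF ts])
  qed
qed

end
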